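(* Let $(\mathcal{A},\varphi)$ be a tracial noncommutative probability space with universal enveloping traffic space $(\mathcal{B},\psi)$. Let $\Delta_Q(\mathcal{B})$ be the unital subalgebra of $\mathcal{B}$ generated by the classes of $Q(t)$, $t\in\mathcal{D}$. Then $\Delta_Q(\mathcal{B})\equiv\Delta(\mathcal{B})\pmod\psi$, i.e. $\Delta_Q(\mathcal{B})$ equals $\Delta(\mathcal{B})$ up to degeneracy: every element of either algebra is equivalent mod $\psi$ to an element of the other.
   Context: $(\mathcal{A},\varphi)$: unital complex algebra with unital tracial linear functional; free cumulants $\kappa_n$ determined by $\varphi(a_1\cdots a_n)=\sum_{\pi\in NC(n)}\prod_{B\in\pi}\kappa_{|B|}[(a_i)_{i\in B}]$. A graph monomial in $\mathcal{A}$ is a finite connected directed multigraph (loops, parallel edges allowed) with distinguished, not necessarily distinct, vertices $v_{\mathrm{in}},v_{\mathrm{out}}$ and edge labels in $\mathcal{A}$, up to isomorphism. $\iota(a)$: two vertices, one edge from $v_{\mathrm{in}}$ to $v_{\mathrm{out}}$ labelled $a$. Substitution $Z_g(t_1,\dots,t_K)$ for a connected bi-rooted multidigraph $g$ with ordered edges $e_1,\dots,e_K$ replaces each $e_i$ by a copy of $t_i$, identifying $\mathrm{src}(e_i)$ with the input and $\mathrm{tgt}(e_i)$ with the output of $t_i$; the product $t_1t_2$ identifies the input of $t_1$ with the output of $t_2$. $\mathcal{B}=\mathcal{G}(\mathcal{A})$ is the span of graph monomials modulo the span of $Z_g(\iota(a_1),\dots,\iota(a_K))-Z_g(P(\iota(b_1),\dots,\iota(b_n)),\iota(a_2),\dots)$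 (any edge position) for $a_1=P(b_1,\dots,b_n)$. $\Delta(\mathcal{B})$: span of classes of graph monomials with $v_{\mathrm{in}}=v_{\mathrm{out}}$. Test graphs: finite connected directed multigraphs with labels in $\mathcal{A}$; $T^\pi$ identifies vertices in blocks. Cactus: connected multigraph with each edge in exactly one simple cycle (loops, pairs of parallel edges count); pads = cycles; oriented cactus: pads directed. $\tau^0_\varphi[T]=\prod_{C\in\mathrm{Pads}(T)}\kappa_{n_C}[\gamma(e_1),\dots,\gamma(e_{n_C})]$ for oriented cacti (edges listed with $\mathrm{src}(e_i)=\mathrm{tgt}(e_{i+1})$, indices mod $n_C$), else $0$; $\tau_\varphi[T]=\sum_\pi\tau^0_\varphi[T^\pi]$. $\psi(t)=\tau_\varphi[\tilde\Delta(t)]$ with $\tilde\Delta(t)$ identifying input and output and forgetting roots. $s\equiv t\pmod\psi$ means $\psi((s-t)u)=0$ for all $u\in\mathcal{B}$. $\mathcal{D}$ is the set of graph monomials with $v_{\mathrm{in}}=v_{\mathrm{out}}$ (the root) such that: (A1) the underlying undirected graph is a tree; (A2) the root has degree $1$; (A3) no edge is labelled by a scalar multiple of $1_{\mathcal{A}}$; (A4) no vertex has both indegree and outdegree equal to one. For $t\in\mathcal{D}$ with vertex set $V$, $Q(t)=\sum_{\pi\in\mathcal{P}(V)}\mu(0_V,\pi)\,t^\pi$, where $t^\pi$ identifies the vertices in each block of $\pi$ and $\mu(0_V,\pi)=\prod_{B\in\pi}(-1)^{|B|-1}(|B|-1)!$. *)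

theory Defs
  imports Complex_Main "HOL-Library.Disjoint_Sets"
begin

definition complex_algebra :: "(complex \<Rightarrow> 'a::ring_1 \<Rightarrow> 'a) \<Rightarrow> bool" where
  "complex_algebra sc \<longleftrightarrow>
     (\<forall>c x y. sc c (x + y) = sc c x + sc c y) \<and>
     (\<forall>c d x. sc (c + d) x = sc c x + sc d x) \<and>
     (\<forall>c d x. sc c (sc d x) = sc (c * d) x) \<and>
     (\<forall>x. sc 1 x = x) \<and>
     (\<forall>c x y. sc c (x * y) = sc c x * y) \<and>
     (\<forall>c x y. sc c (x * y) = x * sc c y)"

definition tracial_state :: "(complex \<Rightarrow> 'a::ring_1 \<Rightarrow> 'a) \<Rightarrow> ('a \<Rightarrow> complex) \<Rightarrow> bool" where
  "tracial_state sc phi \<longleftrightarrow>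
     (\<forall>x y. phi (x + y) = phi x + phi y) \<and>
     (\<forall>c x. phi (sc c x) = c * phi x) \<and>
     phi 1 = 1 \<and>
     (\<forall>x y. phi (x * y) = phi (y * x))"

definition nc_partitions :: "nat \<Rightarrow> nat set set set" where
  "nc_partitions n = {p. partition_on {0..<n} p \<and>
     (\<forall>B1\<in>p. \<forall>B2\<in>p. B1 \<noteq> B2 \<longrightarrow>
        \<not> (\<exists>a b c d. a < b \<and> b < c \<and> c < d \<and> a \<in> B1 \<and> c \<in> B1 \<and> b \<in> B2 \<and> d \<in> B2))}"

text \<open>kappa (the family of free cumulants, kappa [a1,...,an] = kappa_n[a1,...,an])
  is determined by the moment-cumulant formula.\<close>

definition free_cumulants :: "('a::ring_1 \<Rightarrow> complex) \<Rightarrow> ('a list \<Rightarrow> complex) \<Rightarrow> bool" where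
  "free_cumulants phi kappa \<longleftrightarrow>
     (\<forall>as. phi (prod_list as) =
        (\<Sum>p\<in>nc_partitions (length as). \<Prod>B\<in>p. kappa (nths as B)))"

text \<open>Directed multigraphs with vertices in nat; edges are (source, target, label);
  an edge is identified by its index in the edge list.\<close>

record 'a tgraph =
  verts :: "nat set"
  edgs :: "(nat \<times> nat \<times> 'a) list"

record 'a gmon = "'a tgraph" +
  vin :: nat
  vout :: nat

definition esrc :: "nat \<times> nat \<times> 'a \<Rightarrow> nat" where "esrc e = fst e"
definition etgt :: "nat \<times> nat \<times> 'a \<Rightarrow> nat" where "etgt e = fst (snd e)"
definition elab :: "nat \<times> nat \<times> 'a \<Rightarrow> 'a" where "elab e = snd (snd e)"

definition tg_adj :: "('a, 'z) tgraph_scheme \<Rightarrow> nat \<Rightarrow> nat \<Rightarrow> bool" where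
  "tg_adj G u v \<longleftrightarrow> (\<exists>e\<in>set (edgs G).
      (esrc e = u \<and> etgt e = v) \<or> (esrc e = v \<and> etgt e = u))"

definition tg_connected :: "('a, 'z) tgraph_scheme \<Rightarrow> bool" where
  "tg_connected G \<longleftrightarrow> (\<forall>x\<in>verts G. \<forall>y\<in>verts G. (tg_adj G)\<^sup>*\<^sup>* x y)"

definition tg_wf :: "('a, 'z) tgraph_scheme \<Rightarrow> bool" where
  "tg_wf G \<longleftrightarrow> finite (verts G) \<and> verts G \<noteq> {} \<and>
     (\<forall>e\<in>set (edgs G). esrc e \<in> verts G \<and> etgt e \<in> verts G) \<and> tg_connected G"

text \<open>Graph monomial representatives (graph monomials are considered up to isomorphism;
  every function below is isomorphism invariant).\<close>

definition gm_wf :: "'a gmon \<Rightarrow> bool" where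
  "gm_wf t \<longleftrightarrow> tg_wf t \<and> vin t \<in> verts t \<and> vout t \<in> verts t"

definition tg_map :: "(nat \<Rightarrow> nat) \<Rightarrow> ('a, 'z) tgraph_scheme \<Rightarrow> 'a tgraph" where
  "tg_map f G = \<lparr>verts = f ` verts G,
      edgs = map (\<lambda>(s, t, l). (f s, f t, l)) (edgs G)\<rparr>"

definition gm_map :: "(nat \<Rightarrow> nat) \<Rightarrow> 'a gmon \<Rightarrow> 'a gmon" where
  "gm_map f t = \<lparr>verts = f ` verts t,
      edgs = map (\<lambda>(s, u, l). (f s, f u, l)) (edgs t),
      vin = f (vin t), vout = f (vout t)\<rparr>"

definition set_partitions :: "nat set \<Rightarrow> nat set set set" where
  "set_partitions V = {p. partition_on V p}"

definition block_rep :: "nat set set \<Rightarrow> nat \<Rightarrow> nat" where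
  "block_rep p v = Min (THE B. B \<in> p \<and> v \<in> B)"

definition tg_quot :: "nat set set \<Rightarrow> ('a, 'z) tgraph_scheme \<Rightarrow> 'a tgraph" where
  "tg_quot p G = tg_map (block_rep p) G"

definition gm_quot :: "nat set set \<Rightarrow> 'a gmon \<Rightarrow> 'a gmon" where
  "gm_quot p t = gm_map (block_rep p) t"

text \<open>Simple cycles (in the underlying undirected multigraph; loops and pairs of
  parallel edges count), given as sets of edge indices.\<close>

definition is_cycle :: "('a, 'z) tgraph_scheme \<Rightarrow> nat set \<Rightarrow> bool" where
  "is_cycle G C \<longleftrightarrow> (\<exists>es ws. es \<noteq> [] \<and> distinct es \<and> set es = C \<and>
      (\<forall>i\<in>set es. i < length (edgs G)) \<and>
      length ws = length es \<and> distinct ws \<and>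
      (\<forall>i<length es. {esrc (edgs G ! (es ! i)), etgt (edgs G ! (es ! i))} =
                      {ws ! i, ws ! ((i + 1) mod length es)}))"

definition is_cactus :: "('a, 'z) tgraph_scheme \<Rightarrow> bool" where
  "is_cactus G \<longleftrightarrow> tg_connected G \<and>
     (\<forall>i<length (edgs G). \<exists>!C. is_cycle G C \<and> i \<in> C)"

definition pads :: "('a, 'z) tgraph_scheme \<Rightarrow> nat set set" where
  "pads G = {C. is_cycle G C}"

definition oriented_listing :: "('a, 'z) tgraph_scheme \<Rightarrow> nat set \<Rightarrow> nat list \<Rightarrow> bool" where
  "oriented_listing G C es \<longleftrightarrow> distinct es \<and> set es = C \<and>
     (\<forall>i<length es. esrc (edgs G ! (es ! i)) = etgt (edgs G ! (es ! ((i + 1) mod length es))))"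

definition pad_oriented :: "('a, 'z) tgraph_scheme \<Rightarrow> nat set \<Rightarrow> bool" where
  "pad_oriented G C \<longleftrightarrow> (\<exists>es. oriented_listing G C es)"

definition pad_cumulant :: "('a list \<Rightarrow> complex) \<Rightarrow> ('a, 'z) tgraph_scheme \<Rightarrow> nat set \<Rightarrow> complex" where
  "pad_cumulant kappa G C =
     kappa (map (\<lambda>i. elab (edgs G ! i)) (SOME es. oriented_listing G C es))"

definition tau0 :: "('a list \<Rightarrow> complex) \<Rightarrow> ('a, 'z) tgraph_scheme \<Rightarrow> complex" where
  "tau0 kappa G = (if is_cactus G \<and> (\<forall>C\<in>pads G. pad_oriented G C)
                   then \<Prod>C\<in>pads G. pad_cumulant kappa G C else 0)"

definition tau :: "('a list \<Rightarrow> complex) \<Rightarrow> ('a, 'z) tgraph_scheme \<Rightarrow> complex" where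
  "tau kappa G = (\<Sum>p\<in>set_partitions (verts G). tau0 kappa (tg_quot p G))"

definition diag_tg :: "'a gmon \<Rightarrow> 'a tgraph" where
  "diag_tg t = tg_map (\<lambda>v. if v = vout t then vin t else v) t"

definition psi :: "('a list \<Rightarrow> complex) \<Rightarrow> 'a gmon \<Rightarrow> complex" where
  "psi kappa t = tau kappa (diag_tg t)"

definition gm_mult :: "'a gmon \<Rightarrow> 'a gmon \<Rightarrow> 'a gmon" where
  "gm_mult t1 t2 =
    (let k = Suc (Max (verts t1));
         t2' = gm_map (\<lambda>v. v + k) t2;
         t2'' = gm_map (\<lambda>v. if v = vout t2' then vin t1 else v) t2'
     in \<lparr>verts = verts t1 \<union> verts t2'', edgs = edgs t1 @ edgs t2'',
         vin = vin t2'', vout = vout t1\<rparr>)"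

definition gm_unit :: "'a gmon" where
  "gm_unit = \<lparr>verts = {0}, edgs = [], vin = 0, vout = 0\<rparr>"

text \<open>Elements of the span of graph monomials, as finite formal linear combinations.
  psi is defined on them by linear extension; it vanishes on (ideal of) the defining
  relations of B, so equivalence mod psi can be tested on representatives.\<close>

type_synonym 'a fcomb = "(complex \<times> 'a gmon) list"

definition fc_wf :: "'a fcomb \<Rightarrow> bool" where
  "fc_wf s \<longleftrightarrow> (\<forall>(c, m)\<in>set s. gm_wf m)"

definition fc_add :: "'a fcomb \<Rightarrow> 'a fcomb \<Rightarrow> 'a fcomb" where
  "fc_add s u = s @ u"

definition fc_scale :: "complex \<Rightarrow> 'a fcomb \<Rightarrow> 'a fcomb" where
  "fc_scale c s = map (\<lambda>(d, m). (c * d, m)) s"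

definition fc_mult :: "'a fcomb \<Rightarrow> 'a fcomb \<Rightarrow> 'a fcomb" where
  "fc_mult s u = concat (map (\<lambda>(c, m). map (\<lambda>(d, n). (c * d, gm_mult m n)) u) s)"

definition fc_unit :: "'a fcomb" where
  "fc_unit = [(1, gm_unit)]"

definition fc_psi :: "('a list \<Rightarrow> complex) \<Rightarrow> 'a fcomb \<Rightarrow> complex" where
  "fc_psi kappa s = (\<Sum>(c, m)\<leftarrow>s. c * psi kappa m)"

definition fc_equiv :: "('a list \<Rightarrow> complex) \<Rightarrow> 'a fcomb \<Rightarrow> 'a fcomb \<Rightarrow> bool" where
  "fc_equiv kappa s t \<longleftrightarrow>
     (\<forall>u. fc_wf u \<longrightarrow> fc_psi kappa (fc_mult (fc_add s (fc_scale (-1) t)) u) = 0)"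

definition Delta_B :: "'a fcomb set" where
  "Delta_B = {s. \<forall>(c, m)\<in>set s. gm_wf m \<and> vin m = vout m}"

definition indeg :: "('a, 'z) tgraph_scheme \<Rightarrow> nat \<Rightarrow> nat" where
  "indeg G v = length (filter (\<lambda>e. etgt e = v) (edgs G))"

definition outdeg :: "('a, 'z) tgraph_scheme \<Rightarrow> nat \<Rightarrow> nat" where
  "outdeg G v = length (filter (\<lambda>e. esrc e = v) (edgs G))"

definition is_tree :: "('a, 'z) tgraph_scheme \<Rightarrow> bool" where
  "is_tree G \<longleftrightarrow> tg_connected G \<and> (\<nexists>C. is_cycle G C)"

definition in_D :: "(complex \<Rightarrow> 'a::ring_1 \<Rightarrow> 'a) \<Rightarrow> 'a gmon \<Rightarrow> bool" where
  "in_D sc t \<longleftrightarrow> gm_wf t \<and> vin t = vout t \<and>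
     is_tree t \<and>
     indeg t (vin t) + outdeg t (vin t) = 1 \<and>
     (\<forall>e\<in>set (edgs t). \<not> (\<exists>c. elab e = sc c 1)) \<and>
     (\<forall>v\<in>verts t. \<not> (indeg t v = 1 \<and> outdeg t v = 1))"

definition mobius0 :: "nat set set \<Rightarrow> complex" where
  "mobius0 p = (\<Prod>B\<in>p. (-1) ^ (card B - 1) * of_nat (fact (card B - 1)))"

definition list_of_finset :: "'b set \<Rightarrow> 'b list" where
  "list_of_finset S = (SOME xs. distinct xs \<and> set xs = S)"

definition Q_elem :: "'a gmon \<Rightarrow> 'a fcomb" where
  "Q_elem t = map (\<lambda>p. (mobius0 p, gm_quot p t)) (list_of_finset (set_partitions (verts t)))"

inductive_set Delta_Q :: "(complex \<Rightarrow> 'a::ring_1 \<Rightarrow> 'a) \<Rightarrow> 'a fcomb set"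
  for sc :: "complex \<Rightarrow> 'a \<Rightarrow> 'a" where
  unit: "fc_unit \<in> Delta_Q sc"
| gen: "in_D sc t \<Longrightarrow> Q_elem t \<in> Delta_Q sc"
| add: "s \<in> Delta_Q sc \<Longrightarrow> u \<in> Delta_Q sc \<Longrightarrow> fc_add s u \<in> Delta_Q sc"
| scale: "s \<in> Delta_Q sc \<Longrightarrow> fc_scale c s \<in> Delta_Q sc"
| mult: "s \<in> Delta_Q sc \<Longrightarrow> u \<in> Delta_Q sc \<Longrightarrow> fc_mult s u \<in> Delta_Q sc"

end

theory Submission
  imports Defs "HOL-Combinatorics.Permutations"
begin

text \<open>Pairing with the monomials \<open>n\<close> tests equivalence modulo \<open>\<psi>\<close>, and by Moebius inversion
  \<open>Q(g)\<close> paired with \<open>n\<close> is the sum of \<open>\<tau>\<^sup>0\<close> over the quotients of \<open>g n\<close> that keep the vertices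
  of \<open>g\<close> apart. In particular \<open>g\<close> equals \<open>Q(g)\<close> up to proper quotients of \<open>g\<close>, so one can induct
  on the number of vertices and edges of a monomial \<open>g\<close> with equal roots. If \<open>g\<close> contains a cycle,
  this cycle must become a pad of every contributing cactus, which splits off its cumulant as a
  scalar and leaves \<open>Q\<close> of a graph with fewer edges. If \<open>g\<close> is a tree with an edge labelled by a
  scalar, \<open>Q(g)\<close> vanishes because cumulants with a unit entry do. If the root of the tree has degree at
  least two, \<open>g\<close> is a product. If a vertex has indegree and outdegree one, the product formula for
  cumulants allows one to remove it by multiplying the two labels. Otherwise \<open>g \<in> \<D>\<close>.

  The sums over quotients are controlled by characterising pads through cuts: two edges of a pad
  of a cactus are the only edges between some set of vertices and its complement.\<close>

section \<open>Free cumulants\<close>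

text \<open>Modulo \<open>psi\<close> a monomial g matters only through the functional that sends n
  to psi(g n). Products are compared by writing these functionals as sums over partitions of one
  common vertex set; no isomorphisms of graphs are built. Simple cycles, on which
  \<open>tau0\<close> rests, are awkward under identification, gluing and subdivision of edges. Cuts
  behave well: they can be extended along retractions, and the exclusive or of two cuts is a cut.

  Each reduction lives on keeping the vertices of g apart. A cycle of g stays simple, so it has to
  be a pad. A tree edge never becomes a loop, so its pad has a second edge and a scalar label gives
  0, whereas a loop with label c would give c. Along with a cycle, everything attached to it away
  from the root splits off, because n is connected and sits at the root. Moebius corrections lose
  vertices and keep the number of edges, while cutting a cycle or splitting a product loses edges,
  so the sum of both numbers decreases throughout. A root of degree 0 leaves the unit.\<close>

lemma nc_partitions_subset: "p \<in> nc_partitions n \<Longrightarrow> B \<in> p \<Longrightarrow> B \<subseteq> {0..<n}"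
  by (auto simp: nc_partitions_def partition_on_def)

lemma finite_nc_partitions: "finite (nc_partitions n)"
proof -
  have "nc_partitions n \<subseteq> Pow (Pow {0..<n})"
    by (auto dest: nc_partitions_subset)
  thus ?thesis by (rule finite_subset) simp
qed

lemma finite_nc_partition: "p \<in> nc_partitions n \<Longrightarrow> finite p"
  by (rule finite_subset[of _ "Pow {0..<n}"]) (auto dest: nc_partitions_subset)

lemma nc_partitions_disjnt:
  "p \<in> nc_partitions n \<Longrightarrow> B \<in> p \<Longrightarrow> C \<in> p \<Longrightarrow> x \<in> B \<Longrightarrow> x \<in> C \<Longrightarrow> B = C"
  by (auto simp: nc_partitions_def partition_on_def disjoint_def)

lemma nc_partitions_cover: "p \<in> nc_partitions n \<Longrightarrow> i < n \<Longrightarrow> \<exists>B\<in>p. i \<in> B"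
proof -
  assume "p \<in> nc_partitions n" "i < n"
  hence "i \<in> \<Union>p" by (simp add: nc_partitions_def partition_on_def)
  thus ?thesis by blast
qed

lemma nc_partitions_nonempty: "p \<in> nc_partitions n \<Longrightarrow> B \<in> p \<Longrightarrow> B \<noteq> {}"
  by (auto simp: nc_partitions_def partition_on_def)

lemma nc_partitions_noncrossing:
  "p \<in> nc_partitions n \<Longrightarrow> B \<in> p \<Longrightarrow> C \<in> p \<Longrightarrow> a \<in> B \<Longrightarrow> b \<in> C \<Longrightarrow> c \<in> B \<Longrightarrow> d \<in> C \<Longrightarrow>
   a < b \<Longrightarrow> b < c \<Longrightarrow> c < d \<Longrightarrow> B = C"
  unfolding nc_partitions_def mem_Collect_eq by metis

lemma nc_partitionsI:
  assumes "\<And>B. B \<in> p \<Longrightarrow> B \<subseteq> {0..<n} \<and> B \<noteq> {}"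
    and "\<And>i. i < n \<Longrightarrow> \<exists>B\<in>p. i \<in> B"
    and "\<And>B C x. B \<in> p \<Longrightarrow> C \<in> p \<Longrightarrow> x \<in> B \<Longrightarrow> x \<in> C \<Longrightarrow> B = C"
    and "\<And>B C a b c d. B \<in> p \<Longrightarrow> C \<in> p \<Longrightarrow> a \<in> B \<Longrightarrow> b \<in> C \<Longrightarrow> c \<in> B \<Longrightarrow> d \<in> C \<Longrightarrow>
           a < b \<Longrightarrow> b < c \<Longrightarrow> c < d \<Longrightarrow> B = C"
  shows "p \<in> nc_partitions n"
proof -
  have "partition_on {0..<n} p"
  proof (rule partition_onI)
    show "\<Union>p = {0..<n}" using assms(1,2) by fastforce
    show "disjnt B C" if "B \<in> p" "C \<in> p" "B \<noteq> C" for B C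
      using assms(3)[OF that(1,2)] that(3) by (auto simp: disjnt_def)
    show "{} \<notin> p" using assms(1) by blast
  qed
  moreover have "\<forall>B\<in>p. \<forall>C\<in>p. B \<noteq> C \<longrightarrow>
      \<not> (\<exists>a b c d. a < b \<and> b < c \<and> c < d \<and> a \<in> B \<and> c \<in> B \<and> b \<in> C \<and> d \<in> C)"
    using assms(4) by metis
  ultimately show ?thesis unfolding nc_partitions_def by blast
qed

lemma top_nc_partitions: "n > 0 \<Longrightarrow> {{0..<n}} \<in> nc_partitions n"
  by (rule nc_partitionsI) auto

lemma nc_partitions_block_less:
  assumes "p \<in> nc_partitions n" "p \<noteq> {{0..<n}}" "B \<in> p"
  shows "card B < n"
proof -
  have "B \<noteq> {0..<n}"
  proof
    assume B: "B = {0..<n}"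
    have "C = B" if "C \<in> p" for C
      using nc_partitions_disjnt[OF assms(1) that assms(3)] nc_partitions_subset[OF assms(1) that]
        nc_partitions_nonempty[OF assms(1) that] B by blast
    hence "p = {B}" using assms(3) by blast
    thus False using B assms(2) by simp
  qed
  hence "B \<subset> {0..<n}" using nc_partitions_subset[OF assms(1,3)] by blast
  hence "card B < card {0..<n}" by (intro psubset_card_mono) auto
  thus ?thesis by simp
qed

lemma nths_all_upto: "n = length as \<Longrightarrow> nths as {0..<n} = as"
  by (rule nths_all) auto

lemma length_nths_subset: "B \<subseteq> {0..<length as} \<Longrightarrow> length (nths as B) = card B"
  unfolding length_nths by (rule arg_cong[where f = card]) auto

text \<open>All cumulant identities are proved by induction on the length: the one-block
  partition is the only term that is not covered by the induction hypothesis.\<close>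

lemma top_term_eqI:
  fixes f g :: "nat set set \<Rightarrow> complex"
  assumes "n > 0" "sum f (nc_partitions n) = sum g (nc_partitions n)"
    and "\<And>p. p \<in> nc_partitions n \<Longrightarrow> p \<noteq> {{0..<n}} \<Longrightarrow> f p = g p"
  shows "f {{0..<n}} = g {{0..<n}}"
proof -
  let ?N = "nc_partitions n"
  have "sum f ?N = f {{0..<n}} + sum f (?N - {{{0..<n}}})"
    and "sum g ?N = g {{0..<n}} + sum g (?N - {{{0..<n}}})"
    by (auto intro!: sum.remove finite_nc_partitions top_nc_partitions assms(1))
  moreover have "sum f (?N - {{{0..<n}}}) = sum g (?N - {{{0..<n}}})"
    by (rule sum.cong) (auto intro: assms(3))
  ultimately show ?thesis using assms(2) by simp
qed

lemma nths_Cons_block: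
  "nths (x # xs) B = (if 0 \<in> B then [x] else []) @ nths xs {i. Suc i \<in> B}"
  by (simp add: nths_Cons)

lemma nc_partitions_split0:
  assumes "p \<in> nc_partitions n" "n > 0"
  obtains B where "B \<in> p" "0 \<in> B" "\<And>C. C \<in> p - {B} \<Longrightarrow> 0 \<notin> C"
  using nc_partitions_cover[OF assms] nc_partitions_disjnt[OF assms(1)] by blast

text \<open>Only the block of position 0 sees the factor \<open>c\<close>. In a partition with
  several blocks that block is shorter than the whole word, so the induction hypothesis applies to
  it; linearity of \<open>phi\<close> compares the two full sums.\<close>

lemma cumulant_scale:
  fixes sc :: "complex \<Rightarrow> 'a::ring_1 \<Rightarrow> 'a"
  assumes alg: "complex_algebra sc" and tr: "tracial_state sc phi" and fc: "free_cumulants phi kappa"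
  shows "kappa (sc c a # w) = c * kappa (a # w)"
proof (induction "length w" arbitrary: w rule: less_induct)
  case less
  let ?n = "Suc (length w)"
  let ?f = "\<lambda>p. \<Prod>B\<in>p. kappa (nths (sc c a # w) B)"
  let ?g = "\<lambda>p. c * (\<Prod>B\<in>p. kappa (nths (a # w) B))"
  have "?f {{0..<?n}} = ?g {{0..<?n}}"
  proof (rule top_term_eqI)
    have "sum ?f (nc_partitions ?n) = phi (prod_list (sc c a # w))"
      using fc[unfolded free_cumulants_def, rule_format, of "sc c a # w"] by simp
    also have "\<dots> = c * phi (prod_list (a # w))"
      using alg tr unfolding complex_algebra_def tracial_state_def by (metis prod_list.Cons)
    also have "\<dots> = sum ?g (nc_partitions ?n)"
      using fc[unfolded free_cumulants_def, rule_format, of "a # w"] by (simp add: sum_distrib_left)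
    finally show "sum ?f (nc_partitions ?n) = sum ?g (nc_partitions ?n)" .
  next
    fix p assume p: "p \<in> nc_partitions ?n" "p \<noteq> {{0..<?n}}"
    obtain B where B: "B \<in> p" "0 \<in> B" "\<And>C. C \<in> p - {B} \<Longrightarrow> 0 \<notin> C"
      using nc_partitions_split0[OF p(1)] by blast
    have "card B < ?n" using nc_partitions_block_less[OF p B(1)] .
    moreover have "length (nths (a # w) B) = card B"
      using nc_partitions_subset[OF p(1) B(1)] by (intro length_nths_subset) simp
    ultimately have len: "length (nths w {i. Suc i \<in> B}) < length w"
      using B(2) by (simp add: nths_Cons_block)
    have "?f p = kappa (nths (sc c a # w) B) * (\<Prod>C\<in>p-{B}. kappa (nths (sc c a # w) C))"
      using prod.remove[OF finite_nc_partition[OF p(1)] B(1)] by simp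
    also have "\<dots> = (c * kappa (nths (a # w) B)) * (\<Prod>C\<in>p-{B}. kappa (nths (a # w) C))"
      using B(2,3) less[OF len]
      by (intro arg_cong2[where f = "(*)"] prod.cong) (auto simp: nths_Cons_block)
    also have "\<dots> = ?g p"
      using prod.remove[OF finite_nc_partition[OF p(1)] B(1), of "\<lambda>B. kappa (nths (a # w) B)"] by simp
    finally show "?f p = ?g p" .
  qed simp
  thus ?case by (simp add: nths_all_upto)
qed

section \<open>Cyclic invariance of cumulants\<close>

text \<open>Crossings depend only on the cyclic order of the positions. \<open>h\<close> moves
  position 0 to the end, and a crossing whose last point is the moved position comes from a crossing
  that starts at 0, with the two blocks exchanged.\<close>

lemma nc_partitions_rotate:
  assumes p: "p \<in> nc_partitions (Suc m)"
  defines "h \<equiv> (\<lambda>i. if i = 0 then m else i - 1)"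
  shows "(`) h ` p \<in> nc_partitions (Suc m)"
proof -
  have hinj: "x = y" if "h x = h y" "x < Suc m" "y < Suc m" for x y
    using that by (auto simp: h_def split: if_splits)
  have lt: "x < Suc m" if "B \<in> p" "x \<in> B" for B x
    using nc_partitions_subset[OF p that(1)] that(2) by auto
  show ?thesis
  proof (rule nc_partitionsI)
    fix B assume "B \<in> (`) h ` p"
    then obtain B' where B': "B' \<in> p" "B = h ` B'" by auto
    thus "B \<subseteq> {0..<Suc m} \<and> B \<noteq> {}"
      using lt[OF B'(1)] nc_partitions_nonempty[OF p B'(1)] by (fastforce simp: h_def less_Suc_eq_le)
  next
    fix i assume "i < Suc m"
    hence "(if i = m then 0 else Suc i) < Suc m" by auto
    from nc_partitions_cover[OF p this] obtain B where B: "B \<in> p" "(if i = m then 0 else Suc i) \<in> B" by auto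
    moreover have "i = h (if i = m then 0 else Suc i)" by (auto simp: h_def)
    ultimately have "i \<in> h ` B" by (rule_tac image_eqI)
    thus "\<exists>B\<in>(`) h ` p. i \<in> B" using B(1) by blast
  next
    fix B C x assume "B \<in> (`) h ` p" "C \<in> (`) h ` p" "x \<in> B" "x \<in> C"
    then obtain B' C' y z where *: "B' \<in> p" "C' \<in> p" "B = h ` B'" "C = h ` C'" "y \<in> B'" "z \<in> C'"
      "x = h y" "x = h z" by blast
    have "y = z" using * hinj lt by metis
    thus "B = C" using * nc_partitions_disjnt[OF p] by metis
  next
    fix B C a b c d
    assume asm: "B \<in> (`) h ` p" "C \<in> (`) h ` p" "a \<in> B" "b \<in> C" "c \<in> B" "d \<in> C" "a < b" "b < c" "c < d"
    then obtain B' C' where *: "B' \<in> p" "C' \<in> p" "B = h ` B'" "C = h ` C'" by blast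
    from asm * obtain a' b' c' d' where
      ab: "a' \<in> B'" "a = h a'" "b' \<in> C'" "b = h b'" "c' \<in> B'" "c = h c'" "d' \<in> C'" "d = h d'" by blast
    have l: "a' \<le> m" "b' \<le> m" "c' \<le> m" "d' \<le> m" using lt ab * by (metis less_Suc_eq_le)+
    have "h a' < h b'" "h b' < h c'" "h c' < h d'" using asm(7-9) ab by simp_all
    moreover have "h d' \<le> m" using l(4) unfolding h_def by presburger
    ultimately have nz: "a' \<noteq> 0" "b' \<noteq> 0" "c' \<noteq> 0" unfolding h_def by presburger+
    have "h a' < h b'" "h b' < h c'" "h c' < h d'" using asm(7-9) ab by simp_all
    hence ord: "a' < b'" "b' < c'" "d' = 0 \<or> c' < d'"
      using nz unfolding h_def by presburger+
    have "B' = C'"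
    proof (cases "d' = 0")
      case True
      hence "d' < a'" using nz by simp
      from nc_partitions_noncrossing[OF p *(2,1) ab(7) ab(1) ab(3) ab(5) this ord(1,2)] show ?thesis by simp
    next
      case False
      thus ?thesis using nc_partitions_noncrossing[OF p *(1,2) ab(1) ab(3) ab(5) ab(7)] ord by blast
    qed
    thus "B = C" using * by simp
  qed
qed

lemma bij_nc_partitions_rotate:
  "bij_betw ((`) ((`) (\<lambda>i. if i = 0 then m else i - 1))) (nc_partitions (Suc m)) (nc_partitions (Suc m))"
proof -
  let ?h = "\<lambda>i::nat. if i = 0 then m else i - 1"
  have "inj_on ((`) ((`) ?h)) (nc_partitions (Suc m))"
  proof -
    have "inj_on ?h {0..<Suc m}" by (auto simp: inj_on_def split: if_splits)
    hence "inj_on ((`) ?h) (Pow {0..<Suc m})" by (rule inj_on_image_Pow)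
    hence "inj_on ((`) ((`) ?h)) (Pow (Pow {0..<Suc m}))" by (rule inj_on_image_Pow)
    thus ?thesis by (rule inj_on_subset) (auto dest: nc_partitions_subset)
  qed
  moreover have "((`) ((`) ?h)) ` nc_partitions (Suc m) \<subseteq> nc_partitions (Suc m)"
    using nc_partitions_rotate by blast
  ultimately show ?thesis
    using endo_inj_surj[OF finite_nc_partitions] unfolding bij_betw_def by blast
qed

lemma nths_rotate_block:
  assumes "B \<subseteq> {0..<Suc (length w)}"
  defines "h \<equiv> (\<lambda>i. if i = 0 then length w else i - 1)"
  shows "nths (w @ [a]) (h ` B) = nths w {i. Suc i \<in> B} @ (if 0 \<in> B then [a] else [])"
proof -
  have 1: "i \<in> h ` B \<longleftrightarrow> Suc i \<in> B" if "i < length w" for i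
  proof
    assume "i \<in> h ` B"
    then obtain j where "j \<in> B" "i = h j" by blast
    thus "Suc i \<in> B" using that by (cases j) (auto simp: h_def)
  next
    assume "Suc i \<in> B"
    moreover have "i = h (Suc i)" by (simp add: h_def)
    ultimately show "i \<in> h ` B" by (rule rev_image_eqI)
  qed
  have 2: "length w \<in> h ` B \<longleftrightarrow> 0 \<in> B"
  proof
    assume "length w \<in> h ` B"
    then obtain j where "j \<in> B" "length w = h j" by blast
    thus "0 \<in> B" using assms(1) by (cases j) (auto simp: h_def)
  next
    assume "0 \<in> B"
    moreover have "length w = h 0" by (simp add: h_def)
    ultimately show "length w \<in> h ` B" by (rule rev_image_eqI)
  qed
  have "snd p \<in> h ` B \<longleftrightarrow> snd p \<in> {i. Suc i \<in> B}" if "p \<in> set (zip w [0..<length w])" for p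
  proof -
    have "snd p < length w" using that by (auto simp: set_zip)
    from 1[OF this] show ?thesis by simp
  qed
  hence "nths w (h ` B) = nths w {i. Suc i \<in> B}"
    unfolding nths_def by (intro arg_cong[where f = "map fst"] filter_cong) simp_all
  thus ?thesis using 2 by (auto simp: nths_append nths_Cons)
qed

text \<open>Traciality makes the moments of the two words equal, and rotation matches their
  noncrossing partitions block by block; blocks shorter than the whole word agree by
  induction.\<close>

lemma cumulant_rotate1:
  fixes sc :: "complex \<Rightarrow> 'a::ring_1 \<Rightarrow> 'a"
  assumes tr: "tracial_state sc phi" and fc: "free_cumulants phi kappa"
  shows "kappa (w @ [a]) = kappa (a # w)"
proof (induction "length w" arbitrary: w a rule: less_induct)
  case less
  let ?n = "Suc (length w)"
  let ?h = "\<lambda>i. if i = 0 then length w else i - 1"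
  let ?f = "\<lambda>p. \<Prod>B\<in>(`) ?h ` p. kappa (nths (w @ [a]) B)"
  let ?g = "\<lambda>p. \<Prod>B\<in>p. kappa (nths (a # w) B)"
  have f: "?f p = (\<Prod>B\<in>p. kappa (nths (w @ [a]) (?h ` B)))" if p: "p \<in> nc_partitions ?n" for p
  proof -
    have "inj_on ?h {0..<?n}" by (auto simp: inj_on_def split: if_splits)
    hence "inj_on ((`) ?h) (Pow {0..<?n})" by (rule inj_on_image_Pow)
    hence "inj_on ((`) ?h) p" by (rule inj_on_subset) (use p in \<open>auto dest: nc_partitions_subset\<close>)
    thus ?thesis by (simp only: prod.reindex o_def)
  qed
  have "?f {{0..<?n}} = ?g {{0..<?n}}"
  proof (rule top_term_eqI)
    have "sum ?f (nc_partitions ?n) = (\<Sum>p\<in>nc_partitions ?n. \<Prod>B\<in>p. kappa (nths (w @ [a]) B))"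
      by (rule sum.reindex_bij_betw[OF bij_nc_partitions_rotate])
    also have "\<dots> = phi (prod_list (w @ [a]))"
      using fc[unfolded free_cumulants_def, rule_format, of "w @ [a]"] by simp
    also have "\<dots> = phi (prod_list (a # w))"
      using tr unfolding tracial_state_def by simp
    also have "\<dots> = sum ?g (nc_partitions ?n)"
      using fc[unfolded free_cumulants_def, rule_format, of "a # w"] by simp
    finally show "sum ?f (nc_partitions ?n) = sum ?g (nc_partitions ?n)" .
  next
    fix p assume p: "p \<in> nc_partitions ?n" "p \<noteq> {{0..<?n}}"
    have "kappa (nths (w @ [a]) (?h ` B)) = kappa (nths (a # w) B)" if B: "B \<in> p" for B
    proof -
      have sub: "B \<subseteq> {0..<?n}" using nc_partitions_subset[OF p(1) B] .
      have "card B < ?n" using nc_partitions_block_less[OF p B] .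
      moreover have "length (nths (a # w) B) = card B"
        using sub by (intro length_nths_subset) simp
      ultimately show ?thesis
        using less[of "nths w {i. Suc i \<in> B}" a] nths_rotate_block[OF sub, of a] by (auto simp: nths_Cons_block)
    qed
    thus "?f p = ?g p" using f[OF p(1)] by simp
  qed simp
  moreover have "?h ` {0..<?n} = {0..<?n}"
    by (rule endo_inj_surj) (auto simp: inj_on_def split: if_splits)
  ultimately show ?case by (simp only: image_insert image_empty prod.insert finite.emptyI empty_iff not_False_eq_True prod.empty mult_1_right) (simp add: nths_all_upto)
qed

lemma cumulant_rotate:
  fixes sc :: "complex \<Rightarrow> 'a::ring_1 \<Rightarrow> 'a"
  assumes "tracial_state sc phi" and "free_cumulants phi kappa"
  shows "kappa (xs @ ys) = kappa (ys @ xs)"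
proof (induction xs arbitrary: ys)
  case (Cons x xs)
  have "kappa ((x # xs) @ ys) = kappa (xs @ (ys @ [x]))"
    using cumulant_rotate1[OF assms, of "xs @ ys" x] by simp
  also have "\<dots> = kappa (ys @ x # xs)" using Cons by simp
  finally show ?case .
qed simp

section \<open>Merging two letters and the product formula\<close>

text \<open>A word of length k has k + 1 cuts: the one with empty prefix, and one for each letter as
  the last letter of the prefix. This turns cuts of a block indexed by positions \<open>c\<close> in
  the full word into cuts of the block's own word.\<close>

lemma sum_nths_cut:
  fixes F :: "'a list \<Rightarrow> 'a list \<Rightarrow> complex"
  assumes "A \<subseteq> {..<length xs}"
  shows "F [] (nths xs A) + (\<Sum>c\<in>A. F (nths xs {i\<in>A. i \<le> c}) (nths xs {i\<in>A. c < i})) =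
    (\<Sum>j\<le>length (nths xs A). F (take j (nths xs A)) (drop j (nths xs A)))"
  using assms
proof (induction xs arbitrary: A F)
  case (Cons x xs)
  define A' where "A' = {i. Suc i \<in> A}"
  have A': "A' \<subseteq> {..<length xs}" using Cons.prems by (auto simp: A'_def)
  have fin: "finite A'" using A' finite_subset by blast
  have A: "A = (if 0 \<in> A then {0} else {}) \<union> Suc ` A'"
  proof (rule set_eqI)
    show "i \<in> A \<longleftrightarrow> i \<in> (if 0 \<in> A then {0} else {}) \<union> Suc ` A'" for i
      by (cases i) (auto simp: A'_def)
  qed
  let ?T = "\<lambda>c. F (nths (x # xs) {i\<in>A. i \<le> c}) (nths (x # xs) {i\<in>A. c < i})"
  have T0: "?T 0 = F [x] (nths xs A')" if "0 \<in> A"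
    using that by (simp add: nths_Cons A'_def)
  have TS: "?T (Suc c) = F ((if 0 \<in> A then [x] else []) @ nths xs {i\<in>A'. i \<le> c}) (nths xs {i\<in>A'. c < i})" for c
    by (simp add: nths_Cons A'_def)
  have "sum ?T A = sum ?T (if 0 \<in> A then {0} else {}) + sum ?T (Suc ` A')"
    by (subst A, rule sum.union_disjoint) (auto simp: fin)
  also have "sum ?T (Suc ` A') = (\<Sum>c\<in>A'. ?T (Suc c))"
    by (simp add: sum.reindex)
  finally have S: "sum ?T A = sum ?T (if 0 \<in> A then {0} else {}) + (\<Sum>c\<in>A'. ?T (Suc c))" .
  show ?case
  proof (cases "0 \<in> A")
    case True
    have "F [] (nths (x # xs) A) + sum ?T A = F [] (x # nths xs A') + (F [x] (nths xs A') +
      (\<Sum>c\<in>A'. F (x # nths xs {i\<in>A'. i \<le> c}) (nths xs {i\<in>A'. c < i})))"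
      using True unfolding S TS by (simp add: nths_Cons A'_def[symmetric] T0[simplified])
    also have "\<dots> = F [] (x # nths xs A') +
       (\<Sum>j\<le>length (nths xs A'). F (x # take j (nths xs A')) (drop j (nths xs A')))"
      using Cons.IH[OF A', of "\<lambda>u v. F (x # u) v"] by simp
    finally show ?thesis
      using True by (simp add: nths_Cons A'_def[symmetric] sum.atMost_Suc_shift del: sum.atMost_Suc)
  next
    case False
    thus ?thesis using Cons.IH[OF A', of F] unfolding S TS by (simp add: nths_Cons A'_def[symmetric])
  qed
qed simp

definition block0 :: "nat set set \<Rightarrow> nat set" where
  "block0 p = (THE B. B \<in> p \<and> 0 \<in> B)"

lemma block0:
  assumes "p \<in> nc_partitions (Suc m)"
  shows "block0 p \<in> p" "0 \<in> block0 p" "\<And>B. B \<in> p \<Longrightarrow> 0 \<in> B \<Longrightarrow> B = block0 p"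
proof -
  have "\<exists>!B. B \<in> p \<and> 0 \<in> B"
    using nc_partitions_cover[OF assms, of 0] nc_partitions_disjnt[OF assms] by auto
  from theI'[OF this] show *: "block0 p \<in> p" "0 \<in> block0 p" unfolding block0_def by blast+
  show "B = block0 p" if "B \<in> p" "0 \<in> B" for B
    using nc_partitions_disjnt[OF assms that(1) *(1) that(2) *(2)] .
qed

text \<open>The noncrossing partitions of a word \<open>a b x\<^sub>1 \<dots> x\<^sub>m\<close> that yield \<open>p\<close> once \<open>a\<close> and \<open>b\<close>
  are merged into one letter: either the block of the merged letter keeps both, or it is cut
  after the position \<open>c\<close>.\<close>

definition nc_lift :: "nat set set \<Rightarrow> nat option \<Rightarrow> nat set set" where
  "nc_lift p z = (`) Suc ` (p - {block0 p}) \<union>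
     (case z of None \<Rightarrow> {insert 0 (Suc ` block0 p)}
      | Some c \<Rightarrow> {Suc ` {x\<in>block0 p. x \<le> c}, insert 0 (Suc ` {x\<in>block0 p. c < x})})"

text \<open>Truncated subtraction sends both 0 and 1 to 0, the position of the merged letter; the
  blocks of 0 and 1 are joined accordingly and all others are merely shifted.\<close>

definition nc_unlift :: "nat set set \<Rightarrow> nat set set" where
  "nc_unlift q = insert ((\<lambda>i. i - 1) ` \<Union>{D\<in>q. 0 \<in> D \<or> 1 \<in> D})
     ((`) (\<lambda>i. i - 1) ` {D\<in>q. 0 \<notin> D \<and> 1 \<notin> D})"

lemma nc_lift_cases:
  assumes "X \<in> nc_lift p z" "z \<in> insert None (Some ` block0 p)"
  obtains D where "D \<in> p - {block0 p}" "X = Suc ` D"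
  | "z = None" "X = insert 0 (Suc ` block0 p)"
  | c where "z = Some c" "c \<in> block0 p" "X = Suc ` {x\<in>block0 p. x \<le> c}"
  | c where "z = Some c" "c \<in> block0 p" "X = insert 0 (Suc ` {x\<in>block0 p. c < x})"
  using assms by (cases z) (auto simp: nc_lift_def)

text \<open>\<open>e\<close> sends a block of the lift to the block of \<open>p\<close> it comes
  from, and lowering positions maps the former into the latter. Disjointness and noncrossing are
  thus inherited from \<open>p\<close>, except between the two pieces of a cut block. These do not
  cross, as one lies up to the cut and the other consists of 0 and of what lies beyond the
  cut.\<close>

lemma nc_lift_nc_partitions:
  assumes p: "p \<in> nc_partitions (Suc m)" and z: "z \<in> insert None (Some ` block0 p)"
  shows "nc_lift p z \<in> nc_partitions (Suc (Suc m))"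
proof -
  note b0 = block0[OF p]
  define e where "e X = (if 0 \<in> X \<or> 1 \<in> X then block0 p else (\<lambda>i. i - 1) ` X)" for X :: "nat set"
  have eS: "e (Suc ` D) = D" if "D \<in> p - {block0 p}" for D
  proof -
    have "0 \<notin> D" using that b0(3) by blast
    hence "0 \<notin> Suc ` D" "1 \<notin> Suc ` D" by auto
    thus ?thesis unfolding e_def by (simp add: image_image)
  qed
  have e: "e X \<in> p" "x \<in> X \<Longrightarrow> x - 1 \<in> e X" if X: "X \<in> nc_lift p z" for x X
  proof -
    have "(\<exists>D. D \<in> p - {block0 p} \<and> X = Suc ` D) \<or> (0 \<in> X \<or> 1 \<in> X) \<and> (\<forall>x\<in>X. x - 1 \<in> block0 p)"
    proof (rule nc_lift_cases[OF X z])
      show ?thesis if "D \<in> p - {block0 p}" "X = Suc ` D" for D using that by blast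
    qed (use b0(2) in simp_all)
    hence "e X \<in> p \<and> (x \<in> X \<longrightarrow> x - 1 \<in> e X)"
    proof
      assume "\<exists>D. D \<in> p - {block0 p} \<and> X = Suc ` D"
      then obtain D where D: "D \<in> p - {block0 p}" "X = Suc ` D" by (elim exE conjE)
      have "e X = D" unfolding D(2) using D(1) by (rule eS)
      show ?thesis unfolding \<open>e X = D\<close> using D by auto
    next
      assume A: "(0 \<in> X \<or> 1 \<in> X) \<and> (\<forall>x\<in>X. x - 1 \<in> block0 p)"
      hence "e X = block0 p" by (simp add: e_def)
      thus ?thesis using b0(1) A by simp
    qed
    thus "e X \<in> p" "x \<in> X \<Longrightarrow> x - 1 \<in> e X" by auto
  qed
  have eq: "X = Y \<or> (\<exists>c\<in>block0 p. {X, Y} = {Suc ` {x\<in>block0 p. x \<le> c}, insert 0 (Suc ` {x\<in>block0 p. c < x})})"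
    if X: "X \<in> nc_lift p z" and Y: "Y \<in> nc_lift p z" and "e X = e Y" for X Y
  proof -
    have A: "X = Suc ` e X" if X: "X \<in> nc_lift p z" and "e X \<noteq> block0 p" for X
    proof -
      have "(\<exists>D. D \<in> p - {block0 p} \<and> X = Suc ` D) \<or> (0 \<in> X \<or> 1 \<in> X)"
      proof (rule nc_lift_cases[OF X z])
        show ?thesis if "D \<in> p - {block0 p}" "X = Suc ` D" for D using that by blast
      qed (use b0(2) in simp_all)
      thus ?thesis
      proof
        assume "\<exists>D. D \<in> p - {block0 p} \<and> X = Suc ` D"
        then obtain D where D: "D \<in> p - {block0 p}" "X = Suc ` D" by (elim exE conjE)
        have "e X = D" unfolding D(2) using D(1) by (rule eS)
        thus ?thesis using D(2) by (simp only:)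
      next
        assume "0 \<in> X \<or> 1 \<in> X"
        thus ?thesis using that(2) unfolding e_def by simp
      qed
    qed
    show ?thesis
    proof (cases "e X = block0 p")
      case False
      thus ?thesis using A X Y \<open>e X = e Y\<close> by metis
    next
      case True
      have "X \<in> (case z of None \<Rightarrow> {insert 0 (Suc ` block0 p)}
      | Some c \<Rightarrow> {Suc ` {x\<in>block0 p. x \<le> c}, insert 0 (Suc ` {x\<in>block0 p. c < x})})"
       if "X \<in> nc_lift p z" "e X = block0 p" for X
      proof -
        have "X \<notin> (`) Suc ` (p - {block0 p})"
        proof
          assume "X \<in> (`) Suc ` (p - {block0 p})"
          then obtain D where D: "D \<in> p - {block0 p}" "X = Suc ` D" by (elim imageE)
          have "e X = D" unfolding D(2) using D(1) by (rule eS)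
          thus False using D(1) that(2) by blast
        qed
        thus ?thesis using that(1) unfolding nc_lift_def by blast
      qed
      from this[OF X True] this[OF Y] True \<open>e X = e Y\<close> z show ?thesis
        by (cases z) (auto simp: insert_commute)
    qed
  qed
  show ?thesis
  proof (rule nc_partitionsI)
    fix X assume X: "X \<in> nc_lift p z"
    have "X \<noteq> {}"
      by (rule nc_lift_cases[OF X z]) (use nc_partitions_nonempty[OF p] b0(2) in auto)
    moreover have "x < Suc (Suc m)" if "x \<in> X" for x
      using e(2)[OF X that] nc_partitions_subset[OF p e(1)[OF X]] by auto
    ultimately show "X \<subseteq> {0..<Suc (Suc m)} \<and> X \<noteq> {}" by auto
  next
    fix i assume i: "i < Suc (Suc m)"
    show "\<exists>B\<in>nc_lift p z. i \<in> B"
    proof (cases i)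
      case 0 thus ?thesis by (cases z) (auto simp: nc_lift_def)
    next
      case (Suc j)
      then obtain D where D: "D \<in> p" "j \<in> D" using nc_partitions_cover[OF p, of j] i by auto
      show ?thesis
      proof (cases "D = block0 p")
        case False
        hence "Suc ` D \<in> nc_lift p z" using D(1) by (auto simp: nc_lift_def)
        thus ?thesis using D(2) Suc by blast
      next
        case True
        thus ?thesis using D Suc by (cases z; force simp: nc_lift_def)
      qed
    qed
  next
    fix X Y x assume *: "X \<in> nc_lift p z" "Y \<in> nc_lift p z" "x \<in> X" "x \<in> Y"
    hence "e X = e Y" using e nc_partitions_disjnt[OF p] by metis
    from eq[OF *(1,2) this] show "X = Y" using *(3,4) by (auto simp: doubleton_eq_iff)
  next
    fix X Y a b c d
    assume *: "X \<in> nc_lift p z" "Y \<in> nc_lift p z" "a \<in> X" "b \<in> Y" "c \<in> X" "d \<in> Y" "a < b" "b < c" "c < d"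
    show "X = Y"
    proof (rule ccontr)
      assume ne: "X \<noteq> Y"
      have "e X = e Y"
      proof (cases "a = 0 \<and> b = 1")
        case True
        thus ?thesis using *(3,4) by (auto simp: e_def)
      next
        case False
        hence "a - 1 < b - 1" "b - 1 < c - 1" "c - 1 < d - 1" using *(7-9) by auto
        thus ?thesis
          using nc_partitions_noncrossing[OF p e(1)[OF *(1)] e(1)[OF *(2)] e(2)[OF *(1,3)] e(2)[OF *(2,4)]
              e(2)[OF *(1,5)] e(2)[OF *(2,6)]] by blast
      qed
      then obtain t where t: "{X, Y} = {Suc ` {x\<in>block0 p. x \<le> t}, insert 0 (Suc ` {x\<in>block0 p. t < x})}"
        using eq[OF *(1,2)] ne by blast
      hence "X = Suc ` {x\<in>block0 p. x \<le> t} \<and> Y = insert 0 (Suc ` {x\<in>block0 p. t < x}) \<or>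
        Y = Suc ` {x\<in>block0 p. x \<le> t} \<and> X = insert 0 (Suc ` {x\<in>block0 p. t < x})"
        by (auto simp: doubleton_eq_iff)
      thus False using *(3-9) by auto
    qed
  qed
qed

lemma nc_unlift_lift:
  assumes p: "p \<in> nc_partitions (Suc m)" and z: "z \<in> insert None (Some ` block0 p)"
  shows "nc_unlift (nc_lift p z) = p"
proof -
  note b0 = block0[OF p]
  have 1: "{D\<in>nc_lift p z. 0 \<notin> D \<and> 1 \<notin> D} = (`) Suc ` (p - {block0 p})"
  proof -
    have 0: "0 \<notin> D" if "D \<in> p - {block0 p}" for D using that b0(3) by blast
    show ?thesis
    proof (intro equalityI subsetI)
      fix X assume "X \<in> {D\<in>nc_lift p z. 0 \<notin> D \<and> 1 \<notin> D}"
      hence X: "X \<in> nc_lift p z" "0 \<notin> X" "1 \<notin> X" by auto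
      show "X \<in> (`) Suc ` (p - {block0 p})"
        by (rule nc_lift_cases[OF X(1) z]) (use X b0(2) in auto)
    qed (use 0 in \<open>auto simp: nc_lift_def\<close>)
  qed
  have 2: "\<Union>{D\<in>nc_lift p z. 0 \<in> D \<or> 1 \<in> D} = insert 0 (Suc ` block0 p)"
  proof -
    have "0 \<notin> D" if "D \<in> p" "D \<noteq> block0 p" for D using that b0(3) by blast
    hence eq: "{D\<in>nc_lift p z. 0 \<in> D \<or> 1 \<in> D} = (case z of None \<Rightarrow> {insert 0 (Suc ` block0 p)}
      | Some c \<Rightarrow> {Suc ` {x\<in>block0 p. x \<le> c}, insert 0 (Suc ` {x\<in>block0 p. c < x})})"
      using z b0(2) unfolding nc_lift_def by (cases z) auto
    show ?thesis unfolding eq by (cases z) (auto simp: image_iff not_less)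
  qed
  have "nc_unlift (nc_lift p z) = insert (block0 p) ((`) (\<lambda>i. i - 1) ` (`) Suc ` (p - {block0 p}))"
    unfolding nc_unlift_def 1 2 using b0(2) by (simp add: image_image insert_absorb)
  thus ?thesis using b0(1) by (auto simp: image_image)
qed

text \<open>Noncrossing forces the shape of a lift: if 0 and 1 lie in different blocks, every
  positive element of the block of 0 lies beyond the whole block of 1 (this is \<open>sep\<close>),
  so the two are the pieces of one cut block.\<close>

lemma nc_unlift_nc_partitions:
  assumes q: "q \<in> nc_partitions (Suc (Suc m))"
  shows "nc_unlift q \<in> nc_partitions (Suc m) \<and> (\<exists>z\<in>insert None (Some ` block0 (nc_unlift q)). nc_lift (nc_unlift q) z = q)"
proof -
  obtain q0 where q0: "q0 \<in> q" "0 \<in> q0" using nc_partitions_cover[OF q, of 0] by auto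
  obtain q1 where q1: "q1 \<in> q" "Suc 0 \<in> q1" using nc_partitions_cover[OF q, of "Suc 0"] by auto
  let ?d = "\<lambda>i::nat. i - 1"
  define B where "B = ?d ` (q0 \<union> q1)"
  have sp: "{D\<in>q. 0 \<in> D \<or> 1 \<in> D} = {q0, q1}"
    using q0 q1 nc_partitions_disjnt[OF q] by auto
  have sp': "{D\<in>q. 0 \<notin> D \<and> 1 \<notin> D} = q - {q0, q1}" using sp by blast
  have u: "nc_unlift q = insert B ((`) ?d ` (q - {q0, q1}))"
    unfolding nc_unlift_def sp sp' B_def by simp
  have B0: "0 \<in> B" using q0 by (auto simp: B_def)
  have nz: "x > 1" if "D \<in> q - {q0, q1}" "x \<in> D" for D x
    using that q0 q1 nc_partitions_disjnt[OF q] by (cases x rule: nat.exhaust; cases "x - 1") auto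
  have lt: "x < Suc (Suc m)" if "D \<in> q" "x \<in> D" for D x
    using nc_partitions_subset[OF q that(1)] that(2) by auto
  have sep: "x < y" if "q0 \<noteq> q1" "x \<in> q1" "y \<in> q0" "y > 0" for x y
  proof (rule ccontr)
    assume "\<not> x < y"
    moreover have "x \<noteq> y" "y \<noteq> 1" "x \<noteq> 0" using that q0 q1 nc_partitions_disjnt[OF q] by auto
    ultimately have "0 < Suc 0" "Suc 0 < y" "y < x" using that(4) by auto
    from nc_partitions_noncrossing[OF q q0(1) q1(1) q0(2) q1(2) that(3,2) this] that(1) show False by simp
  qed
  have Sd: "x \<in> ?d ` D \<longleftrightarrow> Suc x \<in> D" if "D \<in> q - {q0, q1}" for D x
  proof
    assume "x \<in> ?d ` D"
    then obtain y where "y \<in> D" "x = y - 1" by blast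
    thus "Suc x \<in> D" using nz[OF that, of y] by simp
  qed force
  have SB: "Suc x \<in> q0 \<union> q1" if "x \<in> B" "x > 0" for x
  proof -
    obtain y where "y \<in> q0 \<union> q1" "x = y - 1" using \<open>x \<in> B\<close> unfolding B_def by blast
    thus ?thesis using \<open>x > 0\<close> by simp
  qed
  have cross: "False" if D: "D \<in> q - {q0, q1}" and "u \<in> ?d ` D" "w \<in> ?d ` D" "v \<in> B" "u < v" "v < w" for D u v w
  proof -
    have D': "Suc u \<in> D" "Suc w \<in> D" "D \<in> q" using that Sd[OF D] by auto
    have "1 < Suc u" using nz[OF D D'(1)] .
    hence less: "0 < Suc u" "Suc 0 < Suc u" "Suc u < Suc v" "Suc v < Suc w" using that by auto
    have "Suc v \<in> q0 \<union> q1" using SB that by simp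
    thus False
      using nc_partitions_noncrossing[OF q q0(1) D'(3) q0(2) D'(1) _ D'(2) less(1,3,4)]
        nc_partitions_noncrossing[OF q q1(1) D'(3) q1(2) D'(1) _ D'(2) less(2-4)] D by auto
  qed
  have nc: "nc_unlift q \<in> nc_partitions (Suc m)"
  proof (rule nc_partitionsI)
    fix X assume "X \<in> nc_unlift q"
    thus "X \<subseteq> {0..<Suc m} \<and> X \<noteq> {}"
      using lt q0 q1 nc_partitions_nonempty[OF q] unfolding u by (fastforce simp: B_def)
  next
    fix i assume "i < Suc m"
    then obtain D where "D \<in> q" "Suc i \<in> D" using nc_partitions_cover[OF q, of "Suc i"] by auto
    thus "\<exists>X\<in>nc_unlift q. i \<in> X"
      using Sd[of D i] unfolding u B_def by (cases "D \<in> {q0, q1}") (force simp: image_iff)+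
  next
    fix X Y x assume *: "X \<in> nc_unlift q" "Y \<in> nc_unlift q" "x \<in> X" "x \<in> Y"
    have A: False if "D \<in> q - {q0, q1}" "x \<in> ?d ` D" "x \<in> B" for D
    proof -
      have "Suc x \<in> D" using Sd that by blast
      hence "x > 0" using nz that by fastforce
      hence "Suc x \<in> q0 \<union> q1" using SB that by blast
      thus False using \<open>Suc x \<in> D\<close> that(1) nc_partitions_disjnt[OF q] q0(1) q1(1) by blast
    qed
    have "D = E" if "D \<in> q - {q0, q1}" "x \<in> ?d ` D" "E \<in> q - {q0, q1}" "x \<in> ?d ` E" for D E
      using that Sd nc_partitions_disjnt[OF q] by (meson DiffD1)
    thus "X = Y" using * A unfolding u by blast
  next
    fix X Y a b c d
    assume *: "X \<in> nc_unlift q" "Y \<in> nc_unlift q" "a \<in> X" "b \<in> Y" "c \<in> X" "d \<in> Y" "a < b" "b < c" "c < d"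
    have A: "D = E" if "D \<in> q - {q0, q1}" "X = ?d ` D" "E \<in> q - {q0, q1}" "Y = ?d ` E" for D E
    proof -
      have "Suc a \<in> D" "Suc b \<in> E" "Suc c \<in> D" "Suc d \<in> E"
        using Sd[OF that(1)] Sd[OF that(3)] *(3-6) that(2,4) by simp_all
      thus ?thesis using nc_partitions_noncrossing[OF q, of D E "Suc a" "Suc b" "Suc c" "Suc d"] that(1,3) *(7-9) by simp
    qed
    have X: "X = B \<or> (\<exists>D. D \<in> q - {q0, q1} \<and> X = ?d ` D)"
      and Y: "Y = B \<or> (\<exists>D. D \<in> q - {q0, q1} \<and> Y = ?d ` D)"
      using *(1,2) unfolding u by blast+
    from X show "X = Y"
    proof (elim disjE exE conjE)
      assume "X = B"
      from Y show ?thesis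
      proof (elim disjE exE conjE)
        fix D assume D: "D \<in> q - {q0, q1}" and YD: "Y = ?d ` D"
        from cross[OF D, of b d c] * \<open>X = B\<close> show ?thesis unfolding YD by simp
      qed (use \<open>X = B\<close> in simp)
    next
      fix D assume D: "D \<in> q - {q0, q1}" and XD: "X = ?d ` D"
      from Y show ?thesis
      proof (elim disjE exE conjE)
        assume "Y = B"
        from cross[OF D, of a c b] * this show ?thesis unfolding XD by simp
      next
        fix E assume "E \<in> q - {q0, q1}" "Y = ?d ` E"
        from A[OF D XD this] this(2) XD show ?thesis by simp
      qed
    qed
  qed
  have blk: "block0 (nc_unlift q) = B" using block0(3)[OF nc _ B0] u by simp
  have rest: "(`) Suc ` (nc_unlift q - {B}) = q - {q0, q1}"
  proof -
    have "nc_unlift q - {B} = (`) ?d ` (q - {q0, q1})"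
    proof -
      have "B \<notin> (`) ?d ` (q - {q0, q1})"
      proof
        assume "B \<in> (`) ?d ` (q - {q0, q1})"
        then obtain D where D: "D \<in> q - {q0, q1}" "B = ?d ` D" by blast
        hence "Suc 0 \<in> D" using Sd[OF D(1), of 0] B0 by simp
        thus False using nz[OF D(1), of "Suc 0"] by simp
      qed
      thus ?thesis unfolding u by blast
    qed
    moreover have "Suc ` ?d ` D = D" if "D \<in> q - {q0, q1}" for D
    proof -
      have "Suc (x - 1) = x" if "x \<in> D" for x using nz[OF \<open>D \<in> q - {q0, q1}\<close> that] by simp
      thus ?thesis by (simp add: image_image)
    qed
    ultimately show ?thesis by (simp add: image_image)
  qed
  have "\<exists>z\<in>insert None (Some ` B). nc_lift (nc_unlift q) z = q"
  proof (cases "q0 = q1")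
    case True
    have "insert 0 (Suc ` B) = q0"
    proof (rule set_eqI)
      fix x
      have "y \<in> B \<longleftrightarrow> Suc y \<in> q0" for y
      proof
        assume "y \<in> B"
        then obtain z where "z \<in> q0" "y = z - 1" unfolding B_def True[symmetric] by blast
        thus "Suc y \<in> q0" using q1(2) True by (cases z) auto
      next
        assume "Suc y \<in> q0"
        thus "y \<in> B" unfolding B_def by force
      qed
      thus "x \<in> insert 0 (Suc ` B) \<longleftrightarrow> x \<in> q0" using q0(2) by (cases x) auto
    qed
    hence "nc_lift (nc_unlift q) None = q" 
      using rest q0 True unfolding nc_lift_def blk by auto
    thus ?thesis by blast
  next
    case False
    have z1: "0 \<notin> q1" using q0 q1 False nc_partitions_disjnt[OF q] by blast
    have f1: "finite q1" using nc_partitions_subset[OF q q1(1)] finite_subset by blast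
    \<comment> \<open>The cut follows the last element of the block of 1; subtracting 1 gives its
      position after the merging.\<close>
    define c where "c = Max q1 - 1"
    have M: "Max q1 \<in> q1" "\<And>x. x \<in> q1 \<Longrightarrow> x \<le> Max q1" using Max_in[OF f1] Max_ge[OF f1] q1(2) by blast+
    have c: "c \<in> B" unfolding B_def c_def using M by blast
    have M0: "Max q1 > 0" using M(2)[OF q1(2)] by simp
    have e1: "Suc ` {x\<in>B. x \<le> c} = q1"
    proof (intro equalityI subsetI)
      fix x assume "x \<in> Suc ` {x\<in>B. x \<le> c}"
      then obtain y where y: "y \<in> q0 \<union> q1" "x = Suc (y - 1)" "y - 1 \<le> c" unfolding B_def by blast
      show "x \<in> q1"
      proof (cases "y = 0")
        case True thus ?thesis using y q1 by simp
      next
        case F: False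
        hence "x = y" "y \<le> Max q1" using y M0 unfolding c_def by auto
        thus ?thesis using sep[OF False M(1), of y] y(1) F by auto
      qed
    next
      fix x assume x: "x \<in> q1"
      hence "x = Suc (x - 1)" using z1 by (cases x) auto
      moreover have "x - 1 \<in> B" "x - 1 \<le> c" using x M(2)[OF x] by (auto simp: B_def c_def)
      ultimately show "x \<in> Suc ` {x\<in>B. x \<le> c}" by blast
    qed
    have e0: "insert 0 (Suc ` {x\<in>B. c < x}) = q0"
    proof (intro equalityI subsetI)
      fix x assume "x \<in> insert 0 (Suc ` {x\<in>B. c < x})"
      then consider "x = 0" | y where "y \<in> q0 \<union> q1" "x = Suc (y - 1)" "c < y - 1" unfolding B_def by blast
      thus "x \<in> q0"
      proof cases
        case (2 y)
        hence "x = y" "Max q1 < y" unfolding c_def by auto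
        thus ?thesis using M(2)[of y] 2(1) by auto
      qed (use q0 in auto)
    next
      fix x assume x: "x \<in> q0"
      show "x \<in> insert 0 (Suc ` {x\<in>B. c < x})"
      proof (cases x)
        case (Suc y)
        hence "Max q1 < x" using sep[OF False M(1) x] by simp
        hence "c < y" using M0 Suc unfolding c_def by auto
        moreover have "y \<in> B" using x Suc unfolding B_def by force
        ultimately show ?thesis using Suc by blast
      qed simp
    qed
    have "nc_lift (nc_unlift q) (Some c) = q" 
      using rest e0 e1 q0 q1 unfolding nc_lift_def blk by auto
    thus ?thesis using c by blast
  qed
  thus ?thesis using nc blk by simp
qed

lemma bij_nc_lift:
  "bij_betw (\<lambda>(p, z). nc_lift p z) (SIGMA p:nc_partitions (Suc m). insert None (Some ` block0 p))
     (nc_partitions (Suc (Suc m)))"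
proof (rule bij_betwI')
  fix x y assume xy: "x \<in> (SIGMA p:nc_partitions (Suc m). insert None (Some ` block0 p))"
    "y \<in> (SIGMA p:nc_partitions (Suc m). insert None (Some ` block0 p))"
  obtain p z p' z' where [simp]: "x = (p, z)" "y = (p', z')" by (metis surj_pair)
  from xy have p: "p \<in> nc_partitions (Suc m)" "z \<in> insert None (Some ` block0 p)"
    and p': "p' \<in> nc_partitions (Suc m)" "z' \<in> insert None (Some ` block0 p')" by auto
  have "x = y" if eq: "nc_lift p z = nc_lift p' z'"
  proof -
    have pp: "p = p'" using nc_unlift_lift[OF p] nc_unlift_lift[OF p'] eq by simp
    have N: "\<exists>X\<in>nc_lift p None. 0 \<in> X \<and> 1 \<in> X"
      using block0(2)[OF p(1)] by (auto simp: nc_lift_def)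
    have L: "Suc ` {x\<in>block0 p. x \<le> c} \<in> nc_lift p (Some c)" "1 \<in> Suc ` {x\<in>block0 p. x \<le> c}"
      "0 \<notin> Suc ` {x\<in>block0 p. x \<le> c}" for c
      using block0(2)[OF p(1)] by (auto simp: nc_lift_def)
    have NS: "nc_lift p None \<noteq> nc_lift p (Some c)" if "c \<in> block0 p" for c
    proof
      assume eq: "nc_lift p None = nc_lift p (Some c)"
      obtain X where X: "X \<in> nc_lift p (Some c)" "0 \<in> X" "1 \<in> X" using N unfolding eq by blast
      have "nc_lift p (Some c) \<in> nc_partitions (Suc (Suc m))"
        by (rule nc_lift_nc_partitions[OF p(1)]) (use that in simp)
      from nc_partitions_disjnt[OF this X(1) L(1) X(3) L(2)] X(2) L(3) show False by simp
    qed
    have SS: "c = c'" if "nc_lift p (Some c) = nc_lift p (Some c')" "c \<in> block0 p" "c' \<in> block0 p" for c c'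
    proof -
      have "Suc ` {x\<in>block0 p. x \<le> c} = Suc ` {x\<in>block0 p. x \<le> c'}"
      proof -
        have "nc_lift p (Some c) \<in> nc_partitions (Suc (Suc m))"
          by (rule nc_lift_nc_partitions[OF p(1)]) (use that in simp)
        from nc_partitions_disjnt[OF this L(1) _ L(2) L(2)] L(1)[of c'] show ?thesis
          unfolding that(1) by blast
      qed
      hence "{x\<in>block0 p. x \<le> c} = {x\<in>block0 p. x \<le> c'}" by (simp add: inj_image_eq_iff)
      hence "c \<le> c' \<and> c' \<le> c" using that by blast
      thus ?thesis by simp
    qed
    have "z = z'"
    proof (cases z)
      case None
      thus ?thesis using p'(2) eq NS unfolding pp[symmetric] by (cases z') auto
    next
      case (Some c)
      thus ?thesis using p(2) p'(2) eq NS[of c] SS[of c]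
        unfolding pp[symmetric] by (cases z') auto
    qed
    thus ?thesis using pp by simp
  qed
  thus "((\<lambda>(p, z). nc_lift p z) x = (\<lambda>(p, z). nc_lift p z) y) = (x = y)" by auto
next
  fix x assume "x \<in> (SIGMA p:nc_partitions (Suc m). insert None (Some ` block0 p))"
  thus "(\<lambda>(p, z). nc_lift p z) x \<in> nc_partitions (Suc (Suc m))"
    using nc_lift_nc_partitions by auto
next
  fix q assume "q \<in> nc_partitions (Suc (Suc m))"
  from nc_unlift_nc_partitions[OF this]
  show "\<exists>x\<in>(SIGMA p:nc_partitions (Suc m). insert None (Some ` block0 p)). q = (\<lambda>(p, z). nc_lift p z) x"
    by force
qed

lemma sum_nc_partitions_Suc_Suc:
  fixes W :: "nat set set \<Rightarrow> complex"
  shows "(\<Sum>q\<in>nc_partitions (Suc (Suc m)). W q) =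
    (\<Sum>p\<in>nc_partitions (Suc m). W (nc_lift p None) + (\<Sum>c\<in>block0 p. W (nc_lift p (Some c))))"
proof -
  have fin: "finite (block0 p)" if "p \<in> nc_partitions (Suc m)" for p
    using block0(1)[OF that] nc_partitions_subset[OF that] finite_subset by blast
  have "(\<Sum>q\<in>nc_partitions (Suc (Suc m)). W q) =
    (\<Sum>x\<in>(SIGMA p:nc_partitions (Suc m). insert None (Some ` block0 p)). W ((\<lambda>(p, z). nc_lift p z) x))"
    by (rule sum.reindex_bij_betw[OF bij_nc_lift, symmetric])
  also have "\<dots> = (\<Sum>p\<in>nc_partitions (Suc m). \<Sum>z\<in>insert None (Some ` block0 p). W (nc_lift p z))"
    by (subst sum.Sigma) (auto simp: finite_nc_partitions fin split_def)
  also have "\<dots> = (\<Sum>p\<in>nc_partitions (Suc m). W (nc_lift p None) + (\<Sum>c\<in>block0 p. W (nc_lift p (Some c))))"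
    by (intro sum.cong refl) (auto simp: fin sum.reindex)
  finally show ?thesis .
qed

lemma nths_Suc_image: "0 \<notin> D \<Longrightarrow> nths (a # b # xs) (Suc ` D) = nths (c # xs) D"
  by (simp add: nths_Cons) (auto intro!: arg_cong[where f = "nths xs"] simp: image_iff)

text \<open>Expand the moment of the unmerged word and group its partitions by the partition of the
  merged word they yield. In each group the block of position 0 contributes the right-hand side for
  its own letters: \<open>b\<close> keeps the letters that follow it up to the cut, and
  \<open>a\<close> gets those beyond. By induction all groups but that of the one-block partition
  agree with the expansion of the merged word.\<close>

lemma cumulant_mult:
  fixes sc :: "complex \<Rightarrow> 'a::ring_1 \<Rightarrow> 'a"
  assumes fc: "free_cumulants phi kappa"
  shows "kappa (a * b # w) = kappa (a # b # w) +
    (\<Sum>j\<le>length w. kappa (b # take j w) * kappa (a # drop j w))"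
proof (induction "length w" arbitrary: w rule: less_induct)
  case less
  let ?n = "Suc (length w)"
  let ?F = "\<lambda>u v. kappa (b # u) * kappa (a # v)"
  let ?G = "\<lambda>w. kappa (a # b # w) + (\<Sum>j\<le>length w. ?F (take j w) (drop j w))"
  let ?W = "\<lambda>q. \<Prod>B\<in>q. kappa (nths (a # b # w) B)"
  let ?f = "\<lambda>p. \<Prod>B\<in>p. kappa (nths (a * b # w) B)"
  let ?g = "\<lambda>p. ?W (nc_lift p None) + (\<Sum>c\<in>block0 p. ?W (nc_lift p (Some c)))"
  have g: "?g p = ?G (nths w {i. Suc i \<in> block0 p}) * (\<Prod>B\<in>p - {block0 p}. kappa (nths (a * b # w) B))"
    if p: "p \<in> nc_partitions ?n" for p
  proof -
    note b0 = block0[OF p]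
    let ?B = "block0 p"
    let ?A = "{i. Suc i \<in> ?B}"
    let ?R = "\<Prod>B\<in>p - {?B}. kappa (nths (a * b # w) B)"
    have fp: "finite p" by (rule finite_nc_partition[OF p])
    have fB: "finite ?B" using b0(1) nc_partitions_subset[OF p] finite_subset by blast
    have n0: "0 \<notin> D" if "D \<in> p - {?B}" for D using b0(3) that by blast
    have R: "(\<Prod>X\<in>(`) Suc ` (p - {?B}). kappa (nths (a # b # w) X)) = ?R"
    proof -
      have "inj_on ((`) Suc) (p - {?B})" by (auto simp: inj_on_def inj_image_eq_iff)
      hence "(\<Prod>X\<in>(`) Suc ` (p - {?B}). kappa (nths (a # b # w) X)) =
         (\<Prod>D\<in>p - {?B}. kappa (nths (a # b # w) (Suc ` D)))"
        by (simp add: prod.reindex)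
      also have "\<dots> = ?R"
        by (intro prod.cong refl) (simp add: nths_Suc_image[OF n0, of _ a b w "a * b"])
      finally show ?thesis .
    qed
    have notin: "X \<notin> (`) Suc ` (p - {?B})" if "0 \<in> X \<or> 1 \<in> X" for X
    proof
      assume "X \<in> (`) Suc ` (p - {?B})"
      then obtain D where "D \<in> p - {?B}" "X = Suc ` D" by (elim imageE)
      thus False using n0 that by auto
    qed
    have N: "?W (nc_lift p None) = kappa (a # b # nths w ?A) * ?R"
    proof -
      have "?W (nc_lift p None) = kappa (nths (a # b # w) (insert 0 (Suc ` ?B))) * ?R"
        unfolding nc_lift_def option.case using notin[of "insert 0 (Suc ` ?B)"] fp R by simp
      also have "nths (a # b # w) (insert 0 (Suc ` ?B)) = a # b # nths w ?A"
        using b0(2) by (simp add: nths_Cons) (auto intro!: arg_cong[where f = "nths w"])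
      finally show ?thesis .
    qed
    have S: "?W (nc_lift p (Some c)) = kappa (b # nths w {i\<in>?A. Suc i \<le> c}) * kappa (a # nths w {i\<in>?A. c < Suc i}) * ?R" for c
    proof -
      let ?X = "Suc ` {x\<in>?B. x \<le> c}" and ?Y = "insert 0 (Suc ` {x\<in>?B. c < x})"
      have "?X \<noteq> ?Y" by auto
      moreover have "?X \<notin> (`) Suc ` (p - {?B})" "?Y \<notin> (`) Suc ` (p - {?B})"
        using b0(2) by (auto intro!: notin)
      ultimately have "?W (nc_lift p (Some c)) = kappa (nths (a # b # w) ?X) * kappa (nths (a # b # w) ?Y) * ?R"
        unfolding nc_lift_def option.case using fp R by simp
      also have "nths (a # b # w) ?X = b # nths w {i\<in>?A. Suc i \<le> c}"
        using b0(2) by (simp add: nths_Cons) (auto intro!: arg_cong[where f = "nths w"])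
      also have "nths (a # b # w) ?Y = a # nths w {i\<in>?A. c < Suc i}"
        by (simp add: nths_Cons) (auto intro!: arg_cong[where f = "nths w"])
      finally show ?thesis .
    qed
    have B: "?B = insert 0 (Suc ` ?A)"
    proof (rule set_eqI)
      show "i \<in> ?B \<longleftrightarrow> i \<in> insert 0 (Suc ` ?A)" for i using b0(2) by (cases i) auto
    qed
    have sub: "?A \<subseteq> {..<length w}" using nc_partitions_subset[OF p b0(1)] by auto
    have "(\<Sum>c\<in>?B. ?F (nths w {i\<in>?A. Suc i \<le> c}) (nths w {i\<in>?A. c < Suc i})) =
        (\<Sum>c\<in>insert 0 (Suc ` ?A). ?F (nths w {i\<in>?A. Suc i \<le> c}) (nths w {i\<in>?A. c < Suc i}))"
      using B by (rule sum.cong[OF _ refl])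
    also have "\<dots> = ?F [] (nths w ?A) + (\<Sum>c\<in>?A. ?F (nths w {i\<in>?A. i \<le> c}) (nths w {i\<in>?A. c < i}))"
      using finite_subset[OF sub] by (subst sum.insert) (auto simp: sum.reindex)
    also have "\<dots> = (\<Sum>j\<le>length (nths w ?A). ?F (take j (nths w ?A)) (drop j (nths w ?A)))"
      by (rule sum_nths_cut[OF sub])
    finally have C: "(\<Sum>c\<in>?B. ?F (nths w {i\<in>?A. Suc i \<le> c}) (nths w {i\<in>?A. c < Suc i})) = \<dots>" .
    show ?thesis unfolding N S sum_distrib_right[symmetric] C by (simp add: distrib_right)
  qed
  have "?f {{0..<?n}} = ?g {{0..<?n}}"
  proof (rule top_term_eqI)
    have "sum ?f (nc_partitions ?n) = phi (prod_list (a * b # w))"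
      using fc[unfolded free_cumulants_def, rule_format, of "a * b # w"] by simp
    also have "\<dots> = phi (prod_list (a # b # w))" by (simp add: mult.assoc)
    also have "\<dots> = sum ?W (nc_partitions (Suc ?n))"
      using fc[unfolded free_cumulants_def, rule_format, of "a # b # w"] by simp
    also have "\<dots> = sum ?g (nc_partitions ?n)" by (rule sum_nc_partitions_Suc_Suc)
    finally show "sum ?f (nc_partitions ?n) = sum ?g (nc_partitions ?n)" .
  next
    fix p assume p: "p \<in> nc_partitions ?n" "p \<noteq> {{0..<?n}}"
    note b0 = block0[OF p(1)]
    have "card (block0 p) < ?n" using nc_partitions_block_less[OF p b0(1)] .
    moreover have "length (nths (a # w) (block0 p)) = card (block0 p)"
      using nc_partitions_subset[OF p(1) b0(1)] by (intro length_nths_subset) simp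
    ultimately have len: "length (nths w {i. Suc i \<in> block0 p}) < length w"
      using b0(2) by (simp add: nths_Cons_block)
    have "?f p = kappa (nths (a * b # w) (block0 p)) * (\<Prod>B\<in>p - {block0 p}. kappa (nths (a * b # w) B))"
      by (rule prod.remove[OF finite_nc_partition[OF p(1)] b0(1)])
    also have "nths (a * b # w) (block0 p) = a * b # nths w {i. Suc i \<in> block0 p}"
      using b0(2) by (simp add: nths_Cons)
    also have "kappa \<dots> = ?G (nths w {i. Suc i \<in> block0 p})" by (rule less[OF len])
    finally show "?f p = ?g p" using g[OF p(1)] by simp
  qed simp
  moreover have "?g {{0..<?n}} = ?G w"
  proof -
    have "block0 {{0..<?n}} = {0..<?n}"
      using block0(1)[OF top_nc_partitions[of ?n]] by simp
    moreover have "nths w {i. i < length w} = w" by (rule nths_all) auto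
    ultimately show ?thesis using g[OF top_nc_partitions[of ?n]] by simp
  qed
  ultimately show ?case by (simp add: nths_all_upto)
qed

text \<open>In the product formula for \<open>a * 1\<close> the induction hypothesis kills every cut
  with nonempty prefix, and the empty prefix returns \<open>kappa (a # z)\<close> because
  \<open>kappa [1] = 1\<close>. Hence the cumulant with 1 in second place vanishes, and rotation
  moves the 1 to the front.\<close>

lemma cumulant_one:
  fixes sc :: "complex \<Rightarrow> 'a::ring_1 \<Rightarrow> 'a"
  assumes tr: "tracial_state sc phi" and fc: "free_cumulants phi kappa" and "w \<noteq> []"
  shows "kappa (1 # w) = 0"
  using \<open>w \<noteq> []\<close>
proof (induction "length w" arbitrary: w rule: less_induct)
  case less
  obtain z a where w: "w = z @ [a]" using less.prems by (cases w rule: rev_cases) auto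
  have k1: "kappa [1] = 1"
  proof -
    have N: "nc_partitions 1 = {{{0}}}"
    proof (intro equalityI subsetI)
      fix p assume p: "p \<in> nc_partitions 1"
      have "B = {0}" if "B \<in> p" for B
        using nc_partitions_subset[OF p that] nc_partitions_nonempty[OF p that] by auto
      moreover obtain B where "B \<in> p" using nc_partitions_cover[OF p, of 0] by auto
      ultimately show "p \<in> {{{0}}}" by blast
    next
      fix p :: "nat set set" assume "p \<in> {{{0}}}"
      thus "p \<in> nc_partitions 1" using top_nc_partitions[of 1] by simp
    qed
    show ?thesis
      using tr fc[unfolded free_cumulants_def, rule_format, of "[1]"] N by (simp add: tracial_state_def nths_Cons)
  qed
  have "(\<Sum>j\<le>length z. kappa (1 # take j z) * kappa (a # drop j z)) = kappa (a # z)"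
  proof -
    have "(\<Sum>j\<le>length z. kappa (1 # take j z) * kappa (a # drop j z)) = (\<Sum>j\<in>{0}. kappa (1 # take j z) * kappa (a # drop j z))"
    proof (rule sum.mono_neutral_right)
      show "\<forall>j\<in>{..length z} - {0}. kappa (1 # take j z) * kappa (a # drop j z) = 0"
        using less.hyps w by (auto intro!: less.hyps)
    qed auto
    thus ?thesis using k1 by simp
  qed
  hence "kappa (a # 1 # z) = 0"
    using cumulant_mult[OF fc, of a 1 z] by simp
  thus ?case using cumulant_rotate1[OF tr fc, of "1 # z" a] w by simp
qed

section \<open>Oriented cacti\<close>

text \<open>A walk runs against the edges, as in the listing of a pad: the source of each edge
  is the target of the next one.\<close>

fun walk :: "('e \<Rightarrow> 'v) \<Rightarrow> ('e \<Rightarrow> 'v) \<Rightarrow> 'v \<Rightarrow> 'e list \<Rightarrow> 'v \<Rightarrow> bool" where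
  "walk s t x [] y \<longleftrightarrow> x = y"
| "walk s t x (e # es) y \<longleftrightarrow> t e = x \<and> walk s t (s e) es y"

text \<open>Vertices may repeat along the walk; inside a \<open>pad_system\<close> the cuts rule
  this out.\<close>

definition closed_listing :: "('e \<Rightarrow> 'v) \<Rightarrow> ('e \<Rightarrow> 'v) \<Rightarrow> 'e set \<Rightarrow> 'e list \<Rightarrow> bool" where
  "closed_listing s t C es \<longleftrightarrow> es \<noteq> [] \<and> distinct es \<and> set es = C \<and> (\<exists>x. walk s t x es x)"

definition crossing :: "'e set \<Rightarrow> ('e \<Rightarrow> 'v) \<Rightarrow> ('e \<Rightarrow> 'v) \<Rightarrow> ('v \<Rightarrow> bool) \<Rightarrow> 'e set" where
  "crossing E s t X = {e\<in>E. X (s e) \<noteq> X (t e)}"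

text \<open>The pads of an oriented cactus, characterised by cuts: any two edges of a pad
  are the only edges between some set of vertices and its complement.\<close>

definition pad_system :: "'e set \<Rightarrow> ('e \<Rightarrow> 'v) \<Rightarrow> ('e \<Rightarrow> 'v) \<Rightarrow> 'e set set \<Rightarrow> bool" where
  "pad_system E s t P \<longleftrightarrow> partition_on E P \<and>
     (\<forall>C\<in>P. (\<exists>es. closed_listing s t C es) \<and>
       (\<forall>e\<in>C. \<forall>f\<in>C. e \<noteq> f \<longrightarrow> (\<exists>X. crossing E s t X = {e, f})))"

text \<open>The graph determines its pads, and each pad determines its listings up to rotation, so
  for cyclically invariant \<open>kappa\<close> the choices made here have no effect.\<close>

definition cactus_weight ::
  "('a list \<Rightarrow> complex) \<Rightarrow> 'e set \<Rightarrow> ('e \<Rightarrow> 'v) \<Rightarrow> ('e \<Rightarrow> 'v) \<Rightarrow> ('e \<Rightarrow> 'a) \<Rightarrow> complex" where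
  "cactus_weight kappa E s t l =
     (if \<exists>P. pad_system E s t P
      then \<Prod>C\<in>(THE P. pad_system E s t P). kappa (map l (SOME es. closed_listing s t C es)) else 0)"

section \<open>Walks and closed listings\<close>

lemma walk_append: "walk s t x (es @ fs) y \<longleftrightarrow> (\<exists>z. walk s t x es z \<and> walk s t z fs y)"
  by (induction es arbitrary: x) auto

lemma walk_end: "walk s t x es y \<Longrightarrow> y = (if es = [] then x else s (last es))"
  by (induction es arbitrary: x) auto

text \<open>Sources and targets telescope along a walk. Applied to the indicator of a vertex set,
  this compares how often the walk enters and leaves it.\<close>

lemma walk_balance:
  fixes h :: "'v \<Rightarrow> int"
  shows "walk s t x es y \<Longrightarrow> h x + (\<Sum>e\<leftarrow>es. h (s e)) = (\<Sum>e\<leftarrow>es. h (t e)) + h y"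
  by (induction es arbitrary: x) (auto simp: algebra_simps)

lemma walk_const:
  assumes "walk s t x es y" "\<And>e. e \<in> set es \<Longrightarrow> X (s e) = X (t e)"
  shows "X x = X y"
  using assms
proof (induction es arbitrary: x)
  case (Cons e es)
  have "X (s e) = X y" using Cons.prems by (intro Cons.IH) auto
  thus ?case using Cons.prems by simp
qed simp

lemma walk_cong:
  "walk s t x es y \<Longrightarrow> (\<And>e. e \<in> set es \<Longrightarrow> s' e = s e \<and> t' e = t e) \<Longrightarrow> walk s' t' x es y"
  by (induction es arbitrary: x) auto

lemma walk_map:
  "walk s t x es y \<Longrightarrow> (\<And>e. e \<in> set es \<Longrightarrow> s' e = f (s e) \<and> t' e = f (t e)) \<Longrightarrow> walk s' t' (f x) es (f y)"
  by (induction es arbitrary: x) auto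

lemma walk_map_edges: "walk s t x (map j es) y \<longleftrightarrow> walk (s \<circ> j) (t \<circ> j) x es y"
  by (induction es arbitrary: x) auto

lemma closed_listing_finite: "closed_listing s t C es \<Longrightarrow> finite C \<and> C \<noteq> {}"
  by (auto simp: closed_listing_def)

lemma closed_listing_balance:
  fixes h :: "'v \<Rightarrow> int"
  assumes "closed_listing s t C es"
  shows "(\<Sum>e\<in>C. h (s e)) = (\<Sum>e\<in>C. h (t e))"
  using assms walk_balance[of s t _ es _ h]
  by (force simp: closed_listing_def sum_list_distinct_conv_sum_set)

text \<open>A closed walk enters and leaves \<open>X\<close> equally often, which is the balance for
  the indicator of \<open>X\<close>.\<close>

lemma closed_listing_no_single_crossing:
  fixes X :: "'v \<Rightarrow> bool"
  assumes C: "closed_listing s t C es" and "e \<in> C" "X (s e) \<noteq> X (t e)"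
  shows "\<exists>f\<in>C. f \<noteq> e \<and> X (s f) \<noteq> X (t f)"
proof (rule ccontr)
  assume "\<not> ?thesis"
  hence *: "X (s f) = X (t f)" if "f \<in> C - {e}" for f using that by auto
  let ?h = "\<lambda>v. of_bool (X v) :: int"
  have fin: "finite C" using closed_listing_finite[OF C] by simp
  have "(\<Sum>e\<in>C. ?h (s e)) = ?h (s e) + (\<Sum>e\<in>C-{e}. ?h (s e))"
    and "(\<Sum>e\<in>C. ?h (t e)) = ?h (t e) + (\<Sum>e\<in>C-{e}. ?h (t e))"
    by (rule sum.remove[OF fin assms(2)])+
  moreover have "(\<Sum>e\<in>C-{e}. ?h (s e)) = (\<Sum>e\<in>C-{e}. ?h (t e))"
    using * by (intro sum.cong) auto
  ultimately have "?h (s e) = ?h (t e)" using closed_listing_balance[OF C, of ?h] by simp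
  thus False using assms(3) by (auto simp: of_bool_def split: if_splits)
qed

lemma closed_listing_rotate:
  assumes "closed_listing s t C es" "e \<in> C"
  obtains r where "closed_listing s t C (e # r)" "walk s t (t e) (e # r) (t e)"
proof -
  from assms obtain us vs where es: "es = us @ e # vs"
    unfolding closed_listing_def by (metis split_list)
  from assms obtain x where "walk s t x (us @ e # vs) x" unfolding closed_listing_def es by blast
  hence "walk s t (t e) (e # vs @ us) (t e)" by (auto simp: walk_append)
  moreover have "closed_listing s t C (e # vs @ us)"
    using assms(1) calculation unfolding closed_listing_def es by auto
  ultimately show thesis using that by blast
qed

text \<open>Each edge has its own target, so the current vertex determines the next edge.\<close>

lemma walk_unique:
  assumes "walk s t x es y" "walk s t x fs z" "set es = set fs" "distinct es" "distinct fs" "inj_on t (set es)"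
  shows "es = fs"
  using assms
proof (induction es arbitrary: x fs)
  case (Cons e es)
  then obtain f fs' where fs: "fs = f # fs'" by (cases fs) auto
  have "t e = t f" using Cons.prems fs by simp
  hence "e = f" using Cons.prems fs by (metis inj_onD list.set_intros(1))
  moreover have "es = fs'"
  proof (rule Cons.IH)
    show "set es = set fs'" using Cons.prems(3-5) fs \<open>e = f\<close> by auto
    show "inj_on t (set es)" using Cons.prems(6) by simp
  qed (use Cons.prems fs \<open>e = f\<close> in auto)
  ultimately show ?case using fs by simp
qed simp

definition cyclic_invariant :: "('a list \<Rightarrow> complex) \<Rightarrow> bool" where
  "cyclic_invariant kappa \<longleftrightarrow> (\<forall>xs ys. kappa (xs @ ys) = kappa (ys @ xs))"

text \<open>Rotate the second listing until it starts with the first edge of the other; both walks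
  then start at the same vertex and coincide. So any two listings of a pad differ by a rotation,
  which \<open>kappa\<close> does not see.\<close>

lemma closed_listing_kappa_unique:
  assumes rot: "cyclic_invariant kappa"
    and es: "closed_listing s t C es" and fs: "closed_listing s t C fs" and inj: "inj_on t C"
  shows "kappa (map l es) = kappa (map l fs)"
proof -
  obtain e es' where e: "es = e # es'" using es by (cases es) (auto simp: closed_listing_def)
  have eC: "e \<in> C" using es e by (auto simp: closed_listing_def)
  from eC fs obtain us vs where f: "fs = us @ e # vs"
    unfolding closed_listing_def by (metis split_list)
  have w1: "walk s t (t e) es (t e)" using es e by (auto simp: closed_listing_def)
  have w2: "walk s t (t e) (e # vs @ us) (t e)"
    using fs unfolding closed_listing_def f by (auto simp: walk_append)
  have "es = e # vs @ us"
  proof (rule walk_unique[OF w1 w2])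
    show "set es = set (e # vs @ us)" "distinct es" "distinct (e # vs @ us)" "inj_on t (set es)"
      using es fs inj unfolding closed_listing_def f by auto
  qed
  thus ?thesis using rot[unfolded cyclic_invariant_def, rule_format, of "map l (e # vs)" "map l us"] f by simp
qed

section \<open>Uniqueness of the pads\<close>

lemma pad_systemD:
  assumes "pad_system E s t P" "C \<in> P"
  shows "C \<subseteq> E" "C \<noteq> {}" "finite C" "\<exists>es. closed_listing s t C es"
    "\<And>e f. e \<in> C \<Longrightarrow> f \<in> C \<Longrightarrow> e \<noteq> f \<Longrightarrow> \<exists>X. crossing E s t X = {e, f}"
proof -
  have p: "partition_on E P" using assms(1) by (simp add: pad_system_def)
  show "C \<subseteq> E" "C \<noteq> {}" using p assms(2) by (auto simp: partition_on_def)
  show ex: "\<exists>es. closed_listing s t C es" using assms by (simp add: pad_system_def)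
  thus "finite C" using closed_listing_finite by blast
  show "\<exists>X. crossing E s t X = {e, f}" if "e \<in> C" "f \<in> C" "e \<noteq> f" for e f
    using assms that unfolding pad_system_def by simp
qed

lemma pad_system_disjnt:
  "pad_system E s t P \<Longrightarrow> C \<in> P \<Longrightarrow> D \<in> P \<Longrightarrow> x \<in> C \<Longrightarrow> x \<in> D \<Longrightarrow> C = D"
  by (auto simp: pad_system_def partition_on_def disjoint_def)

lemma pad_system_cover: "pad_system E s t P \<Longrightarrow> e \<in> E \<Longrightarrow> \<exists>C\<in>P. e \<in> C"
  unfolding pad_system_def partition_on_def by blast

text \<open>A closed listing through \<open>e\<close> has to cross the cut \<open>{e, f}\<close> a
  second time, and \<open>f\<close> is the only other edge that crosses it.\<close>

lemma pad_system_subset: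
  assumes P: "pad_system E s t P" and P': "pad_system E s t P'"
    and C: "C \<in> P" "C' \<in> P'" "e \<in> C" "e \<in> C'"
  shows "C \<subseteq> C'"
proof
  fix f assume f: "f \<in> C"
  show "f \<in> C'"
  proof (cases "f = e")
    case False
    then obtain X where X: "crossing E s t X = {e, f}" using pad_systemD(5)[OF P C(1)] C(3) f by metis
    obtain es where "closed_listing s t C' es" using pad_systemD(4)[OF P' C(2)] by blast
    moreover have "X (s e) \<noteq> X (t e)" using X by (auto simp: crossing_def)
    ultimately obtain g where "g \<in> C'" "g \<noteq> e" "X (s g) \<noteq> X (t g)"
      using closed_listing_no_single_crossing[of s t C' es e X] C(4) by blast
    moreover from this have "g \<in> crossing E s t X"
      using pad_systemD(1)[OF P' C(2)] by (auto simp: crossing_def)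
    ultimately show ?thesis using X by auto
  qed (use C in simp)
qed

lemma pad_system_unique:
  assumes P: "pad_system E s t P" and P': "pad_system E s t P'"
  shows "P = P'"
proof -
  have *: "C \<in> P'" if P: "pad_system E s t P" and P': "pad_system E s t P'" and C: "C \<in> P" for P P' C
  proof -
    obtain e where e: "e \<in> C" using pad_systemD(2)[OF P C] by blast
    then obtain C' where C': "C' \<in> P'" "e \<in> C'"
      using pad_system_cover[OF P'] pad_systemD(1)[OF P C] by blast
    have "C = C'" using pad_system_subset[OF P P' C C'(1) e C'(2)] pad_system_subset[OF P' P C'(1) C C'(2) e] by blast
    thus ?thesis using C' by simp
  qed
  show ?thesis using *[OF P P'] *[OF P' P] by blast
qed

text \<open>Within the pad only \<open>e\<close> and \<open>f\<close> cross, and the pad enters and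
  leaves \<open>X\<close> equally often, so one of them enters and the other leaves.\<close>

lemma pad_system_crossing_opposite:
  fixes X :: "'v \<Rightarrow> bool"
  assumes P: "pad_system E s t P" and C: "C \<in> P" and ef: "e \<in> C" "f \<in> C" "e \<noteq> f"
    and X: "crossing E s t X = {e, f}"
  shows "X (t e) \<noteq> X (t f)" "X (s e) \<noteq> X (s f)"
proof -
  obtain es where es: "closed_listing s t C es" using pad_systemD(4)[OF P C] by blast
  have fin: "finite C" using pad_systemD(3)[OF P C] .
  have ne: "X (s e) \<noteq> X (t e)" "X (s f) \<noteq> X (t f)" using X by (auto simp: crossing_def)
  have eq: "X (s g) = X (t g)" if "g \<in> C - {e} - {f}" for g
  proof -
    have "g \<notin> crossing E s t X" using X that by auto
    thus ?thesis using that pad_systemD(1)[OF P C] by (auto simp: crossing_def)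
  qed
  let ?h = "\<lambda>v. of_bool (X v) :: int"
  have "(\<Sum>e\<in>C. F e) = F e + (F f + (\<Sum>e\<in>C-{e}-{f}. F e))" for F :: "_ \<Rightarrow> int"
    using fin ef by (subst sum.remove[of C e], simp_all, subst sum.remove[of "C - {e}" f]) auto
  from this[of "\<lambda>g. ?h (s g)"] this[of "\<lambda>g. ?h (t g)"]
  have "?h (s e) + ?h (s f) = ?h (t e) + ?h (t f)"
    using closed_listing_balance[OF es, of ?h] sum.cong[of "C-{e}-{f}" "C-{e}-{f}" "\<lambda>g. ?h (s g)" "\<lambda>g. ?h (t g)"] eq
    by simp
  thus "X (t e) \<noteq> X (t f)" "X (s e) \<noteq> X (s f)" using ne by (auto simp: of_bool_def split: if_splits)
qed

text \<open>Two edges of a pad have their targets, and likewise their sources, on opposite sides of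
  the cut that they span.\<close>

lemma pad_system_inj:
  assumes "pad_system E s t P" "C \<in> P"
  shows "inj_on t C" "inj_on s C"
  unfolding inj_on_def
  using pad_systemD(5)[OF assms] pad_system_crossing_opposite[OF assms] by metis+

text \<open>Frees all later computations from the choices in the definition: any family of closed
  listings of the pads may be used.\<close>

lemma cactus_weight_eq:
  assumes rot: "cyclic_invariant kappa" and P: "pad_system E s t P"
    and L: "\<And>C. C \<in> P \<Longrightarrow> closed_listing s t C (L C)"
  shows "cactus_weight kappa E s t l = (\<Prod>C\<in>P. kappa (map l (L C)))"
proof -
  have the: "(THE P. pad_system E s t P) = P"
    using P pad_system_unique[OF _ P] by (rule the_equality)
  have "kappa (map l (SOME es. closed_listing s t C es)) = kappa (map l (L C))" if "C \<in> P" for C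
    by (rule closed_listing_kappa_unique[OF rot someI[of "closed_listing s t C"] _ pad_system_inj(1)[OF P that]])
       (use L[OF that] in auto)
  thus ?thesis using P unfolding cactus_weight_def the by auto
qed

lemma cactus_weight_0: "(\<And>P. \<not> pad_system E s t P) \<Longrightarrow> cactus_weight kappa E s t l = 0"
  by (simp add: cactus_weight_def)

lemma pad_system_finite: "pad_system E s t P \<Longrightarrow> finite E \<Longrightarrow> finite P"
  unfolding pad_system_def by (blast intro: finite_elements)

section \<open>Renaming vertices and edges, wedges\<close>

lemma pad_system_map:
  assumes P: "pad_system E s t P" and inj: "inj_on f (s ` E \<union> t ` E)"
    and st: "\<And>e. e \<in> E \<Longrightarrow> s' e = f (s e) \<and> t' e = f (t e)"
  shows "pad_system E s' t' P"
proof -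
  have "\<exists>es. closed_listing s' t' C es" if "C \<in> P" for C
  proof -
    obtain es x where "es \<noteq> [] \<and> distinct es \<and> set es = C" "walk s t x es x"
      using pad_systemD(4)[OF P \<open>C \<in> P\<close>] by (auto simp: closed_listing_def)
    moreover have "walk s' t' (f x) es (f x)"
    proof (rule walk_map[OF calculation(2)])
      fix e assume "e \<in> set es"
      hence "e \<in> E" using calculation(1) pad_systemD(1)[OF P \<open>C \<in> P\<close>] by blast
      thus "s' e = f (s e) \<and> t' e = f (t e)" using st by blast
    qed
    ultimately show ?thesis by (auto simp: closed_listing_def)
  qed
  moreover have "\<exists>X. crossing E s' t' X = {e, g}" if "C \<in> P" "e \<in> C" "g \<in> C" "e \<noteq> g" for C e g
  proof -
    obtain X where X: "crossing E s t X = {e, g}" using pad_systemD(5)[OF P] \<open>C \<in> P\<close> \<open>e \<in> C\<close> \<open>g \<in> C\<close> \<open>e \<noteq> g\<close> by metis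
    let ?Y = "\<lambda>v. X (inv_into (s ` E \<union> t ` E) f v)"
    have "crossing E s' t' ?Y = crossing E s t X"
      using st inj by (auto simp: crossing_def)
    thus ?thesis using X by metis
  qed
  moreover have "partition_on E P" using P by (simp add: pad_system_def)
  ultimately show ?thesis unfolding pad_system_def by (intro conjI ballI impI)
qed

lemma cactus_weight_map:
  assumes inj: "inj_on f (s ` E \<union> t ` E)"
    and st: "\<And>e. e \<in> E \<Longrightarrow> s' e = f (s e) \<and> t' e = f (t e) \<and> l' e = l e"
    and rot: "cyclic_invariant kappa"
  shows "cactus_weight kappa E s' t' l' = cactus_weight kappa E s t l"
proof (cases "\<exists>P. pad_system E s t P")
  case True
  then obtain P where P: "pad_system E s t P" by blast
  have P': "pad_system E s' t' P" using pad_system_map[OF P inj] st by blast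
  define L where "L C = (SOME es. closed_listing s t C es)" for C
  have L: "closed_listing s t C (L C)" if "C \<in> P" for C
    unfolding L_def using pad_systemD(4)[OF P that] by (rule someI_ex)
  have L': "closed_listing s' t' C (L C)" if "C \<in> P" for C
  proof -
    obtain x where "L C \<noteq> [] \<and> distinct (L C) \<and> set (L C) = C" "walk s t x (L C) x"
      using L[OF \<open>C \<in> P\<close>] by (auto simp: closed_listing_def)
    moreover have "walk s' t' (f x) (L C) (f x)"
    proof (rule walk_map[OF calculation(2)])
      fix e assume "e \<in> set (L C)"
      hence "e \<in> E" using calculation(1) pad_systemD(1)[OF P \<open>C \<in> P\<close>] by blast
      thus "s' e = f (s e) \<and> t' e = f (t e)" using st by blast
    qed
    ultimately show ?thesis by (auto simp: closed_listing_def)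
  qed
  have "map l' (L C) = map l (L C)" if "C \<in> P" for C
    using L[OF that] st pad_systemD(1)[OF P that] by (auto simp: closed_listing_def)
  hence "(\<Prod>C\<in>P. kappa (map l' (L C))) = (\<Prod>C\<in>P. kappa (map l (L C)))"
    by (intro prod.cong refl arg_cong[where f = kappa])
  thus ?thesis using cactus_weight_eq[OF rot P L, of l] cactus_weight_eq[OF rot P' L', of l'] by simp
next
  case False
  have "\<not> pad_system E s' t' P" for P
  proof
    assume P: "pad_system E s' t' P"
    have "pad_system E s t P"
    proof (rule pad_system_map[OF P, where f = "inv_into (s ` E \<union> t ` E) f"])
      show "inj_on (inv_into (s ` E \<union> t ` E) f) (s' ` E \<union> t' ` E)"
        by (rule inj_on_inv_into) (use st in auto)
      show "s e = inv_into (s ` E \<union> t ` E) f (s' e) \<and> t e = inv_into (s ` E \<union> t ` E) f (t' e)" if "e \<in> E" for e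
        using st that inj by auto
    qed
    thus False using False by blast
  qed
  thus ?thesis using False by (simp add: cactus_weight_def)
qed

lemma pad_system_image:
  assumes P: "pad_system E (s \<circ> j) (t \<circ> j) P" and inj: "inj_on j E"
  shows "pad_system (j ` E) s t ((`) j ` P)"
  unfolding pad_system_def
proof (intro conjI ballI impI)
  show "partition_on (j ` E) ((`) j ` P)"
  proof -
    have p: "partition_on E P" using P by (simp add: pad_system_def)
    have "(`) j ` P - {{}} = (`) j ` P" using p by (auto simp: partition_on_def)
    thus ?thesis using partition_on_inj_image[OF p inj] by simp
  qed
  fix C' assume "C' \<in> (`) j ` P"
  then obtain C where C: "C \<in> P" "C' = j ` C" by (elim imageE)
  obtain es where "closed_listing (s \<circ> j) (t \<circ> j) C es" using pad_systemD(4)[OF P C(1)] by blast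
  moreover have "inj_on j C" using inj pad_systemD(1)[OF P C(1)] by (rule inj_on_subset)
  ultimately have "closed_listing s t C' (map j es)"
    by (auto simp: closed_listing_def C walk_map_edges distinct_map)
  thus "\<exists>es. closed_listing s t C' es" by blast
  fix e' f' assume "e' \<in> C'" "f' \<in> C'" "e' \<noteq> f'"
  then obtain e f where ef: "e \<in> C" "f \<in> C" "e' = j e" "f' = j f" "e \<noteq> f" using C by auto
  then obtain X where X: "crossing E (s \<circ> j) (t \<circ> j) X = {e, f}"
    using pad_systemD(5)[OF P C(1)] by metis
  have "crossing (j ` E) s t X = j ` crossing E (s \<circ> j) (t \<circ> j) X" by (auto simp: crossing_def)
  thus "\<exists>X. crossing (j ` E) s t X = {e', f'}" using X ef by auto
qed

lemma cactus_weight_image: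
  assumes inj: "inj_on j E" and rot: "cyclic_invariant kappa"
  shows "cactus_weight kappa (j ` E) s t l = cactus_weight kappa E (s \<circ> j) (t \<circ> j) (l \<circ> j)"
proof (cases "\<exists>P. pad_system E (s \<circ> j) (t \<circ> j) P")
  case True
  then obtain P where P: "pad_system E (s \<circ> j) (t \<circ> j) P" by blast
  define L where "L C = (SOME es. closed_listing (s \<circ> j) (t \<circ> j) C es)" for C
  have L: "closed_listing (s \<circ> j) (t \<circ> j) C (L C)" if "C \<in> P" for C
    unfolding L_def using pad_systemD(4)[OF P that] by (rule someI_ex)
  have injP: "inj_on ((`) j) P"
    by (rule inj_on_subset[OF inj_on_image_Pow[OF inj]]) (use pad_systemD(1)[OF P] in auto)
  define L' where "L' C' = map j (L (inv_into P ((`) j) C'))" for C'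
  have L'j: "L' (j ` C) = map j (L C)" if "C \<in> P" for C
    using injP that by (simp add: L'_def)
  have "closed_listing s t C' (L' C')" if "C' \<in> (`) j ` P" for C'
  proof -
    obtain C where C: "C \<in> P" "C' = j ` C" using \<open>C' \<in> (`) j ` P\<close> by (elim imageE)
    have "inj_on j C" using inj pad_systemD(1)[OF P C(1)] by (rule inj_on_subset)
    thus ?thesis using L[OF C(1)] L'j[OF C(1)]
      by (auto simp: closed_listing_def C walk_map_edges distinct_map)
  qed
  from cactus_weight_eq[OF rot pad_system_image[OF P inj] this, of l]
  have "cactus_weight kappa (j ` E) s t l = (\<Prod>C\<in>P. kappa (map l (L' (j ` C))))"
    using injP by (simp add: prod.reindex)
  also have "\<dots> = (\<Prod>C\<in>P. kappa (map (l \<circ> j) (L C)))"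
    by (intro prod.cong) (auto simp: L'j)
  also have "\<dots> = cactus_weight kappa E (s \<circ> j) (t \<circ> j) (l \<circ> j)"
    by (rule cactus_weight_eq[OF rot P L, symmetric])
  finally show ?thesis .
next
  case False
  have "\<not> pad_system (j ` E) s t P" for P
  proof
    assume P: "pad_system (j ` E) s t P"
    let ?i = "inv_into E j"
    have "pad_system (j ` E) ((s \<circ> j) \<circ> ?i) ((t \<circ> j) \<circ> ?i) P"
      by (rule pad_system_map[OF P, of id]) (auto simp: f_inv_into_f)
    from pad_system_image[OF this inj_on_inv_into] show False
      using False inj by (auto simp: image_image)
  qed
  thus ?thesis using False by (simp add: cactus_weight_def)
qed

text \<open>An edge that is not a loop lies in a pad with at least one more edge. Rotated to the
  front of the listing, its label makes the cumulant of this pad vanish.\<close>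

lemma cactus_weight_vanish:
  assumes rot: "cyclic_invariant kappa" and fin: "finite E" and e: "e \<in> E" "s e \<noteq> t e"
    and l: "\<And>w. w \<noteq> [] \<Longrightarrow> kappa (l e # w) = 0"
  shows "cactus_weight kappa E s t l = 0"
proof (cases "\<exists>P. pad_system E s t P")
  case True
  then obtain P where P: "pad_system E s t P" by blast
  define L where "L C = (SOME es. closed_listing s t C es)" for C
  have L: "closed_listing s t C (L C)" if "C \<in> P" for C
    unfolding L_def using pad_systemD(4)[OF P that] by (rule someI_ex)
  obtain C where C: "C \<in> P" "e \<in> C" using pad_system_cover[OF P e(1)] by blast
  obtain r where r: "closed_listing s t C (e # r)" "walk s t (t e) (e # r) (t e)"
    using closed_listing_rotate[OF L[OF C(1)] C(2)] by blast
  have "r \<noteq> []" using r(2) e(2) by auto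
  hence "kappa (map l (L C)) = 0"
    using closed_listing_kappa_unique[OF rot L[OF C(1)] r(1) pad_system_inj(1)[OF P C(1)], of l] l by simp
  thus ?thesis using C(1) pad_system_finite[OF P fin] unfolding cactus_weight_eq[OF rot P L, of l, simplified]
    by (auto intro: prod_zero)
next
  case False
  thus ?thesis by (simp add: cactus_weight_def)
qed

text \<open>Retracting everything outside \<open>V1\<close> to \<open>r\<close> turns a cut of a wedge into one of a summand.\<close>

lemma pad_system_wedge:
  assumes dis: "E1 \<inter> E2 = {}"
    and V1: "\<And>e. e \<in> E1 \<Longrightarrow> s e \<in> V1 \<and> t e \<in> V1"
    and V2: "\<And>e. e \<in> E2 \<Longrightarrow> s e \<in> V2 \<and> t e \<in> V2"
    and r: "V1 \<inter> V2 \<subseteq> {r}"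
  shows "pad_system (E1 \<union> E2) s t P \<longleftrightarrow>
    (\<exists>P1 P2. P = P1 \<union> P2 \<and> pad_system E1 s t P1 \<and> pad_system E2 s t P2)"
proof
  have ext: "crossing (E1 \<union> E2) s t (\<lambda>v. X (if v \<in> V1 then v else r)) = crossing E1 s t X"
    if V1: "\<And>e. e \<in> E1 \<Longrightarrow> s e \<in> V1 \<and> t e \<in> V1"
    and V2: "\<And>e. e \<in> E2 \<Longrightarrow> s e \<in> V2 \<and> t e \<in> V2" and r: "V1 \<inter> V2 \<subseteq> {r}" for E1 E2 V1 V2 X
  proof -
    have 2: "v \<in> V2 \<Longrightarrow> (if v \<in> V1 then v else r) = r" for v using r by auto
    have "X (if s e \<in> V1 then s e else r) = X (if t e \<in> V1 then t e else r)" if "e \<in> E2" for e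
      using V2[OF that] 2[of "s e"] 2[of "t e"] by simp
    moreover have "X (if s e \<in> V1 then s e else r) = X (s e) \<and> X (if t e \<in> V1 then t e else r) = X (t e)"
      if "e \<in> E1" for e using V1[OF that] by simp
    ultimately show ?thesis unfolding crossing_def by blast
  qed
  {
    assume P: "pad_system (E1 \<union> E2) s t P"
    \<comment> \<open>A pad with edges in both parts would have a cut that is crossed by one edge on
      each side. Retracted to \<open>V1\<close>, it is crossed by a single edge, which no closed
      listing allows.\<close>
    have one: "C \<subseteq> E1 \<or> C \<subseteq> E2" if C: "C \<in> P" for C
    proof (rule ccontr)
      assume "\<not> ?thesis"
      then obtain e f where ef: "e \<in> C" "f \<in> C" "e \<in> E1" "f \<in> E2" "f \<notin> E1"
        using pad_systemD(1)[OF P C] by blast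
      then obtain X where X: "crossing (E1 \<union> E2) s t X = {e, f}" using pad_systemD(5)[OF P C] by metis
      let ?Y = "\<lambda>v. X (if v \<in> V1 then v else r)"
      have Y: "crossing (E1 \<union> E2) s t ?Y = {e}"
      proof -
        have "crossing E1 s t X = crossing (E1 \<union> E2) s t X \<inter> E1" unfolding crossing_def by blast
        also have "\<dots> = {e}" unfolding X using ef by blast
        finally show ?thesis using ext[of E1 V1 E2 V2 X, OF V1 V2 r] by simp
      qed
      obtain es where es: "closed_listing s t C es" using pad_systemD(4)[OF P C] by blast
      have "e \<in> crossing (E1 \<union> E2) s t ?Y" unfolding Y by simp
      hence "?Y (s e) \<noteq> ?Y (t e)" unfolding crossing_def mem_Collect_eq by blast
      from closed_listing_no_single_crossing[OF es ef(1), of ?Y, OF this]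
      obtain g where g: "g \<in> C" "g \<noteq> e" "?Y (s g) \<noteq> ?Y (t g)" by blast
      hence "g \<in> crossing (E1 \<union> E2) s t ?Y" using pad_systemD(1)[OF P C] by (auto simp: crossing_def)
      thus False using Y g(2) by simp
    qed
    have sub: "pad_system F s t {C\<in>P. C \<subseteq> F}" if F: "F = E1 \<or> F = E2" for F
      unfolding pad_system_def
    proof (intro conjI ballI impI)
      have cov: "\<exists>C\<in>P. C \<subseteq> F \<and> e \<in> C" if e: "e \<in> F" for e
      proof -
        obtain C where C: "C \<in> P" "e \<in> C" using pad_system_cover[OF P, of e] e F by blast
        have "C \<subseteq> F" using one[OF C(1)] C(2) e F dis by blast
        thus ?thesis using C by blast
      qed
      show "partition_on F {C\<in>P. C \<subseteq> F}"
      proof (rule partition_onI)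
        show "\<Union>{C\<in>P. C \<subseteq> F} = F" using cov by blast
        show "disjnt p p'" if "p \<in> {C\<in>P. C \<subseteq> F}" "p' \<in> {C\<in>P. C \<subseteq> F}" "p \<noteq> p'" for p p'
          using pad_system_disjnt[OF P] that unfolding disjnt_def by blast
        show "{} \<notin> {C\<in>P. C \<subseteq> F}" using pad_systemD(2)[OF P] by blast
      qed
      fix C assume C: "C \<in> {C\<in>P. C \<subseteq> F}"
      thus "\<exists>es. closed_listing s t C es" using pad_systemD(4)[OF P] by blast
      fix e f assume "e \<in> C" "f \<in> C" "e \<noteq> f"
      then obtain X where X: "crossing (E1 \<union> E2) s t X = {e, f}" using pad_systemD(5)[OF P] C by blast
      have "e \<in> F" "f \<in> F" using C \<open>e \<in> C\<close> \<open>f \<in> C\<close> by auto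
      hence "crossing F s t X = {e, f}" using X F unfolding crossing_def by blast
      thus "\<exists>X. crossing F s t X = {e, f}" by blast
    qed
    have "P = {C\<in>P. C \<subseteq> E1} \<union> {C\<in>P. C \<subseteq> E2}" using one by blast
    thus "\<exists>P1 P2. P = P1 \<union> P2 \<and> pad_system E1 s t P1 \<and> pad_system E2 s t P2"
      using sub by blast
  next
    assume "\<exists>P1 P2. P = P1 \<union> P2 \<and> pad_system E1 s t P1 \<and> pad_system E2 s t P2"
    then obtain P1 P2 where P: "P = P1 \<union> P2" and P1: "pad_system E1 s t P1" and P2: "pad_system E2 s t P2" by blast
    show "pad_system (E1 \<union> E2) s t P"
      unfolding pad_system_def
    proof (intro conjI ballI impI)
      show "partition_on (E1 \<union> E2) P"
      proof -
        have 1: "\<Union>P1 = E1" "disjoint P1" "{} \<notin> P1" and 2: "\<Union>P2 = E2" "disjoint P2" "{} \<notin> P2"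
          using P1 P2 by (auto simp: pad_system_def partition_on_def)
        have "A \<inter> B = {}" if "A \<in> P1" "B \<in> P2" for A B using that 1(1) 2(1) dis by blast
        hence "disjoint (P1 \<union> P2)" using 1(2) 2(2) unfolding disjoint_def by (metis Int_commute UnE)
        thus ?thesis unfolding P partition_on_def using 1 2 by simp
      qed
      fix C assume "C \<in> P"
      thus "\<exists>es. closed_listing s t C es" using pad_systemD(4)[OF P1] pad_systemD(4)[OF P2] P by blast
      fix e f assume ef: "e \<in> C" "f \<in> C" "e \<noteq> f"
      show "\<exists>X. crossing (E1 \<union> E2) s t X = {e, f}"
      proof (cases "C \<in> P1")
        case True
        then obtain X where "crossing E1 s t X = {e, f}" using pad_systemD(5)[OF P1 True ef] by blast
        thus ?thesis using ext[of E1 V1 E2 V2 X, OF V1 V2 r] by metis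
      next
        case False
        hence "C \<in> P2" using \<open>C \<in> P\<close> P by simp
        then obtain X where "crossing E2 s t X = {e, f}" using pad_systemD(5)[OF P2 _ ef] by blast
        thus ?thesis using ext[of E2 V2 E1 V1 X, OF V2 V1] r by (metis Int_commute Un_commute)
      qed
    qed
  }
qed

lemma cactus_weight_wedge:
  assumes rot: "cyclic_invariant kappa" and fin: "finite E1" "finite E2"
    and dis: "E1 \<inter> E2 = {}"
    and V1: "\<And>e. e \<in> E1 \<Longrightarrow> s e \<in> V1 \<and> t e \<in> V1"
    and V2: "\<And>e. e \<in> E2 \<Longrightarrow> s e \<in> V2 \<and> t e \<in> V2"
    and r: "V1 \<inter> V2 \<subseteq> {r}"
  shows "cactus_weight kappa (E1 \<union> E2) s t l = cactus_weight kappa E1 s t l * cactus_weight kappa E2 s t l"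
proof (cases "(\<exists>P1. pad_system E1 s t P1) \<and> (\<exists>P2. pad_system E2 s t P2)")
  case True
  then obtain P1 P2 where P1: "pad_system E1 s t P1" and P2: "pad_system E2 s t P2" by blast
  have P: "pad_system (E1 \<union> E2) s t (P1 \<union> P2)"
    using P1 P2 pad_system_wedge[of E1 E2 s V1 t V2 r, OF dis V1 V2 r] by blast
  define L where "L C = (SOME es. closed_listing s t C es)" for C
  have L: "closed_listing s t C (L C)" if "C \<in> P1 \<union> P2" for C
    unfolding L_def using pad_systemD(4)[OF P that] by (rule someI_ex)
  have "P1 \<inter> P2 = {}"
    using pad_systemD(1,2)[OF P1] pad_systemD(1)[OF P2] dis by blast
  thus ?thesis
    using cactus_weight_eq[OF rot P L, of l] cactus_weight_eq[OF rot P1 L, of l] cactus_weight_eq[OF rot P2 L, of l]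
      prod.union_disjoint[OF pad_system_finite[OF P1 fin(1)] pad_system_finite[OF P2 fin(2)]] by simp
next
  case False
  hence "\<not> pad_system (E1 \<union> E2) s t P" for P
    using pad_system_wedge[of E1 E2 s V1 t V2 r, OF dis V1 V2 r] by blast
  thus ?thesis using False by (auto simp: cactus_weight_def)
qed

section \<open>Subdividing an edge\<close>

lemma closed_listing_cong:
  "closed_listing s t C es \<Longrightarrow> (\<And>e. e \<in> C \<Longrightarrow> s' e = s e \<and> t' e = t e) \<Longrightarrow> closed_listing s' t' C es"
  unfolding closed_listing_def using walk_cong[of s t _ es _ s' t'] by metis

text \<open>A graph with an edge \<open>a\<close>, and the graphs obtained by subdividing \<open>a\<close>: the new
  middle vertex \<open>x\<close> is either fresh or identified with an old vertex.\<close>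

context
  fixes E :: "'e set" and s t :: "'e \<Rightarrow> 'v" and a b :: 'e and V :: "'v set"
  assumes a: "a \<in> E" and b: "b \<notin> E"
    and sV: "\<And>e. e \<in> E \<Longrightarrow> e \<noteq> a \<Longrightarrow> s e \<in> V" and tV: "\<And>e. e \<in> E \<Longrightarrow> t e \<in> V" and bV: "s b \<in> V"
begin

text \<open>The data kept in all graphs are the target of \<open>a\<close> and the source of
  \<open>b\<close>. In the merged graph \<open>a\<close> runs from the source of \<open>b\<close> to
  its own target; subdivided at \<open>x\<close>, the edge \<open>b\<close> runs into
  \<open>x\<close> and \<open>a\<close> runs out of it.\<close>

private abbreviation (input) s' where "s' \<equiv> s(a := s b)"
private abbreviation (input) sx where "sx x \<equiv> s(a := x)"
private abbreviation (input) tx where "tx x \<equiv> t(b := x)"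

lemma a_neq_b: "a \<noteq> b" "b \<noteq> a"
  using a b by auto

text \<open>Splits a statement about a cut into conditions on \<open>a\<close>, on \<open>b\<close>
  and on the remaining edges; the last condition is literally the same before and after the
  subdivision.\<close>

lemma crossing_subdivide:
  "crossing (insert b E) (sx x) (tx x) X = F \<longleftrightarrow>
     (\<forall>g\<in>E - {a}. X (s g) \<noteq> X (t g) \<longleftrightarrow> g \<in> F) \<and> (X x \<noteq> X (t a) \<longleftrightarrow> a \<in> F) \<and> (X (s b) \<noteq> X x \<longleftrightarrow> b \<in> F) \<and>
     F \<subseteq> insert b E"
proof -
  have eq: "crossing (insert b E) (sx x) (tx x) X = {g\<in>E - {a}. X (s g) \<noteq> X (t g)} \<union> {g. g = a \<and> X x \<noteq> X (t a)} \<union> {g. g = b \<and> X (s b) \<noteq> X x}"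
    unfolding crossing_def using a b by auto
  show ?thesis unfolding eq using a b by blast
qed

lemma crossing_merged:
  "crossing E s' t X = F \<longleftrightarrow>
     (\<forall>g\<in>E - {a}. X (s g) \<noteq> X (t g) \<longleftrightarrow> g \<in> F) \<and> (X (s b) \<noteq> X (t a) \<longleftrightarrow> a \<in> F) \<and> F \<subseteq> E"
proof -
  have eq: "crossing E s' t X = {g\<in>E - {a}. X (s g) \<noteq> X (t g)} \<union> {g. g = a \<and> X (s b) \<noteq> X (t a)}"
    unfolding crossing_def using a by auto
  show ?thesis unfolding eq using a by blast
qed

lemma subdivide_other_listing:
  assumes "a \<notin> C" "b \<notin> C"
  shows "closed_listing (sx x) (tx x) C es \<longleftrightarrow> closed_listing s' t C es"
proof
  assume "closed_listing (sx x) (tx x) C es"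
  thus "closed_listing s' t C es" by (rule closed_listing_cong) (use assms in auto)
next
  assume "closed_listing s' t C es"
  thus "closed_listing (sx x) (tx x) C es" by (rule closed_listing_cong) (use assms in auto)
qed

text \<open>Only \<open>a\<close> and \<open>b\<close> meet at the fresh vertex, so \<open>b\<close>
  is inserted right after \<open>a\<close> in the pad. An old cut extends because the side of
  \<open>w\<close> is free: \<open>w\<close> sides with the source of \<open>b\<close> if
  \<open>a\<close> is to cross, and with the target of \<open>a\<close> if \<open>b\<close> is to
  cross. The cut \<open>{a, b}\<close> isolates \<open>w\<close>.\<close>

lemma pad_system_subdivide_fresh:
  assumes P: "pad_system E s' t P" and C: "C \<in> P" "a \<in> C"
    and L: "closed_listing s' t C (a # r)" and w: "w \<notin> V"
  shows "pad_system (insert b E) (sx w) (tx w) (insert (insert b C) (P - {C}))"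
    and "closed_listing (sx w) (tx w) (insert b C) (a # b # r)"
proof -
  have bP: "b \<notin> D" if "D \<in> P" for D using pad_systemD(1)[OF P that] b by blast
  have aP: "a \<notin> D" if "D \<in> P - {C}" for D using pad_system_disjnt[OF P C(1) _ C(2)] that by blast
  have "walk s' t (t a) (a # r) (t a)" "distinct (a # r)" "set (a # r) = C"
    using L by (auto simp: closed_listing_def)
  moreover from this have "walk (sx w) (tx w) (s b) r (t a)"
    using bP[OF C(1)] by (auto intro: walk_cong)
  ultimately show Lb: "closed_listing (sx w) (tx w) (insert b C) (a # b # r)"
    using a_neq_b bP[OF C(1)] by (auto simp: closed_listing_def)
  have upd: "crossing (insert b E) (sx w) (tx w) (X(w := y)) = F \<longleftrightarrow>
     (\<forall>g\<in>E - {a}. X (s g) \<noteq> X (t g) \<longleftrightarrow> g \<in> F) \<and> (y \<noteq> X (t a) \<longleftrightarrow> a \<in> F) \<and> (X (s b) \<noteq> y \<longleftrightarrow> b \<in> F) \<and>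
     F \<subseteq> insert b E" for X y F
  proof -
    have "s g \<noteq> w" if "g \<in> E - {a}" for g using sV that w by blast
    moreover have "t g \<noteq> w" if "g \<in> E" for g using tV that w by blast
    ultimately show ?thesis unfolding crossing_subdivide using a bV w by auto
  qed
  show "pad_system (insert b E) (sx w) (tx w) (insert (insert b C) (P - {C}))"
    unfolding pad_system_def
  proof (intro conjI ballI impI)
    have p: "partition_on E P" using P by (simp add: pad_system_def)
    show "partition_on (insert b E) (insert (insert b C) (P - {C}))"
    proof (rule partition_onI)
      show "\<Union>(insert (insert b C) (P - {C})) = insert b E"
        using p C(1) by (auto simp: partition_on_def)
      show "{} \<notin> insert (insert b C) (P - {C})" using pad_systemD(2)[OF P] by auto
      fix A B assume *: "A \<in> insert (insert b C) (P - {C})" "B \<in> insert (insert b C) (P - {C})" "A \<noteq> B"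
      have "A \<inter> B = {}" using * bP pad_system_disjnt[OF P] C(1) by blast
      thus "disjnt A B" by (simp add: disjnt_def)
    qed
    fix D assume D: "D \<in> insert (insert b C) (P - {C})"
    show "\<exists>es. closed_listing (sx w) (tx w) D es"
    proof (cases "D = insert b C")
      case False
      hence D: "D \<in> P - {C}" using D by blast
      then obtain es where "closed_listing s' t D es" using pad_systemD(4)[OF P] by blast
      thus ?thesis using subdivide_other_listing aP[OF D] bP D by blast
    qed (use Lb in blast)
    fix e f assume ef: "e \<in> D" "f \<in> D" "e \<noteq> f"
    have sub: "D \<subseteq> insert b E" using D pad_systemD(1)[OF P] C(1) by blast
    have *: "\<exists>X. crossing (insert b E) (sx w) (tx w) X = {e, f}"
      if D: "D \<in> insert (insert b C) (P - {C})" and ef: "e \<in> D" "f \<in> D" "e \<noteq> f" "e \<noteq> b" for e f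
    proof (cases "f = b")
      case False
      define D' where "D' = (if D = insert b C then C else D)"
      have D': "D' \<in> P" "e \<in> D'" "f \<in> D'" using D ef False C(1) by (auto simp: D'_def)
      then obtain X where X: "crossing E s' t X = {e, f}" using pad_systemD(5)[OF P] ef(3) by metis
      show ?thesis
      proof (intro exI)
        show "crossing (insert b E) (sx w) (tx w) (X(w := (if a \<in> {e, f} then X (s b) else X (t a)))) = {e, f}"
          using X False ef unfolding upd crossing_merged by auto
      qed
    next
      case True
      hence D: "D = insert b C" using D ef bP by blast
      show ?thesis
      proof (cases "e = a")
        case True
        have "crossing (insert b E) (sx w) (tx w) ((\<lambda>_. False)(w := True)) = {e, f}"
          unfolding upd using True \<open>f = b\<close> a b by auto
        thus ?thesis by blast
      next
        case False
        then obtain X where X: "crossing E s' t X = {a, e}"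
          using pad_systemD(5)[OF P C(1), of a e] C(2) D ef by auto
        have "crossing (insert b E) (sx w) (tx w) (X(w := X (t a))) = {e, f}"
          using X False \<open>f = b\<close> b unfolding upd crossing_merged by auto
        thus ?thesis by blast
      qed
    qed
    show "\<exists>X. crossing (insert b E) (sx w) (tx w) X = {e, f}"
    proof (cases "e = b")
      case True
      thus ?thesis using *[OF D ef(2,1)] ef(3) by (metis insert_commute)
    qed (use *[OF D ef] in blast)
  qed
qed

text \<open>Placing the middle vertex at the vertex that the pad reaches after \<open>ys\<close>
  pinches the pad into two. An old cut that crosses no edge of \<open>ys\<close>, or none of
  \<open>zs\<close>, does not separate the ends of that stretch, which turns it into a cut of the
  new graph; in the half of \<open>b\<close>, the edge \<open>b\<close> takes over the role of
  \<open>a\<close>.\<close>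

lemma pad_system_subdivide_old:
  assumes P: "pad_system E s' t P" and C: "C \<in> P" "a \<in> C"
    and L: "closed_listing s' t C (a # ys @ zs)" and x: "walk s t (s b) ys x"
  shows "pad_system (insert b E) (sx x) (tx x) (insert (set (b # ys)) (insert (set (a # zs)) (P - {C})))"
    and "closed_listing (sx x) (tx x) (set (b # ys)) (b # ys)"
    and "closed_listing (sx x) (tx x) (set (a # zs)) (a # zs)"
proof -
  have bP: "b \<notin> D" if "D \<in> P" for D using pad_systemD(1)[OF P that] b by blast
  have aP: "a \<notin> D" if "D \<in> P - {C}" for D using pad_system_disjnt[OF P C(1) _ C(2)] that by blast
  have C': "C = insert a (set ys \<union> set zs)" "distinct (a # ys @ zs)"
    using L by (auto simp: closed_listing_def)
  have CE: "C \<subseteq> E" using pad_systemD(1)[OF P C(1)] .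
  have bC: "b \<notin> C" using bP[OF C(1)] .
  have "walk s' t (t a) (a # ys @ zs) (t a)"
    using L by (auto simp: closed_listing_def)
  then obtain x' where x': "walk s' t (s b) ys x'" "walk s' t x' zs (t a)"
    by (auto simp: walk_append)
  have "walk s t (s b) ys x'" using x'(1) by (rule walk_cong) (use C' in auto)
  moreover have "x' = x" if "walk s t u ys x'" "walk s t u ys x" for u
    using that by (induction ys arbitrary: u) auto
  ultimately have [simp]: "x' = x" using x by blast
  have w1: "walk s t (s b) ys x" by fact
  have w2: "walk s t x zs (t a)" using x'(2) unfolding \<open>x' = x\<close> by (rule walk_cong) (use C' in auto)
  have ne: "set (b # ys) \<inter> set (a # zs) = {}" using C' bC a_neq_b by auto
  have "walk (sx x) (tx x) (s b) ys x" using w1 by (rule walk_cong) (use C' bC in auto)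
  thus Lb: "closed_listing (sx x) (tx x) (set (b # ys)) (b # ys)"
    using a_neq_b bC C' by (auto simp: closed_listing_def)
  have "walk (sx x) (tx x) x zs (t a)" using w2 by (rule walk_cong) (use C' bC in auto)
  thus La: "closed_listing (sx x) (tx x) (set (a # zs)) (a # zs)"
    using a_neq_b bC C' by (auto simp: closed_listing_def)
  have cy: "X (s b) = X x" if "\<And>e. e \<in> set ys \<Longrightarrow> X (s e) = X (t e)" for X :: "'v \<Rightarrow> bool"
    using walk_const[OF w1, of X] that by blast
  have cz: "X x = X (t a)" if "\<And>e. e \<in> set zs \<Longrightarrow> X (s e) = X (t e)" for X :: "'v \<Rightarrow> bool"
    using walk_const[OF w2, of X] that by blast
  have ysE: "e \<in> E - {a}" if "e \<in> set ys \<union> set zs" for e using that C' CE by auto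
  show "pad_system (insert b E) (sx x) (tx x) (insert (set (b # ys)) (insert (set (a # zs)) (P - {C})))"
    unfolding pad_system_def
  proof (intro conjI ballI impI)
    have p: "partition_on E P" using P by (simp add: pad_system_def)
    show "partition_on (insert b E) (insert (set (b # ys)) (insert (set (a # zs)) (P - {C})))"
    proof (rule partition_onI)
      have "\<Union>P = E" using p by (simp add: partition_on_def)
      hence "E = C \<union> \<Union>(P - {C})" using C(1) by blast
      thus "\<Union>(insert (set (b # ys)) (insert (set (a # zs)) (P - {C}))) = insert b E"
        using C'(1) by auto
      show "{} \<notin> insert (set (b # ys)) (insert (set (a # zs)) (P - {C}))" using pad_systemD(2)[OF P] by auto
      fix A B assume *: "A \<in> insert (set (b # ys)) (insert (set (a # zs)) (P - {C}))"
        "B \<in> insert (set (b # ys)) (insert (set (a # zs)) (P - {C}))" "A \<noteq> B"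
      have o: "D \<inter> set (b # ys) = {} \<and> D \<inter> set (a # zs) = {}" if D: "D \<in> P - {C}" for D
      proof -
        have "D \<inter> C = {}" using pad_system_disjnt[OF P, of D C] D C(1) by blast
        thus ?thesis using C'(1) bP D by auto
      qed
      have oo: "D \<inter> D' = {}" if "D \<in> P - {C}" "D' \<in> P - {C}" "D \<noteq> D'" for D D'
        using pad_system_disjnt[OF P, of D D'] that by blast
      have A: "A \<in> P - {C} \<or> A = set (b # ys) \<or> A = set (a # zs)"
        and B: "B \<in> P - {C} \<or> B = set (b # ys) \<or> B = set (a # zs)" using *(1,2) by blast+
      have "A \<inter> B = {}"
      proof (cases "A \<in> P - {C}")
        case True
        from B show ?thesis using o[OF True] oo[OF True _ *(3)] by metis
      next
        case False
        hence A: "A = set (b # ys) \<or> A = set (a # zs)" using A by blast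
        show ?thesis
        proof (cases "B \<in> P - {C}")
          case True
          thus ?thesis using o[OF True] A by (metis Int_commute)
        next
          case False
          hence "B = set (b # ys) \<or> B = set (a # zs)" using B by blast
          thus ?thesis using A ne *(3) by (metis Int_commute)
        qed
      qed
      thus "disjnt A B" by (simp add: disjnt_def)
    qed
    fix D assume D: "D \<in> insert (set (b # ys)) (insert (set (a # zs)) (P - {C}))"
    show "\<exists>es. closed_listing (sx x) (tx x) D es"
    proof (cases "D \<in> P - {C}")
      case True
      then obtain es where "closed_listing s' t D es" using pad_systemD(4)[OF P] by blast
      thus ?thesis using subdivide_other_listing aP[OF True] bP True by blast
    qed (use D La Lb in blast)
    fix e f assume ef: "e \<in> D" "f \<in> D" "e \<noteq> f"
    have noc: "X (s g) = X (t g)" if "crossing E s' t X = F" "g \<in> E - {a}" "g \<notin> F" for X F g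
      using that unfolding crossing_merged by blast
    from D consider "D \<in> P - {C}" | "D = set (b # ys)" | "D = set (a # zs)" by blast
    thus "\<exists>X. crossing (insert b E) (sx x) (tx x) X = {e, f}"
    proof cases
      case 1
      then obtain X where X: "crossing E s' t X = {e, f}" using pad_systemD(5)[OF P _ ef] by blast
      have "D \<inter> C = {}" using pad_system_disjnt[OF P, of D C] 1 C(1) by blast
      hence nC: "g \<notin> {e, f}" if "g \<in> C" for g using that ef by blast
      have "X (s b) = X x" by (rule cy, rule noc[OF X]) (use ysE nC C' in auto)
      moreover have "X x = X (t a)" by (rule cz, rule noc[OF X]) (use ysE nC C' in auto)
      moreover have "b \<notin> {e, f}" "a \<notin> {e, f}" using 1 ef bP aP by blast+
      ultimately have "crossing (insert b E) (sx x) (tx x) X = {e, f}"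
        using X unfolding crossing_subdivide crossing_merged by blast
      thus ?thesis by blast
    next
      case 2
      have *: "\<exists>X. crossing (insert b E) (sx x) (tx x) X = {e, f}"
        if ef: "e \<in> set (b # ys)" "f \<in> set ys" "e \<noteq> f" for e f
      proof -
        define e' where "e' = (if e = b then a else e)"
        have "e' \<in> C" "f \<in> C" "e' \<noteq> f" using ef C' by (auto simp: e'_def)
        then obtain X where X: "crossing E s' t X = {e', f}" using pad_systemD(5)[OF P C(1)] by metis
        have "X x = X (t a)" by (rule cz, rule noc[OF X]) (use ysE ef C' in \<open>auto simp: e'_def split: if_splits\<close>)
        hence "crossing (insert b E) (sx x) (tx x) X = {e, f}"
          using X ef a_neq_b C' bC b unfolding crossing_subdivide crossing_merged e'_def by (cases "e = b") auto
        thus ?thesis by blast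
      qed
      show ?thesis
      proof (cases "f = b")
        case True
        thus ?thesis using *[of f e] ef 2 by (simp add: insert_commute)
      qed (use *[of e f] ef 2 in simp)
    next
      case 3
      then obtain X where X: "crossing E s' t X = {e, f}" using pad_systemD(5)[OF P C(1), of e f] ef C' by auto
      have "X (s b) = X x" by (rule cy, rule noc[OF X]) (use ysE ef 3 C' in auto)
      hence "crossing (insert b E) (sx x) (tx x) X = {e, f}"
        using X ef a_neq_b C' bC 3 unfolding crossing_subdivide crossing_merged by auto
      thus ?thesis by blast
    qed
  qed
qed

text \<open>After \<open>a\<close> the listing has to continue with \<open>b\<close>, the only edge
  with target \<open>w\<close>. Deleting \<open>b\<close> from the pad gives a pad of the merged
  graph, with the cuts unchanged.\<close>

lemma pad_system_merge_fresh:
  assumes P: "pad_system (insert b E) (sx w) (tx w) P" and w: "w \<notin> V"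
  shows "\<exists>P. pad_system E s' t P"
proof -
  obtain A where A: "A \<in> P" "a \<in> A" using pad_system_cover[OF P, of a] a by blast
  obtain es where "closed_listing (sx w) (tx w) A es" using pad_systemD(4)[OF P A(1)] by blast
  then obtain r where r: "closed_listing (sx w) (tx w) A (a # r)" "walk (sx w) (tx w) (tx w a) (a # r) (tx w a)"
    using closed_listing_rotate[OF _ A(2)] by blast
  have AE: "A \<subseteq> insert b E" using pad_systemD(1)[OF P A(1)] .
  have r2: "walk (sx w) (tx w) w r (t a)" using r(2) a_neq_b by auto
  then obtain c r' where r': "r = c # r'" using w tV[OF a] by (cases r) auto
  have "c = b"
  proof (rule ccontr)
    assume "c \<noteq> b"
    hence "c \<in> E" using r(1) r' AE by (auto simp: closed_listing_def)
    thus False using r2 r' tV[of c] w \<open>c \<noteq> b\<close> by auto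
  qed
  hence A': "A = insert a (insert b (set r'))" "distinct (a # b # r')"
    using r(1) r' by (auto simp: closed_listing_def)
  have "walk s' t (s b) r' (t a)"
  proof -
    have "walk (sx w) (tx w) (s b) r' (t a)" using r2 a_neq_b unfolding r' \<open>c = b\<close> by simp
    thus ?thesis by (rule walk_cong) (use A'(2) in auto)
  qed
  hence L: "closed_listing s' t (A - {b}) (a # r')" using A' by (auto simp: closed_listing_def)
  have aP: "a \<notin> D \<and> b \<notin> D" if "D \<in> P - {A}" for D
    using pad_system_disjnt[OF P A(1), of D] A' that by blast
  have "pad_system E s' t (insert (A - {b}) (P - {A}))"
    unfolding pad_system_def
  proof (intro conjI ballI impI)
    have U: "\<Union>P = insert b E" using P by (simp add: pad_system_def partition_on_def)
    show "partition_on E (insert (A - {b}) (P - {A}))"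
    proof (rule partition_onI)
      have "\<Union>P = A \<union> \<Union>(P - {A})" using A(1) by blast
      moreover have "b \<notin> \<Union>(P - {A})" using aP by blast
      moreover have "b \<in> A" using A'(1) by blast
      ultimately show "\<Union>(insert (A - {b}) (P - {A})) = E" using U b by auto
      show "{} \<notin> insert (A - {b}) (P - {A})" using pad_systemD(2)[OF P] A a_neq_b by auto
      fix D D' assume "D \<in> insert (A - {b}) (P - {A})" "D' \<in> insert (A - {b}) (P - {A})" "D \<noteq> D'"
      hence "D \<inter> D' = {}" using pad_system_disjnt[OF P] A(1) by blast
      thus "disjnt D D'" by (simp add: disjnt_def)
    qed
    fix D assume D: "D \<in> insert (A - {b}) (P - {A})"
    show "\<exists>es. closed_listing s' t D es"
    proof (cases "D = A - {b}")
      case False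
      hence "D \<in> P - {A}" using D by blast
      thus ?thesis using pad_systemD(4)[OF P, of D] subdivide_other_listing[of D w] aP by blast
    qed (use L in blast)
    fix e f assume ef: "e \<in> D" "f \<in> D" "e \<noteq> f"
    define D' where "D' = (if D = A - {b} then A else D)"
    have D': "D' \<in> P" "e \<in> D'" "f \<in> D'" "b \<notin> {e, f}" using D ef A(1) aP by (auto simp: D'_def)
    then obtain X where X: "crossing (insert b E) (sx w) (tx w) X = {e, f}" using pad_systemD(5)[OF P] ef(3) by metis
    have "crossing E s' t X = {e, f}"
      using X D'(4) unfolding crossing_subdivide crossing_merged by blast
    thus "\<exists>X. crossing E s' t X = {e, f}" by blast
  qed
  thus ?thesis by blast
qed

text \<open>Connectivity of the merged graph puts \<open>a\<close> and \<open>b\<close> into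
  different pads: a cut crossed by exactly these two would be constant along every edge of the
  merged graph and still separate \<open>x\<close> from the target of \<open>a\<close>. The two pads
  share \<open>x\<close>, and the merged edge joins them into one.\<close>

lemma pad_system_merge_old:
  assumes P: "pad_system (insert b E) (sx x) (tx x) P" and x: "x \<in> V"
    and conn: "\<And>X :: 'v \<Rightarrow> bool. (\<forall>e\<in>E. X (s' e) = X (t e)) \<Longrightarrow> \<forall>u\<in>V. \<forall>v\<in>V. X u = X v"
  shows "\<exists>P C. pad_system E s' t P \<and> C \<in> P \<and> a \<in> C \<and> x \<in> s' ` C"
proof -
  obtain A where A: "A \<in> P" "a \<in> A" using pad_system_cover[OF P, of a] a by blast
  obtain B where B: "B \<in> P" "b \<in> B" using pad_system_cover[OF P, of b] by blast
  have AB: "A \<noteq> B"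
  proof
    assume "A = B"
    then obtain X where X: "crossing (insert b E) (sx x) (tx x) X = {a, b}"
      using pad_systemD(5)[OF P A(1,2), of b] B a_neq_b by auto
    have xa: "X x \<noteq> X (t a)" "X (s b) \<noteq> X x" and o: "\<forall>g\<in>E - {a}. X (s g) = X (t g)"
      using X b unfolding crossing_subdivide by blast+
    have "\<forall>e\<in>E. X (s' e) = X (t e)" using o xa by auto
    from conn[OF this] show False using xa x tV[OF a] by blast
  qed
  have dAB: "A \<inter> B = {}" using pad_system_disjnt[OF P A(1) B(1)] AB by blast
  hence nAB: "b \<notin> A" "a \<notin> B" using A B by auto
  obtain es where "closed_listing (sx x) (tx x) A es" using pad_systemD(4)[OF P A(1)] by blast
  then obtain r where r: "closed_listing (sx x) (tx x) A (a # r)" "walk (sx x) (tx x) (tx x a) (a # r) (tx x a)"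
    using closed_listing_rotate[OF _ A(2)] by blast
  obtain es where "closed_listing (sx x) (tx x) B es" using pad_systemD(4)[OF P B(1)] by blast
  then obtain q where q: "closed_listing (sx x) (tx x) B (b # q)" "walk (sx x) (tx x) (tx x b) (b # q) (tx x b)"
    using closed_listing_rotate[OF _ B(2)] by blast
  have AE: "A \<subseteq> insert b E" "B \<subseteq> insert b E" using pad_systemD(1)[OF P] A(1) B(1) by auto
  have A': "A = insert a (set r)" "distinct (a # r)" using r(1) by (auto simp: closed_listing_def)
  have B': "B = insert b (set q)" "distinct (b # q)" using q(1) by (auto simp: closed_listing_def)
  have w1: "walk s' t x r (t a)"
    using r(2) a_neq_b A' nAB by (auto intro!: walk_cong[of "sx x" "tx x" x r "t a" s' t])
  have w2: "walk s' t (s b) q x"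
    using q(2) a_neq_b B' nAB by (auto intro!: walk_cong[of "sx x" "tx x" "s b" q x s' t])
  have L: "closed_listing s' t (A \<union> (B - {b})) (a # q @ r)"
    using w1 w2 A' B' dAB a_neq_b by (auto simp: closed_listing_def walk_append)
  have xC: "x \<in> s' ` (A \<union> (B - {b}))"
  proof (cases q rule: rev_cases)
    case Nil
    hence "x = s' a" using w2 by simp
    thus ?thesis using A(2) by blast
  next
    case (snoc q' c)
    hence "x = s' c" using w2 by (auto simp: walk_append)
    moreover have "c \<in> B - {b}" using B' snoc by auto
    ultimately show ?thesis by blast
  qed
  have o: "a \<notin> D \<and> b \<notin> D \<and> D \<inter> A = {} \<and> D \<inter> B = {}" if "D \<in> P - {A, B}" for D
    using pad_system_disjnt[OF P A(1), of D] pad_system_disjnt[OF P B(1), of D] A B that by blast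
  let ?C = "A \<union> (B - {b})"
  have "pad_system E s' t (insert ?C (P - {A, B}))"
    unfolding pad_system_def
  proof (intro conjI ballI impI)
    have U: "\<Union>P = insert b E" using P by (simp add: pad_system_def partition_on_def)
    show "partition_on E (insert ?C (P - {A, B}))"
    proof (rule partition_onI)
      have "\<Union>P = A \<union> B \<union> \<Union>(P - {A, B})" using A(1) B(1) by blast
      moreover have "b \<notin> \<Union>(P - {A, B})" using o by blast
      ultimately show "\<Union>(insert ?C (P - {A, B})) = E" using U nAB(1) b B(2) by auto
      show "{} \<notin> insert ?C (P - {A, B})" using pad_systemD(2)[OF P] A by auto
      fix D D' assume *: "D \<in> insert ?C (P - {A, B})" "D' \<in> insert ?C (P - {A, B})" "D \<noteq> D'"
      have oo: "D \<inter> D' = {}" if "D \<in> P - {A, B}" "D' \<in> P - {A, B}" "D \<noteq> D'" for D D'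
        using pad_system_disjnt[OF P, of D D'] that by blast
      have CC: "?C \<inter> D = {}" if "D \<in> P - {A, B}" for D using o[OF that] by blast
      have "D \<inter> D' = {}"
      proof (cases "D = ?C")
        case True
        hence "D' \<in> P - {A, B}" using * by blast
        thus ?thesis using CC[of D'] True by blast
      next
        case False
        hence D: "D \<in> P - {A, B}" using *(1) by blast
        show ?thesis
        proof (cases "D' = ?C")
          case True
          thus ?thesis using CC[OF D] by blast
        next
          case False
          hence "D' \<in> P - {A, B}" using *(2) by blast
          thus ?thesis using oo[OF D _ *(3)] by blast
        qed
      qed
      thus "disjnt D D'" by (simp add: disjnt_def)
    qed
    fix D assume D: "D \<in> insert ?C (P - {A, B})"
    show "\<exists>es. closed_listing s' t D es"
    proof (cases "D = ?C")
      case False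
      hence "D \<in> P - {A, B}" using D by blast
      thus ?thesis using pad_systemD(4)[OF P, of D] subdivide_other_listing[of D x] o by blast
    qed (use L in blast)
    fix e f assume ef: "e \<in> D" "f \<in> D" "e \<noteq> f"
    have same: "\<exists>X. crossing E s' t X = {e, f}" if D': "D' \<in> P" "e \<in> D'" "f \<in> D'" "e \<noteq> f" "b \<notin> {e, f}" for D' e f
    proof -
      obtain X where X: "crossing (insert b E) (sx x) (tx x) X = {e, f}" using pad_systemD(5)[OF P D'(1-4)] by blast
      have "crossing E s' t X = {e, f}"
        using X D'(5) unfolding crossing_subdivide crossing_merged by blast
      thus ?thesis by blast
    qed
    have mixed: "\<exists>X. crossing E s' t X = {e, f}" if e: "e \<in> A" and f: "f \<in> B - {b}" for e f
    proof -
      have ef: "e \<noteq> b" "f \<noteq> a" "f \<noteq> b" "e \<noteq> f" using e f nAB dAB by auto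
      have efE: "e \<in> E" "f \<in> E" using e f AE ef by auto
      obtain Y where Y: "crossing (insert b E) (sx x) (tx x) Y = {b, f}"
        using pad_systemD(5)[OF P B, of f] f by blast
      show ?thesis
      proof (cases "e = a")
        case True
        have y: "\<forall>g\<in>E - {a}. Y (s g) \<noteq> Y (t g) \<longleftrightarrow> g \<in> {b, f}"
            "Y x \<noteq> Y (t a) \<longleftrightarrow> a \<in> {b, f}" "Y (s b) \<noteq> Y x \<longleftrightarrow> b \<in> {b, f}"
          using Y unfolding crossing_subdivide by blast+
        have "Y (s b) \<noteq> Y (t a)" using y(2,3) ef(2) a_neq_b by auto
        moreover have "Y (s g) \<noteq> Y (t g) \<longleftrightarrow> g \<in> {e, f}" if "g \<in> E - {a}" for g
          using y(1) that True b by auto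
        ultimately have "crossing E s' t Y = {e, f}"
          using True efE unfolding crossing_merged by blast
        thus ?thesis by blast
      next
        case False
        obtain X where X: "crossing (insert b E) (sx x) (tx x) X = {a, e}"
          using pad_systemD(5)[OF P A, of e] e False by blast
        have y: "\<forall>g\<in>E - {a}. Y (s g) \<noteq> Y (t g) \<longleftrightarrow> g \<in> {b, f}"
            "Y x \<noteq> Y (t a) \<longleftrightarrow> a \<in> {b, f}" "Y (s b) \<noteq> Y x \<longleftrightarrow> b \<in> {b, f}"
          using Y unfolding crossing_subdivide by blast+
        have z: "\<forall>g\<in>E - {a}. X (s g) \<noteq> X (t g) \<longleftrightarrow> g \<in> {a, e}"
            "X x \<noteq> X (t a) \<longleftrightarrow> a \<in> {a, e}" "X (s b) \<noteq> X x \<longleftrightarrow> b \<in> {a, e}"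
          using X unfolding crossing_subdivide by blast+
        \<comment> \<open>The exclusive or of the cuts \<open>{a, e}\<close> and
          \<open>{b, f}\<close>. The merged edge stands for \<open>a\<close> and \<open>b\<close> in
          succession, so it crosses twice and ends on the same side; \<open>e\<close> and
          \<open>f\<close> remain.\<close>
        let ?Z = "\<lambda>v. X v \<noteq> Y v"
        have "\<not> ?Z (s b) \<noteq> ?Z (t a)" using y(2,3) z(2,3) ef(1,2) a_neq_b by auto
        moreover have "?Z (s g) \<noteq> ?Z (t g) \<longleftrightarrow> g \<in> {e, f}" if "g \<in> E - {a}" for g
        proof -
          have "g \<noteq> b" "g \<noteq> a" using that b by auto
          thus ?thesis using y(1)[rule_format, OF that] z(1)[rule_format, OF that] ef(4) by auto
        qed
        ultimately have "crossing E s' t ?Z = {e, f}"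
          using False efE ef(2) unfolding crossing_merged by blast
        thus ?thesis by blast
      qed
    qed
    show "\<exists>X. crossing E s' t X = {e, f}"
    proof (cases "D = ?C")
      case False
      hence "D \<in> P - {A, B}" using D by blast
      thus ?thesis using same[of D e f] ef o by blast
    next
      case True
      then consider "e \<in> A" "f \<in> A" | "e \<in> B - {b}" "f \<in> B - {b}" | "e \<in> A" "f \<in> B - {b}" | "e \<in> B - {b}" "f \<in> A"
        using ef by blast
      thus ?thesis
      proof cases
        case 1 thus ?thesis using same[OF A(1), of e f] ef(3) nAB by blast
      next
        case 2 thus ?thesis using same[OF B(1), of e f] ef(3) by blast
      next
        case 3 thus ?thesis by (rule mixed)
      next
        case 4 thus ?thesis using mixed[of f e] by (simp add: insert_commute)
      qed
    qed
  qed
  thus ?thesis using A(2) xC by blast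
qed

end

text \<open>The product formula for the cumulant of the pad through the merged edge, read
  geometrically: the first term is the fresh middle vertex, and the term with cut \<open>j\<close>
  is the middle vertex placed where the pad arrives after \<open>j\<close> further edges. A middle
  vertex at a vertex of \<open>V\<close> outside this pad gives no cactus.\<close>

lemma cactus_weight_subdivide:
  fixes E :: "'e set" and s t :: "'e \<Rightarrow> 'v" and V :: "'v set"
  assumes rot: "cyclic_invariant kappa" and fin: "finite E" "finite V"
    and mul: "\<And>x y w. kappa (x * y # w) = kappa (x # y # w) +
      (\<Sum>j\<le>length w. kappa (y # take j w) * kappa (x # drop j w))"
    and a: "a \<in> E" and b: "b \<notin> E"
    and sV: "\<And>e. e \<in> E \<Longrightarrow> e \<noteq> a \<Longrightarrow> s e \<in> V" and tV: "\<And>e. e \<in> E \<Longrightarrow> t e \<in> V" and bV: "s b \<in> V"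
    and w: "w \<notin> V"
    and conn: "\<And>X :: 'v \<Rightarrow> bool. (\<forall>e\<in>E. X ((s(a := s b)) e) = X (t e)) \<Longrightarrow> \<forall>u\<in>V. \<forall>v\<in>V. X u = X v"
  shows "cactus_weight kappa E (s(a := s b)) t (l(a := l a * l b)) =
    cactus_weight kappa (insert b E) (s(a := w)) (t(b := w)) l +
    (\<Sum>x\<in>V. cactus_weight kappa (insert b E) (s(a := x)) (t(b := x)) l)"
proof (cases "\<exists>P. pad_system E (s(a := s b)) t P")
  case False
  have "\<not> pad_system (insert b E) (s(a := w)) (t(b := w)) P" for P
  proof
    assume "pad_system (insert b E) (s(a := w)) (t(b := w)) P"
    from pad_system_merge_fresh[OF a b sV tV bV this w] False show False by blast
  qed
  moreover have "\<not> pad_system (insert b E) (s(a := x)) (t(b := x)) P" if "x \<in> V" for x P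
  proof
    assume "pad_system (insert b E) (s(a := x)) (t(b := x)) P"
    from pad_system_merge_old[OF a b sV tV bV this that conn] False show False by blast
  qed
  ultimately show ?thesis using False by (simp add: cactus_weight_def)
next
  case True
  let ?s = "s(a := s b)" and ?l = "l(a := l a * l b)"
  from True obtain P where P: "pad_system E ?s t P" by blast
  obtain C where C: "C \<in> P" "a \<in> C" using pad_system_cover[OF P a] by blast
  define L where "L C = (SOME es. closed_listing ?s t C es)" for C
  have L: "closed_listing ?s t C (L C)" if "C \<in> P" for C
    unfolding L_def using pad_systemD(4)[OF P that] by (rule someI_ex)
  obtain r where r: "closed_listing ?s t C (a # r)" "walk ?s t (t a) (a # r) (t a)"
    using closed_listing_rotate[OF L[OF C(1)] C(2)] by blast
  have C': "C = insert a (set r)" "distinct (a # r)" using r(1) by (auto simp: closed_listing_def)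
  have fP: "finite P" using pad_system_finite[OF P fin(1)] .
  have bP: "b \<notin> D" if "D \<in> P" for D using pad_systemD(1)[OF P that] b by blast
  have aP: "a \<notin> D" if "D \<in> P - {C}" for D using pad_system_disjnt[OF P C(1) _ C(2)] that by blast
  have ab: "a \<noteq> b" using a b by auto
  have lr: "map ?l r = map l r" using C'(2) by auto
  define R where "R = (\<Prod>D\<in>P - {C}. kappa (map l (L D)))"
  have R': "(\<Prod>D\<in>P - {C}. kappa (map ?l (L D))) = R"
    unfolding R_def
  proof (intro prod.cong refl arg_cong[where f = kappa] map_cong)
    fix D e assume "D \<in> P - {C}" "e \<in> set (L D)"
    hence "e \<noteq> a" using aP[of D] L[of D] by (auto simp: closed_listing_def)
    thus "?l e = l e" by simp
  qed
  have LD: "closed_listing (s(a := x)) (t(b := x)) D (L D)" if "D \<in> P - {C}" for D x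
  proof (rule closed_listing_cong[OF L])
    show "D \<in> P" using that by blast
    fix e assume "e \<in> D"
    hence "e \<noteq> a" "e \<noteq> b" using aP[OF that] bP[of D] that by auto
    thus "(s(a := x)) e = ?s e \<and> (t(b := x)) e = t e" by simp
  qed
  have W: "cactus_weight kappa E ?s t ?l = kappa (l a * l b # map l r) * R"
  proof -
    have "cactus_weight kappa E ?s t ?l = (\<Prod>D\<in>P. kappa (map ?l ((L(C := a # r)) D)))"
      by (rule cactus_weight_eq[OF rot P]) (use L r in auto)
    also have "\<dots> = kappa (map ?l (a # r)) * (\<Prod>D\<in>P - {C}. kappa (map ?l ((L(C := a # r)) D)))"
      unfolding prod.remove[OF fP C(1), of "\<lambda>D. kappa (map ?l ((L(C := a # r)) D))"] by simp
    also have "(\<Prod>D\<in>P - {C}. kappa (map ?l ((L(C := a # r)) D))) = R"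
      unfolding R'[symmetric] by (intro prod.cong) auto
    also have "map ?l (a # r) = l a * l b # map l r" unfolding list.map(2) lr by simp
    finally show ?thesis .
  qed
  have Ww: "cactus_weight kappa (insert b E) (s(a := w)) (t(b := w)) l = kappa (l a # l b # map l r) * R"
  proof -
    note F = pad_system_subdivide_fresh[OF a b sV tV bV P C r(1) w]
    have nP: "insert b C \<notin> P - {C}" using bP by blast
    have "cactus_weight kappa (insert b E) (s(a := w)) (t(b := w)) l =
      (\<Prod>D\<in>insert (insert b C) (P - {C}). kappa (map l ((L(insert b C := a # b # r)) D)))"
      by (rule cactus_weight_eq[OF rot F(1)]) (use LD F(2) in auto)
    also have "\<dots> = kappa (map l (a # b # r)) * (\<Prod>D\<in>P - {C}. kappa (map l ((L(insert b C := a # b # r)) D)))"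
      using nP fP by (subst prod.insert) auto
    also have "(\<Prod>D\<in>P - {C}. kappa (map l ((L(insert b C := a # b # r)) D))) = R"
      unfolding R_def using nP by (intro prod.cong) auto
    also have "map l (a # b # r) = l a # l b # map l r" by simp
    finally show ?thesis .
  qed
  have Wx: "cactus_weight kappa (insert b E) (s(a := x)) (t(b := x)) l =
      kappa (l b # map l ys) * kappa (l a # map l zs) * R"
    if x: "walk s t (s b) ys x" and yz: "r = ys @ zs" for x ys zs
  proof -
    note F = pad_system_subdivide_old[OF a b sV tV bV P C r(1)[unfolded yz] x]
    let ?B = "set (b # ys)" and ?A = "set (a # zs)"
    have nB: "?B \<notin> P - {C}" using bP by auto
    have nA: "?A \<notin> P - {C}" using aP by auto
    have "a \<notin> ?B" using C' yz ab by auto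
    hence nAB: "?B \<noteq> ?A" by (metis list.set_intros(1))
    let ?L = "L(?B := b # ys, ?A := a # zs)"
    have LA: "closed_listing (s(a := x)) (t(b := x)) D (?L D)"
      if D: "D \<in> insert ?B (insert ?A (P - {C}))" for D
    proof (cases "D = ?A")
      case True
      hence "?L D = a # zs" by simp
      show ?thesis unfolding \<open>?L D = a # zs\<close> unfolding True using F(3) by blast
    next
      case False
      show ?thesis
      proof (cases "D = ?B")
        case T: True
        hence "?L D = b # ys" using nAB by simp
        show ?thesis unfolding \<open>?L D = b # ys\<close> unfolding T using F(2) by blast
      next
        case F: False
        hence "D \<in> P - {C}" using D False by blast
        moreover have "?L D = L D" using False F by simp
        ultimately show ?thesis using LD[of D x] by (simp only:)
      qed
    qed
    have "cactus_weight kappa (insert b E) (s(a := x)) (t(b := x)) l =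
      (\<Prod>D\<in>insert ?B (insert ?A (P - {C})). kappa (map l (?L D)))"
      by (rule cactus_weight_eq[OF rot F(1) LA])
    also have "\<dots> = kappa (map l (?L ?B)) * (kappa (map l (?L ?A)) * (\<Prod>D\<in>P - {C}. kappa (map l (?L D))))"
    proof -
      have "?B \<notin> insert ?A (P - {C})" using nB nAB by blast
      thus ?thesis using fP nA by (simp only: prod.insert finite_insert finite_Diff not_False_eq_True)
    qed
    also have "(\<Prod>D\<in>P - {C}. kappa (map l (?L D))) = R"
      unfolding R_def
    proof (intro prod.cong refl)
      fix D assume "D \<in> P - {C}"
      hence "?L D = L D" using nA nB by (metis fun_upd_other)
      thus "kappa (map l (?L D)) = kappa (map l (L D))" by (simp only:)
    qed
    also have "?L ?B = b # ys" using nAB by simp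
    also have "?L ?A = a # zs" by simp
    also have "kappa (map l (b # ys)) * (kappa (map l (a # zs)) * R) =
        kappa (l b # map l ys) * kappa (l a # map l zs) * R"
      by simp
    finally show ?thesis .
  qed
  \<comment> \<open>The vertex reached after the first \<open>j\<close> edges of \<open>r\<close>;
    for \<open>j = 0\<close> it is the source of the merged edge, that is
    \<open>s b\<close>.\<close>
  define x where "x j = ?s ((a # r) ! j)" for j
  have wx: "walk s t (s b) (take j r) (x j)" if "j \<le> length r" for j
  proof -
    have w1: "walk ?s t (s b) (take j r @ drop j r) (t a)" using r(2) by simp
    obtain y where y: "walk ?s t (s b) (take j r) y" using w1 unfolding walk_append by blast
    have "y = (if take j r = [] then s b else ?s (last (take j r)))" by (rule walk_end[OF y])
    also have "\<dots> = x j"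
    proof (cases j)
      case (Suc i)
      hence "take j r = take i r @ [r ! i]" using that by (simp add: take_Suc_conv_app_nth)
      hence "take j r \<noteq> []" "last (take j r) = r ! i" by simp_all
      thus ?thesis using Suc by (simp add: x_def)
    qed (simp add: x_def)
    finally have "walk ?s t (s b) (take j r) (x j)" using y by simp
    moreover have "e \<noteq> a" if "e \<in> set (take j r)" for e using C'(2) that by (auto dest: in_set_takeD)
    ultimately show ?thesis by (elim walk_cong) auto
  qed
  have xinj: "inj_on x {..length r}"
  proof (rule inj_onI)
    fix i j assume "i \<in> {..length r}" "j \<in> {..length r}" "x i = x j"
    moreover from this have "(a # r) ! i \<in> C" "(a # r) ! j \<in> C"
      unfolding C'(1) list.simps(15)[symmetric] by (intro nth_mem; simp)+
    ultimately have "(a # r) ! i = (a # r) ! j"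
      using inj_onD[OF pad_system_inj(2)[OF P C(1)]] \<open>x i = x j\<close> unfolding x_def by blast
    thus "i = j" using C'(2) \<open>i \<in> _\<close> \<open>j \<in> _\<close> by (subst (asm) nth_eq_iff_index_eq) auto
  qed
  have ximg: "x ` {..length r} = ?s ` C"
  proof -
    have "(!) (a # r) ` {..length r} = set (a # r)"
      by (subst set_conv_nth) (auto simp: less_Suc_eq_le image_iff)
    thus ?thesis unfolding x_def C'(1) by (metis image_image list.simps(15))
  qed
  have sub: "?s ` C \<subseteq> V" using pad_systemD(1)[OF P C(1)] sV bV by auto
  have "(\<Sum>x\<in>V. cactus_weight kappa (insert b E) (s(a := x)) (t(b := x)) l) =
    (\<Sum>x\<in>?s ` C. cactus_weight kappa (insert b E) (s(a := x)) (t(b := x)) l)"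
  proof (rule sum.mono_neutral_right[OF fin(2) sub], intro ballI cactus_weight_0)
    fix y Q assume y: "y \<in> V - ?s ` C"
    show "\<not> pad_system (insert b E) (s(a := y)) (t(b := y)) Q"
    proof
      assume "pad_system (insert b E) (s(a := y)) (t(b := y)) Q"
      from pad_system_merge_old[OF a b sV tV bV this _ conn] y
      obtain P' D where "pad_system E ?s t P'" "D \<in> P'" "a \<in> D" "y \<in> ?s ` D" by blast
      moreover from this have "D = C"
        using pad_system_unique[OF P, of P'] pad_system_disjnt[OF P _ C(1) _ C(2), of D] by blast
      ultimately show False using y by blast
    qed
  qed
  also have "\<dots> = (\<Sum>j\<le>length r. cactus_weight kappa (insert b E) (s(a := x j)) (t(b := x j)) l)"
    unfolding ximg[symmetric] by (simp add: sum.reindex[OF xinj])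
  also have "\<dots> = (\<Sum>j\<le>length r. kappa (l b # take j (map l r)) * kappa (l a # drop j (map l r)) * R)"
    by (intro sum.cong refl) (simp add: Wx[OF wx] take_map drop_map)
  also have "\<dots> = (\<Sum>j\<le>length r. kappa (l b # take j (map l r)) * kappa (l a # drop j (map l r))) * R"
    by (simp add: sum_distrib_right)
  finally show ?thesis unfolding W Ww using mul[of "l a" "l b" "map l r"] by (simp add: distrib_right)
qed

section \<open>Agreement with simple cycles\<close>

text \<open>The body of \<open>is_cycle\<close> detached from the graph record; the bound on the
  edge indices becomes a separate inclusion.\<close>

definition simple_cycle :: "('e \<Rightarrow> 'v) \<Rightarrow> ('e \<Rightarrow> 'v) \<Rightarrow> 'e set \<Rightarrow> bool" where
  "simple_cycle s t D \<longleftrightarrow> (\<exists>es ws. es \<noteq> [] \<and> distinct es \<and> set es = D \<and>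
      length ws = length es \<and> distinct ws \<and>
      (\<forall>i<length es. {s (es ! i), t (es ! i)} = {ws ! i, ws ! ((i + 1) mod length es)}))"

lemma simple_cycle_cong:
  assumes "simple_cycle s t D" "\<And>e. e \<in> D \<Longrightarrow> u e = s e \<and> v e = t e"
  shows "simple_cycle u v D"
proof -
  from assms(1) obtain es ws where *: "es \<noteq> [] \<and> distinct es \<and> set es = D \<and>
      length ws = length es \<and> distinct ws"
    "\<forall>i<length es. {s (es ! i), t (es ! i)} = {ws ! i, ws ! ((i + 1) mod length es)}"
    unfolding simple_cycle_def by blast
  have "u (es ! i) = s (es ! i) \<and> v (es ! i) = t (es ! i)" if "i < length es" for i
    using assms(2)[of "es ! i"] * that by auto
  thus ?thesis using * unfolding simple_cycle_def by (intro exI[of _ es] exI[of _ ws]) simp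
qed

lemma simple_cycle_map:
  assumes "simple_cycle s t D" and inj: "inj_on f (s ` D \<union> t ` D)"
  shows "simple_cycle (f \<circ> s) (f \<circ> t) D"
proof -
  from assms(1) obtain es ws where *: "es \<noteq> []" "distinct es" "set es = D"
      "length ws = length es" "distinct ws"
    "\<forall>i<length es. {s (es ! i), t (es ! i)} = {ws ! i, ws ! ((i + 1) mod length es)}"
    unfolding simple_cycle_def by blast
  have "set ws \<subseteq> s ` D \<union> t ` D"
  proof
    fix w assume "w \<in> set ws"
    then obtain i where i: "i < length es" "w = ws ! i" using *(4) by (metis in_set_conv_nth)
    hence "w \<in> {s (es ! i), t (es ! i)}" using *(6) by auto
    moreover have "es ! i \<in> D" using i *(3) by auto
    ultimately show "w \<in> s ` D \<union> t ` D" by auto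
  qed
  hence "distinct (map f ws)" using *(5) inj by (auto simp: distinct_map intro: inj_on_subset)
  moreover have "{(f \<circ> s) (es ! i), (f \<circ> t) (es ! i)} = {map f ws ! i, map f ws ! ((i + 1) mod length es)}"
    if i: "i < length es" for i
  proof -
    have "(i + 1) mod length es < length ws" using *(1,4) by simp
    hence "{map f ws ! i, map f ws ! ((i + 1) mod length es)} = f ` {ws ! i, ws ! ((i + 1) mod length es)}"
      using i *(4) by (simp add: nth_map)
    also have "\<dots> = f ` {s (es ! i), t (es ! i)}" using *(6) i by simp
    finally show ?thesis by simp
  qed
  ultimately show ?thesis using * unfolding simple_cycle_def by (intro exI[of _ es] exI[of _ "map f ws"]) simp
qed

lemma simple_cycle_finite: "simple_cycle s t D \<Longrightarrow> finite D \<and> D \<noteq> {}"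
  by (auto simp: simple_cycle_def)

text \<open>\<open>W\<close> is the vertex set of the cycle. The clauses express, free of the
  ordered listing, that all degrees are 2 (tested against functions \<open>h\<close>), that the
  cycle is connected, and that its edges end in \<open>W\<close>.\<close>

lemma simple_cycle_degree:
  fixes s t :: "'e \<Rightarrow> 'v"
  assumes "simple_cycle s t D"
  shows "\<exists>W. finite W \<and> (\<forall>h :: 'v \<Rightarrow> nat. (\<Sum>e\<in>D. h (s e) + h (t e)) = 2 * (\<Sum>w\<in>W. h w)) \<and>
    (\<forall>U. (\<forall>e\<in>D. s e \<in> U \<longleftrightarrow> t e \<in> U) \<longrightarrow> W \<inter> U \<noteq> {} \<longrightarrow> W \<subseteq> U) \<and>
    (\<forall>e\<in>D. s e \<in> W \<and> t e \<in> W)"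
proof -
  from assms obtain es ws where *: "es \<noteq> []" "distinct es" "set es = D"
      "length ws = length es" "distinct ws"
    "\<And>i. i < length es \<Longrightarrow> {s (es ! i), t (es ! i)} = {ws ! i, ws ! ((i + 1) mod length es)}"
    unfolding simple_cycle_def by blast
  let ?n = "length es"
  have n: "?n > 0" using *(1) by simp
  have 1: "finite (set ws)" by simp
  have 2: "(\<Sum>e\<in>D. h (s e) + h (t e)) = 2 * (\<Sum>w\<in>set ws. h w)" for h :: "'v \<Rightarrow> nat"
  proof -
    have pt: "h (s (es ! i)) + h (t (es ! i)) = h (ws ! i) + h (ws ! ((i + 1) mod ?n))" if "i < ?n" for i
      using *(6)[OF that] by (auto simp: doubleton_eq_iff)
    have "(\<Sum>e\<in>D. h (s e) + h (t e)) = (\<Sum>i<?n. h (s (es ! i)) + h (t (es ! i)))"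
      by (rule sum.reindex_bij_betw[OF bij_betw_nth[OF *(2) refl *(3)[symmetric]], symmetric])
    also have "\<dots> = (\<Sum>i<?n. h (ws ! i)) + (\<Sum>i<?n. h (ws ! ((i + 1) mod ?n)))"
      using pt by (simp add: sum.distrib)
    also have "(\<Sum>i<?n. h (ws ! ((i + 1) mod ?n))) = (\<Sum>i<?n. h (ws ! i))"
    proof -
      have "bij_betw (\<lambda>i. (i + 1) mod ?n) {..<?n} {..<?n}"
      proof -
        have "inj_on (\<lambda>i. (i + 1) mod ?n) {..<?n}"
        proof (rule inj_onI)
          fix i j assume ij: "i \<in> {..<?n}" "j \<in> {..<?n}" "(i + 1) mod ?n = (j + 1) mod ?n"
          have "(k + 1) mod ?n = (if k + 1 = ?n then 0 else k + 1)" if "k < ?n" for k using that by auto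
          thus "i = j" using ij by (auto split: if_splits)
        qed
        moreover have "(\<lambda>i. (i + 1) mod ?n) ` {..<?n} \<subseteq> {..<?n}" using n by auto
        ultimately show ?thesis by (simp add: bij_betw_def endo_inj_surj)
      qed
      from sum.reindex_bij_betw[OF this, of "\<lambda>i. h (ws ! i)"] show ?thesis .
    qed
    also have "(\<Sum>i<?n. h (ws ! i)) = (\<Sum>w\<in>set ws. h w)"
      using sum.reindex_bij_betw[OF bij_betw_nth[OF *(5) refl refl], of h] *(4) by simp
    finally show ?thesis by simp
  qed
  have 3: "set ws \<subseteq> U" if U: "\<forall>e\<in>D. s e \<in> U \<longleftrightarrow> t e \<in> U" and ne: "set ws \<inter> U \<noteq> {}" for U
  proof -
    have step: "ws ! i \<in> U \<longleftrightarrow> ws ! ((i + 1) mod ?n) \<in> U" if "i < ?n" for i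
    proof -
      have "es ! i \<in> D" using that *(3) by auto
      hence "s (es ! i) \<in> U \<longleftrightarrow> t (es ! i) \<in> U" using U by blast
      thus ?thesis using *(6)[OF that] by (auto simp: doubleton_eq_iff)
    qed
    have all: "ws ! i \<in> U \<longleftrightarrow> ws ! 0 \<in> U" if "i < ?n" for i
      using that
    proof (induction i)
      case (Suc i) thus ?case using step[of i] by simp
    qed simp
    obtain w where "w \<in> set ws" "w \<in> U" using ne by blast
    hence "ws ! 0 \<in> U" using all *(4) by (metis in_set_conv_nth)
    thus ?thesis using all *(4) by (metis in_set_conv_nth subsetI)
  qed
  have 4: "s e \<in> set ws \<and> t e \<in> set ws" if "e \<in> D" for e
  proof -
    from that obtain i where i: "i < ?n" "e = es ! i" using *(3) by (metis in_set_conv_nth)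
    have "ws ! i \<in> set ws" "ws ! ((i + 1) mod ?n) \<in> set ws" using i *(4) n by auto
    thus ?thesis using *(6)[OF i(1)] i(2) by (auto simp: doubleton_eq_iff)
  qed
  show ?thesis by (intro exI[of _ "set ws"] conjI allI impI ballI 1 2 3) (use 4 in auto)
qed

lemma simple_cycle_even:
  fixes h :: "'v \<Rightarrow> nat"
  shows "simple_cycle s t D \<Longrightarrow> even (\<Sum>e\<in>D. h (s e) + h (t e))"
  by (drule simple_cycle_degree) (elim exE conjE, simp)

text \<open>A parity argument, as the orientation is unknown: all degrees being 2, an even number of
  edge ends lies in \<open>X\<close>, and a single crossing edge would make this number odd.\<close>

lemma simple_cycle_no_single_crossing:
  fixes X :: "'v \<Rightarrow> bool"
  assumes D: "simple_cycle s t D" and e: "e \<in> D" "X (s e) \<noteq> X (t e)"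
  shows "\<exists>f\<in>D. f \<noteq> e \<and> X (s f) \<noteq> X (t f)"
proof (rule ccontr)
  assume "\<not> ?thesis"
  hence *: "X (s f) = X (t f)" if "f \<in> D - {e}" for f using that by auto
  define h where "h v = (if X v then 1 else 0 :: nat)" for v
  have fin: "finite D" using simple_cycle_finite[OF D] by simp
  have "(\<Sum>f\<in>D. h (s f) + h (t f)) = h (s e) + h (t e) + (\<Sum>f\<in>D-{e}. h (s f) + h (t f))"
    by (rule sum.remove[OF fin e(1)])
  also have "(\<Sum>f\<in>D-{e}. h (s f) + h (t f)) = (\<Sum>f\<in>D-{e}. 2 * h (s f))"
    using * by (intro sum.cong) (auto simp: h_def)
  also have "\<dots> = 2 * (\<Sum>f\<in>D-{e}. h (s f))" by (simp add: sum_distrib_left)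
  finally have "even (h (s e) + h (t e) + 2 * (\<Sum>f\<in>D-{e}. h (s f)))"
    using simple_cycle_even[OF D, of h] by simp
  moreover have "h (s e) + h (t e) = 1" using e(2) by (auto simp: h_def)
  ultimately show False by simp
qed

lemma closed_listing_simple_cycle:
  assumes "closed_listing s t C es" "inj_on t C"
  shows "simple_cycle s t C"
proof -
  have *: "es \<noteq> []" "distinct es" "set es = C" using assms by (auto simp: closed_listing_def)
  obtain x where w: "walk s t x es x" using assms by (auto simp: closed_listing_def)
  have st: "walk s t u fs v \<Longrightarrow> i < length fs \<Longrightarrow> s (fs ! i) = (if Suc i < length fs then t (fs ! Suc i) else v)" for u fs v i
  proof (induction fs arbitrary: u i)
    case (Cons f fs)
    show ?case
    proof (cases i)
      case 0 thus ?thesis using Cons.prems by (cases fs) auto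
    next
      case (Suc j)
      have "walk s t (s f) fs v" "j < length fs" using Cons.prems Suc by auto
      from Cons.IH[OF this] show ?thesis using Suc by simp
    qed
  qed simp
  have "x = t (es ! 0)" using w *(1) by (cases es) auto
  hence "s (es ! i) = t (es ! ((i + 1) mod length es))" if "i < length es" for i
    using st[OF w that] that *(1) by (cases "Suc i = length es") auto
  hence "{s (es ! i), t (es ! i)} = {map t es ! i, map t es ! ((i + 1) mod length es)}" if "i < length es" for i
    using that *(1) by (simp add: insert_commute nth_map)
  moreover have "distinct (map t es)" using assms(2) * by (simp add: distinct_map)
  ultimately show ?thesis using * unfolding simple_cycle_def
    by (intro exI[of _ es] exI[of _ "map t es"]) simp
qed

text \<open>All degrees in a simple cycle are 2, so a simple cycle that contains a pad equals it.\<close>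

lemma simple_cycle_in_pad_system:
  assumes P: "pad_system E s t P" and D: "simple_cycle s t D" and "D \<subseteq> E"
  shows "D \<in> P"
proof -
  obtain e where e: "e \<in> D" using simple_cycle_finite[OF D] by blast
  obtain C where C: "C \<in> P" "e \<in> C" using pad_system_cover[OF P, of e] e assms(3) by blast
  \<comment> \<open>The cycle crosses the cut \<open>{e, f}\<close> at \<open>e\<close>, hence also
    at \<open>f\<close>.\<close>
  have CD: "C \<subseteq> D"
  proof
    fix f assume f: "f \<in> C"
    show "f \<in> D"
    proof (cases "f = e")
      case False
      then obtain X where X: "crossing E s t X = {e, f}" using pad_systemD(5)[OF P C(1) C(2) f] by metis
      hence "X (s e) \<noteq> X (t e)" by (auto simp: crossing_def)
      then obtain g where g: "g \<in> D" "g \<noteq> e" "X (s g) \<noteq> X (t g)"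
        using simple_cycle_no_single_crossing[OF D e] by blast
      hence "g \<in> crossing E s t X" using assms(3) unfolding crossing_def by blast
      thus ?thesis using X g by auto
    qed (use e in simp)
  qed
  obtain es where es: "closed_listing s t C es" using pad_systemD(4)[OF P C(1)] by blast
  have inj: "inj_on t C" "inj_on s C" using pad_system_inj[OF P C(1)] by auto
  have fin: "finite D" "finite C" using simple_cycle_finite[OF D] CD finite_subset by auto
  from simple_cycle_degree[OF D] obtain W where "finite W \<and>
    (\<forall>h :: _ \<Rightarrow> nat. (\<Sum>e\<in>D. h (s e) + h (t e)) = 2 * (\<Sum>w\<in>W. h w)) \<and>
    (\<forall>U. (\<forall>e\<in>D. s e \<in> U \<longleftrightarrow> t e \<in> U) \<longrightarrow> W \<inter> U \<noteq> {} \<longrightarrow> W \<subseteq> U) \<and>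
    (\<forall>e\<in>D. s e \<in> W \<and> t e \<in> W)" ..
  hence W: "finite W" "\<And>h :: _ \<Rightarrow> nat. (\<Sum>e\<in>D. h (s e) + h (t e)) = 2 * (\<Sum>w\<in>W. h w)"
    "\<And>U. (\<forall>e\<in>D. s e \<in> U \<longleftrightarrow> t e \<in> U) \<Longrightarrow> W \<inter> U \<noteq> {} \<Longrightarrow> W \<subseteq> U"
    "\<And>e. e \<in> D \<Longrightarrow> s e \<in> W \<and> t e \<in> W" by auto
  let ?U = "t ` C"
  have sU: "s ` C = t ` C"
  proof -
    have *: "v \<in> g' ` C"
      if eq: "\<And>h :: _ \<Rightarrow> int. (\<Sum>e\<in>C. h (g e)) = (\<Sum>e\<in>C. h (g' e))" and v: "v \<in> g ` C" for g g' v
    proof (rule ccontr)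
      assume "v \<notin> g' ` C"
      define h where "h u = (if u = v then 1 else 0 :: int)" for u
      obtain e where "e \<in> C" "g e = v" using v by blast
      hence "h (g e) \<le> (\<Sum>e\<in>C. h (g e))" using fin(2) by (intro member_le_sum) (auto simp: h_def)
      moreover have "(\<Sum>e\<in>C. h (g' e)) = 0" using \<open>v \<notin> g' ` C\<close> by (intro sum.neutral) (auto simp: h_def)
      ultimately show False using eq[of h] \<open>g e = v\<close> by (simp add: h_def)
    qed
    show ?thesis
      using *[of s t] *[of t s] closed_listing_balance[OF es] by (metis subsetI subset_antisym)
  qed
  \<comment> \<open>The indicator \<open>h\<close> of one vertex counts degrees. A vertex of the pad
    already has degree 2 inside the pad, so no further edge of \<open>D\<close> can end there;
    connectivity of \<open>D\<close> then leaves no room for edges outside the pad.\<close>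
  have notouch: "s f \<notin> ?U \<and> t f \<notin> ?U" if f: "f \<in> D - C" for f
  proof (rule ccontr)
    assume "\<not> ?thesis"
    then obtain v where v: "v \<in> ?U" "v = s f \<or> v = t f" by blast
    define h where "h u = (if u = v then 1 else 0 :: nat)" for u
    have "(\<Sum>e\<in>C. h (s e)) = 1" "(\<Sum>e\<in>C. h (t e)) = 1"
    proof -
      have one: "(\<Sum>e\<in>C. h (g e)) = 1" if g: "inj_on g C" "v \<in> g ` C" for g
      proof -
        have "(\<Sum>e\<in>C. h (g e)) = (\<Sum>u\<in>g ` C. h u)" using g by (simp add: sum.reindex)
        thus ?thesis using g fin(2) by (simp add: h_def)
      qed
      show "(\<Sum>e\<in>C. h (s e)) = 1" "(\<Sum>e\<in>C. h (t e)) = 1" using one inj v sU by auto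
    qed
    moreover have "(\<Sum>e\<in>D. h (s e) + h (t e)) = (\<Sum>e\<in>D-C. h (s e) + h (t e)) + (\<Sum>e\<in>C. h (s e) + h (t e))"
      using fin CD by (simp add: sum.subset_diff)
    moreover have "(\<Sum>e\<in>D-C. h (s e) + h (t e)) \<ge> h (s f) + h (t f)"
      using f fin by (intro member_le_sum) auto
    moreover have "h (s f) + h (t f) \<ge> 1" using v by (auto simp: h_def)
    moreover have "(\<Sum>w\<in>W. h w) \<le> 1" using W(1) by (simp add: h_def)
    ultimately show False using W(2)[of h] by (simp add: sum.distrib)
  qed
  have "W \<subseteq> ?U"
  proof (rule W(3))
    show "\<forall>f\<in>D. s f \<in> ?U \<longleftrightarrow> t f \<in> ?U"
    proof
      fix f assume "f \<in> D"
      thus "s f \<in> ?U \<longleftrightarrow> t f \<in> ?U" using notouch[of f] sU by (cases "f \<in> C") auto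
    qed
    show "W \<inter> ?U \<noteq> {}" using W(4)[OF e] C(2) by blast
  qed
  hence "D \<subseteq> C" using W(4) notouch by blast
  thus ?thesis using CD C(1) by auto
qed

definition undirected_adj :: "'e set \<Rightarrow> ('e \<Rightarrow> 'v) \<Rightarrow> ('e \<Rightarrow> 'v) \<Rightarrow> 'v \<Rightarrow> 'v \<Rightarrow> bool" where
  "undirected_adj F s t x y \<longleftrightarrow> (\<exists>e\<in>F. {s e, t e} = {x, y})"

text \<open>Paths are shortened on the fly: if the new first vertex already occurs, the piece before
  its occurrence is dropped instead of extending the path.\<close>

lemma undirected_path:
  assumes "(undirected_adj F s t)\<^sup>*\<^sup>* x y"
  shows "\<exists>vs es. length vs = Suc (length es) \<and> vs ! 0 = x \<and> vs ! length es = y \<and> distinct vs \<and>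
    (\<forall>i<length es. es ! i \<in> F \<and> {s (es ! i), t (es ! i)} = {vs ! i, vs ! Suc i})"
  using assms
proof (induction rule: converse_rtranclp_induct)
  case base
  show ?case by (intro exI[of _ "[y]"] exI[of _ "[]"]) simp
next
  case (step x z)
  then obtain vs es where *: "length vs = Suc (length es)" "vs ! 0 = z" "vs ! length es = y" "distinct vs"
    "\<forall>i<length es. es ! i \<in> F \<and> {s (es ! i), t (es ! i)} = {vs ! i, vs ! Suc i}" by blast
  obtain e where e: "e \<in> F" "{s e, t e} = {x, z}" using step(1) by (auto simp: undirected_adj_def)
  show ?case
  proof (cases "x \<in> set vs")
    case False
    show ?thesis
    proof (intro exI[of _ "x # vs"] exI[of _ "e # es"] conjI allI impI)
      fix i assume "i < length (e # es)"
      thus "(e # es) ! i \<in> F" "{s ((e # es) ! i), t ((e # es) ! i)} = {(x # vs) ! i, (x # vs) ! Suc i}"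
        using * e by (cases i; simp)+
    qed (use * False in auto)
  next
    case True
    then obtain k where k: "k < length vs" "vs ! k = x" by (metis in_set_conv_nth)
    show ?thesis
    proof (intro exI[of _ "drop k vs"] exI[of _ "drop k es"] conjI allI impI)
      fix i assume "i < length (drop k es)"
      thus "drop k es ! i \<in> F" "{s (drop k es ! i), t (drop k es ! i)} = {drop k vs ! i, drop k vs ! Suc i}"
        using * k by auto
    qed (use * k in auto)
  qed
qed

text \<open>A path without repeated vertices between the ends of \<open>e\<close> is closed up by
  \<open>e\<close>. For a loop the path is trivial and the cycle is \<open>{e}\<close>.\<close>

lemma simple_cycle_through:
  assumes path: "(undirected_adj F s t)\<^sup>*\<^sup>* (s e) (t e)" and e: "e \<notin> F"
  obtains D where "simple_cycle s t D" "e \<in> D" "D \<subseteq> insert e F"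
proof -
  from undirected_path[OF path] obtain vs es where
    *: "length vs = Suc (length es)" "vs ! 0 = s e" "vs ! length es = t e" "distinct vs"
    "\<And>i. i < length es \<Longrightarrow> es ! i \<in> F \<and> {s (es ! i), t (es ! i)} = {vs ! i, vs ! Suc i}" by blast
  have dist: "distinct es"
  proof (unfold distinct_conv_nth, intro allI impI notI)
    fix i j assume ij: "i < length es" "j < length es" "i \<noteq> j" "es ! i = es ! j"
    hence "{vs ! i, vs ! Suc i} = {vs ! j, vs ! Suc j}" using *(5) by metis
    thus False using ij *(1,4) by (auto simp: doubleton_eq_iff nth_eq_iff_index_eq)
  qed
  have F: "set es \<subseteq> F" using *(5) by (metis in_set_conv_nth subsetI)
  have "simple_cycle s t (insert e (set es))"
    unfolding simple_cycle_def
  proof (intro exI[of _ "es @ [e]"] exI[of _ vs] conjI allI impI)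
    fix i assume i: "i < length (es @ [e])"
    show "{s ((es @ [e]) ! i), t ((es @ [e]) ! i)} = {vs ! i, vs ! ((i + 1) mod length (es @ [e]))}"
    proof (cases "i = length es")
      case True thus ?thesis using * by (simp add: insert_commute)
    next
      case False
      hence "i < length es" using i by simp
      thus ?thesis using *(5)[of i] by (simp add: nth_append)
    qed
  qed (use * dist F e in auto)
  thus thesis using that F by blast
qed

text \<open>The cut for \<open>e\<close> and \<open>f\<close> is the component of the source of
  \<open>e\<close> once both edges are removed. If it contained the target of \<open>e\<close>,
  there would be a second simple cycle through \<open>e\<close>, one that avoids \<open>f\<close>. A
  closed listing cannot cross it at \<open>e\<close> alone, so \<open>f\<close> crosses too.\<close>

lemma pad_system_of_cactus:
  assumes cyc: "\<And>e. e \<in> E \<Longrightarrow> \<exists>!C. simple_cycle s t C \<and> C \<subseteq> E \<and> e \<in> C"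
    and ori: "\<And>C. simple_cycle s t C \<Longrightarrow> C \<subseteq> E \<Longrightarrow> \<exists>es. closed_listing s t C es"
  shows "pad_system E s t {C. simple_cycle s t C \<and> C \<subseteq> E}"
  unfolding pad_system_def
proof (intro conjI ballI impI)
  show "partition_on E {C. simple_cycle s t C \<and> C \<subseteq> E}"
  proof (rule partition_onI)
    show "\<Union>{C. simple_cycle s t C \<and> C \<subseteq> E} = E" using cyc by blast
    show "{} \<notin> {C. simple_cycle s t C \<and> C \<subseteq> E}" using simple_cycle_finite by blast
    fix C D assume CD: "C \<in> {C. simple_cycle s t C \<and> C \<subseteq> E}" "D \<in> {C. simple_cycle s t C \<and> C \<subseteq> E}" "C \<noteq> D"
    show "disjnt C D"
    proof (rule ccontr)
      assume "\<not> disjnt C D"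
      then obtain e where "e \<in> C" "e \<in> D" by (auto simp: disjnt_def)
      thus False using cyc[of e] CD by blast
    qed
  qed
  fix C assume C: "C \<in> {C. simple_cycle s t C \<and> C \<subseteq> E}"
  thus ex: "\<exists>es. closed_listing s t C es" using ori by blast
  fix e f assume ef: "e \<in> C" "f \<in> C" "e \<noteq> f"
  define X where "X v = (undirected_adj (E - {e, f}) s t)\<^sup>*\<^sup>* (s e) v" for v
  have Xe: "X (s e)" "\<not> X (t e)"
  proof -
    show "X (s e)" by (simp add: X_def)
    show "\<not> X (t e)"
    proof
      assume "X (t e)"
      then obtain D where D: "simple_cycle s t D" "e \<in> D" "D \<subseteq> insert e (E - {e, f})"
        using simple_cycle_through[of "E - {e, f}" s t e] unfolding X_def by blast
      have "e \<in> E" using C ef by blast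
      hence "D = C" using cyc[of e] D C ef(1) by blast
      thus False using D(3) ef by blast
    qed
  qed
  have other: "X (s g) = X (t g)" if "g \<in> E - {e, f}" for g
  proof -
    have "undirected_adj (E - {e, f}) s t (s g) (t g)" "undirected_adj (E - {e, f}) s t (t g) (s g)"
      using that unfolding undirected_adj_def by (auto simp: insert_commute)
    thus ?thesis unfolding X_def by (meson rtranclp.rtrancl_into_rtrancl)
  qed
  have "X (s f) \<noteq> X (t f)"
  proof -
    obtain es where "closed_listing s t C es" using ex by blast
    from closed_listing_no_single_crossing[OF this ef(1), of X] Xe
    obtain g where g: "g \<in> C" "g \<noteq> e" "X (s g) \<noteq> X (t g)" by auto
    moreover have "g \<in> E" using g(1) C by blast
    ultimately show ?thesis using other[of g] by (cases "g = f") auto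
  qed
  hence "crossing E s t X = {e, f}" using Xe other C ef unfolding crossing_def by blast
  thus "\<exists>X. crossing E s t X = {e, f}" by blast
qed

lemma pads_of_pad_system:
  assumes P: "pad_system E s t P"
  shows "P = {C. simple_cycle s t C \<and> C \<subseteq> E}"
    and "e \<in> E \<Longrightarrow> \<exists>!C. simple_cycle s t C \<and> C \<subseteq> E \<and> e \<in> C"
proof -
  have 1: "simple_cycle s t C \<and> C \<subseteq> E" if "C \<in> P" for C
    using closed_listing_simple_cycle pad_systemD(1,4)[OF P that] pad_system_inj(1)[OF P that] by blast
  show 2: "P = {C. simple_cycle s t C \<and> C \<subseteq> E}"
    using 1 simple_cycle_in_pad_system[OF P] by blast
  show "\<exists>!C. simple_cycle s t C \<and> C \<subseteq> E \<and> e \<in> C" if "e \<in> E"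
    using pad_system_cover[OF P that] pad_system_disjnt[OF P] unfolding 2 by blast
qed

section \<open>Quotients of labelled graphs\<close>

abbreviation (input) src_of :: "'v \<times> 'v \<times> 'a \<Rightarrow> 'v" where "src_of e \<equiv> fst e"
abbreviation (input) tgt_of :: "'v \<times> 'v \<times> 'a \<Rightarrow> 'v" where "tgt_of e \<equiv> fst (snd e)"
abbreviation (input) lab_of :: "'v \<times> 'v \<times> 'a \<Rightarrow> 'a" where "lab_of e \<equiv> snd (snd e)"

definition edge_map :: "('u \<Rightarrow> 'v) \<Rightarrow> 'u \<times> 'u \<times> 'a \<Rightarrow> 'v \<times> 'v \<times> 'a" where
  "edge_map f = (\<lambda>(x, y, l). (f x, f y, l))"

lemma edge_map_simps [simp]:
  "fst (edge_map f e) = f (fst e)" "fst (snd (edge_map f e)) = f (fst (snd e))"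
  "snd (snd (edge_map f e)) = snd (snd e)"
  "edge_map f (x, y, l) = (f x, f y, l)"
  by (auto simp: edge_map_def split: prod.splits)

lemma edge_map_edge_map [simp]: "edge_map f (edge_map g e) = edge_map (f \<circ> g) e"
  by (auto simp: edge_map_def split: prod.splits)

lemma map_edge_map: "map (edge_map f) (map (edge_map g) es) = map (edge_map (f \<circ> g)) es"
  by simp

definition ends :: "('v \<times> 'v \<times> 'a) list \<Rightarrow> 'v set" where
  "ends es = (\<Union>e\<in>set es. {fst e, fst (snd e)})"

lemma ends_simps [simp]:
  "ends [] = {}" "ends (e # es) = {fst e, fst (snd e)} \<union> ends es" "ends (es @ fs) = ends es \<union> ends fs"
  by (auto simp: ends_def)

lemma ends_map [simp]: "ends (map (edge_map f) es) = f ` ends es"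
  by (auto simp: ends_def)

lemma ends_in: "e \<in> set es \<Longrightarrow> fst e \<in> ends es \<and> fst (snd e) \<in> ends es"
  by (auto simp: ends_def)

lemma ends_mset: "mset es = mset fs \<Longrightarrow> ends es = ends fs"
  unfolding ends_def by (drule mset_eq_setD) simp

section \<open>The weight of a list of edges\<close>

text \<open>Edges are positions in the list, so parallel edges with equal labels stay distinct. The
  vertex type is arbitrary, which admits disjoint unions and blocks of partitions as
  vertices.\<close>

definition weight :: "('a list \<Rightarrow> complex) \<Rightarrow> ('v \<times> 'v \<times> 'a) list \<Rightarrow> complex" where
  "weight kappa es = cactus_weight kappa {..<length es}
     (\<lambda>i. fst (es ! i)) (\<lambda>i. fst (snd (es ! i))) (\<lambda>i. snd (snd (es ! i)))"

lemma weight_mset: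
  assumes rot: "cyclic_invariant kappa" and eq: "mset es = mset fs"
  shows "weight kappa es = weight kappa fs"
proof -
  obtain p where p: "p permutes {..<length fs}" "permute_list p fs = es"
    using eq by (rule mset_eq_permutation)
  have len: "length es = length fs" using eq by (rule mset_eq_length)
  have nth: "es ! i = fs ! p i" if "i < length fs" for i
    using permute_list_nth[OF p(1) that] p(2) by simp
  have "weight kappa fs = cactus_weight kappa (p ` {..<length fs})
     (\<lambda>i. fst (fs ! i)) (\<lambda>i. fst (snd (fs ! i))) (\<lambda>i. snd (snd (fs ! i)))"
    using permutes_image[OF p(1)] by (simp add: weight_def)
  also have "\<dots> = cactus_weight kappa {..<length fs}
     ((\<lambda>i. fst (fs ! i)) \<circ> p) ((\<lambda>i. fst (snd (fs ! i))) \<circ> p) ((\<lambda>i. snd (snd (fs ! i))) \<circ> p)"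
    by (rule cactus_weight_image[OF permutes_inj_on[OF p(1)] rot])
  also have "\<dots> = weight kappa es"
    unfolding weight_def len
    by (rule cactus_weight_map[where f = id, OF _ _ rot]) (auto simp: nth)
  finally show ?thesis by simp
qed

text \<open>Only the coincidences among the end points matter: either relabelling factors through
  the other by a map that is injective on the vertices in use. This allows switching between blocks
  and their representatives.\<close>

lemma weight_kernel:
  assumes rot: "cyclic_invariant kappa"
    and ker: "\<And>x y. x \<in> ends es \<Longrightarrow> y \<in> ends es \<Longrightarrow> f x = f y \<longleftrightarrow> g x = g y"
  shows "weight kappa (map (edge_map f) es) = weight kappa (map (edge_map g) es)"
proof -
  define h where "h = f \<circ> inv_into (ends es) g"
  have hg: "h (g x) = f x" if "x \<in> ends es" for x
  proof -
    have "inv_into (ends es) g (g x) \<in> ends es" "g (inv_into (ends es) g (g x)) = g x"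
      using that by (auto intro: inv_into_into f_inv_into_f)
    thus ?thesis using ker[OF _ that] unfolding h_def o_def by blast
  qed
  have inj: "inj_on h (g ` ends es)"
  proof (rule inj_onI)
    fix u v assume "u \<in> g ` ends es" "v \<in> g ` ends es" "h u = h v"
    then obtain x y where "x \<in> ends es" "y \<in> ends es" "u = g x" "v = g y" by blast
    thus "u = v" using hg ker \<open>h u = h v\<close> by metis
  qed
  have en: "fst (es ! i) \<in> ends es" "fst (snd (es ! i)) \<in> ends es" if "i < length es" for i
    using ends_in[OF nth_mem[OF that]] by simp_all
  show ?thesis
    unfolding weight_def length_map
  proof (rule cactus_weight_map[where f = h, OF inj_on_subset[OF inj] _ rot])
    show "(\<lambda>i. fst (map (edge_map g) es ! i)) ` {..<length es} \<union>
        (\<lambda>i. fst (snd (map (edge_map g) es ! i))) ` {..<length es} \<subseteq> g ` ends es"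
      using en by auto
  qed (simp add: hg en)
qed

lemma weight_cong:
  assumes "cyclic_invariant kappa" "\<And>x. x \<in> ends es \<Longrightarrow> f x = g x"
  shows "weight kappa (map (edge_map f) es) = weight kappa (map (edge_map g) es)"
  by (rule weight_kernel[OF assms(1)]) (simp add: assms(2))

lemma weight_append:
  assumes rot: "cyclic_invariant kappa" and "ends es \<inter> ends fs \<subseteq> {r}"
  shows "weight kappa (es @ fs) = weight kappa es * weight kappa fs"
proof -
  let ?n = "length es"
  let ?s = "\<lambda>i. fst ((es @ fs) ! i)" and ?t = "\<lambda>i. fst (snd ((es @ fs) ! i))" and ?l = "\<lambda>i. snd (snd ((es @ fs) ! i))"
  let ?E1 = "{..<?n}" and ?E2 = "(\<lambda>i. i + ?n) ` {..<length fs}"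
  have E: "{..<length (es @ fs)} = ?E1 \<union> ?E2"
  proof (rule set_eqI)
    fix i show "i \<in> {..<length (es @ fs)} \<longleftrightarrow> i \<in> ?E1 \<union> ?E2"
      by (cases "i < ?n") (auto intro!: image_eqI[of _ _ "i - ?n"])
  qed
  have "weight kappa (es @ fs) = cactus_weight kappa (?E1 \<union> ?E2) ?s ?t ?l"
    unfolding weight_def E ..
  also have "\<dots> = cactus_weight kappa ?E1 ?s ?t ?l * cactus_weight kappa ?E2 ?s ?t ?l"
    by (rule cactus_weight_wedge[of kappa ?E1 ?E2 ?s "ends es" ?t "ends fs" r, OF rot])
       (use assms(2) in \<open>auto simp: nth_append ends_in\<close>)
  also have "cactus_weight kappa ?E1 ?s ?t ?l = weight kappa es"
    unfolding weight_def by (rule cactus_weight_map[where f = id, OF _ _ rot, symmetric]) (auto simp: nth_append)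
  also have "cactus_weight kappa ?E2 ?s ?t ?l =
      cactus_weight kappa {..<length fs} (?s \<circ> (\<lambda>i. i + ?n)) (?t \<circ> (\<lambda>i. i + ?n)) (?l \<circ> (\<lambda>i. i + ?n))"
    by (rule cactus_weight_image[OF _ rot]) (auto simp: inj_on_def)
  also have "\<dots> = weight kappa fs"
    unfolding weight_def by (rule cactus_weight_map[where f = id, OF _ _ rot, symmetric]) (auto simp: nth_append)
  finally show ?thesis .
qed

lemma weight_vanish:
  assumes rot: "cyclic_invariant kappa" and e: "e \<in> set es" "fst e \<noteq> fst (snd e)"
    and l: "\<And>w. w \<noteq> [] \<Longrightarrow> kappa (snd (snd e) # w) = 0"
  shows "weight kappa es = 0"
proof -
  obtain i where "i < length es" "e = es ! i" using e(1) by (metis in_set_conv_nth)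
  thus ?thesis unfolding weight_def using e(2) l
    by (intro cactus_weight_vanish[OF rot, of _ i]) auto
qed

text \<open>Connectivity tested by two-valued functions: whatever is constant along edges is
  constant. In this form it applies directly to cuts and passes to images and wedges without
  handling paths.\<close>

definition edges_connected :: "'v set \<Rightarrow> ('v \<times> 'v \<times> 'a) list \<Rightarrow> bool" where
  "edges_connected V es \<longleftrightarrow> (\<forall>X :: 'v \<Rightarrow> bool. (\<forall>e\<in>set es. X (fst e) = X (fst (snd e))) \<longrightarrow>
     (\<forall>u\<in>V. \<forall>v\<in>V. X u = X v))"

lemma weight_subdivide:
  fixes es :: "('v \<times> 'v \<times> 'a::monoid_mult) list"
  assumes rot: "cyclic_invariant kappa"
    and mul: "\<And>x y w. kappa (x * y # w) = kappa (x # y # w) +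
      (\<Sum>j\<le>length w. kappa (y # take j w) * kappa (x # drop j w))"
    and V: "finite V" "ends es \<subseteq> V" "u \<in> V" "v \<in> V" "w \<notin> V"
    and conn: "edges_connected V ((v, u, x * y) # es)"
  shows "weight kappa ((v, u, x * y) # es) = weight kappa ((w, u, x) # (v, w, y) # es) +
    (\<Sum>z\<in>V. weight kappa ((z, u, x) # (v, z, y) # es))"
proof -
  let ?n = "Suc (length es)"
  \<comment> \<open>The two halves of the subdivided edge go to the two ends of the list: index 0
    plays \<open>a\<close> and index \<open>?n\<close> plays \<open>b\<close>, while the indices of
    \<open>es\<close> are the same as in the merged list.\<close>
  define g where "g z = (z, u, x) # es @ [(v, z, y)]" for z
  let ?E = "{..<?n}"
  let ?s = "\<lambda>i. fst (g w ! i)" and ?t = "\<lambda>i. fst (snd (g w ! i))" and ?l = "\<lambda>i. snd (snd (g w ! i))"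
  have g: "weight kappa ((z, u, x) # (v, z, y) # es) =
     cactus_weight kappa (insert ?n ?E) (?s(0 := z)) (?t(?n := z)) ?l" for z
  proof -
    have "weight kappa ((z, u, x) # (v, z, y) # es) = weight kappa (g z)"
      by (rule weight_mset[OF rot]) (simp add: g_def)
    also have "\<dots> = cactus_weight kappa {..<length (g z)} (?s(0 := z)) (?t(?n := z)) ?l"
      unfolding weight_def
      by (rule cactus_weight_map[where f = id, OF _ _ rot]) (auto simp: g_def nth_Cons nth_append less_Suc_eq split: nat.splits)
    also have "{..<length (g z)} = insert ?n ?E" by (auto simp: g_def)
    finally show ?thesis .
  qed
  have sn: "?s ?n = v" by (simp add: g_def nth_append)
  have "weight kappa ((v, u, x * y) # es) = cactus_weight kappa ?E (?s(0 := ?s ?n)) ?t (?l(0 := ?l 0 * ?l ?n))"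
    unfolding weight_def sn length_Cons
    by (rule cactus_weight_map[where f = id, OF _ _ rot])
       (auto simp: g_def nth_Cons nth_append less_Suc_eq split: nat.splits)
  also have "\<dots> = cactus_weight kappa (insert ?n ?E) (?s(0 := w)) (?t(?n := w)) ?l +
    (\<Sum>z\<in>V. cactus_weight kappa (insert ?n ?E) (?s(0 := z)) (?t(?n := z)) ?l)"
  proof (rule cactus_weight_subdivide[OF rot _ V(1) mul])
    have gi: "g w ! i = (if i = 0 then (w, u, x) else es ! (i - 1))" if "i < ?n" for i
      using that by (cases i) (auto simp: g_def nth_append)
    show "?s e \<in> V" if "e \<in> ?E" "e \<noteq> 0" for e
      using that V(2) ends_in[of "es ! (e - 1)" es] by (auto simp: gi)
    show "?t e \<in> V" if "e \<in> ?E" for e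
      using that V(2,3) ends_in[of "es ! (e - 1)" es] by (auto simp: gi)
    show "?s ?n \<in> V" using sn V by simp
    show "\<forall>u\<in>V. \<forall>v\<in>V. X u = X v" if X: "\<forall>e\<in>?E. X ((?s(0 := ?s ?n)) e) = X (?t e)" for X :: "'v \<Rightarrow> bool"
    proof -
      have "X v = X u" using X[rule_format, of 0] sn by (simp add: gi)
      moreover have "X (fst e) = X (fst (snd e))" if "e \<in> set es" for e
      proof -
        obtain i where i: "i < length es" "e = es ! i" using \<open>e \<in> set es\<close> by (metis in_set_conv_nth)
        hence "g w ! Suc i = e" using gi[of "Suc i"] by simp
        thus ?thesis using X[rule_format, of "Suc i"] i(1) by simp
      qed
      ultimately have "\<forall>e\<in>set ((v, u, x * y) # es). X (fst e) = X (fst (snd e))" by simp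
      with conn[unfolded edges_connected_def, THEN spec, of X] show ?thesis by (rule mp)
    qed
  qed (use V in auto)
  finally show ?thesis unfolding g .
qed

lemma is_cycle_iff:
  "is_cycle G C \<longleftrightarrow> simple_cycle (\<lambda>i. fst (edgs G ! i)) (\<lambda>i. fst (snd (edgs G ! i))) C \<and> C \<subseteq> {..<length (edgs G)}"
  unfolding is_cycle_def simple_cycle_def esrc_def etgt_def by blast

lemma closed_listing_iff_oriented_listing:
  assumes "es \<noteq> []"
  shows "closed_listing (\<lambda>i. fst (edgs G ! i)) (\<lambda>i. fst (snd (edgs G ! i))) C es \<longleftrightarrow> oriented_listing G C es"
proof -
  let ?s = "\<lambda>i. fst (edgs G ! i)" and ?t = "\<lambda>i. fst (snd (edgs G ! i))"
  have w: "walk ?s ?t x es y \<longleftrightarrow> ?t (es ! 0) = x \<and> (\<forall>i. Suc i < length es \<longrightarrow> ?s (es ! i) = ?t (es ! Suc i)) \<and>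
    ?s (es ! (length es - 1)) = y" if "es \<noteq> []" for es x y
    using that
  proof (induction es arbitrary: x)
    case (Cons e es)
    show ?case
    proof (cases "es = []")
      case False
      have "walk ?s ?t x (e # es) y \<longleftrightarrow> ?t e = x \<and> ?t (es ! 0) = ?s e \<and>
          (\<forall>i. Suc i < length es \<longrightarrow> ?s (es ! i) = ?t (es ! Suc i)) \<and> ?s (es ! (length es - 1)) = y"
        using Cons.IH[OF False] by simp
      also have "\<dots> \<longleftrightarrow> ?t e = x \<and> (\<forall>i. Suc i < length (e # es) \<longrightarrow> ?s ((e # es) ! i) = ?t ((e # es) ! Suc i)) \<and>
          ?s ((e # es) ! (length (e # es) - 1)) = y"
      proof -
        have split: "(\<forall>i. Q i) \<longleftrightarrow> Q 0 \<and> (\<forall>i. Q (Suc i))" for Q :: "nat \<Rightarrow> bool"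
          by (metis not0_implies_Suc)
        show ?thesis
          using False by (subst (2) split) auto
      qed
      finally show ?thesis by simp
    qed auto
  qed simp
  have "(\<exists>x. walk ?s ?t x es x) \<longleftrightarrow> (\<forall>i<length es. ?s (es ! i) = ?t (es ! ((i + 1) mod length es)))"
  proof -
    have "(\<forall>i<length es. ?s (es ! i) = ?t (es ! ((i + 1) mod length es))) \<longleftrightarrow>
      (\<forall>i. Suc i < length es \<longrightarrow> ?s (es ! i) = ?t (es ! Suc i)) \<and> ?s (es ! (length es - 1)) = ?t (es ! 0)"
    proof (intro iffI conjI allI impI)
      assume *: "\<forall>i<length es. ?s (es ! i) = ?t (es ! ((i + 1) mod length es))"
      show "?s (es ! i) = ?t (es ! Suc i)" if "Suc i < length es" for i
        using *[rule_format, of i] that by simp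
      show "?s (es ! (length es - 1)) = ?t (es ! 0)"
        using *[rule_format, of "length es - 1"] assms by simp
    next
      fix i assume *: "(\<forall>i. Suc i < length es \<longrightarrow> ?s (es ! i) = ?t (es ! Suc i)) \<and> ?s (es ! (length es - 1)) = ?t (es ! 0)"
        and i: "i < length es"
      show "?s (es ! i) = ?t (es ! ((i + 1) mod length es))"
      proof (cases "Suc i = length es")
        case True
        hence "i = length es - 1" by simp
        thus ?thesis using * True by simp
      next
        case False
        thus ?thesis using * i by simp
      qed
    qed
    thus ?thesis unfolding w[OF assms] by auto
  qed
  thus ?thesis using assms unfolding closed_listing_def oriented_listing_def esrc_def etgt_def by blast
qed

text \<open>The bridge to the given definition. If pads in the sense of cuts exist, they are exactly
  the simple cycles, one through each edge; conversely an oriented cactus has the required cuts.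
  Connectivity is a hypothesis since \<open>is_cactus\<close> asks for it, whereas
  \<open>weight\<close> looks at the edges only.\<close>

lemma tau0_eq_weight:
  assumes rot: "cyclic_invariant kappa" and conn: "tg_connected G"
  shows "tau0 kappa G = weight kappa (edgs G)"
proof -
  let ?s = "\<lambda>i. fst (edgs G ! i)" and ?t = "\<lambda>i. fst (snd (edgs G ! i))" and ?l = "\<lambda>i. snd (snd (edgs G ! i))"
  let ?E = "{..<length (edgs G)}"
  have pads: "pads G = {C. simple_cycle ?s ?t C \<and> C \<subseteq> ?E}"
    unfolding pads_def is_cycle_iff ..
  have cac: "is_cactus G \<longleftrightarrow> (\<forall>e\<in>?E. \<exists>!C. simple_cycle ?s ?t C \<and> C \<subseteq> ?E \<and> e \<in> C)"
    using conn unfolding is_cactus_def is_cycle_iff by (simp add: conj_assoc Ball_def)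
  have ori: "pad_oriented G C \<longleftrightarrow> (\<exists>es. closed_listing ?s ?t C es)" if "C \<noteq> {}" for C
  proof
    assume "pad_oriented G C"
    then obtain es where es: "oriented_listing G C es" by (auto simp: pad_oriented_def)
    moreover from this have "es \<noteq> []" using that by (auto simp: oriented_listing_def)
    ultimately show "\<exists>es. closed_listing ?s ?t C es" using closed_listing_iff_oriented_listing by blast
  next
    assume "\<exists>es. closed_listing ?s ?t C es"
    then obtain es where "closed_listing ?s ?t C es" by blast
    moreover from this have "es \<noteq> []" by (simp add: closed_listing_def)
    ultimately show "pad_oriented G C" unfolding pad_oriented_def using closed_listing_iff_oriented_listing by blast
  qed
  have ne: "C \<noteq> {}" if "C \<in> pads G" for C using that simple_cycle_finite unfolding pads by blast
  show ?thesis
  proof (cases "\<exists>P. pad_system ?E ?s ?t P")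
    case True
    then obtain P where P: "pad_system ?E ?s ?t P" by blast
    have PP: "P = pads G" unfolding pads by (rule pads_of_pad_system(1)[OF P])
    have "is_cactus G" unfolding cac using pads_of_pad_system(2)[OF P] by blast
    moreover have "pad_oriented G C" if "C \<in> pads G" for C
      using ori[OF ne[OF that]] pad_systemD(4)[OF P] that PP by blast
    ultimately have "tau0 kappa G = (\<Prod>C\<in>P. pad_cumulant kappa G C)"
      unfolding tau0_def PP by simp
    also have "\<dots> = (\<Prod>C\<in>P. kappa (map ?l (SOME es. oriented_listing G C es)))"
      unfolding pad_cumulant_def elab_def ..
    also have "\<dots> = weight kappa (edgs G)"
      unfolding weight_def
    proof (rule cactus_weight_eq[OF rot P, symmetric])
      fix C assume C: "C \<in> P"
      obtain es where "closed_listing ?s ?t C es" using pad_systemD(4)[OF P C] by blast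
      moreover from this have "es \<noteq> []" by (simp add: closed_listing_def)
      ultimately have "oriented_listing G C es" using closed_listing_iff_oriented_listing by blast
      hence o: "oriented_listing G C (SOME es. oriented_listing G C es)" by (rule someI)
      hence "(SOME es. oriented_listing G C es) \<noteq> []"
        using ne[of C] C PP by (metis (no_types, lifting) list.set(1) oriented_listing_def)
      thus "closed_listing ?s ?t C (SOME es. oriented_listing G C es)"
        using o closed_listing_iff_oriented_listing by blast
    qed
    finally show ?thesis .
  next
    case False
    have "\<not> (is_cactus G \<and> (\<forall>C\<in>pads G. pad_oriented G C))"
    proof
      assume *: "is_cactus G \<and> (\<forall>C\<in>pads G. pad_oriented G C)"
      have "pad_system ?E ?s ?t {C. simple_cycle ?s ?t C \<and> C \<subseteq> ?E}"
      proof (rule pad_system_of_cactus)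
        show "\<exists>!C. simple_cycle ?s ?t C \<and> C \<subseteq> ?E \<and> e \<in> C" if "e \<in> ?E" for e
          using * that unfolding cac by blast
        show "\<exists>es. closed_listing ?s ?t C es" if "simple_cycle ?s ?t C" "C \<subseteq> ?E" for C
          using * that ori[of C] ne[of C] unfolding pads by blast
      qed
      thus False using False by blast
    qed
    hence "tau0 kappa G = 0" unfolding tau0_def by (rule if_not_P)
    moreover have "weight kappa (edgs G) = 0" using False unfolding weight_def cactus_weight_def by (rule if_not_P)
    ultimately show ?thesis by simp
  qed
qed

lemma tg_connected_iff: "tg_connected G \<longleftrightarrow> edges_connected (verts G) (edgs G)"
proof
  assume c: "tg_connected G"
  show "edges_connected (verts G) (edgs G)"
    unfolding edges_connected_def
  proof (intro allI impI ballI)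
    fix X :: "nat \<Rightarrow> bool" and u v
    assume X: "\<forall>e\<in>set (edgs G). X (fst e) = X (fst (snd e))" and "u \<in> verts G" "v \<in> verts G"
    hence "(tg_adj G)\<^sup>*\<^sup>* u v" using c by (simp add: tg_connected_def)
    thus "X u = X v"
    proof induction
      case (step y z) thus ?case using X by (auto simp: tg_adj_def esrc_def etgt_def)
    qed simp
  qed
next
  assume c: "edges_connected (verts G) (edgs G)"
  show "tg_connected G"
    unfolding tg_connected_def
  proof (intro ballI)
    fix u v assume uv: "u \<in> verts G" "v \<in> verts G"
    have "\<forall>e\<in>set (edgs G). (tg_adj G)\<^sup>*\<^sup>* u (fst e) = (tg_adj G)\<^sup>*\<^sup>* u (fst (snd e))"
    proof
      fix e assume "e \<in> set (edgs G)"
      hence "tg_adj G (fst e) (fst (snd e))" "tg_adj G (fst (snd e)) (fst e)"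
        by (auto simp: tg_adj_def esrc_def etgt_def)
      thus "(tg_adj G)\<^sup>*\<^sup>* u (fst e) = (tg_adj G)\<^sup>*\<^sup>* u (fst (snd e))"
        by (meson rtranclp.rtrancl_into_rtrancl)
    qed
    with c uv have "(tg_adj G)\<^sup>*\<^sup>* u u = (tg_adj G)\<^sup>*\<^sup>* u v" unfolding edges_connected_def by blast
    thus "(tg_adj G)\<^sup>*\<^sup>* u v" by simp
  qed
qed

lemma edges_connected_map:
  fixes f :: "'u \<Rightarrow> 'v"
  shows "edges_connected V es \<Longrightarrow> edges_connected (f ` V) (map (edge_map f) es)"
  unfolding edges_connected_def
proof (intro allI impI ballI)
  fix X :: "'v \<Rightarrow> bool" and u v
  assume c: "\<forall>X :: 'u \<Rightarrow> bool. (\<forall>e\<in>set es. X (fst e) = X (fst (snd e))) \<longrightarrow> (\<forall>u\<in>V. \<forall>v\<in>V. X u = X v)"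
    and X: "\<forall>e\<in>set (map (edge_map f) es). X (fst e) = X (fst (snd e))" and "u \<in> f ` V" "v \<in> f ` V"
  then obtain u' v' where "u' \<in> V" "u = f u'" "v' \<in> V" "v = f v'" by blast
  moreover have "\<forall>e\<in>set es. (X \<circ> f) (fst e) = (X \<circ> f) (fst (snd e))" using X by simp
  moreover have "\<forall>u\<in>V. \<forall>v\<in>V. (X \<circ> f) u = (X \<circ> f) v"
    by (rule mp[OF c[THEN spec, of "X \<circ> f"] calculation(5)])
  ultimately have "(X \<circ> f) u' = (X \<circ> f) v'" by blast
  thus "X u = X v" unfolding \<open>u = f u'\<close> \<open>v = f v'\<close> by simp
qed

lemma edges_connected_append:
  assumes "edges_connected V es" "edges_connected W fs" "r \<in> V" "r \<in> W"
  shows "edges_connected (V \<union> W) (es @ fs)"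
  using assms unfolding edges_connected_def by (metis UnE Un_iff set_append)

section \<open>Sums over partitions and Moebius inversion\<close>

text \<open>The quotient map with the block itself as the new vertex. In contrast to
  \<open>block_rep\<close>, which takes a minimum, it is available for vertices of any type.\<close>

definition blk :: "'v set set \<Rightarrow> 'v \<Rightarrow> 'v set" where
  "blk p v = (THE B. B \<in> p \<and> v \<in> B)"

lemma blk_eq: "partition_on V p \<Longrightarrow> B \<in> p \<Longrightarrow> v \<in> B \<Longrightarrow> blk p v = B"
  unfolding blk_def partition_on_def disjoint_def by (intro the_equality) auto

lemma blk: "partition_on V p \<Longrightarrow> v \<in> V \<Longrightarrow> blk p v \<in> p \<and> v \<in> blk p v"
proof -
  assume p: "partition_on V p" and "v \<in> V"
  then obtain B where "B \<in> p" "v \<in> B" using partition_onD1[OF p] by blast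
  thus ?thesis using blk_eq[OF p] by simp
qed

lemma blk_image: "partition_on V p \<Longrightarrow> blk p ` V = p"
proof (intro equalityI subsetI)
  assume p: "partition_on V p"
  fix B assume B: "B \<in> p"
  then obtain x where "x \<in> B" using p by (metis equals0I partition_onD3)
  moreover from this have "x \<in> V" using B p by (auto simp: partition_on_def)
  ultimately show "B \<in> blk p ` V" using blk_eq[OF p B] by blast
next
  assume p: "partition_on V p"
  fix B assume "B \<in> blk p ` V"
  then obtain v where "v \<in> V" "B = blk p v" by (elim imageE)
  thus "B \<in> p" using blk[OF p] by simp
qed

lemma finite_partitions: "finite V \<Longrightarrow> finite {p. partition_on V p \<and> Q p}"
  by (rule finite_subset[of _ "{p. partition_on V p}"]) (auto intro: finitely_many_partition_on)

text \<open>Partitions of an image are the partitions of the source that are coarser than the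
  fibres.\<close>

lemma tau_quotient:
  fixes q :: "'v \<Rightarrow> nat"
  assumes rot: "cyclic_invariant kappa" and V: "finite V"
    and G: "verts G = q ` V" "mset (edgs G) = mset (map (edge_map q) es)" "ends es \<subseteq> V"
    and conn: "tg_connected G"
  shows "tau kappa G = (\<Sum>p | partition_on V p \<and> (\<forall>x\<in>V. \<forall>y\<in>V. q x = q y \<longrightarrow> blk p x = blk p y).
    weight kappa (map (edge_map (blk p)) es))"
proof -
  let ?S = "{p. partition_on V p \<and> (\<forall>x\<in>V. \<forall>y\<in>V. q x = q y \<longrightarrow> blk p x = blk p y)}"
  define pull where "pull p = (\<lambda>B. q -` B \<inter> V) ` p" for p
  define push where "push p = (`) q ` p" for p
  have sat: "x \<in> V \<Longrightarrow> B \<in> p \<Longrightarrow> q x \<in> q ` B \<Longrightarrow> x \<in> B" if "p \<in> ?S" for p B x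
  proof -
    assume "x \<in> V" "B \<in> p" "q x \<in> q ` B"
    then obtain y where y: "y \<in> B" "q x = q y" by blast
    have p: "partition_on V p" using that by simp
    have q: "\<forall>x\<in>V. \<forall>y\<in>V. q x = q y \<longrightarrow> blk p x = blk p y"
      using that unfolding mem_Collect_eq by (rule conjunct2)
    have "y \<in> V" using partition_onD1[OF p] \<open>B \<in> p\<close> y(1) by blast
    hence "blk p x = blk p y" using q y(2) \<open>x \<in> V\<close> by blast
    also have "\<dots> = B" using blk_eq[OF p \<open>B \<in> p\<close> y(1)] .
    finally show "x \<in> B" using blk[OF p \<open>x \<in> V\<close>] by simp
  qed
  have push: "partition_on (q ` V) (push p)" if p: "p \<in> ?S" for p
  proof (rule partition_onI)
    show "\<Union>(push p) = q ` V" using p by (auto simp: push_def partition_on_def)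
    show "{} \<notin> push p" using p by (auto simp: push_def partition_on_def)
    fix A B assume "A \<in> push p" "B \<in> push p" "A \<noteq> B"
    then obtain A' B' where *: "A' \<in> p" "B' \<in> p" "A = q ` A'" "B = q ` B'" "A' \<noteq> B'" by (auto simp: push_def)
    have sub: "A' \<subseteq> V" using p * by (auto simp: partition_on_def)
    have "A' \<inter> B' = {}" using p * by (auto simp: partition_on_def disjoint_def)
    show "disjnt A B"
    proof (rule ccontr)
      assume "\<not> disjnt A B"
      then obtain x where "x \<in> A'" "q x \<in> q ` B'" using * by (auto simp: disjnt_def)
      thus False using sat[OF p _ *(2)] sub \<open>A' \<inter> B' = {}\<close> by blast
    qed
  qed
  have pull: "pull p \<in> ?S" "\<And>x. x \<in> V \<Longrightarrow> blk (pull p) x = q -` (blk p (q x)) \<inter> V" if p: "partition_on (q ` V) p" for p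
  proof -
    have pp: "partition_on V (pull p)"
    proof (rule partition_onI)
      show "\<Union>(pull p) = V" using p by (auto simp: pull_def partition_on_def)
      show "{} \<notin> pull p"
      proof
        assume "{} \<in> pull p"
        then obtain B where B: "B \<in> p" "q -` B \<inter> V = {}" unfolding pull_def by blast
        have "B \<noteq> {}" "B \<subseteq> q ` V" using B(1) partition_onD1[OF p] partition_onD3[OF p] by blast+
        thus False using B(2) by blast
      qed
      fix A B assume "A \<in> pull p" "B \<in> pull p" "A \<noteq> B"
      then obtain A' B' where *: "A' \<in> p" "B' \<in> p" "A = q -` A' \<inter> V" "B = q -` B' \<inter> V" "A' \<noteq> B'"
        by (auto simp: pull_def)
      hence "A' \<inter> B' = {}" using partition_onD2[OF p] by (auto simp: disjoint_def)
      thus "disjnt A B" using *(3,4) by (auto simp: disjnt_def)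
    qed
    show bl: "blk (pull p) x = q -` (blk p (q x)) \<inter> V" if "x \<in> V" for x
      by (rule blk_eq[OF pp]) (use blk[OF p, of "q x"] that in \<open>auto simp: pull_def\<close>)
    show "pull p \<in> ?S" using pp bl by simp
  qed
  have "tau kappa G = (\<Sum>p | partition_on (q ` V) p. weight kappa (map (edge_map (block_rep p)) (edgs G)))"
    unfolding tau_def set_partitions_def G(1)
  proof (intro sum.cong refl)
    fix p assume "p \<in> {p. partition_on (q ` V) p}"
    have "edgs (tg_quot p G) = map (edge_map (block_rep p)) (edgs G)"
      by (simp add: tg_quot_def tg_map_def edge_map_def)
    moreover have "tg_connected (tg_quot p G)"
      using conn edges_connected_map[of "verts G" "edgs G" "block_rep p"] unfolding tg_connected_iff
      by (simp add: tg_quot_def tg_map_def edge_map_def)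
    ultimately show "tau0 kappa (tg_quot p G) = weight kappa (map (edge_map (block_rep p)) (edgs G))"
      using tau0_eq_weight[OF rot] by metis
  qed
  also have "\<dots> = (\<Sum>p\<in>?S. weight kappa (map (edge_map (blk p)) es))"
  proof (rule sum.reindex_bij_witness[where i = push and j = pull])
    fix p assume "p \<in> {p. partition_on (q ` V) p}"
    hence p: "partition_on (q ` V) p" by simp
    show "pull p \<in> ?S" by (rule pull(1)[OF p])
    have "q ` (q -` B \<inter> V) = B" if "B \<in> p" for B
    proof -
      have "B \<subseteq> q ` V" using that partition_onD1[OF p] by blast
      thus ?thesis by blast
    qed
    thus "push (pull p) = p" unfolding push_def pull_def image_image by simp
    have "weight kappa (map (edge_map (block_rep p)) (edgs G)) =
        weight kappa (map (edge_map (block_rep p)) (map (edge_map q) es))"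
      by (rule weight_mset[OF rot]) (use G(2) in \<open>simp only: mset_map\<close>)
    also have "\<dots> = weight kappa (map (edge_map (block_rep p \<circ> q)) es)" by (simp only: map_edge_map)
    also have "\<dots> = weight kappa (map (edge_map (blk (pull p))) es)"
    proof (rule weight_kernel[OF rot])
      fix x y assume "x \<in> ends es" "y \<in> ends es"
      hence xy: "x \<in> V" "y \<in> V" using G(3) by auto
      have fin: "finite B" if "B \<in> p" for B
        using that p V by (metis finite_imageI finite_UnionD finite_Union partition_onD1 rev_finite_subset Sup_upper)
      have br: "block_rep p v = Min (blk p v)" for v by (simp add: block_rep_def blk_def)
      have "blk p (q x) = blk p (q y)" if "block_rep p (q x) = block_rep p (q y)"
      proof -
        have b: "blk p (q x) \<in> p \<and> q x \<in> blk p (q x)" "blk p (q y) \<in> p \<and> q y \<in> blk p (q y)"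
          using blk[OF p] xy by auto
        hence "Min (blk p (q x)) \<in> blk p (q x)" "Min (blk p (q y)) \<in> blk p (q y)"
          using fin by (auto intro!: Min_in)
        thus ?thesis using that b unfolding br by (metis blk_eq[OF p])
      qed
      moreover have "q -` (blk p (q x)) \<inter> V = q -` (blk p (q y)) \<inter> V \<Longrightarrow> blk p (q x) = blk p (q y)"
      proof -
        assume "q -` (blk p (q x)) \<inter> V = q -` (blk p (q y)) \<inter> V"
        moreover have "x \<in> q -` (blk p (q x)) \<inter> V" using blk[OF p, of "q x"] xy by auto
        ultimately have "q x \<in> blk p (q y)" by auto
        thus ?thesis using blk[OF p, of "q y"] blk_eq[OF p] xy by blast
      qed
      ultimately show "(block_rep p \<circ> q) x = (block_rep p \<circ> q) y \<longleftrightarrow> blk (pull p) x = blk (pull p) y"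
        using pull(2)[OF p] xy br by auto
    qed
    finally show "weight kappa (map (edge_map (blk (pull p))) es) = weight kappa (map (edge_map (block_rep p)) (edgs G))"
      by simp
  next
    fix p assume p: "p \<in> ?S"
    show "push p \<in> {p. partition_on (q ` V) p}" using push[OF p] by simp
    have "q -` (q ` B) \<inter> V = B" if "B \<in> p" for B
    proof
      show "q -` q ` B \<inter> V \<subseteq> B" using sat[OF p _ that] by blast
      have "B \<subseteq> V" using p that by (auto simp: partition_on_def)
      thus "B \<subseteq> q -` q ` B \<inter> V" by blast
    qed
    thus "pull (push p) = p" unfolding push_def pull_def image_image by simp
  qed
  finally show ?thesis .
qed

text \<open>The new point \<open>w\<close> is a block of its own or joins an existing block. In the
  bijection the empty set, which is never a block, encodes the first case.\<close>

lemma partition_on_insert_cases: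
  assumes w: "w \<notin> V" and V: "finite V"
  shows "(\<Sum>p | partition_on (insert w V) p. F p) =
    (\<Sum>p | partition_on V p. F (insert {w} p) + (\<Sum>B\<in>p. F (insert (insert w B) (p - {B}))))"
  (is "sum F ?L = _")
proof -
  define g where "g = (\<lambda>(p :: 'a set set, B). insert (insert w B) (p - {B}))"
  let ?D = "SIGMA p:{p. partition_on V p}. insert {} p"
  have part: "partition_on (insert w V) (g (p, B))" if p: "partition_on V p" and B: "B \<in> insert {} p" for p B
  proof (rule partition_onI)
    have ne: "{} \<notin> p" and U: "\<Union>p = V" and d: "disjoint p"
      by (fact partition_onD3[OF p], fact partition_onD1[OF p, symmetric], fact partition_onD2[OF p])
    show "\<Union>(g (p, B)) = insert w V" using U B by (auto simp: g_def)
    show "{} \<notin> g (p, B)" using ne by (auto simp: g_def)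
    fix C D assume *: "C \<in> g (p, B)" "D \<in> g (p, B)" "C \<noteq> D"
    have dw: "insert w B \<inter> C = {}" if "C \<in> p - {B}" for C
    proof -
      have "w \<notin> C" using that U w by blast
      moreover have "B \<inter> C = {}" using that d B by (auto simp: disjoint_def)
      ultimately show ?thesis by simp
    qed
    have dd: "C \<inter> D = {}" if "C \<in> p - {B}" "D \<in> p - {B}" "C \<noteq> D" for C D
      using that d by (auto simp: disjoint_def)
    have C: "C = insert w B \<or> C \<in> p - {B}" and D: "D = insert w B \<or> D \<in> p - {B}" using * by (auto simp: g_def)
    from C show "disjnt C D"
    proof
      assume C: "C = insert w B"
      hence "D \<in> p - {B}" using D *(3) by metis
      thus ?thesis using dw[of D] unfolding C disjnt_def by blast
    next
      assume C: "C \<in> p - {B}"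
      from D show ?thesis
      proof
        assume D: "D = insert w B"
        show ?thesis using dw[OF C] unfolding D disjnt_def by blast
      qed (use dd[OF C _ *(3)] in \<open>simp add: disjnt_def\<close>)
    qed
  qed
  have "bij_betw g ?D ?L"
  proof (rule bij_betwI')
    fix x y assume "x \<in> ?D" "y \<in> ?D"
    then obtain p B p' B' where xy: "x = (p, B)" "y = (p', B')" "partition_on V p" "partition_on V p'"
      "B \<in> insert {} p" "B' \<in> insert {} p'" by blast
    have rec: "insert w B \<in> g (p, B) \<and> (\<forall>C\<in>g (p, B). w \<in> C \<longrightarrow> C = insert w B) \<and>
       p = (g (p, B) - {insert w B}) \<union> (if B = {} then {} else {B}) \<and> w \<notin> B"
      if "partition_on V p" "B \<in> insert {} p" for p B
    proof -
      have nw: "w \<notin> C" if "C \<in> p" for C using that \<open>partition_on V p\<close> w by (auto simp: partition_on_def)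
      have ne: "{} \<notin> p" using \<open>partition_on V p\<close> by (auto simp: partition_on_def)
      have "insert w B \<notin> p" using nw by blast
      hence "g (p, B) - {insert w B} = p - {B}" by (auto simp: g_def)
      thus ?thesis using that(2) nw ne by (auto simp: g_def)
    qed
    have "x = y" if "g (p, B) = g (p', B')"
    proof -
      note r = rec[OF xy(3,5)] and r' = rec[OF xy(4,6)]
      have "insert w B = insert w B'" using r r' that by (metis insertI1)
      hence "B = B'" using r r' by (metis insert_ident)
      thus ?thesis using r r' that xy(1,2) by metis
    qed
    thus "g x = g y \<longleftrightarrow> x = y" using xy(1,2) by auto
  next
    fix x assume "x \<in> ?D"
    thus "g x \<in> ?L" using part by auto
  next
    fix p assume "p \<in> ?L"
    hence p: "partition_on (insert w V) p" by simp
    define C where "C = blk p w"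
    have C: "C \<in> p" "w \<in> C" using blk[OF p, of w] by (auto simp: C_def)
    define B where "B = C - {w}"
    define p' where "p' = (p - {C}) \<union> (if B = {} then {} else {B})"
    have dC: "D \<inter> C = {}" if "D \<in> p - {C}" for D using p C that by (auto simp: partition_on_def disjoint_def)
    have "partition_on V p'"
    proof (rule partition_onI)
      have "\<Union>p = insert w V" using p by (simp add: partition_on_def)
      hence "\<Union>(p - {C}) \<union> C = insert w V" using C(1) by blast
      moreover have "w \<notin> \<Union>(p - {C})" using dC C(2) by blast
      moreover have "\<Union>p' = \<Union>(p - {C}) \<union> B" by (auto simp: p'_def)
      moreover have "\<Union>(p - {C}) \<union> (C - {w}) = (\<Union>(p - {C}) \<union> C) - {w}"
        using \<open>w \<notin> \<Union>(p - {C})\<close> by blast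
      ultimately show "\<Union>p' = V" using w unfolding B_def by simp
      show "{} \<notin> p'" using p by (auto simp: p'_def partition_on_def)
      fix D E assume *: "D \<in> p'" "E \<in> p'" "D \<noteq> E"
      have D: "D = B \<or> D \<in> p - {C}" and E: "E = B \<or> E \<in> p - {C}" using * by (auto simp: p'_def split: if_splits)
      have dB: "D \<inter> B = {}" if "D \<in> p - {C}" for D using dC[OF that] by (auto simp: B_def)
      from D show "disjnt D E"
      proof
        assume D: "D = B"
        hence "E \<in> p - {C}" using E *(3) by metis
        thus ?thesis using dB[of E] unfolding D disjnt_def by blast
      next
        assume D: "D \<in> p - {C}"
        from E show ?thesis
        proof
          assume E: "E = B"
          show ?thesis using dB[OF D] unfolding E disjnt_def by blast
        next
          assume E: "E \<in> p - {C}"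
          show ?thesis using partition_onD2[OF p] D E *(3) by (auto simp: disjoint_def disjnt_def)
        qed
      qed
    qed
    moreover have "B \<in> insert {} p'" by (auto simp: p'_def)
    moreover have "g (p', B) = p"
    proof -
      have "{} \<notin> p" by (rule partition_onD3[OF p])
      have "B \<notin> p - {C}"
      proof
        assume B: "B \<in> p - {C}"
        have "B \<subseteq> C" by (auto simp: B_def)
        hence "B = {}" using dC[OF B] by blast
        thus False using B \<open>{} \<notin> p\<close> by simp
      qed
      hence "p' - {B} = p - {C}" by (auto simp: p'_def)
      moreover have "insert w B = C" using C by (auto simp: B_def)
      ultimately show ?thesis using C by (auto simp: g_def)
    qed
    ultimately show "\<exists>x\<in>?D. p = g x" by blast
  qed
  hence "sum F ?L = (\<Sum>x\<in>?D. F (g x))" by (rule sum.reindex_bij_betw[symmetric])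
  also have "\<dots> = (\<Sum>p | partition_on V p. \<Sum>B\<in>insert {} p. F (g (p, B)))"
    using finitely_many_partition_on[OF V] finite_elements[OF V] by (subst sum.Sigma) (auto simp: split_def)
  also have "\<dots> = (\<Sum>p | partition_on V p. F (insert {w} p) + (\<Sum>B\<in>p. F (insert (insert w B) (p - {B}))))"
  proof (intro sum.cong refl)
    fix p assume "p \<in> {p. partition_on V p}"
    hence "{} \<notin> p" "finite p" using finite_elements[OF V] by (auto simp: partition_on_def)
    thus "(\<Sum>B\<in>insert {} p. F (g (p, B))) = F (insert {w} p) + (\<Sum>B\<in>p. F (insert (insert w B) (p - {B})))"
      by (simp add: g_def)
  qed
  finally show ?thesis .
qed

text \<open>The defining property of the Moebius function of the partition lattice: its sum over all
  partitions below the kernel of \<open>f\<close> detects whether this kernel is trivial. Adding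
  \<open>w\<close> multiplies the sum by 1 minus the number of earlier points with the value of
  \<open>w\<close>, because enlarging a block by one point multiplies its factor by minus its size.
  If \<open>f\<close> was injective so far, this number is 0 or 1.\<close>

lemma sum_mobius0:
  assumes "finite U"
  shows "(\<Sum>p | partition_on U p \<and> (\<forall>B\<in>p. \<forall>x\<in>B. \<forall>y\<in>B. f x = f y). mobius0 p) = (if inj_on f U then 1 else 0)"
  using assms
proof (induction U)
  case empty
  have eq: "{p. partition_on {} p \<and> (\<forall>B\<in>p. \<forall>x\<in>B. \<forall>y\<in>B. f x = f y)} = {{}}"
    unfolding partition_on_empty by (rule set_eqI) (simp add: conj_commute cong: conj_cong)
  show ?case unfolding eq by (simp add: mobius0_def)
next
  case (insert w U)
  let ?ok = "\<lambda>p. \<forall>B\<in>p. \<forall>x\<in>B. \<forall>y\<in>B. f x = f y"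
  let ?M = "\<lambda>p. if ?ok p then mobius0 p else 0"
  let ?k = "of_nat (card {x\<in>U. f x = f w}) :: complex"
  have cond: "(\<Sum>p | partition_on V p \<and> ?ok p. mobius0 p) = (\<Sum>p | partition_on V p. ?M p)" if "finite V" for V
    using finitely_many_partition_on[OF that] by (simp add: sum.If_cases Collect_conj_eq)
  have step: "?M (insert {w} p) + (\<Sum>B\<in>p. ?M (insert (insert w B) (p - {B}))) = (1 - ?k) * ?M p"
    if p: "partition_on U p" for p
  proof (cases "?ok p")
    case False
    have M0: "?M p = 0" using False by (rule if_not_P)
    have Mw: "?M (insert {w} p) = 0"
      by (rule if_not_P) (use False in blast)
    have "?M (insert (insert w B) (p - {B})) = 0" if "B \<in> p" for B
    proof -
      obtain D where D: "D \<in> p" "\<not> (\<forall>x\<in>D. \<forall>y\<in>D. f x = f y)" using False by blast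
      have "\<not> ?ok (insert (insert w B) (p - {B}))"
      proof
        assume ok: "?ok (insert (insert w B) (p - {B}))"
        show False
        proof (cases "D = B")
          case True
          have "\<forall>x\<in>insert w B. \<forall>y\<in>insert w B. f x = f y" by (rule bspec[OF ok insertI1])
          thus False using D(2) unfolding True by blast
        next
          case False
          hence "\<forall>x\<in>D. \<forall>y\<in>D. f x = f y" using D(1) by (intro bspec[OF ok] insertI2 DiffI) auto
          thus False using D(2) by contradiction
        qed
      qed
      thus ?thesis by (rule if_not_P)
    qed
    hence "(\<Sum>B\<in>p. ?M (insert (insert w B) (p - {B}))) = 0" by (rule sum.neutral[OF ballI])
    thus ?thesis unfolding M0 Mw by simp
  next
    case True
    have fp: "finite p" by (rule finite_elements[OF insert(1) p])
    have fB: "finite B" "B \<noteq> {}" "w \<notin> B" if "B \<in> p" for B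
    proof -
      have "B \<subseteq> U" using p that by (auto simp: partition_on_def)
      thus "finite B" "w \<notin> B" using insert(1,2) finite_subset by auto
      show "B \<noteq> {}" using p that by (auto simp: partition_on_def)
    qed
    define m where "m B = (-1) ^ (card B - 1) * (of_nat (fact (card B - 1)) :: complex)" for B :: "nat set"
    have mob: "mobius0 p = (\<Prod>B\<in>p. m B)" for p unfolding mobius0_def m_def ..
    have w1: "?M (insert {w} p) = mobius0 p"
    proof -
      have "{w} \<notin> p" using fB(3) by blast
      hence "mobius0 (insert {w} p) = mobius0 p" using fp by (simp add: mob) (simp add: m_def)
      moreover have "?M (insert {w} p) = mobius0 (insert {w} p)"
        by (rule if_P) (use True in blast)
      ultimately show ?thesis by (simp only:)
    qed
    have MP: "?M p = mobius0 p" using True by (rule if_P)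
    have "?M (insert (insert w B) (p - {B})) = (if f ` B = {f w} then - of_nat (card B) * mobius0 p else 0)"
      if B: "B \<in> p" for B
    proof -
      have fw: "f ` B = {f w} \<longleftrightarrow> (\<forall>x\<in>insert w B. \<forall>y\<in>insert w B. f x = f y)"
      proof
        assume "f ` B = {f w}"
        hence "\<forall>x\<in>insert w B. f x = f w" by blast
        thus "\<forall>x\<in>insert w B. \<forall>y\<in>insert w B. f x = f y" by metis
      next
        assume "\<forall>x\<in>insert w B. \<forall>y\<in>insert w B. f x = f y"
        hence "\<forall>x\<in>B. f x = f w" by blast
        thus "f ` B = {f w}" using fB(2)[OF B] by force
      qed
      have ok: "?ok (insert (insert w B) (p - {B})) \<longleftrightarrow> f ` B = {f w}"
        unfolding fw
      proof
        assume ok: "?ok (insert (insert w B) (p - {B}))"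
        show "\<forall>x\<in>insert w B. \<forall>y\<in>insert w B. f x = f y" by (rule bspec[OF ok insertI1])
      next
        assume h: "\<forall>x\<in>insert w B. \<forall>y\<in>insert w B. f x = f y"
        show "?ok (insert (insert w B) (p - {B}))"
        proof
          fix D assume "D \<in> insert (insert w B) (p - {B})"
          hence "D = insert w B \<or> D \<in> p" by blast
          thus "\<forall>x\<in>D. \<forall>y\<in>D. f x = f y"
          proof
            assume D: "D = insert w B"
            show ?thesis unfolding D by (rule h)
          qed (rule bspec[OF True])
        qed
      qed
      have nin: "insert w B \<notin> p - {B}" using fB(3) by blast
      have "card B > 0" using fB[OF B] by (simp add: card_gt_0_iff)
      then obtain k where k: "card B = Suc k" by (cases "card B") auto
      have "m (insert w B) = - of_nat (card B) * m B"
        unfolding m_def using fB[OF B] k by (simp add: algebra_simps)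
      hence "mobius0 (insert (insert w B) (p - {B})) = - of_nat (card B) * mobius0 p"
        unfolding mob using nin fp prod.remove[OF fp B, of m] by simp
      thus ?thesis using ok by auto
    qed
    hence "(\<Sum>B\<in>p. ?M (insert (insert w B) (p - {B}))) = (\<Sum>B\<in>p. if f ` B = {f w} then - of_nat (card B) * mobius0 p else 0)"
      by (rule sum.cong[OF refl])
    also have "\<dots> = (\<Sum>B\<in>{B\<in>p. f ` B = {f w}}. - of_nat (card B) * mobius0 p)"
      using fp by (simp add: sum.If_cases Int_def conj_commute)
    also have "\<dots> = - (of_nat (\<Sum>B\<in>{B\<in>p. f ` B = {f w}}. card B)) * mobius0 p"
      by (simp add: sum_negf sum_distrib_right)
    also have "(\<Sum>B\<in>{B\<in>p. f ` B = {f w}}. card B) = card (\<Union>{B\<in>p. f ` B = {f w}})"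
      by (rule card_Union_disjoint[symmetric])
         (use p fB in \<open>auto simp: partition_on_def disjoint_def pairwise_def disjnt_def\<close>)
    also have "\<Union>{B\<in>p. f ` B = {f w}} = {x\<in>U. f x = f w}"
    proof (intro equalityI subsetI)
      fix x assume "x \<in> {x\<in>U. f x = f w}"
      hence x: "x \<in> U" "f x = f w" by auto
      have b: "blk p x \<in> p" "x \<in> blk p x" using blk[OF p x(1)] by auto
      hence "\<forall>y\<in>blk p x. f y = f w" using True x(2) by metis
      hence "f ` blk p x = {f w}" using b(2) by force
      thus "x \<in> \<Union>{B\<in>p. f ` B = {f w}}" using b by blast
    next
      fix x assume "x \<in> \<Union>{B\<in>p. f ` B = {f w}}"
      thus "x \<in> {x\<in>U. f x = f w}" using p by (auto simp: partition_on_def)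
    qed
    finally show ?thesis unfolding w1 MP by (simp add: algebra_simps)
  qed
  have "(\<Sum>p | partition_on (insert w U) p \<and> ?ok p. mobius0 p) = (\<Sum>p | partition_on (insert w U) p. ?M p)"
    using insert(1) by (intro cond) simp
  also have "\<dots> = (\<Sum>p | partition_on U p. ?M (insert {w} p) + (\<Sum>B\<in>p. ?M (insert (insert w B) (p - {B}))))"
    by (rule partition_on_insert_cases[OF insert(2,1)])
  also have "\<dots> = (\<Sum>p | partition_on U p. (1 - ?k) * ?M p)"
    by (intro sum.cong refl step) simp
  also have "\<dots> = (1 - ?k) * (if inj_on f U then 1 else 0)"
    unfolding sum_distrib_left[symmetric] cond[OF insert(1), symmetric] insert(3) ..
  also have "\<dots> = (if inj_on f (insert w U) then 1 else 0)"
  proof (cases "inj_on f U")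
    case True
    show ?thesis
    proof (cases "f w \<in> f ` U")
      case T: True
      then obtain x where x: "x \<in> U" "f x = f w" by force
      have "y = x" if "y \<in> U" "f y = f w" for y
        using inj_onD[OF True, of y x] that x by simp
      hence e: "{x\<in>U. f x = f w} = {x}" using x by blast
      show ?thesis unfolding e using T True insert(2) by (simp add: inj_on_insert)
    next
      case False
      have "\<not> (x \<in> U \<and> f x = f w)" for x using False by (metis imageI)
      hence e: "{x\<in>U. f x = f w} = {}" by blast
      show ?thesis unfolding e using False True insert(2) by (simp add: inj_on_insert)
    qed
  qed simp
  finally show ?case .
qed

lemma gm_wf_iff:
  "gm_wf t \<longleftrightarrow> finite (verts t) \<and> ends (edgs t) \<subseteq> verts t \<and> edges_connected (verts t) (edgs t) \<and>
     vin t \<in> verts t \<and> vout t \<in> verts t"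
  unfolding gm_wf_def tg_wf_def tg_connected_iff ends_def esrc_def etgt_def by blast

lemma gm_map_simps [simp]:
  "verts (gm_map f t) = f ` verts t" "edgs (gm_map f t) = map (edge_map f) (edgs t)"
  "vin (gm_map f t) = f (vin t)" "vout (gm_map f t) = f (vout t)"
  by (simp_all add: gm_map_def edge_map_def)

lemma gm_wf_map: "gm_wf t \<Longrightarrow> gm_wf (gm_map f t)"
  by (auto simp: gm_wf_iff edges_connected_map)

lemma gm_map_ident:
  assumes "gm_wf t" "\<And>v. v \<in> verts t \<Longrightarrow> f v = v"
  shows "gm_map f t = t"
proof -
  have "map (edge_map f) (edgs t) = edgs t"
  proof (rule map_idI)
    fix e assume "e \<in> set (edgs t)"
    hence "fst e \<in> verts t" "fst (snd e) \<in> verts t" using assms(1) ends_in[of e "edgs t"] by (auto simp: gm_wf_iff)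
    thus "edge_map f e = e" using assms(2) by (cases e) simp
  qed
  moreover have "f ` verts t = verts t" using assms(2) by (auto intro!: image_eqI)
  moreover have "f (vin t) = vin t" "f (vout t) = vout t" using assms by (auto simp: gm_wf_iff)
  ultimately have "verts (gm_map f t) = verts t" "edgs (gm_map f t) = edgs t"
    "vin (gm_map f t) = vin t" "vout (gm_map f t) = vout t" by simp_all
  thus ?thesis by (intro gmon.equality) auto
qed

section \<open>Products of monomials\<close>

definition dsum :: "'u set \<Rightarrow> 'v set \<Rightarrow> ('u + 'v) set" where
  "dsum V W = Inl ` V \<union> Inr ` W"

definition dedges :: "('u \<times> 'u \<times> 'a) list \<Rightarrow> ('v \<times> 'v \<times> 'a) list \<Rightarrow> (('u + 'v) \<times> ('u + 'v) \<times> 'a) list" where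
  "dedges es fs = map (edge_map Inl) es @ map (edge_map Inr) fs"

lemma in_dsum [simp]: "Inl x \<in> dsum V W \<longleftrightarrow> x \<in> V" "Inr y \<in> dsum V W \<longleftrightarrow> y \<in> W"
  by (auto simp: dsum_def)

lemma finite_dsum [simp]: "finite V \<Longrightarrow> finite W \<Longrightarrow> finite (dsum V W)"
  by (simp add: dsum_def)

lemma ends_dedges [simp]: "ends (dedges es fs) = dsum (ends es) (ends fs)"
  by (simp add: dedges_def dsum_def)

lemma dsum_mono: "V \<subseteq> V' \<Longrightarrow> W \<subseteq> W' \<Longrightarrow> dsum V W \<subseteq> dsum V' W'"
  by (auto simp: dsum_def)

text \<open>Exhibits the vertex set of \<open>gm_mult\<close> as a quotient of the disjoint union,
  so that \<open>psi\<close> of a product becomes a sum over partitions of that union.\<close>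

definition glue :: "'a gmon \<Rightarrow> 'a gmon \<Rightarrow> nat + nat \<Rightarrow> nat" where
  "glue m n = case_sum (\<lambda>v. v) (\<lambda>v. if v = vout n then vin m else v + Suc (Max (verts m)))"

lemma glue_simps [simp]:
  "glue m n (Inl v) = v" "glue m n (Inr v) = (if v = vout n then vin m else v + Suc (Max (verts m)))"
  by (simp_all add: glue_def)

lemma gm_mult_simps [simp]:
  "verts (gm_mult m n) = glue m n ` dsum (verts m) (verts n)"
  "edgs (gm_mult m n) = map (edge_map (glue m n)) (dedges (edgs m) (edgs n))"
  "vin (gm_mult m n) = glue m n (Inr (vin n))" "vout (gm_mult m n) = vout m"
proof -
  show "verts (gm_mult m n) = glue m n ` dsum (verts m) (verts n)"
  proof -
    let ?k = "Suc (Max (verts m))"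
    have 1: "(\<lambda>v. if v = vout n + ?k then vin m else v) ` (\<lambda>v. v + ?k) ` verts n = glue m n ` Inr ` verts n"
      unfolding image_image by (intro image_cong) auto
    have 2: "glue m n ` Inl ` verts m = verts m" by (simp add: image_image)
    show ?thesis
      unfolding dsum_def image_Un 1[symmetric] 2 by (simp only: gm_mult_def Let_def gm_map_simps tgraph.select_convs)
  qed
  have "edge_map (glue m n \<circ> Inl) = (\<lambda>e. e)" by (auto simp: edge_map_def fun_eq_iff)
  thus "edgs (gm_mult m n) = map (edge_map (glue m n)) (dedges (edgs m) (edgs n))"
    by (simp add: gm_mult_def Let_def dedges_def o_def) (simp add: edge_map_def)
qed (simp_all add: gm_mult_def Let_def)

text \<open>The shift exceeds every vertex of the first factor, so no vertices collide beyond the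
  intended identification.\<close>

lemma glue_kernel:
  assumes "gm_wf m" "x \<in> dsum (verts m) (verts n)" "y \<in> dsum (verts m) (verts n)" "glue m n x = glue m n y"
  shows "x = y \<or> {x, y} \<subseteq> {Inl (vin m), Inr (vout n)}"
proof -
  have "v < Suc (Max (verts m))" if "v \<in> verts m" for v
    using assms(1) that by (simp add: gm_wf_iff less_Suc_eq_le)
  moreover have "vin m \<in> verts m" using assms(1) by (simp add: gm_wf_iff)
  ultimately show ?thesis
    using assms(2-4) by (cases x; cases y) (auto split: if_splits, fastforce+)
qed

lemma gm_wf_mult:
  assumes "gm_wf m" "gm_wf n"
  shows "gm_wf (gm_mult m n)"
proof -
  let ?q = "glue m n"
  have "edges_connected (?q ` Inl ` verts m \<union> ?q ` Inr ` verts n)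
     (map (edge_map ?q) (map (edge_map Inl) (edgs m)) @ map (edge_map ?q) (map (edge_map Inr) (edgs n)))"
  proof (rule edges_connected_append[where r = "vin m"])
    show "vin m \<in> ?q ` Inr ` verts n" using assms(2) by (force simp: gm_wf_iff)
    show "vin m \<in> ?q ` Inl ` verts m" using assms(1) by (force simp: gm_wf_iff)
  qed (use assms in \<open>auto simp only: gm_wf_iff intro!: edges_connected_map\<close>)
  hence "edges_connected (verts (gm_mult m n)) (edgs (gm_mult m n))"
    unfolding gm_mult_simps dsum_def dedges_def image_Un map_append .
  moreover have "ends (edgs (gm_mult m n)) \<subseteq> verts (gm_mult m n)"
    unfolding gm_mult_simps ends_map ends_dedges
    by (intro image_mono dsum_mono) (use assms in \<open>auto simp: gm_wf_iff\<close>)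
  moreover have "vout m \<in> verts (gm_mult m n)" "vin (gm_mult m n) \<in> verts (gm_mult m n)"
    "finite (verts (gm_mult m n))"
    using assms unfolding gm_mult_simps(1,3) by (auto simp: gm_wf_iff dsum_def intro!: image_eqI[where x = "Inl (vout m)"] simp del: glue_simps(2))
  ultimately show ?thesis unfolding gm_wf_iff by simp
qed

section \<open>The functional psi as a sum over partitions\<close>

text \<open>The partitions summed over in \<open>psi\<close> live on the vertices after the roots
  are identified. Pulled back to a set \<open>V\<close> that covers these vertices, they become the
  partitions coarser than the fibres of \<open>q\<close> that also join everything lying over the
  two roots.\<close>

lemma psi_quotient:
  fixes q :: "'v \<Rightarrow> nat"
  assumes rot: "cyclic_invariant kappa" and wf: "gm_wf m" and V: "finite V"
    and m: "verts m = q ` V" "mset (edgs m) = mset (map (edge_map q) es)" "ends es \<subseteq> V"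
  shows "psi kappa m = (\<Sum>p | partition_on V p \<and>
      (\<forall>x\<in>V. \<forall>y\<in>V. q x = q y \<or> {q x, q y} \<subseteq> {vin m, vout m} \<longrightarrow> blk p x = blk p y).
    weight kappa (map (edge_map (blk p)) es))"
proof -
  let ?d = "\<lambda>v. if v = vout m then vin m else v"
  have e: "edgs (diag_tg m) = map (edge_map ?d) (edgs m)" and v: "verts (diag_tg m) = ?d ` verts m"
    by (simp_all add: diag_tg_def tg_map_def edge_map_def)
  have "psi kappa m = (\<Sum>p | partition_on V p \<and> (\<forall>x\<in>V. \<forall>y\<in>V. (?d \<circ> q) x = (?d \<circ> q) y \<longrightarrow> blk p x = blk p y).
    weight kappa (map (edge_map (blk p)) es))"
    unfolding psi_def
  proof (rule tau_quotient[OF rot V])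
    show "verts (diag_tg m) = (?d \<circ> q) ` V" unfolding v m(1) by (rule image_comp)
    have "mset (edgs (diag_tg m)) = mset (map (edge_map ?d) (map (edge_map q) es))"
      using m(2) unfolding e by (simp only: mset_map)
    thus "mset (edgs (diag_tg m)) = mset (map (edge_map (?d \<circ> q)) es)" unfolding map_edge_map .
    show "tg_connected (diag_tg m)"
      unfolding tg_connected_iff e v by (rule edges_connected_map) (use wf in \<open>simp add: gm_wf_iff\<close>)
  qed (use m in simp)
  moreover have "(?d \<circ> q) x = (?d \<circ> q) y \<longleftrightarrow> q x = q y \<or> {q x, q y} \<subseteq> {vin m, vout m}" for x y
    by auto
  ultimately show ?thesis by (simp only:)
qed

text \<open>A normal form for products: \<open>V\<close> is a disjoint union of pieces, and
  \<open>R\<close> collects the points that all end up in the root. Products with the same pieces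
  and the same \<open>R\<close> have the same \<open>psi\<close>.\<close>

definition rooted_sum :: "('a list \<Rightarrow> complex) \<Rightarrow> 'v set \<Rightarrow> ('v \<times> 'v \<times> 'a) list \<Rightarrow> 'v set \<Rightarrow> complex" where
  "rooted_sum kappa V es R = (\<Sum>p | partition_on V p \<and> (\<forall>x\<in>R. \<forall>y\<in>R. blk p x = blk p y).
    weight kappa (map (edge_map (blk p)) es))"

lemma psi_rooted_sum:
  fixes q :: "'v \<Rightarrow> nat"
  assumes rot: "cyclic_invariant kappa" and wf: "gm_wf m" and V: "finite V"
    and m: "verts m = q ` V" "mset (edgs m) = mset (map (edge_map q) es)" "ends es \<subseteq> V"
    and R: "R \<subseteq> V" "q ` R = {vin m, vout m}"
    and ker: "\<And>x y. x \<in> V \<Longrightarrow> y \<in> V \<Longrightarrow> q x = q y \<Longrightarrow> x = y \<or> x \<in> R \<and> y \<in> R"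
  shows "psi kappa m = rooted_sum kappa V es R"
proof -
  have *: "q x = q y \<or> {q x, q y} \<subseteq> {vin m, vout m} \<longleftrightarrow> x = y \<or> x \<in> R \<and> y \<in> R"
    if "x \<in> V" "y \<in> V" for x y
  proof -
    have in_R: "z \<in> R" if z: "z \<in> V" "q z \<in> q ` R" for z
    proof -
      obtain u where "u \<in> R" "q z = q u" using z(2) by blast
      thus ?thesis using ker[OF z(1), of u] R(1) by blast
    qed
    show ?thesis unfolding R(2)[symmetric]
    proof
      assume "q x = q y \<or> {q x, q y} \<subseteq> q ` R"
      thus "x = y \<or> x \<in> R \<and> y \<in> R" using ker[OF that] in_R[OF that(1)] in_R[OF that(2)] by blast
    qed blast
  qed
  have "(\<forall>x\<in>V. \<forall>y\<in>V. q x = q y \<or> {q x, q y} \<subseteq> {vin m, vout m} \<longrightarrow> blk p x = blk p y) \<longleftrightarrow>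
      (\<forall>x\<in>R. \<forall>y\<in>R. blk p x = blk p y)" for p :: "'v set set"
  proof
    assume h: "\<forall>x\<in>V. \<forall>y\<in>V. q x = q y \<or> {q x, q y} \<subseteq> {vin m, vout m} \<longrightarrow> blk p x = blk p y"
    show "\<forall>x\<in>R. \<forall>y\<in>R. blk p x = blk p y"
    proof (intro ballI)
      fix x y assume "x \<in> R" "y \<in> R"
      moreover from this have "x \<in> V" "y \<in> V" using R(1) by auto
      ultimately show "blk p x = blk p y" using h *[of x y] by blast
    qed
  next
    assume h: "\<forall>x\<in>R. \<forall>y\<in>R. blk p x = blk p y"
    show "\<forall>x\<in>V. \<forall>y\<in>V. q x = q y \<or> {q x, q y} \<subseteq> {vin m, vout m} \<longrightarrow> blk p x = blk p y"
    proof (intro ballI impI)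
      fix x y assume xy: "x \<in> V" "y \<in> V" "q x = q y \<or> {q x, q y} \<subseteq> {vin m, vout m}"
      hence "x = y \<or> x \<in> R \<and> y \<in> R" using *[OF xy(1,2)] by blast
      thus "blk p x = blk p y" using h by blast
    qed
  qed
  thus ?thesis unfolding psi_quotient[OF rot wf V m] rooted_sum_def by (simp only:)
qed

lemma block_rep_eq_iff:
  assumes p: "partition_on V p" and V: "finite V" and x: "x \<in> V" "y \<in> V"
  shows "block_rep p x = block_rep p y \<longleftrightarrow> blk p x = blk p y"
proof -
  have br: "block_rep p v = Min (blk p v)" for v by (simp add: block_rep_def blk_def)
  have "Min (blk p v) \<in> blk p v" if "v \<in> V" for v
  proof -
    have "blk p v \<subseteq> V" "v \<in> blk p v" using blk[OF p that] partition_onD1[OF p] by auto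
    thus ?thesis using V by (intro Min_in) (auto intro: finite_subset)
  qed
  thus ?thesis unfolding br using x blk[OF p] blk_eq[OF p] by metis
qed

text \<open>For \<open>g\<close> with equal roots, closing up \<open>g n\<close> makes three points
  coincide: the root of \<open>g\<close> and both roots of \<open>n\<close>.\<close>

definition roots_eq :: "nat \<Rightarrow> 'a gmon \<Rightarrow> (nat + nat) set set \<Rightarrow> bool" where
  "roots_eq r n p \<longleftrightarrow> blk p (Inl r) = blk p (Inr (vin n)) \<and> blk p (Inl r) = blk p (Inr (vout n))"

text \<open>The map \<open>f\<close> is arbitrary so that all quotients of \<open>g\<close> in
  \<open>Q_elem g\<close> are covered: each becomes a sum over partitions of the same set,
  restricted to those that respect the kernel of \<open>f\<close>. This common index set is what the
  Moebius inversion acts on.\<close>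

lemma psi_gm_map_mult:
  assumes rot: "cyclic_invariant kappa" and g: "gm_wf g" "vin g = vout g" and n: "gm_wf n"
  shows "psi kappa (gm_mult (gm_map f g) n) =
    (\<Sum>p | partition_on (dsum (verts g) (verts n)) p \<and> roots_eq (vin g) n p \<and>
       (\<forall>x\<in>verts g. \<forall>y\<in>verts g. f x = f y \<longrightarrow> blk p (Inl x) = blk p (Inl y)).
     weight kappa (map (edge_map (blk p)) (dedges (edgs g) (edgs n))))"
proof -
  let ?g = "gm_map f g"
  let ?m = "gm_mult ?g n"
  let ?V = "dsum (verts g) (verts n)"
  let ?h = "map_sum f (\<lambda>v. v)"
  let ?q = "glue ?g n \<circ> ?h"
  have wfg: "gm_wf ?g" by (rule gm_wf_map[OF g(1)])
  have hV: "?h ` ?V = dsum (f ` verts g) (verts n)" by (force simp: dsum_def image_Un image_image)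
  have he: "map (edge_map ?h) (dedges (edgs g) (edgs n)) = dedges (map (edge_map f) (edgs g)) (edgs n)"
  proof -
    have "edge_map (?h \<circ> Inl) e = edge_map (Inl \<circ> f) e" "edge_map (?h \<circ> Inr) e' = edge_map Inr e'"
      for e e' by (auto simp: edge_map_def split: prod.splits)
    thus ?thesis by (simp add: dedges_def o_def)
  qed
  have r: "vin ?m = ?q (Inr (vin n))" "vout ?m = ?q (Inl (vin g))" "?q (Inr (vout n)) = f (vin g)"
    using g(2) by simp_all
  have inV: "Inl (vin g) \<in> ?V" "Inr (vin n) \<in> ?V" "Inr (vout n) \<in> ?V" using g n by (auto simp: gm_wf_iff)
  have cond: "(\<forall>x\<in>?V. \<forall>y\<in>?V. ?q x = ?q y \<or> {?q x, ?q y} \<subseteq> {vin ?m, vout ?m} \<longrightarrow> blk p x = blk p y) \<longleftrightarrow>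
     roots_eq (vin g) n p \<and> (\<forall>x\<in>verts g. \<forall>y\<in>verts g. f x = f y \<longrightarrow> blk p (Inl x) = blk p (Inl y))"
    (is "?A p \<longleftrightarrow> ?B p") for p
  proof
    assume A0: "?A p"
    have A: "blk p x = blk p y" if "x \<in> ?V" "y \<in> ?V" "?q x = ?q y \<or> {?q x, ?q y} \<subseteq> {vin ?m, vout ?m}" for x y
      by (rule A0[THEN bspec, THEN bspec, THEN mp, OF that])
    have "blk p (Inl (vin g)) = blk p (Inr (vin n))"
    proof -
      have "{?q (Inl (vin g)), ?q (Inr (vin n))} \<subseteq> {vin ?m, vout ?m}" unfolding r(1,2) by blast
      thus ?thesis by (intro A inV disjI2)
    qed
    moreover have "blk p (Inl (vin g)) = blk p (Inr (vout n))"
    proof -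
      have "?q (Inl (vin g)) = ?q (Inr (vout n))" using r(3) by simp
      thus ?thesis by (intro A inV disjI1)
    qed
    moreover have "blk p (Inl x) = blk p (Inl y)" if "x \<in> verts g" "y \<in> verts g" "f x = f y" for x y
    proof -
      have "?q (Inl x) = ?q (Inl y)" "Inl x \<in> ?V" "Inl y \<in> ?V" using that by simp_all
      thus ?thesis by (intro A disjI1)
    qed
    ultimately show "?B p" unfolding roots_eq_def by (intro conjI ballI impI)
  next
    assume B: "?B p"
    have B1: "blk p (Inl (vin g)) = blk p (Inr (vin n))" "blk p (Inl (vin g)) = blk p (Inr (vout n))"
      using B[THEN conjunct1] by (auto simp: roots_eq_def)
    have B2: "blk p (Inl x) = blk p (Inl y)" if "x \<in> verts g" "y \<in> verts g" "f x = f y" for x y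
      by (rule B[THEN conjunct2, THEN bspec, THEN bspec, THEN mp, OF that])
    define c where "c = blk p (Inl (vin g))"
    have root: "blk p x = c" if x: "x \<in> ?V" and qx: "?q x \<in> {vin ?m, vout ?m}" for x
    proof -
      have hx: "?h x \<in> dsum (verts ?g) (verts n)" "?h (Inr (vin n)) \<in> dsum (verts ?g) (verts n)"
          "?h (Inl (vin g)) \<in> dsum (verts ?g) (verts n)"
        using x inV by (auto simp: dsum_def)
      have "glue ?g n (?h x) = glue ?g n (Inr (vin n)) \<or> glue ?g n (?h x) = glue ?g n (Inl (f (vin g)))"
        using qx r(1,2) by auto
      hence "?h x = Inr (vin n) \<or> ?h x = Inl (f (vin g)) \<or> ?h x = Inr (vout n)"
        using glue_kernel[OF wfg hx(1,2)] glue_kernel[OF wfg hx(1,3)] by auto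
      thus ?thesis
      proof (cases x)
        case (Inl v)
        with \<open>?h x = _ \<or> _\<close> have "f v = f (vin g)" by simp
        thus ?thesis unfolding c_def Inl using x Inl inV(1) by (intro B2) auto
      next
        case (Inr v)
        with \<open>?h x = _ \<or> _\<close> have "v = vin n \<or> v = vout n" by simp
        thus ?thesis unfolding c_def Inr using B1 by auto
      qed
    qed
    show "?A p"
    proof (intro ballI impI)
      fix x y assume xy: "x \<in> ?V" "y \<in> ?V" "?q x = ?q y \<or> {?q x, ?q y} \<subseteq> {vin ?m, vout ?m}"
      show "blk p x = blk p y"
      proof (cases "{?q x, ?q y} \<subseteq> {vin ?m, vout ?m}")
        case True
        thus ?thesis using root[OF xy(1)] root[OF xy(2)] by simp
      next
        case False
        hence eq: "?q x = ?q y" using xy(3) by blast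
        have hx: "?h x \<in> dsum (verts ?g) (verts n)" "?h y \<in> dsum (verts ?g) (verts n)"
          using imageI[OF xy(1), of ?h] imageI[OF xy(2), of ?h] unfolding hV gm_map_simps .
        have "?h x = ?h y \<or> {?h x, ?h y} \<subseteq> {Inl (vin ?g), Inr (vout n)}"
          by (rule glue_kernel[OF wfg hx]) (use eq in simp)
        moreover have "\<not> {?h x, ?h y} \<subseteq> {Inl (vin ?g), Inr (vout n)}"
        proof
          assume "{?h x, ?h y} \<subseteq> {Inl (vin ?g), Inr (vout n)}"
          hence "?q x = vout ?m" "?q y = vout ?m" using g(2) by auto
          thus False using False by simp
        qed
        ultimately have "?h x = ?h y" by blast
        thus ?thesis
        proof (cases x)
          case (Inl u)
          then obtain v where v: "y = Inl v" "f u = f v" using \<open>?h x = ?h y\<close> by (cases y) auto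
          have "u \<in> verts g" "v \<in> verts g" using xy(1,2) unfolding Inl v(1) by simp_all
          thus ?thesis unfolding Inl v(1) using v(2) by (rule B2)
        next
          case (Inr u)
          thus ?thesis using \<open>?h x = ?h y\<close> by (cases y) auto
        qed
      qed
    qed
  qed
  have "psi kappa ?m = (\<Sum>p | partition_on ?V p \<and> ?A p.
     weight kappa (map (edge_map (blk p)) (dedges (edgs g) (edgs n))))"
  proof (rule psi_quotient[OF rot gm_wf_mult[OF wfg n]])
    show "verts ?m = ?q ` ?V" unfolding image_comp[symmetric] hV by simp
    show "mset (edgs ?m) = mset (map (edge_map ?q) (dedges (edgs g) (edgs n)))"
      unfolding map_edge_map[symmetric] he by simp
    show "ends (dedges (edgs g) (edgs n)) \<subseteq> ?V"
      using g n by (auto simp: gm_wf_iff dsum_def)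
  qed (use g n in \<open>auto simp: gm_wf_iff\<close>)
  thus ?thesis unfolding cond .
qed

lemma psi_mult:
  assumes rot: "cyclic_invariant kappa" and g: "gm_wf g" "vin g = vout g" and n: "gm_wf n"
  shows "psi kappa (gm_mult g n) =
    (\<Sum>p | partition_on (dsum (verts g) (verts n)) p \<and> roots_eq (vin g) n p.
     weight kappa (map (edge_map (blk p)) (dedges (edgs g) (edgs n))))"
proof -
  have "gm_map (\<lambda>v. v) g = g" using g by (intro gm_map_ident) auto
  thus ?thesis using psi_gm_map_mult[OF rot g n, of "\<lambda>v. v"] by simp
qed

lemma psi_mult_rename:
  assumes rot: "cyclic_invariant kappa" and g: "gm_wf g" "vin g = vout g" and n: "gm_wf n"
    and inj: "inj_on f (verts g)"
  shows "psi kappa (gm_mult (gm_map f g) n) = psi kappa (gm_mult g n)"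
proof -
  have K: "\<forall>x\<in>verts g. \<forall>y\<in>verts g. f x = f y \<longrightarrow> blk p (Inl x) = blk p (Inl y)" for p :: "(nat + nat) set set"
    by (simp add: inj_on_eq_iff[OF inj])
  show ?thesis unfolding psi_gm_map_mult[OF rot g n] psi_mult[OF rot g n]
    by (rule sum.cong[OF Collect_cong refl]) (intro conj_cong refl, use K in blast)
qed

text \<open>As the two left factors have equal roots, all identifications in the iterated product
  take place among four points. The map \<open>h\<close> lets the pieces be bracketed in a different
  order in \<open>V\<close>.\<close>

lemma psi_mult_nested:
  fixes h :: "'v \<Rightarrow> nat + (nat + nat)"
  assumes rot: "cyclic_invariant kappa" and c: "gm_wf c" "vin c = vout c" and d: "gm_wf d" "vin d = vout d"
    and n: "gm_wf n"
    and V: "finite V" "inj_on h V" "h ` V = dsum (verts c) (dsum (verts d) (verts n))"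
    and es: "ends es \<subseteq> V" "mset (map (edge_map h) es) = mset (dedges (edgs c) (dedges (edgs d) (edgs n)))"
    and R: "R \<subseteq> V" "h ` R = {Inl (vin c), Inr (Inl (vin d)), Inr (Inr (vin n)), Inr (Inr (vout n))}"
  shows "psi kappa (gm_mult c (gm_mult d n)) = rooted_sum kappa V es R"
proof (rule psi_rooted_sum[OF rot gm_wf_mult[OF c(1) gm_wf_mult[OF d(1) n]] V(1) _ _ es(1) R(1)])
  let ?m = "gm_mult d n"
  let ?g = "map_sum (\<lambda>v. v) (glue d n) :: nat + (nat + nat) \<Rightarrow> nat + nat"
  let ?q = "glue c ?m \<circ> ?g \<circ> h"
  have "?q ` V = glue c ?m ` ?g ` (h ` V)" by (simp only: image_comp comp_assoc)
  also have "?g ` (h ` V) = dsum (verts c) (verts ?m)"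
    unfolding V(3) dsum_def gm_mult_simps image_Un image_image by simp
  finally show "verts (gm_mult c ?m) = ?q ` V" by simp
  have eg: "map (edge_map ?g) (dedges (edgs c) (dedges (edgs d) (edgs n))) = dedges (edgs c) (edgs ?m)"
  proof -
    have "?g \<circ> Inl = Inl" "?g \<circ> Inr = Inr \<circ> glue d n" by (auto simp: fun_eq_iff)
    thus ?thesis unfolding gm_mult_simps(2) dedges_def[of "edgs c"] map_append map_edge_map by (simp only:)
  qed
  have "mset (map (edge_map ?q) es) = mset (map (edge_map (glue c ?m)) (map (edge_map ?g) (map (edge_map h) es)))"
    by (simp only: map_edge_map comp_assoc)
  also have "\<dots> = image_mset (edge_map (glue c ?m)) (image_mset (edge_map ?g) (mset (map (edge_map h) es)))"
    by (simp only: mset_map)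
  also have "\<dots> = mset (map (edge_map (glue c ?m)) (dedges (edgs c) (edgs ?m)))"
    unfolding es(2) eg[symmetric] by (simp only: mset_map)
  finally show "mset (edgs (gm_mult c ?m)) = mset (map (edge_map ?q) es)" by (simp only: gm_mult_simps(2))
  have "?q ` R = glue c ?m ` ?g ` (h ` R)" by (simp only: image_comp comp_assoc)
  thus "?q ` R = {vin (gm_mult c ?m), vout (gm_mult c ?m)}"
    using c d unfolding R(2) by auto
  fix x y assume xy: "x \<in> V" "y \<in> V" "?q x = ?q y"
  have hz: "h z \<in> dsum (verts c) (dsum (verts d) (verts n))" if "z \<in> V" for z using V(3) that by blast
  have gz: "?g Z \<in> dsum (verts c) (verts ?m)" if "Z \<in> dsum (verts c) (dsum (verts d) (verts n))" for Z
    using that unfolding gm_mult_simps by (cases Z) simp_all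
  have kd: "s = t \<or> s \<in> {Inl (vin d), Inr (vout n)} \<and> t \<in> {Inl (vin d), Inr (vout n)}"
    if "s \<in> dsum (verts d) (verts n)" "t \<in> dsum (verts d) (verts n)" "glue d n s = glue d n t" for s t
    using glue_kernel[OF d(1) that] by blast
  have inR: "z \<in> R" if z: "z \<in> V" "h z \<in> h ` R" for z
  proof -
    obtain u where "u \<in> R" "h z = h u" using z(2) by blast
    thus ?thesis using inj_onD[OF V(2), of z u] z(1) R(1) by blast
  qed
  have root: "z \<in> R" if z: "z \<in> V" "?g (h z) \<in> {Inl (vin c), Inr (vin d)}" for z
  proof (rule inR[OF z(1)])
    show "h z \<in> h ` R"
    proof (cases "h z")
      case (Inl v) thus ?thesis using z(2) unfolding R(2) by simp
    next
      case (Inr s)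
      have "s \<in> dsum (verts d) (verts n)" using hz[OF z(1)] Inr by simp
      moreover have "Inl (vin d) \<in> dsum (verts d) (verts n)" using d by (simp add: gm_wf_iff)
      moreover have "glue d n s = glue d n (Inl (vin d))" using z(2) Inr by simp
      ultimately have "s \<in> {Inl (vin d), Inr (vout n)}" using kd by blast
      thus ?thesis using Inr unfolding R(2) by auto
    qed
  qed
  have "?g (h x) = ?g (h y) \<or> {?g (h x), ?g (h y)} \<subseteq> {Inl (vin c), Inr (vout ?m)}"
    by (rule glue_kernel[OF c(1) gz[OF hz[OF xy(1)]] gz[OF hz[OF xy(2)]]]) (use xy(3) in simp)
  thus "x = y \<or> x \<in> R \<and> y \<in> R"
  proof
    assume e: "?g (h x) = ?g (h y)"
    show ?thesis
    proof (cases "h x")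
      case (Inl v)
      hence "h x = h y" using e by (cases "h y") auto
      thus ?thesis using inj_onD[OF V(2) _ xy(1,2)] by blast
    next
      case (Inr s)
      then obtain t where t: "h y = Inr t" "glue d n s = glue d n t" using e by (cases "h y") auto
      have "s \<in> dsum (verts d) (verts n)" "t \<in> dsum (verts d) (verts n)"
        using hz[OF xy(1)] hz[OF xy(2)] Inr t by simp_all
      from kd[OF this t(2)] show ?thesis
      proof
        assume "s = t"
        hence "h x = h y" using Inr t by simp
        thus ?thesis using inj_onD[OF V(2) _ xy(1,2)] by blast
      next
        assume st: "s \<in> {Inl (vin d), Inr (vout n)} \<and> t \<in> {Inl (vin d), Inr (vout n)}"
        have "h x \<in> h ` R" "h y \<in> h ` R" unfolding R(2) Inr t(1) using st by auto
        thus ?thesis using inR xy(1,2) by blast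
      qed
    qed
  next
    assume "{?g (h x), ?g (h y)} \<subseteq> {Inl (vin c), Inr (vout ?m)}"
    thus ?thesis using root[OF xy(1)] root[OF xy(2)] d(2) by simp
  qed
qed

text \<open>One rooted sum computes all four expressions. Modulo \<open>psi\<close> this gives
  associativity and commutativity for monomials with equal roots, and it turns a monomial whose two
  parts meet only in the root into a product.\<close>

lemma psi_mult_assoc_rooted:
  assumes rot: "cyclic_invariant kappa" and a: "gm_wf a" "vin a = vout a" and b: "gm_wf b" "vin b = vout b"
    and n: "gm_wf n"
  defines "V \<equiv> dsum (dsum (verts a) (verts b)) (verts n)"
    and "es \<equiv> dedges (dedges (edgs a) (edgs b)) (edgs n)"
    and "R \<equiv> {Inl (Inl (vin a)), Inl (Inr (vin b)), Inr (vin n), Inr (vout n)}"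
  shows "psi kappa (gm_mult (gm_mult a b) n) = rooted_sum kappa V es R"
    and "psi kappa (gm_mult a (gm_mult b n)) = rooted_sum kappa V es R"
    and "psi kappa (gm_mult b (gm_mult a n)) = rooted_sum kappa V es R"
    and "\<And>g. gm_wf g \<Longrightarrow> vin g = vin a \<Longrightarrow> vout g = vin a \<Longrightarrow> vin b = vin a \<Longrightarrow>
      verts g = verts a \<union> verts b \<Longrightarrow> verts a \<inter> verts b = {vin a} \<Longrightarrow>
      mset (edgs g) = mset (edgs a @ edgs b) \<Longrightarrow> psi kappa (gm_mult g n) = rooted_sum kappa V es R"
proof -
  have V: "finite V" using a b n by (simp add: V_def gm_wf_iff)
  have es: "ends es \<subseteq> V" unfolding es_def V_def ends_dedges using a b n by (intro dsum_mono) (auto simp: gm_wf_iff)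
  have R: "R \<subseteq> V" using a b n by (auto simp: R_def V_def gm_wf_iff)
  have Vc: "(\<exists>v\<in>verts a. x = Inl (Inl v)) \<or> (\<exists>v\<in>verts b. x = Inl (Inr v)) \<or> (\<exists>v\<in>verts n. x = Inr v)" if "x \<in> V" for x
    using that by (auto simp: V_def dsum_def)
  have ab: "gm_wf (gm_mult a b)" "gm_wf (gm_mult b n)" "gm_wf (gm_mult a n)" using a b n by (auto intro: gm_wf_mult)
  show "psi kappa (gm_mult (gm_mult a b) n) = rooted_sum kappa V es R"
  proof (rule psi_rooted_sum[OF rot gm_wf_mult[OF ab(1) n] V _ _ es R])
    let ?h = "map_sum (glue a b) (\<lambda>v. v)"
    let ?q = "glue (gm_mult a b) n \<circ> ?h"
    show "verts (gm_mult (gm_mult a b) n) = ?q ` V"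
      by (simp add: V_def dsum_def image_Un image_image)
    have "edge_map (?h \<circ> Inl) e = edge_map (Inl \<circ> glue a b) e" "edge_map (?h \<circ> Inr) e' = edge_map Inr e'"
      for e e' by (auto simp: edge_map_def split: prod.splits)
    hence "map (edge_map ?h) es = dedges (edgs (gm_mult a b)) (edgs n)"
      by (simp add: es_def dedges_def o_def)
    thus "mset (edgs (gm_mult (gm_mult a b) n)) = mset (map (edge_map ?q) es)"
      unfolding map_edge_map[symmetric] by simp
    show "?q ` R = {vin (gm_mult (gm_mult a b) n), vout (gm_mult (gm_mult a b) n)}"
      using a b by (auto simp: R_def)
    fix x y assume xy: "x \<in> V" "y \<in> V" "?q x = ?q y"
    have hz: "?h z \<in> dsum (verts (gm_mult a b)) (verts n)" if "z \<in> V" for z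
      using Vc[OF that] by (elim disjE bexE) (simp_all del: glue_simps)
    note h = hz[OF xy(1)] hz[OF xy(2)]
    have inR: "z \<in> R" if "z \<in> V" "?h z \<in> {Inl (vin (gm_mult a b)), Inr (vout n)}" for z
      using Vc[OF that(1)]
    proof (elim disjE bexE)
      fix v assume v: "v \<in> verts a" "z = Inl (Inl v)"
      thus ?thesis using that(2) b by (simp add: R_def)
    next
      fix v assume v: "v \<in> verts b" "z = Inl (Inr v)"
      hence "glue a b (Inr v) = glue a b (Inr (vin b))" using that(2) by simp
      from glue_kernel[OF a(1) _ _ this] show ?thesis using v b by (auto simp: R_def gm_wf_iff)
    next
      fix v assume v: "v \<in> verts n" "z = Inr v"
      thus ?thesis using that(2) by (simp add: R_def)
    qed
    have "?h x = ?h y \<or> {?h x, ?h y} \<subseteq> {Inl (vin (gm_mult a b)), Inr (vout n)}"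
      by (rule glue_kernel[OF ab(1) h]) (use xy(3) in simp)
    thus "x = y \<or> x \<in> R \<and> y \<in> R"
    proof
      assume e: "?h x = ?h y"
      show ?thesis
      proof (cases x)
        case (Inr v) thus ?thesis using e by (cases y) auto
      next
        case (Inl u)
        then obtain u' where y: "y = Inl u'" using e by (cases y) auto
        have "u \<in> dsum (verts a) (verts b)" "u' \<in> dsum (verts a) (verts b)" "glue a b u = glue a b u'"
          using xy(1,2) Inl y e by (auto simp: V_def)
        from glue_kernel[OF a(1) this] show ?thesis using Inl y b by (auto simp: R_def)
      qed
    qed (use inR xy in blast)
  qed
  show "psi kappa (gm_mult a (gm_mult b n)) = rooted_sum kappa V es R"
  proof (rule psi_mult_nested[OF rot a b n V _ _ es _ R])
    let ?h = "case_sum (case_sum Inl (\<lambda>v. Inr (Inl v))) (\<lambda>v. Inr (Inr v)) :: (nat + nat) + nat \<Rightarrow> nat + (nat + nat)"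
    show "inj_on ?h V" by (auto simp: inj_on_def split: sum.splits)
    show "?h ` V = dsum (verts a) (dsum (verts b) (verts n))"
      unfolding V_def dsum_def image_Un image_image Un_assoc by simp
    have "?h \<circ> Inl \<circ> Inl = Inl" "?h \<circ> Inl \<circ> Inr = Inr \<circ> Inl" "?h \<circ> Inr = Inr \<circ> Inr"
      by (auto simp: fun_eq_iff)
    thus "mset (map (edge_map ?h) es) = mset (dedges (edgs a) (dedges (edgs b) (edgs n)))"
      unfolding es_def dedges_def map_append map_edge_map comp_assoc by simp
    show "?h ` R = {Inl (vin a), Inr (Inl (vin b)), Inr (Inr (vin n)), Inr (Inr (vout n))}"
      by (simp add: R_def)
  qed
  show "psi kappa (gm_mult b (gm_mult a n)) = rooted_sum kappa V es R"
  proof (rule psi_mult_nested[OF rot b a n V _ _ es _ R])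
    let ?h = "case_sum (case_sum (\<lambda>v. Inr (Inl v)) Inl) (\<lambda>v. Inr (Inr v)) :: (nat + nat) + nat \<Rightarrow> nat + (nat + nat)"
    show "inj_on ?h V" by (auto simp: inj_on_def split: sum.splits)
    show "?h ` V = dsum (verts b) (dsum (verts a) (verts n))"
      unfolding V_def dsum_def image_Un image_image by auto
    have "?h \<circ> Inl \<circ> Inl = Inr \<circ> Inl" "?h \<circ> Inl \<circ> Inr = Inl" "?h \<circ> Inr = Inr \<circ> Inr"
      by (auto simp: fun_eq_iff)
    thus "mset (map (edge_map ?h) es) = mset (dedges (edgs b) (dedges (edgs a) (edgs n)))"
      unfolding es_def dedges_def map_append map_edge_map comp_assoc by simp
    show "?h ` R = {Inl (vin b), Inr (Inl (vin a)), Inr (Inr (vin n)), Inr (Inr (vout n))}"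
      by (auto simp: R_def)
  qed
  fix g assume g: "gm_wf g" "vin g = vin a" "vout g = vin a" "vin b = vin a" "verts g = verts a \<union> verts b"
    "verts a \<inter> verts b = {vin a}" "mset (edgs g) = mset (edgs a @ edgs b)"
  show "psi kappa (gm_mult g n) = rooted_sum kappa V es R"
  proof (rule psi_rooted_sum[OF rot gm_wf_mult[OF g(1) n] V _ _ es R])
    let ?h = "map_sum (case_sum (\<lambda>v. v) (\<lambda>v. v)) (\<lambda>v. v)"
    let ?q = "glue g n \<circ> ?h"
    show "verts (gm_mult g n) = ?q ` V"
      unfolding gm_mult_simps g(5) by (simp add: V_def dsum_def image_Un image_image del: glue_simps)
    have "map (edge_map ?h) es = dedges (edgs a @ edgs b) (edgs n)"
      by (simp add: es_def dedges_def) (simp add: o_def)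
    moreover have "mset (dedges (edgs g) (edgs n)) = mset (dedges (edgs a @ edgs b) (edgs n))"
      using g(7) by (simp add: dedges_def)
    ultimately have "mset (map (edge_map (glue g n)) (map (edge_map ?h) es)) =
        mset (map (edge_map (glue g n)) (dedges (edgs g) (edgs n)))"
      by (simp only: mset_map)
    thus "mset (edgs (gm_mult g n)) = mset (map (edge_map ?q) es)"
      unfolding map_edge_map[symmetric] by simp
    show "?q ` R = {vin (gm_mult g n), vout (gm_mult g n)}"
      using g by (auto simp: R_def)
    fix x y assume xy: "x \<in> V" "y \<in> V" "?q x = ?q y"
    have h: "?h z \<in> dsum (verts g) (verts n)" if "z \<in> V" for z
      using Vc[OF that] g(5) by auto
    have "?h x = ?h y \<or> {?h x, ?h y} \<subseteq> {Inl (vin g), Inr (vout n)}"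
      by (rule glue_kernel[OF g(1) h[OF xy(1)] h[OF xy(2)]]) (use xy(3) in simp)
    moreover have "z \<in> R" if "z \<in> V" "?h z \<in> {Inl (vin g), Inr (vout n)}" for z
      using Vc[OF that(1)] that(2) g(2,4) by (elim disjE bexE) (auto simp: R_def)
    moreover have "x = y \<or> x \<in> R \<and> y \<in> R" if "?h x = ?h y"
      using Vc[OF xy(1)] Vc[OF xy(2)] that g(4,6) by (elim disjE bexE) (auto simp: R_def)
    ultimately show "x = y \<or> x \<in> R \<and> y \<in> R" using xy(1,2) by blast
  qed
qed

section \<open>Pairing with monomials\<close>

text \<open>The functional on monomials induced by a formal combination; by bilinearity, equal
  functionals mean equivalence modulo \<open>psi\<close>.\<close>

definition pairing :: "('a list \<Rightarrow> complex) \<Rightarrow> 'a fcomb \<Rightarrow> 'a gmon \<Rightarrow> complex" where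
  "pairing kappa s n = (\<Sum>(c, m)\<leftarrow>s. c * psi kappa (gm_mult m n))"

lemma pairing_simps [simp]:
  "pairing kappa [] n = 0" "pairing kappa ((c, m) # s) n = c * psi kappa (gm_mult m n) + pairing kappa s n"
  "pairing kappa (s @ t) n = pairing kappa s n + pairing kappa t n"
  by (simp_all add: pairing_def)

lemma pairing_scale: "pairing kappa (fc_scale c s) n = c * pairing kappa s n"
  by (induction s) (auto simp: fc_scale_def algebra_simps)

lemma fc_psi_mult: "fc_psi kappa (fc_mult s u) = (\<Sum>(d, n)\<leftarrow>u. d * pairing kappa s n)"
proof (induction s)
  case Nil
  show ?case by (induction u) (auto simp: fc_psi_def fc_mult_def)
next
  case (Cons x s)
  obtain c m where x: "x = (c, m)" by (cases x)
  have "fc_psi kappa (fc_mult (x # s) u) = (\<Sum>(d, n)\<leftarrow>u. c * d * psi kappa (gm_mult m n)) + fc_psi kappa (fc_mult s u)"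
    by (simp add: fc_psi_def fc_mult_def x o_def split_def)
  also have "\<dots> = (\<Sum>(d, n)\<leftarrow>u. d * pairing kappa (x # s) n)"
    unfolding Cons.IH by (induction u) (auto simp: x algebra_simps)
  finally show ?case .
qed

lemma fc_equivI:
  assumes "\<And>n. gm_wf n \<Longrightarrow> pairing kappa x n = pairing kappa y n"
  shows "fc_equiv kappa x y"
  unfolding fc_equiv_def
proof (intro allI impI)
  fix u :: "'a fcomb" assume u: "fc_wf u"
  have "pairing kappa (fc_add x (fc_scale (- 1) y)) n = 0" if "gm_wf n" for n
    using assms[OF that] by (simp add: fc_add_def pairing_scale)
  with u show "fc_psi kappa (fc_mult (fc_add x (fc_scale (- 1) y)) u) = 0"
    unfolding fc_psi_mult by (induction u) (auto simp: fc_wf_def)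
qed

lemma pairing_mult:
  "pairing kappa (fc_mult s u) n = (\<Sum>(c, m)\<leftarrow>s. c * (\<Sum>(d, k)\<leftarrow>u. d * psi kappa (gm_mult (gm_mult m k) n)))"
proof (induction s)
  case (Cons x s)
  obtain c m where x: "x = (c, m)" by (cases x)
  have "pairing kappa (fc_mult (x # s) u) n =
      pairing kappa (map (\<lambda>(d, k). (c * d, gm_mult m k)) u) n + pairing kappa (fc_mult s u) n"
    by (simp add: fc_mult_def x)
  also have "pairing kappa (map (\<lambda>(d, k). (c * d, gm_mult m k)) u) n = c * (\<Sum>(d, k)\<leftarrow>u. d * psi kappa (gm_mult (gm_mult m k) n))"
    by (induction u) (auto simp: algebra_simps)
  finally show ?case using Cons.IH x by simp
qed (simp add: fc_mult_def)

lemma gm_quot_eq: "gm_quot p t = gm_map (block_rep p) t"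
  by (simp add: gm_quot_def)

lemma list_of_finset:
  assumes "finite S"
  shows "distinct (list_of_finset S)" "set (list_of_finset S) = S"
proof -
  have "\<exists>xs. distinct xs \<and> set xs = S" using finite_distinct_list[OF assms] by blast
  from someI_ex[OF this] show "distinct (list_of_finset S)" "set (list_of_finset S) = S"
    unfolding list_of_finset_def by auto
qed

lemma gm_wf_unit: "gm_wf gm_unit"
  by (simp add: gm_wf_iff gm_unit_def edges_connected_def)

text \<open>Quotients and products of monomials with equal roots again have equal roots. The
  inclusion holds on the level of formal combinations and settles one half of the theorem.\<close>

lemma Delta_Q_subset_Delta_B: "Delta_Q sc \<subseteq> Delta_B"
proof
  fix x assume "x \<in> Delta_Q sc"
  thus "x \<in> Delta_B"
  proof induction
    case unit
    show ?case using gm_wf_unit by (simp add: Delta_B_def fc_unit_def) (simp add: gm_unit_def)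
  next
    case (gen t)
    hence t: "gm_wf t" "vin t = vout t" by (auto simp: in_D_def)
    have "gm_wf (gm_quot p t) \<and> vin (gm_quot p t) = vout (gm_quot p t)" for p
      using t by (simp add: gm_quot_eq gm_wf_map)
    thus ?case by (auto simp: Delta_B_def Q_elem_def)
  next
    case (add s u) thus ?case by (auto simp: Delta_B_def fc_add_def)
  next
    case (scale s c) thus ?case by (auto simp: Delta_B_def fc_scale_def)
  next
    case (mult s u)
    have "gm_wf (gm_mult m k) \<and> vin (gm_mult m k) = vout (gm_mult m k)"
      if "gm_wf m \<and> vin m = vout m" "gm_wf k \<and> vin k = vout k" for m k :: "'a gmon"
      using that gm_wf_mult[of m k] by simp
    thus ?case using mult.IH unfolding Delta_B_def fc_mult_def by fastforce
  qed
qed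

text \<open>The value of \<open>Q(g)\<close> paired with \<open>n\<close>, by Moebius inversion.\<close>

definition separated_sum :: "('a list \<Rightarrow> complex) \<Rightarrow> 'a gmon \<Rightarrow> 'a gmon \<Rightarrow> complex" where
  "separated_sum kappa g n =
    (\<Sum>p | partition_on (dsum (verts g) (verts n)) p \<and> roots_eq (vin g) n p \<and> inj_on (blk p \<circ> Inl) (verts g).
     weight kappa (map (edge_map (blk p)) (dedges (edgs g) (edgs n))))"

text \<open>After exchanging the sums, a partition of the disjoint union carries as coefficient the
  Moebius sum over all partitions finer than the one it induces on the vertices of \<open>g\<close>.
  This is 1 if these vertices are kept apart and 0 otherwise.\<close>

lemma sum_mobius0_psi:
  assumes rot: "cyclic_invariant kappa" and g: "gm_wf g" "vin g = vout g" and n: "gm_wf n"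
  shows "(\<Sum>p | partition_on (verts g) p. mobius0 p * psi kappa (gm_mult (gm_quot p g) n)) = separated_sum kappa g n"
proof -
  let ?V = "dsum (verts g) (verts n)"
  let ?A = "{p. partition_on ?V p \<and> roots_eq (vin g) n p}"
  let ?w = "\<lambda>p. weight kappa (map (edge_map (blk p)) (dedges (edgs g) (edgs n)))"
  have fg: "finite (verts g)" and fV: "finite ?V" using g n by (auto simp: gm_wf_iff)
  have fA: "finite ?A" by (rule finite_partitions[OF fV])
  let ?K = "\<lambda>p f. \<forall>B\<in>p. \<forall>x\<in>B. \<forall>y\<in>B. f x = f y"
  have K: "(\<forall>x\<in>verts g. \<forall>y\<in>verts g. block_rep p x = block_rep p y \<longrightarrow> f x = f y) \<longleftrightarrow> ?K p f"
    if p: "partition_on (verts g) p" for p and f :: "nat \<Rightarrow> (nat + nat) set"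
  proof
    assume h: "\<forall>x\<in>verts g. \<forall>y\<in>verts g. block_rep p x = block_rep p y \<longrightarrow> f x = f y"
    show "?K p f"
    proof (intro ballI)
      fix B x y assume B: "B \<in> p" "x \<in> B" "y \<in> B"
      hence v: "x \<in> verts g" "y \<in> verts g" using partition_onD1[OF p] by auto
      have "block_rep p x = block_rep p y"
        using block_rep_eq_iff[OF p fg v] blk_eq[OF p B(1,2)] blk_eq[OF p B(1,3)] by simp
      thus "f x = f y" by (rule h[THEN bspec[OF _ v(1)], THEN bspec[OF _ v(2)], THEN mp])
    qed
  next
    assume h: "?K p f"
    show "\<forall>x\<in>verts g. \<forall>y\<in>verts g. block_rep p x = block_rep p y \<longrightarrow> f x = f y"
    proof (intro ballI impI)
      fix x y assume v: "x \<in> verts g" "y \<in> verts g" "block_rep p x = block_rep p y"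
      hence e: "blk p x = blk p y" using block_rep_eq_iff[OF p fg v(1,2)] by simp
      have "blk p x \<in> p" "x \<in> blk p x" "y \<in> blk p x" using blk[OF p v(1)] blk[OF p v(2)] e by auto
      thus "f x = f y" using h by blast
    qed
  qed
  have psi: "psi kappa (gm_mult (gm_quot p g) n) = (\<Sum>\<pi>\<in>?A. if ?K p (blk \<pi> \<circ> Inl) then ?w \<pi> else 0)"
    if p: "partition_on (verts g) p" for p
  proof -
    have "psi kappa (gm_mult (gm_quot p g) n) = (\<Sum>\<pi> | \<pi> \<in> ?A \<and> ?K p (blk \<pi> \<circ> Inl). ?w \<pi>)"
      unfolding gm_quot_eq psi_gm_map_mult[OF rot g n] K[OF p, symmetric]
      by (rule sum.cong[OF Collect_cong refl]) simp
    thus ?thesis using fA by (simp only: sum.inter_filter)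
  qed
  have "(\<Sum>p | partition_on (verts g) p. mobius0 p * psi kappa (gm_mult (gm_quot p g) n)) =
     (\<Sum>p | partition_on (verts g) p. \<Sum>\<pi>\<in>?A. if ?K p (blk \<pi> \<circ> Inl) then mobius0 p * ?w \<pi> else 0)"
    by (intro sum.cong refl) (simp add: psi sum_distrib_left if_distrib cong: if_cong del: o_apply)
  also have "\<dots> = (\<Sum>\<pi>\<in>?A. \<Sum>p | partition_on (verts g) p. if ?K p (blk \<pi> \<circ> Inl) then mobius0 p * ?w \<pi> else 0)"
    by (rule sum.swap)
  also have "\<dots> = (\<Sum>\<pi>\<in>?A. if inj_on (blk \<pi> \<circ> Inl) (verts g) then ?w \<pi> else 0)"
  proof (intro sum.cong refl)
    fix \<pi> :: "(nat + nat) set set"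
    let ?f = "blk \<pi> \<circ> Inl"
    have "(\<Sum>p | partition_on (verts g) p. if ?K p ?f then mobius0 p * ?w \<pi> else 0) =
       (\<Sum>p | p \<in> {p. partition_on (verts g) p} \<and> ?K p ?f. mobius0 p * ?w \<pi>)"
      using finitely_many_partition_on[OF fg] by (subst sum.inter_filter) auto
    also have "\<dots> = (\<Sum>p | partition_on (verts g) p \<and> ?K p ?f. mobius0 p) * ?w \<pi>"
      by (simp only: mem_Collect_eq sum_distrib_right)
    also have "\<dots> = (if inj_on ?f (verts g) then ?w \<pi> else 0)"
      unfolding sum_mobius0[OF fg]
      by (cases "inj_on ?f (verts g)") (simp_all only: if_True if_False mult_1 mult_zero_left)
    finally show "(\<Sum>p | partition_on (verts g) p. if ?K p ?f then mobius0 p * ?w \<pi> else 0) = \<dots>" .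
  qed
  also have "\<dots> = (\<Sum>\<pi> | \<pi> \<in> ?A \<and> inj_on (blk \<pi> \<circ> Inl) (verts g). ?w \<pi>)"
    using fA by (simp only: sum.inter_filter)
  finally show ?thesis unfolding separated_sum_def by (simp only: mem_Collect_eq conj_assoc)
qed

lemma pairing_Q_elem:
  assumes rot: "cyclic_invariant kappa" and g: "gm_wf g" "vin g = vout g" and n: "gm_wf n"
  shows "pairing kappa (Q_elem g) n = separated_sum kappa g n"
proof -
  let ?S = "set_partitions (verts g)"
  have S: "?S = {p. partition_on (verts g) p}" by (simp add: set_partitions_def)
  have fin: "finite ?S" unfolding S using g by (intro finitely_many_partition_on) (simp add: gm_wf_iff)
  have "pairing kappa (Q_elem g) n = (\<Sum>p\<leftarrow>list_of_finset ?S. mobius0 p * psi kappa (gm_mult (gm_quot p g) n))"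
    by (simp add: pairing_def Q_elem_def o_def)
  also have "\<dots> = (\<Sum>p\<in>?S. mobius0 p * psi kappa (gm_mult (gm_quot p g) n))"
    using list_of_finset[OF fin] by (simp add: sum_list_distinct_conv_sum_set)
  finally show ?thesis unfolding S using sum_mobius0_psi[OF rot g n] by simp
qed

text \<open>The leading term of \<open>Q_elem g\<close>. Representatives of blocks are minima, so
  the finest quotient is equal to \<open>g\<close> and not merely isomorphic to it.\<close>

lemma gm_quot_singletons:
  assumes "gm_wf g"
  shows "gm_quot ((\<lambda>v. {v}) ` verts g) g = g" "mobius0 ((\<lambda>v. {v}) ` verts g) = 1"
proof -
  have p: "partition_on (verts g) ((\<lambda>v. {v}) ` verts g)" by (rule partition_on_singletons)
  have "block_rep ((\<lambda>v. {v}) ` verts g) v = v" if "v \<in> verts g" for v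
  proof -
    have "blk ((\<lambda>v. {v}) ` verts g) v = {v}" by (rule blk_eq[OF p]) (use that in auto)
    thus ?thesis by (simp add: block_rep_def blk_def)
  qed
  thus "gm_quot ((\<lambda>v. {v}) ` verts g) g = g" unfolding gm_quot_eq by (rule gm_map_ident[OF assms])
  show "mobius0 ((\<lambda>v. {v}) ` verts g) = 1" unfolding mobius0_def by (rule prod.neutral) auto
qed

lemma card_verts_gm_quot:
  assumes g: "gm_wf g" and p: "partition_on (verts g) p" and ne: "p \<noteq> (\<lambda>v. {v}) ` verts g"
  shows "card (verts (gm_quot p g)) < card (verts g)"
proof -
  have fin: "finite (verts g)" using g by (simp add: gm_wf_iff)
  have "\<not> inj_on (block_rep p) (verts g)"
  proof
    assume inj: "inj_on (block_rep p) (verts g)"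
    have "B \<in> (\<lambda>v. {v}) ` verts g \<longleftrightarrow> B \<in> p" for B
    proof -
      have bl: "blk p v = {v}" if v: "v \<in> verts g" for v
      proof -
        have b: "blk p v \<in> p" "v \<in> blk p v" using blk[OF p v] by auto
        have "u = v" if u: "u \<in> blk p v" for u
        proof -
          have uv: "u \<in> verts g" using u b(1) partition_onD1[OF p] by blast
          have "block_rep p u = block_rep p v"
            using block_rep_eq_iff[OF p fin uv v] blk_eq[OF p b(1) u] by simp
          thus ?thesis using inj uv v by (simp add: inj_on_eq_iff)
        qed
        thus ?thesis using b by blast
      qed
      hence "blk p ` verts g = (\<lambda>v. {v}) ` verts g" by (intro image_cong) auto
      thus ?thesis using blk_image[OF p] by simp
    qed
    thus False using ne by blast
  qed
  hence "card (block_rep p ` verts g) \<noteq> card (verts g)" using eq_card_imp_inj_on[OF fin] by blast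
  moreover have "card (block_rep p ` verts g) \<le> card (verts g)" by (rule card_image_le[OF fin])
  ultimately show ?thesis by (simp add: gm_quot_eq)
qed

section \<open>Cutting off a cycle\<close>

lemma mset_nths_compl: "mset (nths xs I) + mset (nths xs (- I)) = mset xs"
proof (induction xs arbitrary: I)
  case (Cons x xs)
  have "{i. Suc i \<in> - I} = - {i. Suc i \<in> I}" by auto
  thus ?case using Cons[of "{i. Suc i \<in> I}"] by (simp add: nths_Cons)
qed simp

text \<open>A test function on \<open>V1\<close> is extended to the other part by its value at
  \<open>r\<close>; there it is constant, so it remains constant along all edges.\<close>

lemma edges_connected_wedge:
  fixes V1 V2 :: "'v set"
  assumes c: "edges_connected V es" and V: "V1 \<subseteq> V" and r: "V1 \<inter> V2 \<subseteq> {r}"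
    and es: "set es \<subseteq> set es1 \<union> set es2" and e2: "ends es2 \<subseteq> V2" and e1: "ends es1 \<subseteq> V1"
  shows "edges_connected V1 es1"
  unfolding edges_connected_def
proof (intro allI impI ballI)
  fix X :: "'v \<Rightarrow> bool" and u v
  assume X: "\<forall>e\<in>set es1. X (fst e) = X (fst (snd e))" and uv: "u \<in> V1" "v \<in> V1"
  let ?X = "\<lambda>v. if v \<in> V1 then X v else X r"
  have "?X (fst e) = ?X (fst (snd e))" if e: "e \<in> set es" for e
  proof (cases "e \<in> set es1")
    case True
    thus ?thesis using X ends_in[OF True] e1 by auto
  next
    case False
    hence "e \<in> set es2" using e es by blast
    hence "fst e \<in> V2" "fst (snd e) \<in> V2" using ends_in[of e es2] e2 by auto
    moreover have "?X v = X r" if "v \<in> V2" for v using r that by auto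
    ultimately show ?thesis by simp
  qed
  hence "?X u = ?X v" using c[unfolded edges_connected_def, THEN spec, of ?X] uv V by blast
  thus "X u = X v" using uv by simp
qed

definition component :: "('v \<times> 'v \<times> 'a) list \<Rightarrow> nat set \<Rightarrow> 'v \<Rightarrow> 'v \<Rightarrow> bool" where
  "component es F = (undirected_adj F (\<lambda>i. fst (es ! i)) (\<lambda>i. fst (snd (es ! i))))\<^sup>*\<^sup>*"

lemma component_refl [simp]: "component es F x x"
  by (simp add: component_def)

lemma component_edge:
  assumes "i \<in> F"
  shows "component es F x (fst (es ! i)) \<longleftrightarrow> component es F x (fst (snd (es ! i)))"
    and "component es F (fst (es ! i)) x \<longleftrightarrow> component es F (fst (snd (es ! i))) x"
proof -
  let ?A = "undirected_adj F (\<lambda>i. fst (es ! i)) (\<lambda>i. fst (snd (es ! i)))"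
  have a: "?A (fst (es ! i)) (fst (snd (es ! i)))" "?A (fst (snd (es ! i))) (fst (es ! i))"
    using assms unfolding undirected_adj_def by (auto simp: insert_commute)
  show "component es F x (fst (es ! i)) \<longleftrightarrow> component es F x (fst (snd (es ! i)))"
    using a unfolding component_def by (meson rtranclp.rtrancl_into_rtrancl)
  show "component es F (fst (es ! i)) x \<longleftrightarrow> component es F (fst (snd (es ! i))) x"
    using a unfolding component_def by (meson converse_rtranclp_into_rtranclp)
qed

lemma component_const:
  assumes "component es F x y" "\<And>i. i \<in> F \<Longrightarrow> X (fst (es ! i)) = X (fst (snd (es ! i)))"
  shows "X x = X y"
  using assms(1) unfolding component_def
proof induction
  case (step y z)
  then obtain i where "i \<in> F" "{fst (es ! i), fst (snd (es ! i))} = {y, z}" by (auto simp: undirected_adj_def)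
  hence "X y = X z" using assms(2)[of i] by (auto simp: doubleton_eq_iff)
  thus ?case using step.IH by simp
qed simp

lemma component_sym: "component es F x y \<Longrightarrow> component es F y x"
  using component_const[of es F x y "\<lambda>z. component es F z x"] component_edge(2)[of _ F es x] by simp

lemma component_trans: "component es F x y \<Longrightarrow> component es F y z \<Longrightarrow> component es F x z"
  unfolding component_def by (rule rtranclp_trans)

lemma closed_listing_sources:
  assumes "closed_listing s t C es"
  shows "s ` C \<subseteq> t ` C"
proof -
  have w: "walk s t x es y \<Longrightarrow> s ` set es \<subseteq> insert y (t ` set es)" for x y es
  proof (induction es arbitrary: x)
    case (Cons e es)
    thus ?case by (cases es) auto
  qed simp
  obtain x where x: "walk s t x es x" "es \<noteq> []" "set es = C" using assms by (auto simp: closed_listing_def)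
  have "x \<in> t ` set es" using x by (cases es) auto
  thus ?thesis using w[OF x(1)] x(3) by auto
qed

lemma nth_dedges_Inl: "i < length es \<Longrightarrow> dedges es fs ! i = edge_map Inl (es ! i)"
  by (simp add: dedges_def nth_append)

text \<open>A simple cycle of \<open>g\<close> whose vertices are kept apart must become a pad, and a pad of a cactus
  can be cut between any two of its vertices without touching another edge.\<close>

lemma separating_cut:
  fixes p :: "('u + 'v) set set"
  assumes w: "weight kappa (map (edge_map (blk p)) (dedges es fs)) \<noteq> 0"
    and C: "simple_cycle (\<lambda>i. fst (es ! i)) (\<lambda>i. fst (snd (es ! i))) C" "C \<subseteq> {..<length es}"
    and inj: "inj_on (blk p \<circ> Inl) (ends es)"
    and c: "c \<in> (\<lambda>i. fst (es ! i)) ` C \<union> (\<lambda>i. fst (snd (es ! i))) ` C"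
      "c' \<in> (\<lambda>i. fst (es ! i)) ` C \<union> (\<lambda>i. fst (snd (es ! i))) ` C" "c \<noteq> c'"
  obtains Y :: "('u + 'v) set \<Rightarrow> bool" where "Y (blk p (Inl c)) \<noteq> Y (blk p (Inl c'))"
    "\<And>i. i < length es \<Longrightarrow> i \<notin> C \<Longrightarrow> Y (blk p (Inl (fst (es ! i)))) = Y (blk p (Inl (fst (snd (es ! i)))))"
    "\<And>e. e \<in> set fs \<Longrightarrow> Y (blk p (Inr (fst e))) = Y (blk p (Inr (fst (snd e))))"
proof -
  let ?L = "map (edge_map (blk p)) (dedges es fs)"
  let ?s = "\<lambda>i. fst (?L ! i)" and ?t = "\<lambda>i. fst (snd (?L ! i))"
  let ?sa = "\<lambda>i. fst (es ! i)" and ?ta = "\<lambda>i. fst (snd (es ! i))"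
  have len: "length (dedges es fs) = length es + length fs" by (simp add: dedges_def)
  have L: "?s i = (blk p \<circ> Inl) (?sa i) \<and> ?t i = (blk p \<circ> Inl) (?ta i)" if "i < length es" for i
    using that len by (simp add: nth_dedges_Inl)
  have LC: "?s i = (blk p \<circ> Inl) (?sa i) \<and> ?t i = (blk p \<circ> Inl) (?ta i)" if "i \<in> C" for i
    using that C(2) by (intro L) auto
  obtain P where P: "pad_system {..<length ?L} ?s ?t P"
    using w unfolding weight_def cactus_weight_def by (auto split: if_splits)
  have VE: "?sa ` C \<union> ?ta ` C \<subseteq> ends es"
  proof -
    have "?sa i \<in> ends es \<and> ?ta i \<in> ends es" if "i \<in> C" for i
      using ends_in[OF nth_mem[of i es]] C(2) that by blast
    thus ?thesis by blast
  qed
  have sc: "simple_cycle ((blk p \<circ> Inl) \<circ> ?sa) ((blk p \<circ> Inl) \<circ> ?ta) C"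
    by (rule simple_cycle_map[OF C(1) inj_on_subset[OF inj VE]])
  have "simple_cycle ?s ?t C"
  proof (rule simple_cycle_cong[OF sc])
    fix i assume "i \<in> C"
    from LC[OF this] show "?s i = (blk p \<circ> Inl \<circ> ?sa) i \<and> ?t i = (blk p \<circ> Inl \<circ> ?ta) i" by simp
  qed
  moreover have "C \<subseteq> {..<length ?L}" using C(2) len by auto
  ultimately have CP: "C \<in> P" using simple_cycle_in_pad_system[OF P] by blast
  obtain es' where es': "closed_listing ?s ?t C es'" using pad_systemD(4)[OF P CP] by blast
  have tgt: "\<exists>i\<in>C. ?t i = blk p (Inl c)" if "c \<in> ?sa ` C \<union> ?ta ` C" for c
  proof -
    have "blk p (Inl c) \<in> ?s ` C \<union> ?t ` C"
    proof -
      from that obtain i where "i \<in> C" "c = ?sa i \<or> c = ?ta i" by blast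
      thus ?thesis using LC[of i] by (auto simp: image_iff)
    qed
    hence "blk p (Inl c) \<in> ?t ` C" using closed_listing_sources[OF es'] by blast
    then obtain i where "i \<in> C" "blk p (Inl c) = ?t i" by (rule imageE)
    from this(1) this(2)[symmetric] show ?thesis by (rule bexI[rotated])
  qed
  obtain e f where e: "e \<in> C" "?t e = blk p (Inl c)" and f: "f \<in> C" "?t f = blk p (Inl c')"
    using tgt[OF c(1)] tgt[OF c(2)] by blast
  have "blk p (Inl c) \<noteq> blk p (Inl c')"
  proof
    assume "blk p (Inl c) = blk p (Inl c')"
    hence "(blk p \<circ> Inl) c = (blk p \<circ> Inl) c'" by simp
    moreover have "c \<in> ends es" "c' \<in> ends es" using c(1,2) VE by blast+
    ultimately show False using inj_onD[OF inj] c(3) by blast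
  qed
  hence ef: "e \<noteq> f" using e(2) f(2) by auto
  obtain Y where Y: "crossing {..<length ?L} ?s ?t Y = {e, f}" using pad_systemD(5)[OF P CP e(1) f(1) ef] by blast
  have const: "Y (?s i) = Y (?t i)" if "i < length ?L" "i \<notin> C" for i
  proof -
    have "i \<notin> crossing {..<length ?L} ?s ?t Y" unfolding Y using that e f by auto
    thus ?thesis using that(1) unfolding crossing_def by blast
  qed
  show thesis
  proof (rule that)
    show "Y (blk p (Inl c)) \<noteq> Y (blk p (Inl c'))"
      using pad_system_crossing_opposite(1)[OF P CP e(1) f(1) ef Y] e(2) f(2) by simp
    show "Y (blk p (Inl (?sa i))) = Y (blk p (Inl (?ta i)))" if "i < length es" "i \<notin> C" for i
      using const[of i] L[OF that(1)] that len by simp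
    show "Y (blk p (Inr (fst e))) = Y (blk p (Inr (fst (snd e))))" if e: "e \<in> set fs" for e
    proof -
      obtain j where j: "j < length fs" "e = fs ! j" using e by (metis in_set_conv_nth)
      have "length es + j \<notin> C" using C(2) by auto
      moreover have "length es + j < length ?L" using j len by simp
      moreover have "dedges es fs ! (length es + j) = edge_map Inr e"
        using j by (simp add: dedges_def nth_append)
      ultimately show ?thesis using const[of "length es + j"] by simp
    qed
  qed
qed

text \<open>Remove the edges of the cycle and look at the component of the root. If it meets the
  cycle in two vertices, a contributing cactus would have a cut between them that no remaining edge
  crosses, so the sum is 0. If it meets the cycle in \<open>r0\<close> alone, the vertices outside
  the component stay single, every contributing cactus is a wedge at \<open>r0\<close>, and the
  outer part, which includes the cycle, contributes a factor independent of
  \<open>n\<close>.\<close>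

lemma separated_sum_cycle:
  assumes rot: "cyclic_invariant kappa" and g: "gm_wf g" "vin g = vout g" and cyc: "is_cycle g C"
  shows "\<exists>c g'. gm_wf g' \<and> vin g' = vout g' \<and> card (verts g') \<le> card (verts g) \<and>
    length (edgs g') < length (edgs g) \<and>
    (\<forall>n. gm_wf n \<longrightarrow> separated_sum kappa g n = c * separated_sum kappa g' n)"
proof -
  let ?es = "edgs g" and ?V = "verts g" and ?r = "vin g"
  let ?N = "length ?es"
  let ?s = "\<lambda>i. fst (?es ! i)" and ?t = "\<lambda>i. fst (snd (?es ! i))"
  define F where "F = {..<?N} - C"
  let ?comp = "component ?es F"
  define VC where "VC = ?s ` C \<union> ?t ` C"
  have C: "simple_cycle ?s ?t C" "C \<subseteq> {..<?N}" using cyc unfolding is_cycle_iff by auto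
  have Cne: "C \<noteq> {}" using simple_cycle_finite[OF C(1)] by simp
  have fV: "finite ?V" and eV: "ends ?es \<subseteq> ?V" and conn: "edges_connected ?V ?es" and rV: "?r \<in> ?V"
    using g by (auto simp: gm_wf_iff)
  have st: "?s i \<in> ?V \<and> ?t i \<in> ?V" if "i < ?N" for i
    using ends_in[OF nth_mem[OF that]] eV by blast
  have VCV: "VC \<subseteq> ?V" using C(2) st unfolding VC_def by auto
  have reach: "\<exists>c\<in>VC. ?comp y c" if y: "y \<in> ?V" for y
  proof (rule ccontr)
    assume no: "\<not> ?thesis"
    have "?comp y (fst e) = ?comp y (fst (snd e))" if e: "e \<in> set ?es" for e
    proof -
      obtain i where i: "i < ?N" "e = ?es ! i" using e by (metis in_set_conv_nth)
      show ?thesis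
      proof (cases "i \<in> C")
        case True
        hence "?s i \<in> VC" "?t i \<in> VC" unfolding VC_def by auto
        thus ?thesis using no i(2) by blast
      next
        case False
        thus ?thesis using i component_edge(1)[of i F ?es y] by (simp add: F_def)
      qed
    qed
    hence "\<forall>u\<in>?V. \<forall>v\<in>?V. ?comp y u = ?comp y v"
      using conn[unfolded edges_connected_def, THEN spec, of "?comp y"] by blast
    moreover obtain i where "i \<in> C" using Cne by blast
    moreover have "?s i \<in> VC" using \<open>i \<in> C\<close> by (auto simp: VC_def)
    ultimately have "?comp y (?s i)" using y VCV component_refl[of ?es F y] by blast
    thus False using no \<open>?s i \<in> VC\<close> by blast
  qed
  obtain r0 where r0: "r0 \<in> VC" "?comp ?r r0" using reach[OF rV] by blast
  let ?valid = "\<lambda>n. {p. partition_on (dsum ?V (verts n)) p \<and> roots_eq ?r n p \<and> inj_on (blk p \<circ> Inl) ?V}"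
  let ?w = "\<lambda>n p. weight kappa (map (edge_map (blk p)) (dedges ?es (edgs n)))"
  have cut: "\<exists>Y :: (nat + nat) set \<Rightarrow> bool. Y (blk p (Inl c)) \<noteq> Y (blk p (Inl c')) \<and>
      (\<forall>u v. ?comp u v \<longrightarrow> Y (blk p (Inl u)) = Y (blk p (Inl v))) \<and>
      (\<forall>e\<in>set (edgs n). Y (blk p (Inr (fst e))) = Y (blk p (Inr (fst (snd e)))))"
    if p: "p \<in> ?valid n" "?w n p \<noteq> 0" and c: "c \<in> VC" "c' \<in> VC" "c \<noteq> c'" for n c c' and p :: "(nat + nat) set set"
  proof -
    have inj: "inj_on (blk p \<circ> Inl) (ends ?es)" using p(1) eV by (auto intro: inj_on_subset)
    obtain Y :: "(nat + nat) set \<Rightarrow> bool" where Y: "Y (blk p (Inl c)) \<noteq> Y (blk p (Inl c'))"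
      "\<And>i. i < ?N \<Longrightarrow> i \<notin> C \<Longrightarrow> Y (blk p (Inl (?s i))) = Y (blk p (Inl (?t i)))"
      "\<And>e. e \<in> set (edgs n) \<Longrightarrow> Y (blk p (Inr (fst e))) = Y (blk p (Inr (fst (snd e))))"
      using separating_cut[OF p(2) C inj c[unfolded VC_def]] by metis
    have "Y (blk p (Inl u)) = Y (blk p (Inl v))" if "?comp u v" for u v
      using component_const[OF that, of "\<lambda>z. Y (blk p (Inl z))"] Y(2) by (simp add: F_def)
    thus ?thesis using Y(1,3) by blast
  qed
  show ?thesis
  proof (cases "\<exists>c\<in>VC. ?comp ?r c \<and> c \<noteq> r0")
    case True
    then obtain c where c: "c \<in> VC" "?comp ?r c" "c \<noteq> r0" by blast
    have cr: "?comp c r0" using component_trans[OF component_sym[OF c(2)] r0(2)] .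
    \<comment> \<open>The factor is 0 in this case, so any smaller monomial serves as a
      witness.\<close>
    let ?g = "\<lparr>verts = {?r}, edgs = [], vin = ?r, vout = ?r\<rparr> :: 'a gmon"
    have zero: "separated_sum kappa g n = 0" for n
      unfolding separated_sum_def
    proof (rule sum.neutral, rule ballI, rule ccontr)
      fix p assume "p \<in> ?valid n" "?w n p \<noteq> 0"
      from cut[OF this c(1) r0(1) c(3)] cr show False by blast
    qed
    have "gm_wf ?g" by (simp add: gm_wf_iff edges_connected_def)
    moreover have "card (verts ?g) \<le> card ?V"
    proof -
      have "card {?r} \<le> card ?V" by (rule card_mono[OF fV]) (use rV in simp)
      thus ?thesis by simp
    qed
    moreover have "0 < ?N" using Cne C(2) by auto
    ultimately show ?thesis using zero by (intro exI[of _ 0] exI[of _ ?g]) simp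
  next
    case False
    hence only: "c = r0" if "c \<in> VC" "?comp ?r c" for c using that by blast
    define V0 where "V0 = {v\<in>?V. ?comp ?r v}"
    define I0 where "I0 = {i. i \<in> F \<and> ?comp ?r (?s i)}"
    define es0 where "es0 = nths ?es I0"
    define esh where "esh = nths ?es (- I0)"
    define g' where "g' = (\<lparr>verts = V0, edgs = es0, vin = ?r, vout = ?r\<rparr> :: 'a gmon)"
    have r0V: "r0 \<in> V0" "?r \<in> V0" using r0 VCV rV by (auto simp: V0_def)
    have V0V: "V0 \<subseteq> ?V" by (auto simp: V0_def)
    have ends0: "ends es0 \<subseteq> V0"
    proof -
      have "?s i \<in> V0 \<and> ?t i \<in> V0" if "i < ?N" "i \<in> I0" for i
        using st[OF that(1)] that(2) component_edge(1)[of i F ?es ?r] by (auto simp: V0_def I0_def)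
      thus ?thesis unfolding ends_def es0_def set_nths by blast
    qed
    have endsh: "ends esh \<subseteq> insert r0 (?V - V0)"
    proof -
      have "?s i \<in> insert r0 (?V - V0) \<and> ?t i \<in> insert r0 (?V - V0)" if i: "i < ?N" "i \<notin> I0" for i
      proof (cases "i \<in> C")
        case True
        hence "?s i \<in> VC" "?t i \<in> VC" by (auto simp: VC_def)
        thus ?thesis using only st[OF i(1)] by (auto simp: V0_def)
      next
        case False
        hence "i \<in> F" using i by (simp add: F_def)
        hence "\<not> ?comp ?r (?s i)" "\<not> ?comp ?r (?t i)"
          using i(2) component_edge(1)[of i F ?es ?r] by (auto simp: I0_def)
        thus ?thesis using st[OF i(1)] by (auto simp: V0_def)
      qed
      thus ?thesis unfolding ends_def esh_def set_nths by blast
    qed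
    have mse: "mset ?es = mset es0 + mset esh" unfolding es0_def esh_def by (rule mset_nths_compl[symmetric])
    have wf': "gm_wf g'"
    proof -
      have "edges_connected V0 es0"
      proof (rule edges_connected_wedge[OF conn V0V _ _ endsh ends0])
        show "V0 \<inter> insert r0 (?V - V0) \<subseteq> {r0}" by blast
        show "set ?es \<subseteq> set es0 \<union> set esh" using mse by (metis order_refl set_mset_mset set_mset_union)
      qed
      thus ?thesis unfolding gm_wf_iff g'_def using ends0 r0V finite_subset[OF V0V fV] by simp
    qed
    have size: "card V0 \<le> card ?V" "length es0 < ?N"
    proof -
      show "card V0 \<le> card ?V" by (rule card_mono[OF fV V0V])
      have "I0 \<subseteq> F" by (auto simp: I0_def)
      hence "card {i. i < ?N \<and> i \<in> I0} \<le> card ({..<?N} - C)" by (intro card_mono) (auto simp: F_def)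
      also have "\<dots> < card {..<?N}" using C(2) Cne by (intro psubset_card_mono) auto
      finally show "length es0 < ?N" unfolding es0_def length_nths by simp
    qed
    have main: "separated_sum kappa g n = weight kappa esh * separated_sum kappa g' n" if n: "gm_wf n" for n
    proof -
      let ?W = "dsum ?V (verts n)" and ?Wz = "dsum V0 (verts n)"
      define Y where "Y = (Inl ` (?V - V0) :: (nat + nat) set)"
      define sg where "sg = (\<lambda>y. {y}) ` Y"
      have nV: "finite (verts n)" "edges_connected (verts n) (edgs n)" "vin n \<in> verts n" "vout n \<in> verts n"
          "ends (edgs n) \<subseteq> verts n"
        using n by (auto simp: gm_wf_iff)
      have WY: "?W = ?Wz \<union> Y" "?Wz \<inter> Y = {}" using V0V by (auto simp: Y_def dsum_def)
      \<comment> \<open>The component of such a vertex contains a cycle vertex different from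
        \<open>r0\<close>, and some cut separates the two. Identifying the vertex with one of
        \<open>n\<close> would contradict this cut, because \<open>n\<close> is connected and joined
        to the root, which lies on the side of \<open>r0\<close>.\<close>
      have single: "blk p y = {y}" if p: "p \<in> ?valid n" "?w n p \<noteq> 0" and y: "y \<in> Y" for p y
      proof -
        from y obtain v where v: "y = Inl v" "v \<in> ?V" "v \<notin> V0" by (auto simp: Y_def)
        have pp: "partition_on ?W p" and inj: "inj_on (blk p \<circ> Inl) ?V" and ro: "roots_eq ?r n p" using p(1) by auto
        have yW: "y \<in> ?W" using v by simp
        have b: "blk p y \<in> p" "y \<in> blk p y" using blk[OF pp yW] by auto
        have "z = y" if z: "z \<in> blk p y" for z
        proof (rule ccontr)
          assume zy: "z \<noteq> y"
          have zW: "z \<in> ?W" using z b(1) partition_onD1[OF pp] by blast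
          have bz: "blk p z = blk p y" by (rule blk_eq[OF pp b(1) z])
          show False
          proof (cases z)
            case (Inl u)
            hence uv: "u \<in> ?V" "(blk p \<circ> Inl) u = (blk p \<circ> Inl) v" using zW bz v(1) by auto
            have "u = v" by (rule inj_onD[OF inj uv(2,1) v(2)])
            thus False using zy Inl v(1) by simp
          next
            case (Inr u)
            hence u: "u \<in> verts n" using zW by simp
            obtain c where c: "c \<in> VC" "?comp v c" using reach[OF v(2)] by blast
            have "c \<noteq> r0"
            proof
              assume "c = r0"
              hence "?comp ?r c" using r0(2) by (simp only:)
              hence "?comp ?r v" by (rule component_trans[OF _ component_sym[OF c(2)]])
              thus False using v by (simp add: V0_def)
            qed
            then obtain Z :: "(nat + nat) set \<Rightarrow> bool" where Z: "Z (blk p (Inl c)) \<noteq> Z (blk p (Inl r0))"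
              "\<forall>u v. ?comp u v \<longrightarrow> Z (blk p (Inl u)) = Z (blk p (Inl v))"
              "\<forall>e\<in>set (edgs n). Z (blk p (Inr (fst e))) = Z (blk p (Inr (fst (snd e))))"
              using cut[OF p c(1) r0(1)] by blast
            have "Z (blk p (Inl c)) = Z (blk p (Inl v))" using Z(2) c(2) by blast
            also have "\<dots> = Z (blk p (Inr u))" using bz v(1) Inr by simp
            also have "\<dots> = Z (blk p (Inr (vin n)))"
              using nV(2)[unfolded edges_connected_def, THEN spec, of "\<lambda>z. Z (blk p (Inr z))"] Z(3) u nV(3) by blast
            also have "\<dots> = Z (blk p (Inl ?r))" using ro by (simp add: roots_eq_def)
            also have "\<dots> = Z (blk p (Inl r0))" using Z(2) r0(2) by blast
            finally show False using Z(1) by blast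
          qed
        qed
        thus ?thesis using b(2) by blast
      qed
      have sgp: "partition_on Y sg" unfolding sg_def by (rule partition_on_singletons)
      let ?validz = "{p. partition_on ?Wz p \<and> roots_eq ?r n p \<and> inj_on (blk p \<circ> Inl) V0}"
      let ?wz = "\<lambda>p. weight kappa (map (edge_map (blk p)) (dedges es0 (edgs n)))"
      have inW0: "Inl ?r \<in> ?Wz" "Inr (vin n) \<in> ?Wz" "Inr (vout n) \<in> ?Wz" using r0V nV by auto
      have fvalid: "finite (?valid n)" using finite_partitions[of ?W] fV nV(1) by simp
      \<comment> \<open>Partitions that leave all of \<open>Y\<close> single correspond to
        partitions of the rest: the singletons \<open>sg\<close> are added here and removed in
        \<open>down\<close>.\<close>
      have up: "p0 \<union> sg \<in> ?valid n \<and> (\<forall>x\<in>?Wz. blk (p0 \<union> sg) x = blk p0 x) \<and> (\<forall>y\<in>Y. blk (p0 \<union> sg) y = {y}) \<and> p0 \<inter> sg = {}"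
        if p0: "p0 \<in> ?validz" for p0
      proof -
        have q: "partition_on ?Wz p0" "roots_eq ?r n p0" "inj_on (blk p0 \<circ> Inl) V0" using p0 by auto
        have disj: "B \<inter> D = {}" if "B \<in> p0" "D \<in> sg" for B D
          using that partition_onD1[OF q(1)] partition_onD1[OF sgp] WY(2) by blast
        have pp: "partition_on ?W (p0 \<union> sg)"
        proof (rule partition_onI)
          show "\<Union>(p0 \<union> sg) = ?W" using partition_onD1[OF q(1)] partition_onD1[OF sgp] WY(1) by simp
          show "{} \<notin> p0 \<union> sg" using partition_onD3[OF q(1)] partition_onD3[OF sgp] by simp
          fix B D assume BD: "B \<in> p0 \<union> sg" "D \<in> p0 \<union> sg" "B \<noteq> D"
          have d1: "B \<inter> D = {}" if "B \<in> p0" "D \<in> p0" using partition_onD2[OF q(1)] that BD(3) by (auto simp: disjoint_def)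
          have d2: "B \<inter> D = {}" if "B \<in> sg" "D \<in> sg" using partition_onD2[OF sgp] that BD(3) by (auto simp: disjoint_def)
          show "disjnt B D" unfolding disjnt_def using BD(1,2) d1 d2 disj[of B D] disj[of D B] by blast
        qed
        have b0: "blk (p0 \<union> sg) x = blk p0 x" if "x \<in> ?Wz" for x
          using blk_eq[OF pp, of "blk p0 x" x] blk[OF q(1) that] by blast
        have bs: "blk (p0 \<union> sg) y = {y}" if "y \<in> Y" for y
          using blk_eq[OF pp, of "{y}" y] that by (auto simp: sg_def)
        have "inj_on (blk (p0 \<union> sg) \<circ> Inl) ?V"
        proof (rule inj_onI)
          fix u v assume uv: "u \<in> ?V" "v \<in> ?V" "(blk (p0 \<union> sg) \<circ> Inl) u = (blk (p0 \<union> sg) \<circ> Inl) v"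
          have uW: "Inl u \<in> ?W" "Inl v \<in> ?W" using uv by auto
          have mem: "Inl u \<in> blk (p0 \<union> sg) (Inl u)" "Inl v \<in> blk (p0 \<union> sg) (Inl v)" using blk[OF pp uW(1)] blk[OF pp uW(2)] by auto
          have eq: "blk (p0 \<union> sg) (Inl u) = blk (p0 \<union> sg) (Inl v)" using uv(3) by simp
          consider "u \<notin> V0" | "v \<notin> V0" | "u \<in> V0" "v \<in> V0" by blast
          thus "u = v"
          proof cases
            case 1
            hence "Inl u \<in> Y" using uv by (auto simp: Y_def)
            hence "blk (p0 \<union> sg) (Inl v) = {Inl u}" using bs eq by metis
            thus ?thesis using mem(2) by simp
          next
            case 2
            hence "Inl v \<in> Y" using uv by (auto simp: Y_def)
            hence "blk (p0 \<union> sg) (Inl u) = {Inl v}" using bs eq by metis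
            thus ?thesis using mem(1) by simp
          next
            case 3
            have "blk p0 (Inl u) = blk p0 (Inl v)" using eq b0[of "Inl u"] b0[of "Inl v"] 3 by simp
            hence "(blk p0 \<circ> Inl) u = (blk p0 \<circ> Inl) v" by simp
            hence "u = v" using inj_onD[OF q(3)] 3 by blast
            thus ?thesis using 3 by simp
          qed
        qed
        moreover have "roots_eq ?r n (p0 \<union> sg)"
          using q(2) unfolding roots_eq_def by (metis b0 inW0)
        moreover have "p0 \<inter> sg = {}"
        proof -
          have "B \<noteq> {}" if "B \<in> p0" for B using partition_onD3[OF q(1)] that by metis
          thus ?thesis using disj by blast
        qed
        ultimately show ?thesis using pp b0 bs by simp
      qed
      have down: "p - sg \<in> ?validz \<and> sg \<subseteq> p" if p: "p \<in> ?valid n" "\<forall>y\<in>Y. blk p y = {y}" for p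
      proof -
        have q: "partition_on ?W p" "roots_eq ?r n p" "inj_on (blk p \<circ> Inl) ?V" using p(1) by auto
        have sub: "sg \<subseteq> p"
        proof
          fix B assume "B \<in> sg"
          then obtain y where "y \<in> Y" "B = {y}" by (auto simp: sg_def)
          thus "B \<in> p" using p(2) blk[OF q(1), of y] WY(1) by auto
        qed
        have notsg: "blk p x \<notin> sg" if x: "x \<in> ?Wz" for x
        proof
          assume "blk p x \<in> sg"
          moreover have "x \<in> blk p x" using blk[OF q(1), of x] x WY(1) by blast
          ultimately have "x \<in> Y" by (auto simp: sg_def)
          thus False using x WY(2) by blast
        qed
        have pp: "partition_on ?Wz (p - sg)"
        proof (rule partition_onI)
          show "\<Union>(p - sg) = ?Wz"
          proof (intro equalityI subsetI)
            fix x assume "x \<in> \<Union>(p - sg)"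
            then obtain B where B: "B \<in> p" "B \<notin> sg" "x \<in> B" by blast
            have "x \<in> ?W" using B partition_onD1[OF q(1)] by blast
            moreover have "x \<notin> Y"
            proof
              assume "x \<in> Y"
              hence "B = {x}" using p(2) blk_eq[OF q(1) B(1,3)] by simp
              thus False using B(2) \<open>x \<in> Y\<close> by (simp add: sg_def)
            qed
            ultimately show "x \<in> ?Wz" using WY(1) by blast
          next
            fix x assume x: "x \<in> ?Wz"
            have "blk p x \<in> p - sg" "x \<in> blk p x" using blk[OF q(1), of x] notsg[OF x] x WY(1) by auto
            thus "x \<in> \<Union>(p - sg)" by blast
          qed
          show "{} \<notin> p - sg" using partition_onD3[OF q(1)] by simp
          show "disjnt B D" if "B \<in> p - sg" "D \<in> p - sg" "B \<noteq> D" for B D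
            using partition_onD2[OF q(1)] that by (auto simp: disjoint_def disjnt_def)
        qed
        have b: "blk (p - sg) x = blk p x" if x: "x \<in> ?Wz" for x
          using blk_eq[OF pp, of "blk p x" x] blk[OF q(1), of x] notsg[OF x] x WY(1) by auto
        have "roots_eq ?r n (p - sg)"
          using q(2) unfolding roots_eq_def by (metis b inW0)
        moreover have "inj_on (blk (p - sg) \<circ> Inl) V0"
        proof (rule inj_onI)
          fix u v assume "u \<in> V0" "v \<in> V0" "(blk (p - sg) \<circ> Inl) u = (blk (p - sg) \<circ> Inl) v"
          moreover from this have "(blk p \<circ> Inl) u = (blk p \<circ> Inl) v" using b by simp
          ultimately show "u = v" using inj_onD[OF q(3)] V0V by blast
        qed
        ultimately show ?thesis using pp sub by simp
      qed
      have "separated_sum kappa g n = sum (?w n) (?valid n)" by (simp add: separated_sum_def)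
      also have "\<dots> = sum (?w n) {p\<in>?valid n. \<forall>y\<in>Y. blk p y = {y}}"
        by (rule sum.mono_neutral_right[OF fvalid]) (use single in blast)+
      also have "\<dots> = (\<Sum>p0\<in>?validz. ?w n (p0 \<union> sg))"
      proof (rule sum.reindex_bij_witness[where i = "\<lambda>p0. p0 \<union> sg" and j = "\<lambda>p. p - sg"])
        fix p assume "p \<in> {p\<in>?valid n. \<forall>y\<in>Y. blk p y = {y}}"
        hence p: "p \<in> ?valid n" "\<forall>y\<in>Y. blk p y = {y}" by blast+
        show "(p - sg) \<union> sg = p" using down[OF p] by blast
        thus "?w n ((p - sg) \<union> sg) = ?w n p" by simp
        show "p - sg \<in> ?validz" using down[OF p] by blast
      next
        fix p0 assume p0: "p0 \<in> ?validz"
        show "(p0 \<union> sg) - sg = p0" using up[OF p0] by blast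
        show "p0 \<union> sg \<in> {p\<in>?valid n. \<forall>y\<in>Y. blk p y = {y}}" using up[OF p0] by blast
      qed
      also have "\<dots> = (\<Sum>p0\<in>?validz. weight kappa esh * ?wz p0)"
      proof (rule sum.cong[OF refl])
        fix p0 assume p0: "p0 \<in> ?validz"
        define p where "p = p0 \<union> sg"
        have pv: "p \<in> ?valid n" and b0: "\<forall>x\<in>?Wz. blk p x = blk p0 x" and bs: "\<forall>y\<in>Y. blk p y = {y}"
          using up[OF p0] unfolding p_def by blast+
        have pp: "partition_on ?W p" and inj: "inj_on (blk p \<circ> Inl) ?V" using pv by auto
        let ?A = "map (edge_map (blk p \<circ> Inl)) esh" and ?B = "map (edge_map (blk p)) (dedges es0 (edgs n))"
        have "?w n p = weight kappa (?A @ ?B)"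
        proof (rule weight_mset[OF rot])
          have "mset (map (edge_map (blk p)) (dedges ?es (edgs n))) =
             image_mset (edge_map (blk p \<circ> Inl)) (mset ?es) + image_mset (edge_map (blk p \<circ> Inr)) (mset (edgs n))"
            by (simp add: dedges_def multiset.map_comp o_def)
          also have "\<dots> = mset (?A @ ?B)" unfolding mse by (simp add: dedges_def multiset.map_comp o_def)
          finally show "mset (map (edge_map (blk p)) (dedges ?es (edgs n))) = mset (?A @ ?B)" .
        qed
        also have "\<dots> = weight kappa ?A * weight kappa ?B"
        proof (rule weight_append[OF rot, where r = "blk p (Inl r0)"])
          show "ends ?A \<inter> ends ?B \<subseteq> {blk p (Inl r0)}"
          proof
            fix B assume "B \<in> ends ?A \<inter> ends ?B"
            then obtain u z where u: "u \<in> ends esh" "B = blk p (Inl u)" and z: "z \<in> ends (dedges es0 (edgs n))" "B = blk p z"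
              unfolding ends_map by auto
            have zW: "z \<in> ?Wz" using z(1) ends0 nV(5) dsum_mono[of "ends es0" V0 "ends (edgs n)" "verts n"] by auto
            have "z \<in> B" using blk[OF pp, of z] zW WY(1) z(2) by blast
            show "B \<in> {blk p (Inl r0)}"
            proof (cases "u = r0")
              case False
              hence "Inl u \<in> Y" using u(1) endsh by (auto simp: Y_def)
              hence "z = Inl u" using \<open>z \<in> B\<close> bs u(2) by auto
              thus ?thesis using zW \<open>Inl u \<in> Y\<close> WY(2) by blast
            qed (use u in simp)
          qed
        qed
        \<comment> \<open>The vertices of \<open>g\<close> are kept apart, so the outer part is not
          changed by the quotient; this is why its weight does not depend on the partition.\<close>
        also have "weight kappa ?A = weight kappa (map (edge_map (\<lambda>v. v)) esh)"
        proof (rule weight_kernel[OF rot])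
          fix x y assume "x \<in> ends esh" "y \<in> ends esh"
          hence "x \<in> ?V" "y \<in> ?V" using endsh r0 VCV by auto
          thus "(blk p \<circ> Inl) x = (blk p \<circ> Inl) y \<longleftrightarrow> x = y" using inj by (rule inj_on_eq_iff[rotated 1])
        qed
        also have "map (edge_map (\<lambda>v. v)) esh = esh" by (rule map_idI) (simp add: edge_map_def)
        also have "weight kappa ?B = ?wz p0"
        proof (rule weight_cong[OF rot])
          fix x assume "x \<in> ends (dedges es0 (edgs n))"
          hence "x \<in> ?Wz" using ends0 nV(5) dsum_mono[of "ends es0" V0 "ends (edgs n)" "verts n"] by auto
          thus "blk p x = blk p0 x" using b0 by blast
        qed
        finally show "?w n (p0 \<union> sg) = weight kappa esh * ?wz p0" unfolding p_def .
      qed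
      also have "\<dots> = weight kappa esh * separated_sum kappa g' n"
        unfolding separated_sum_def g'_def by (simp add: sum_distrib_left)
      finally show ?thesis .
    qed
    have "vin g' = vout g'" "card (verts g') \<le> card ?V" "length (edgs g') < ?N"
      using size by (simp_all add: g'_def)
    thus ?thesis using wf' main by blast
  qed
qed

section \<open>Merging a vertex of degree two\<close>

lemma replace_eq_iff:
  "X \<noteq> P \<Longrightarrow> X \<noteq> Q \<Longrightarrow> (if P = B then X else P) = (if Q = B then X else Q) \<longleftrightarrow> P = Q"
  by auto

text \<open>The product formula for cumulants splits the pad through the merged edge in all ways; these
  match the ways of identifying \<open>w\<close> with another vertex.\<close>

lemma psi_mult_merge:
  fixes g :: "'a::monoid_mult gmon"
  assumes rot: "cyclic_invariant kappa"
    and mul: "\<And>x y w. kappa (x * y # w) = kappa (x # y # w) +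
      (\<Sum>j\<le>length w. kappa (y # take j w) * kappa (x # drop j w))"
    and g: "gm_wf g" "vin g = vout g" and w: "w \<in> verts g" "w \<noteq> vin g"
    and es: "mset (edgs g) = mset ((w, u, x) # (v, w, y) # es)"
    and ne: "u \<noteq> w" "v \<noteq> w" "w \<notin> ends es"
  defines "g' \<equiv> \<lparr>verts = verts g - {w}, edgs = (v, u, x * y) # es, vin = vin g, vout = vin g\<rparr>"
  shows "gm_wf g'" and "gm_wf n \<Longrightarrow> psi kappa (gm_mult g n) = psi kappa (gm_mult g' n)"
proof -
  have ends_g: "ends (edgs g) = {w, u, v} \<union> ends es" using ends_mset[OF es] by auto
  have V: "finite (verts g)" "ends (edgs g) \<subseteq> verts g" "edges_connected (verts g) (edgs g)" "vin g \<in> verts g"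
    using g by (auto simp: gm_wf_iff)
  have uv: "u \<in> verts g - {w}" "v \<in> verts g - {w}" "ends es \<subseteq> verts g - {w}" using ends_g V(2) ne by auto
  have conn': "edges_connected (verts g - {w}) ((v, u, x * y) # es)"
    unfolding edges_connected_def
  proof (intro allI impI ballI)
    fix X :: "nat \<Rightarrow> bool" and a b
    assume X: "\<forall>e\<in>set ((v, u, x * y) # es). X (fst e) = X (fst (snd e))"
      and ab: "a \<in> verts g - {w}" "b \<in> verts g - {w}"
    let ?X = "X(w := X v)"
    have "?X (fst e) = ?X (fst (snd e))" if e: "e \<in> set (edgs g)" for e
    proof -
      have "e = (w, u, x) \<or> e = (v, w, y) \<or> e \<in> set es"
        using e mset_eq_setD[OF es] by auto
      thus ?thesis
      proof (elim disjE)
        assume "e \<in> set es"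
        hence "fst e \<noteq> w" "fst (snd e) \<noteq> w" using ends_in[of e es] ne(3) by auto
        thus ?thesis using X \<open>e \<in> set es\<close> by simp
      qed (use X ne in auto)
    qed
    hence "?X a = ?X b" using V(3)[unfolded edges_connected_def, THEN spec, of ?X] ab by blast
    thus "X a = X b" using ab by simp
  qed
  show wf': "gm_wf g'"
    unfolding gm_wf_iff g'_def using V uv conn' w by auto
  assume n: "gm_wf n"
  have nV: "finite (verts n)" "edges_connected (verts n) (edgs n)" "vin n \<in> verts n" "vout n \<in> verts n"
      "ends (edgs n) \<subseteq> verts n"
    using n by (auto simp: gm_wf_iff)
  let ?U = "dsum (verts g - {w}) (verts n)"
  let ?w = "Inl w :: nat + nat"
  have ins: "dsum (verts g) (verts n) = insert ?w ?U" using w by (auto simp: dsum_def)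
  have wU: "?w \<notin> ?U" by simp
  have fU: "finite ?U" using V nV by simp
  let ?E = "dedges es (edgs n)"
  have endsE: "ends ?E \<subseteq> ?U" unfolding ends_dedges by (rule dsum_mono[OF uv(3) nV(5)])
  let ?ro = "roots_eq (vin g) n"
  let ?W = "\<lambda>p. weight kappa (map (edge_map (blk p)) (dedges (edgs g) (edgs n)))"
  let ?Fw = "\<lambda>p. if ?ro p then ?W p else 0"
  let ?L = "\<lambda>f z. (z, f (Inl u), x) # (f (Inl v), z, y) # map (edge_map f) ?E"
  have Weq: "weight kappa (map (edge_map f) (dedges (edgs g) (edgs n))) = weight kappa (?L f (f ?w))"
    for f :: "nat + nat \<Rightarrow> (nat + nat) set"
  proof (rule weight_mset[OF rot])
    have "mset (map (edge_map f) (dedges (edgs g) (edgs n))) =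
       image_mset (edge_map (f \<circ> Inl)) (mset (edgs g)) + image_mset (edge_map (f \<circ> Inr)) (mset (edgs n))"
      by (simp add: dedges_def multiset.map_comp o_def)
    also have "\<dots> = mset (?L f (f ?w))" unfolding es by (simp add: dedges_def multiset.map_comp o_def)
    finally show "mset (map (edge_map f) (dedges (edgs g) (edgs n))) = mset (?L f (f ?w))" .
  qed
  have inU: "Inl (vin g) \<in> ?U" "Inr (vin n) \<in> ?U" "Inr (vout n) \<in> ?U" "Inl u \<in> ?U" "Inl v \<in> ?U"
    using V w nV uv by auto
  \<comment> \<open>For a fixed partition of the other vertices, whose blocks are the vertices of
    the quotient: \<open>w\<close> as a singleton is the fresh middle vertex, and \<open>w\<close>
    in the block \<open>B\<close> is the middle vertex placed at \<open>B\<close>.\<close>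
  have step: "?Fw (insert {?w} p) + (\<Sum>B\<in>p. ?Fw (insert (insert ?w B) (p - {B}))) =
      (if ?ro p then weight kappa (map (edge_map (blk p)) (dedges ((v, u, x * y) # es) (edgs n))) else 0)"
    if p: "partition_on ?U p" for p
  proof -
    have np: "?w \<notin> B" if "B \<in> p" for B using that partition_onD1[OF p] wU by blast
    have P1: "partition_on (insert ?w ?U) (insert {?w} p)"
    proof -
      have "disjnt {?w} (\<Union>p)" using partition_onD1[OF p] wU by (simp add: disjnt_def)
      moreover have "insert ?w ?U - {?w} = ?U" using wU by blast
      ultimately show ?thesis using partition_on_insert[of "{?w}" p] p by simp
    qed
    have b1: "blk (insert {?w} p) z = blk p z" if "z \<in> ?U" for z
      using blk_eq[OF P1, of "blk p z" z] blk[OF p that] by blast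
    have b1w: "blk (insert {?w} p) ?w = {?w}" by (rule blk_eq[OF P1]) auto
    have P2: "partition_on (insert ?w ?U) (insert (insert ?w B) (p - {B}))" if B: "B \<in> p" for B
    proof -
      have BU: "B \<subseteq> ?U" using B partition_onD1[OF p] by blast
      have "D \<inter> B = {}" if "D \<in> p - {B}" for D
        using partition_onD2[OF p] that B by (auto simp: disjoint_def)
      hence "disjnt B (\<Union>(p - {B}))" by (auto simp: disjnt_def)
      moreover have "insert B (p - {B}) = p" using B by blast
      ultimately have q: "partition_on (?U - B) (p - {B})" using partition_on_insert[of B "p - {B}" ?U] p by simp
      have "\<Union>(p - {B}) = ?U - B" using partition_onD1[OF q] by simp
      hence "disjnt (insert ?w B) (\<Union>(p - {B}))" using wU by (auto simp: disjnt_def)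
      moreover have "insert ?w ?U - insert ?w B = ?U - B" using wU by blast
      ultimately show ?thesis using partition_on_insert[of "insert ?w B" "p - {B}" "insert ?w ?U"] q BU by auto
    qed
    have b2: "blk (insert (insert ?w B) (p - {B})) z = (if z = ?w \<or> blk p z = B then insert ?w B else blk p z)"
      if B: "B \<in> p" and z: "z \<in> insert ?w ?U" for B z
    proof (cases "z = ?w \<or> blk p z = B")
      case True
      hence "z \<in> insert ?w B" using z blk[OF p, of z] by auto
      thus ?thesis using True blk_eq[OF P2[OF B], of "insert ?w B" z] by simp
    next
      case False
      hence "z \<in> ?U" using z by blast
      hence "blk p z \<in> insert (insert ?w B) (p - {B})" "z \<in> blk p z" using blk[OF p, of z] False by auto
      thus ?thesis using False blk_eq[OF P2[OF B]] by simp
    qed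
    have ro1: "?ro (insert {?w} p) = ?ro p" using b1 inU by (simp add: roots_eq_def)
    have ro2: "?ro (insert (insert ?w B) (p - {B})) = ?ro p" if B: "B \<in> p" for B
    proof -
      have "blk (insert (insert ?w B) (p - {B})) y = blk (insert (insert ?w B) (p - {B})) z \<longleftrightarrow> blk p y = blk p z"
        if yz: "y \<in> ?U" "z \<in> ?U" for y z
      proof -
        have ne: "insert ?w B \<noteq> blk p y" "insert ?w B \<noteq> blk p z" using np blk[OF p yz(1)] blk[OF p yz(2)] by blast+
        have "y \<noteq> ?w" "z \<noteq> ?w" using yz wU by blast+
        hence "blk (insert (insert ?w B) (p - {B})) y = (if blk p y = B then insert ?w B else blk p y)"
          "blk (insert (insert ?w B) (p - {B})) z = (if blk p z = B then insert ?w B else blk p z)"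
          using b2[OF B, of y] b2[OF B, of z] yz by simp_all
        thus ?thesis using ne by (auto split: if_splits)
      qed
      thus ?thesis using inU by (simp only: roots_eq_def)
    qed
    have W1: "?W (insert {?w} p) = weight kappa (?L (blk p) {?w})"
    proof -
      have "map (edge_map (blk (insert {?w} p))) ?E = map (edge_map (blk p)) ?E"
      proof (rule map_cong[OF refl])
        fix e assume "e \<in> set ?E"
        hence "fst e \<in> ?U" "fst (snd e) \<in> ?U" using ends_in[of e ?E] endsE by auto
        thus "edge_map (blk (insert {?w} p)) e = edge_map (blk p) e" using b1 by (cases e) simp
      qed
      thus ?thesis unfolding Weq using b1 b1w inU by (simp only:)
    qed
    have W2: "?W (insert (insert ?w B) (p - {B})) = weight kappa (?L (blk p) B)" if B: "B \<in> p" for B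
    proof -
      \<comment> \<open>Joining \<open>w\<close> to \<open>B\<close> also changes the name of that
        block. \<open>?h\<close> has the same kernel and keeps the old names, as the subdivision
        formula requires.\<close>
      let ?f = "blk (insert (insert ?w B) (p - {B}))" and ?h = "(blk p)(?w := B)"
      have "?W (insert (insert ?w B) (p - {B})) = weight kappa (map (edge_map ?h) (dedges (edgs g) (edgs n)))"
      proof (rule weight_kernel[OF rot])
        fix a b assume "a \<in> ends (dedges (edgs g) (edgs n))" "b \<in> ends (dedges (edgs g) (edgs n))"
        hence ab: "a \<in> insert ?w ?U" "b \<in> insert ?w ?U"
          unfolding ins[symmetric] ends_dedges using dsum_mono[OF V(2) nV(5)] by auto
        have f: "?f z = (if ?h z = B then insert ?w B else ?h z)" if "z \<in> insert ?w ?U" for z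
          using b2[OF B that] by auto
        have h: "?h z \<in> p" if "z \<in> insert ?w ?U" for z using that B blk[OF p, of z] by auto
        have nB: "insert ?w B \<noteq> ?h z" if "z \<in> insert ?w ?U" for z using np[OF h[OF that]] by blast
        show "?f a = ?f b \<longleftrightarrow> ?h a = ?h b"
          unfolding f[OF ab(1)] f[OF ab(2)] by (rule replace_eq_iff[OF nB[OF ab(1)] nB[OF ab(2)]])
      qed
      also have "\<dots> = weight kappa (?L ?h (?h ?w))" by (rule Weq)
      also have "weight kappa (?L ?h (?h ?w)) = weight kappa (?L (blk p) B)"
      proof -
        have hu: "?h (Inl u) = blk p (Inl u)" "?h (Inl v) = blk p (Inl v)" "?h ?w = B" using ne by simp_all
        have "map (edge_map ?h) ?E = map (edge_map (blk p)) ?E"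
      proof (rule map_cong[OF refl])
        fix e assume "e \<in> set ?E"
        hence "fst e \<noteq> ?w" "fst (snd e) \<noteq> ?w" using ends_in[of e ?E] endsE wU by auto
        thus "edge_map ?h e = edge_map (blk p) e" by (cases e) simp
      qed
        thus ?thesis by (simp only: hu)
      qed
      finally show ?thesis .
    qed
    show ?thesis
    proof (cases "?ro p")
      case True
      have "weight kappa ((blk p (Inl v), blk p (Inl u), x * y) # map (edge_map (blk p)) ?E) =
          weight kappa (?L (blk p) {?w}) + (\<Sum>B\<in>p. weight kappa (?L (blk p) B))"
      proof (rule weight_subdivide[OF rot mul])
        show "finite p" by (rule finite_elements[OF fU p])
        show "ends (map (edge_map (blk p)) ?E) \<subseteq> p" unfolding ends_map using endsE blk[OF p] by blast
        show "blk p (Inl u) \<in> p" "blk p (Inl v) \<in> p" using blk[OF p] inU by auto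
        show "{?w} \<notin> p" using np by blast
        \<comment> \<open>The subdivision formula asks for a connected quotient; it is one because
          the merged graph and \<open>n\<close> are connected and share the root.\<close>
        have c: "edges_connected (blk p ` Inl ` (verts g - {w}) \<union> blk p ` Inr ` verts n)
           (map (edge_map (blk p)) (map (edge_map Inl) ((v, u, x * y) # es)) @ map (edge_map (blk p)) (map (edge_map Inr) (edgs n)))"
        proof (rule edges_connected_append[where r = "blk p (Inl (vin g))"])
          show "edges_connected (blk p ` Inl ` (verts g - {w})) (map (edge_map (blk p)) (map (edge_map Inl) ((v, u, x * y) # es)))"
            by (intro edges_connected_map conn')
          show "edges_connected (blk p ` Inr ` verts n) (map (edge_map (blk p)) (map (edge_map Inr) (edgs n)))"
            by (intro edges_connected_map nV(2))
          show "blk p (Inl (vin g)) \<in> blk p ` Inl ` (verts g - {w})" using V(4) w(2) by blast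
          have "blk p (Inl (vin g)) = blk p (Inr (vin n))" using True by (simp add: roots_eq_def)
          thus "blk p (Inl (vin g)) \<in> blk p ` Inr ` verts n" using nV(3) by blast
        qed
        have "blk p ` Inl ` (verts g - {w}) \<union> blk p ` Inr ` verts n = p"
          using blk_image[OF p] unfolding dsum_def image_Un .
        moreover have "map (edge_map (blk p)) (map (edge_map Inl) ((v, u, x * y) # es)) @ map (edge_map (blk p)) (map (edge_map Inr) (edgs n)) =
           (blk p (Inl v), blk p (Inl u), x * y) # map (edge_map (blk p)) ?E"
          by (simp add: dedges_def)
        ultimately show "edges_connected p ((blk p (Inl v), blk p (Inl u), x * y) # map (edge_map (blk p)) ?E)"
          using c by simp
      qed
      moreover have "map (edge_map (blk p)) (dedges ((v, u, x * y) # es) (edgs n)) =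
          (blk p (Inl v), blk p (Inl u), x * y) # map (edge_map (blk p)) ?E" by (simp add: dedges_def)
      ultimately show ?thesis using True ro1 ro2 W1 W2 by simp
    next
      case False
      thus ?thesis using ro1 ro2 by simp
    qed
  qed
  have filt: "(\<Sum>p | partition_on S p \<and> ?ro p. h p) = (\<Sum>p | partition_on S p. if ?ro p then h p else 0)"
    if "finite S" for S and h :: "(nat + nat) set set \<Rightarrow> complex"
  proof -
    have "{p. partition_on S p \<and> ?ro p} = {p \<in> {p. partition_on S p}. ?ro p}" by blast
    thus ?thesis using finitely_many_partition_on[OF that] by (simp only: sum.inter_filter)
  qed
  have "psi kappa (gm_mult g n) = (\<Sum>p | partition_on (insert ?w ?U) p. ?Fw p)"
    unfolding psi_mult[OF rot g n] ins by (rule filt) (use fU in simp)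
  also have "\<dots> = (\<Sum>p | partition_on ?U p. ?Fw (insert {?w} p) + (\<Sum>B\<in>p. ?Fw (insert (insert ?w B) (p - {B}))))"
    by (rule partition_on_insert_cases[OF wU fU])
  also have "\<dots> = (\<Sum>p | partition_on ?U p.
      if ?ro p then weight kappa (map (edge_map (blk p)) (dedges ((v, u, x * y) # es) (edgs n))) else 0)"
    by (intro sum.cong refl step) simp
  also have "\<dots> = (\<Sum>p | partition_on ?U p \<and> ?ro p.
      weight kappa (map (edge_map (blk p)) (dedges ((v, u, x * y) # es) (edgs n))))"
    by (rule filt[OF fU, symmetric])
  also have "\<dots> = psi kappa (gm_mult g' n)"
    using psi_mult[OF rot wf' _ n] by (simp add: g'_def)
  finally show "psi kappa (gm_mult g n) = psi kappa (gm_mult g' n)" .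
qed

section \<open>Induction on monomials\<close>

lemma forest_no_loop:
  assumes "\<nexists>C. is_cycle g C" "e \<in> set (edgs g)"
  shows "fst e \<noteq> fst (snd e)"
proof
  assume l: "fst e = fst (snd e)"
  obtain i where i: "i < length (edgs g)" "e = edgs g ! i" using assms(2) by (metis in_set_conv_nth)
  let ?s = "\<lambda>i. fst (edgs g ! i)" and ?t = "\<lambda>i. fst (snd (edgs g ! i))"
  have "(undirected_adj {} ?s ?t)\<^sup>*\<^sup>* (?s i) (?t i)" using l i(2) by simp
  then obtain D where "simple_cycle ?s ?t D" "D \<subseteq> {i}"
    using simple_cycle_through[of "{}" ?s ?t i] by blast
  hence "is_cycle g D" unfolding is_cycle_iff using i(1) by auto
  thus False using assms(1) by blast
qed

lemma degree_card:
  "indeg g v = card {j. j < length (edgs g) \<and> fst (snd (edgs g ! j)) = v}"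
  "outdeg g v = card {j. j < length (edgs g) \<and> fst (edgs g ! j) = v}"
  by (simp_all add: indeg_def outdeg_def etgt_def esrc_def length_filter_conv_card)

text \<open>In a forest, removing the root edge \<open>i\<close> separates its other end
  \<open>z\<close> from the root. The component of \<open>z\<close> together with \<open>i\<close>
  is one factor and the remainder is the other. Both have edges, since \<open>i\<close> does not
  exhaust the degree of the root, and they meet only in the root.\<close>

lemma tree_root_split:
  assumes rot: "cyclic_invariant kappa" and g: "gm_wf g" "vin g = vout g" and nc: "\<nexists>C. is_cycle g C"
    and i: "i < length (edgs g)" "fst (edgs g ! i) = vin g \<or> fst (snd (edgs g ! i)) = vin g"
    and deg: "indeg g (vin g) + outdeg g (vin g) \<noteq> 1"
  shows "\<exists>a b. gm_wf a \<and> vin a = vout a \<and> gm_wf b \<and> vin b = vout b \<and>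
    card (verts a) \<le> card (verts g) \<and> card (verts b) \<le> card (verts g) \<and>
    length (edgs a) < length (edgs g) \<and> length (edgs b) < length (edgs g) \<and>
    (\<forall>n. gm_wf n \<longrightarrow> psi kappa (gm_mult g n) = psi kappa (gm_mult (gm_mult a b) n))"
proof -
  let ?es = "edgs g" and ?V = "verts g" and ?r = "vin g"
  let ?N = "length ?es"
  let ?s = "\<lambda>i. fst (?es ! i)" and ?t = "\<lambda>i. fst (snd (?es ! i))"
  define F where "F = {..<?N} - {i}"
  define z where "z = (if ?s i = ?r then ?t i else ?s i)"
  let ?comp = "component ?es F"
  have fV: "finite ?V" and eV: "ends ?es \<subseteq> ?V" and conn: "edges_connected ?V ?es" and rV: "?r \<in> ?V"
    using g by (auto simp: gm_wf_iff)
  have st: "?s i \<in> ?V \<and> ?t i \<in> ?V" if "i < ?N" for i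
    using ends_in[OF nth_mem[OF that]] eV by blast
  have noloop: "?s i \<noteq> ?t i" using forest_no_loop[OF nc nth_mem[OF i(1)]] .
  have zr: "{?s i, ?t i} = {?r, z}" "z \<noteq> ?r" using i(2) noloop by (auto simp: z_def)
  have ncomp: "\<not> ?comp z ?r"
  proof
    assume "?comp z ?r"
    hence "?comp (?s i) (?t i)" using zr(1) component_sym[of ?es F z ?r] by (auto simp: doubleton_eq_iff)
    then obtain D where D: "simple_cycle ?s ?t D" "D \<subseteq> insert i F"
      using simple_cycle_through[of F ?s ?t i] unfolding component_def by (auto simp: F_def)
    have "is_cycle g D" unfolding is_cycle_iff using D i(1) by (auto simp: F_def)
    thus False using nc by blast
  qed
  define V1 where "V1 = insert ?r {v\<in>?V. ?comp z v}"
  define V2 where "V2 = {v\<in>?V. \<not> ?comp z v}"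
  define I where "I = insert i {j\<in>F. ?comp z (?s j)}"
  define es1 where "es1 = nths ?es I"
  define es2 where "es2 = nths ?es (- I)"
  have V12: "V1 \<union> V2 = ?V" "V1 \<inter> V2 = {?r}" using rV ncomp by (auto simp: V1_def V2_def)
  have mse: "mset ?es = mset es1 + mset es2" unfolding es1_def es2_def by (rule mset_nths_compl[symmetric])
  have zV: "z \<in> ?V" using st[OF i(1)] by (simp add: z_def)
  have e1: "ends es1 \<subseteq> V1"
  proof -
    have "?s j \<in> V1 \<and> ?t j \<in> V1" if j: "j < ?N" "j \<in> I" for j
    proof (cases "j = i")
      case True
      have "{?s i, ?t i} \<subseteq> V1" unfolding zr(1) using zV by (auto simp: V1_def)
      thus ?thesis using True by simp
    next
      case False
      hence "j \<in> F" "?comp z (?s j)" using j(2) by (auto simp: I_def)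
      thus ?thesis using st[OF j(1)] component_edge(1)[of j F ?es z] by (auto simp: V1_def)
    qed
    thus ?thesis unfolding ends_def es1_def set_nths by blast
  qed
  have e2: "ends es2 \<subseteq> V2"
  proof -
    have "?s j \<in> V2 \<and> ?t j \<in> V2" if j: "j < ?N" "j \<notin> I" for j
    proof -
      have "j \<in> F" using j by (auto simp: I_def F_def)
      thus ?thesis using st[OF j(1)] j(2) component_edge(1)[of j F ?es z] by (auto simp: V2_def I_def)
    qed
    thus ?thesis unfolding ends_def es2_def set_nths by blast
  qed
  have len: "length es1 + length es2 = ?N" using arg_cong[OF mse, of size] by simp
  have l1: "es1 \<noteq> []"
  proof -
    have "?es ! i \<in> set es1" unfolding es1_def set_nths using i(1) by (auto simp: I_def)
    thus ?thesis by auto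
  qed
  have l2: "es2 \<noteq> []"
  proof
    assume "es2 = []"
    hence "{?es ! j |j. j < ?N \<and> j \<in> - I} = {}" unfolding es2_def set_nths[symmetric] by simp
    hence all: "j \<in> I" if "j < ?N" for j using that by blast
    have other: "?s j \<noteq> ?r \<and> ?t j \<noteq> ?r" if j: "j < ?N" "j \<noteq> i" for j
    proof -
      have "j \<in> F" "?comp z (?s j)" using all[OF j(1)] j(2) by (auto simp: I_def)
      thus ?thesis using ncomp component_edge(1)[of j F ?es z] by auto
    qed
    have "indeg g ?r + outdeg g ?r = 1"
    proof (cases "?s i = ?r")
      case True
      hence "?t i \<noteq> ?r" using noloop by simp
      hence "{j. j < ?N \<and> ?t j = ?r} = {}" using other by blast
      moreover have "{j. j < ?N \<and> ?s j = ?r} = {i}" using other True i(1) by blast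
      ultimately show ?thesis unfolding degree_card by simp
    next
      case False
      hence t: "?t i = ?r" using i(2) by simp
      have "{j. j < ?N \<and> ?s j = ?r} = {}" using other False by blast
      moreover have "{j. j < ?N \<and> ?t j = ?r} = {i}" using other t i(1) by blast
      ultimately show ?thesis unfolding degree_card by simp
    qed
    thus False using deg by simp
  qed
  let ?a = "\<lparr>verts = V1, edgs = es1, vin = ?r, vout = ?r\<rparr> :: 'a gmon"
  let ?b = "\<lparr>verts = V2, edgs = es2, vin = ?r, vout = ?r\<rparr> :: 'a gmon"
  have sete: "set ?es \<subseteq> set es1 \<union> set es2" using mse by (metis order_refl set_mset_mset set_mset_union)
  have fin12: "finite V1" "finite V2" using fV unfolding V12(1)[symmetric] by simp_all
  have "edges_connected V1 es1"
    by (rule edges_connected_wedge[OF conn _ _ sete e2 e1]) (use V12 in blast)+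
  hence a: "gm_wf ?a" using e1 V12(2) fin12 by (auto simp: gm_wf_iff)
  have "edges_connected V2 es2"
    by (rule edges_connected_wedge[OF conn _ _ _ e1 e2]) (use V12 sete in blast)+
  hence b: "gm_wf ?b" using e2 V12(2) fin12 by (auto simp: gm_wf_iff)
  have psi: "psi kappa (gm_mult g n) = psi kappa (gm_mult (gm_mult ?a ?b) n)" if n: "gm_wf n" for n
  proof -
    have va: "vin ?a = vout ?a" "vin ?b = vout ?b" by simp_all
    show ?thesis
      unfolding psi_mult_assoc_rooted(1)[OF rot a va(1) b va(2) n]
      by (rule psi_mult_assoc_rooted(4)[OF rot a va(1) b va(2) n g(1)]) (use g(2) V12 mse in simp_all)
  qed
  have "V1 \<subseteq> ?V" "V2 \<subseteq> ?V" using V12(1) by auto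
  hence "card V1 \<le> card ?V" "card V2 \<le> card ?V" by (auto intro: card_mono[OF fV])
  moreover have "length es1 < ?N" "length es2 < ?N"
    using len l1 l2 by (simp_all add: neq_Nil_conv) (auto simp: neq_Nil_conv)
  ultimately show ?thesis
    using a b psi by (intro exI[of _ ?a] exI[of _ ?b]) simp
qed

lemma filter_singleton_eq: "length (filter P xs) = 1 \<Longrightarrow> \<exists>x. filter P xs = [x]"
  by (metis One_nat_def length_0_conv length_Suc_conv)

text \<open>Without loops the edge into \<open>w\<close> and the edge out of \<open>w\<close> are
  different, so both can be split off and no remaining edge touches \<open>w\<close>.\<close>

lemma merge_vertex:
  assumes nl: "\<And>e. e \<in> set es \<Longrightarrow> fst e \<noteq> fst (snd e)"
    and d: "length (filter (\<lambda>e. etgt e = w) es) = 1" "length (filter (\<lambda>e. esrc e = w) es) = 1"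
  shows "\<exists>u x v y es'. mset es = mset ((w, u, x) # (v, w, y) # es') \<and> u \<noteq> w \<and> v \<noteq> w \<and> w \<notin> ends es'"
proof -
  let ?P = "\<lambda>e. etgt e = w" and ?Q = "\<lambda>e. esrc e = w"
  obtain e1 e2 where e: "filter ?P es = [e1]" "filter ?Q es = [e2]"
    using filter_singleton_eq[OF d(1)] filter_singleton_eq[OF d(2)] by blast
  let ?L = "filter (\<lambda>e. \<not> ?P e) es"
  let ?es = "filter (\<lambda>e. \<not> ?Q e) ?L"
  have part: "mset xs = mset (filter R xs) + mset (filter (\<lambda>x. \<not> R x) xs)" for R xs
    by (induction xs) auto
  have QL: "filter ?Q ?L = filter ?Q es"
    unfolding filter_filter by (rule filter_cong[OF refl]) (auto simp: esrc_def etgt_def dest: nl)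
  have A: "mset ?L = {#e2#} + mset ?es"
    using part[of ?L ?Q, unfolded QL e(2)] by simp
  have B: "mset es = {#e1#} + mset ?L"
    using part[of es ?P, unfolded e(1)] by simp
  have m: "mset es = mset (e2 # e1 # ?es)" by (rule trans[OF B[unfolded A]]) simp
  have "e1 \<in> set (filter ?P es)" "e2 \<in> set (filter ?Q es)" using e by simp_all
  hence "e1 \<in> set es" "etgt e1 = w" "e2 \<in> set es" "esrc e2 = w" by auto
  moreover from this have "fst e1 \<noteq> w" "fst (snd e2) \<noteq> w"
    using nl[of e1] nl[of e2] by (auto simp: esrc_def etgt_def)
  moreover have "w \<notin> ends ?es" by (auto simp: ends_def esrc_def etgt_def)
  moreover obtain v w1 y where "e1 = (v, w1, y)" by (cases e1)
  moreover obtain u x where "e2 = (w, u, x)" using calculation by (cases e2) (auto simp: esrc_def)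
  ultimately have "mset es = mset ((w, u, x) # (v, w1, y) # ?es)" "u \<noteq> w" "v \<noteq> w" "w1 = w" "w \<notin> ends ?es"
    using m by (simp_all add: esrc_def etgt_def)
  thus ?thesis by blast
qed

section \<open>Functionals realized by the subalgebra\<close>

locale tracial_space =
  fixes sc :: "complex \<Rightarrow> 'a::ring_1 \<Rightarrow> 'a" and phi :: "'a \<Rightarrow> complex" and kappa :: "'a list \<Rightarrow> complex"
  assumes algebra: "complex_algebra sc" and state: "tracial_state sc phi"
    and cumulants: "free_cumulants phi kappa"
begin

lemma kappa_cyclic: "cyclic_invariant kappa"
  unfolding cyclic_invariant_def using cumulant_rotate[OF state cumulants] by blast

lemma kappa_scalar: "w \<noteq> [] \<Longrightarrow> kappa (sc c 1 # w) = 0"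
  by (simp add: cumulant_scale[OF algebra state cumulants] cumulant_one[OF state cumulants])

text \<open>The induction runs over functionals instead of combinations: identities between values
  of \<open>psi\<close> can then be used directly, and linear combinations of realized functionals
  are again realized.\<close>

definition realized :: "('a gmon \<Rightarrow> complex) \<Rightarrow> bool" where
  "realized F \<longleftrightarrow> (\<exists>x\<in>Delta_Q sc. \<forall>n. gm_wf n \<longrightarrow> pairing kappa x n = F n)"

lemma realized_cong: "realized F \<Longrightarrow> (\<And>n. gm_wf n \<Longrightarrow> G n = F n) \<Longrightarrow> realized G"
  by (auto simp: realized_def)

lemma realized_add:
  assumes "realized F" "realized G"
  shows "realized (\<lambda>n. F n + G n)"
proof -
  obtain x y where "x \<in> Delta_Q sc" "y \<in> Delta_Q sc" "\<forall>n. gm_wf n \<longrightarrow> pairing kappa x n = F n"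
    "\<forall>n. gm_wf n \<longrightarrow> pairing kappa y n = G n"
    using assms by (auto simp: realized_def)
  thus ?thesis unfolding realized_def
    by (intro bexI[of _ "fc_add x y"] Delta_Q.add) (auto simp: fc_add_def)
qed

lemma realized_scale:
  assumes "realized F"
  shows "realized (\<lambda>n. c * F n)"
proof -
  obtain x where "x \<in> Delta_Q sc" "\<forall>n. gm_wf n \<longrightarrow> pairing kappa x n = F n"
    using assms by (auto simp: realized_def)
  thus ?thesis unfolding realized_def
    by (intro bexI[of _ "fc_scale c x"] Delta_Q.scale) (auto simp: pairing_scale)
qed

lemma realized_unit: "realized (\<lambda>n. psi kappa (gm_mult gm_unit n))"
  unfolding realized_def by (rule bexI[OF _ Delta_Q.unit]) (simp add: fc_unit_def)

lemma realized_zero: "realized (\<lambda>n. 0)"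
  using realized_scale[OF realized_unit, of 0] by simp

lemma realized_sum:
  assumes "finite S" "\<And>i. i \<in> S \<Longrightarrow> realized (F i)"
  shows "realized (\<lambda>n. \<Sum>i\<in>S. F i n)"
  using assms by (induction S) (auto intro: realized_zero realized_add)

text \<open>By commutativity modulo \<open>psi\<close>, the right factor of \<open>m k n\<close> can
  be moved to the front, where summing over \<open>y\<close> replaces it by \<open>b\<close>. Then
  \<open>m\<close> is moved to the front, and summing over \<open>x\<close> replaces it by
  \<open>a\<close>.\<close>

lemma realized_mult:
  assumes a: "gm_wf a" "vin a = vout a" and b: "gm_wf b" "vin b = vout b"
    and ra: "realized (\<lambda>n. psi kappa (gm_mult a n))" and rb: "realized (\<lambda>n. psi kappa (gm_mult b n))"
  shows "realized (\<lambda>n. psi kappa (gm_mult (gm_mult a b) n))"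
proof -
  note assoc = psi_mult_assoc_rooted[OF kappa_cyclic]
  obtain x y where x: "x \<in> Delta_Q sc" "\<And>n. gm_wf n \<Longrightarrow> pairing kappa x n = psi kappa (gm_mult a n)"
    and y: "y \<in> Delta_Q sc" "\<And>n. gm_wf n \<Longrightarrow> pairing kappa y n = psi kappa (gm_mult b n)"
    using ra rb by (auto simp: realized_def)
  have xm: "gm_wf m \<and> vin m = vout m" if "(c, m) \<in> set x" for c m
    using subsetD[OF Delta_Q_subset_Delta_B x(1)] that by (auto simp: Delta_B_def)
  have ym: "gm_wf m \<and> vin m = vout m" if "(c, m) \<in> set y" for c m
    using subsetD[OF Delta_Q_subset_Delta_B y(1)] that by (auto simp: Delta_B_def)
  have "pairing kappa (fc_mult x y) n = psi kappa (gm_mult (gm_mult a b) n)" if n: "gm_wf n" for n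
  proof -
    have inner: "(\<Sum>(d, k)\<leftarrow>y. d * psi kappa (gm_mult (gm_mult m k) n)) = psi kappa (gm_mult m (gm_mult b n))"
      if m: "(c, m) \<in> set x" for c m
    proof -
      note m' = xm[OF m]
      have "(\<Sum>(d, k)\<leftarrow>y. d * psi kappa (gm_mult (gm_mult m k) n)) = pairing kappa y (gm_mult m n)"
        unfolding pairing_def
      proof (intro arg_cong[where f = sum_list] map_cong refl)
        fix e assume "e \<in> set y"
        obtain d k where e: "e = (d, k)" by (cases e)
        with \<open>e \<in> set y\<close> have dk: "(d, k) \<in> set y" by (simp only:)
        note k = ym[OF dk]
        have "psi kappa (gm_mult (gm_mult m k) n) = psi kappa (gm_mult k (gm_mult m n))"
          using assoc(1,3)[of m k n] m' k n by simp
        thus "(case e of (d, k) \<Rightarrow> d * psi kappa (gm_mult (gm_mult m k) n)) =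
            (case e of (c, k) \<Rightarrow> c * psi kappa (gm_mult k (gm_mult m n)))"
          using e by (simp only: prod.case)
      qed
      also have "\<dots> = psi kappa (gm_mult b (gm_mult m n))" using y(2) gm_wf_mult m' n by blast
      also have "\<dots> = psi kappa (gm_mult m (gm_mult b n))" using assoc(2,3)[of m b n] m' b n by simp
      finally show ?thesis .
    qed
    have "pairing kappa (fc_mult x y) n = pairing kappa x (gm_mult b n)"
      unfolding pairing_mult pairing_def[of kappa x]
      by (intro arg_cong[where f = sum_list] map_cong refl) (auto simp: inner simp del: gm_mult_simps)
    also have "\<dots> = psi kappa (gm_mult a (gm_mult b n))" using x(2) gm_wf_mult b n by blast
    also have "\<dots> = psi kappa (gm_mult (gm_mult a b) n)" using assoc(1,2)[of a b n] a b n by simp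
    finally show ?thesis .
  qed
  thus ?thesis unfolding realized_def using Delta_Q.mult[OF x(1) y(1)] by blast
qed

text \<open>\<open>Q(g)\<close> differs from \<open>g\<close> by proper quotients of \<open>g\<close>.\<close>

lemma realized_of_separated_sum:
  assumes g: "gm_wf g" "vin g = vout g"
    and smaller: "\<And>h. gm_wf h \<Longrightarrow> vin h = vout h \<Longrightarrow> card (verts h) < card (verts g) \<Longrightarrow>
      length (edgs h) = length (edgs g) \<Longrightarrow> realized (\<lambda>n. psi kappa (gm_mult h n))"
    and sep: "realized (separated_sum kappa g)"
  shows "realized (\<lambda>n. psi kappa (gm_mult g n))"
proof -
  let ?S = "{p. partition_on (verts g) p}" and ?z = "(\<lambda>v. {v}) ` verts g"
  have fin: "finite ?S" using g by (intro finitely_many_partition_on) (simp add: gm_wf_iff)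
  have z: "?z \<in> ?S" using partition_on_singletons by blast
  have "realized (\<lambda>n. \<Sum>p\<in>?S - {?z}. mobius0 p * psi kappa (gm_mult (gm_quot p g) n))"
  proof (rule realized_sum)
    fix p assume p: "p \<in> ?S - {?z}"
    have "realized (\<lambda>n. psi kappa (gm_mult (gm_quot p g) n))"
    proof (rule smaller)
      show "gm_wf (gm_quot p g)" "vin (gm_quot p g) = vout (gm_quot p g)"
        using g by (simp_all add: gm_quot_eq gm_wf_map)
      show "card (verts (gm_quot p g)) < card (verts g)" using card_verts_gm_quot[OF g(1)] p by blast
      show "length (edgs (gm_quot p g)) = length (edgs g)" by (simp add: gm_quot_eq)
    qed
    thus "realized (\<lambda>n. mobius0 p * psi kappa (gm_mult (gm_quot p g) n))" by (rule realized_scale)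
  qed (use fin in simp)
  from realized_add[OF sep realized_scale[OF this, of "-1"]] show ?thesis
  proof (rule realized_cong)
    fix n :: "'a gmon" assume n: "gm_wf n"
    have "separated_sum kappa g n = psi kappa (gm_mult g n) +
       (\<Sum>p\<in>?S - {?z}. mobius0 p * psi kappa (gm_mult (gm_quot p g) n))"
      unfolding sum_mobius0_psi[OF kappa_cyclic g n, symmetric] sum.remove[OF fin z] gm_quot_singletons[OF g(1)] by simp
    thus "psi kappa (gm_mult g n) = separated_sum kappa g n +
        - 1 * (\<Sum>p\<in>?S - {?z}. mobius0 p * psi kappa (gm_mult (gm_quot p g) n))" by simp
  qed
qed

text \<open>The ends of \<open>e\<close> stay apart in every admissible quotient, so
  \<open>e\<close> does not become a loop, and the pad containing it has a second edge whenever
  there is a cactus.\<close>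

lemma separated_sum_scalar:
  assumes g: "gm_wf g" and e: "e \<in> set (edgs g)" "fst e \<noteq> fst (snd e)" "elab e = sc c 1"
  shows "separated_sum kappa g n = 0"
  unfolding separated_sum_def
proof (rule sum.neutral, rule ballI)
  fix p assume p: "p \<in> {p. partition_on (dsum (verts g) (verts n)) p \<and> roots_eq (vin g) n p \<and>
    inj_on (blk p \<circ> Inl) (verts g)}"
  let ?e = "edge_map (blk p) (edge_map Inl e)"
  have "fst e \<in> verts g" "fst (snd e) \<in> verts g" using ends_in[OF e(1)] g by (auto simp: gm_wf_iff)
  hence ne: "(blk p \<circ> Inl) (fst e) \<noteq> (blk p \<circ> Inl) (fst (snd e))"
    using p e(2) by (metis (mono_tags, lifting) mem_Collect_eq inj_on_eq_iff)
  show "weight kappa (map (edge_map (blk p)) (dedges (edgs g) (edgs n))) = 0"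
  proof (rule weight_vanish[OF kappa_cyclic])
    have "edge_map Inl e \<in> set (dedges (edgs g) (edgs n))" using e(1) by (simp add: dedges_def)
    thus "?e \<in> set (map (edge_map (blk p)) (dedges (edgs g) (edgs n)))" unfolding set_map by (rule imageI)
    show "fst ?e \<noteq> fst (snd ?e)" using ne by simp
    show "kappa (snd (snd ?e) # w) = 0" if "w \<noteq> []" for w
      using kappa_scalar[OF that] e(3) by (simp add: elab_def)
  qed
qed

lemma realized_monomial:
  "gm_wf g \<Longrightarrow> vin g = vout g \<Longrightarrow> realized (\<lambda>n. psi kappa (gm_mult g n))"
proof (induction "card (verts g) + length (edgs g)" arbitrary: g rule: less_induct)
  case less
  note g = less.prems
  let ?r = "vin g" and ?es = "edgs g"
  have IH: "realized (\<lambda>n. psi kappa (gm_mult h n))"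
    if "gm_wf h" "vin h = vout h" "card (verts h) + length (edgs h) < card (verts g) + length ?es" for h
    using less.hyps[OF that(3,1,2)] .
  have reduce: "realized (\<lambda>n. psi kappa (gm_mult g n))" if "realized (separated_sum kappa g)"
    by (rule realized_of_separated_sum[OF g _ that]) (auto intro: IH)
  \<comment> \<open>If \<open>in_D\<close> fails, one of its conditions does. A root of degree
    different from 1 is either untouched by edges or has an edge beside which there is another
    one.\<close>
  consider C where "is_cycle g C"
    | "\<nexists>C. is_cycle g C" "\<exists>e\<in>set ?es. \<exists>c. elab e = sc c 1"
    | "\<nexists>C. is_cycle g C" "\<forall>i<length ?es. fst (?es ! i) \<noteq> ?r \<and> fst (snd (?es ! i)) \<noteq> ?r"
    | i where "\<nexists>C. is_cycle g C" "i < length ?es" "fst (?es ! i) = ?r \<or> fst (snd (?es ! i)) = ?r"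
        "indeg g ?r + outdeg g ?r \<noteq> 1"
    | w where "\<nexists>C. is_cycle g C" "indeg g ?r + outdeg g ?r = 1" "w \<in> verts g" "indeg g w = 1" "outdeg g w = 1"
    | "in_D sc g"
  proof -
    have conn: "tg_connected g" using g by (simp add: gm_wf_def tg_wf_def)
    show thesis
    proof (cases "in_D sc g \<or> (\<exists>C. is_cycle g C) \<or> (\<exists>e\<in>set ?es. \<exists>c. elab e = sc c 1)")
      case True thus thesis using that(1,2,6) by blast
    next
      case False
      hence nc: "\<nexists>C. is_cycle g C" by blast
      have "indeg g ?r + outdeg g ?r \<noteq> 1 \<or> (\<exists>w\<in>verts g. indeg g w = 1 \<and> outdeg g w = 1)"
        using False g conn unfolding in_D_def is_tree_def by blast
      thus thesis using that(3,4,5)[OF nc] by blast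
    qed
  qed
  thus ?case
  proof cases
    case (1 C)
    obtain c g' where g': "gm_wf g'" "vin g' = vout g'" "card (verts g') \<le> card (verts g)"
      "length (edgs g') < length ?es" "\<And>n. gm_wf n \<Longrightarrow> separated_sum kappa g n = c * separated_sum kappa g' n"
      using separated_sum_cycle[OF kappa_cyclic g 1] by blast
    have fin: "finite (verts g')" using g'(1) by (simp add: gm_wf_iff)
    \<comment> \<open>All quotients of \<open>g'\<close> are needed, including \<open>g'\<close>
      itself; they have fewer edges than \<open>g\<close> and no more vertices, so the induction
      hypothesis applies to each.\<close>
    have "realized (\<lambda>n. \<Sum>p | partition_on (verts g') p. mobius0 p * psi kappa (gm_mult (gm_quot p g') n))"
    proof (rule realized_sum[OF finitely_many_partition_on[OF fin]], rule realized_scale, rule IH)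
      fix p assume "p \<in> {p. partition_on (verts g') p}"
      show "gm_wf (gm_quot p g')" "vin (gm_quot p g') = vout (gm_quot p g')"
        using g'(1,2) by (simp_all add: gm_quot_eq gm_wf_map)
      have "card (verts (gm_quot p g')) \<le> card (verts g')" using card_image_le[OF fin] by (simp add: gm_quot_eq)
      thus "card (verts (gm_quot p g')) + length (edgs (gm_quot p g')) < card (verts g) + length ?es"
        using g'(3,4) by (simp add: gm_quot_eq)
    qed
    hence "realized (separated_sum kappa g')"
      by (rule realized_cong) (simp add: sum_mobius0_psi[OF kappa_cyclic g'(1,2)])
    from realized_scale[OF this, of c] have "realized (separated_sum kappa g)"
      by (rule realized_cong) (simp add: g'(5))
    thus ?thesis by (rule reduce)
  next
    case 2
    then obtain e c where e: "e \<in> set ?es" "elab e = sc c 1" by blast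
    have "separated_sum kappa g n = 0" for n
      using separated_sum_scalar[OF g(1) e(1) forest_no_loop[OF 2(1) e(1)] e(2)] .
    hence "realized (separated_sum kappa g)" by (intro realized_cong[OF realized_zero]) simp
    thus ?thesis by (rule reduce)
  next
    case 3
    have ends: "ends ?es \<subseteq> verts g" using g by (simp add: gm_wf_iff)
    have "\<forall>e\<in>set ?es. fst e \<noteq> ?r \<and> fst (snd e) \<noteq> ?r"
      using 3(2) by (simp only: all_set_conv_all_nth)
    hence notin: "?r \<notin> ends ?es" unfolding ends_def by (metis (no_types, lifting) UN_E insertE singletonD)
    have conn: "edges_connected (verts g) ?es" and rV: "?r \<in> verts g" using g by (auto simp: gm_wf_iff)
    have "\<forall>e\<in>set ?es. (fst e = ?r) = (fst (snd e) = ?r)"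
      using \<open>\<forall>e\<in>set ?es. fst e \<noteq> ?r \<and> fst (snd e) \<noteq> ?r\<close> by blast
    \<comment> \<open>Connectivity tested with the indicator of the root: no edge touches the root,
      so it is the only vertex.\<close>
    hence "\<forall>u\<in>verts g. \<forall>v\<in>verts g. (u = ?r) = (v = ?r)"
      using conn[unfolded edges_connected_def, THEN spec, of "\<lambda>v. v = ?r"] by blast
    hence V: "verts g = {?r}" using rV by blast
    have E: "?es = []"
    proof (rule ccontr)
      assume "?es \<noteq> []"
      hence "fst (hd ?es) \<in> ends ?es" using ends_in[of "hd ?es" ?es] by simp
      hence "fst (hd ?es) \<in> {?r}" using ends unfolding V by (rule rev_subsetD)
      thus False using \<open>fst (hd ?es) \<in> ends ?es\<close> notin by (metis singletonD)
    qed
    \<comment> \<open>The vertex of \<open>gm_unit\<close> is 0, so \<open>g\<close> is a renamed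
      unit and its pairings are the same.\<close>
    let ?u = "gm_map (\<lambda>_. ?r) (gm_unit :: 'a gmon)"
    have "g = ?u"
      by (rule gmon.equality) (use V E g in \<open>simp_all add: gm_unit_def\<close>)
    moreover have "psi kappa (gm_mult ?u n) = psi kappa (gm_mult gm_unit n)" if "gm_wf n" for n
      by (rule psi_mult_rename[OF kappa_cyclic gm_wf_unit _ that]) (simp_all add: gm_unit_def)
    ultimately show ?thesis by (intro realized_cong[OF realized_unit]) metis
  next
    case (4 i)
    obtain a b where ab: "gm_wf a" "vin a = vout a" "gm_wf b" "vin b = vout b"
      "card (verts a) \<le> card (verts g)" "card (verts b) \<le> card (verts g)"
      "length (edgs a) < length ?es" "length (edgs b) < length ?es"
      "\<And>n. gm_wf n \<Longrightarrow> psi kappa (gm_mult g n) = psi kappa (gm_mult (gm_mult a b) n)"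
      using tree_root_split[OF kappa_cyclic g 4] by blast
    have "realized (\<lambda>n. psi kappa (gm_mult (gm_mult a b) n))"
      using ab by (intro realized_mult IH) auto
    thus ?thesis by (rule realized_cong) (rule ab(9))
  next
    case (5 w)
    \<comment> \<open>The degrees tell them apart: \<open>w\<close> has total degree 2 and the root
      has 1.\<close>
    have wr: "w \<noteq> ?r" using 5(2,4,5) by auto
    obtain u x v y es' where m: "mset ?es = mset ((w, u, x) # (v, w, y) # es')" "u \<noteq> w" "v \<noteq> w" "w \<notin> ends es'"
      using merge_vertex[of ?es w] forest_no_loop[OF 5(1)] 5(4,5) unfolding indeg_def outdeg_def by blast
    note merge = psi_mult_merge[OF kappa_cyclic cumulant_mult[OF cumulants] g 5(3) wr m]
    let ?g = "\<lparr>verts = verts g - {w}, edgs = (v, u, x * y) # es', vin = ?r, vout = ?r\<rparr>"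
    have "length ?es = length es' + 2" using mset_eq_length[OF m(1)] by simp
    moreover have "card (verts g - {w}) \<le> card (verts g)" using g by (intro card_mono) (auto simp: gm_wf_iff)
    ultimately have "realized (\<lambda>n. psi kappa (gm_mult ?g n))" using merge(1) by (intro IH) auto
    thus ?thesis by (rule realized_cong) (rule merge(2))
  next
    case 6
    have "realized (separated_sum kappa g)"
      unfolding realized_def by (rule bexI[OF _ Delta_Q.gen[OF 6]]) (simp add: pairing_Q_elem[OF kappa_cyclic g])
    thus ?thesis by (rule reduce)
  qed
qed

lemma realized_Delta_B: "y \<in> Delta_B \<Longrightarrow> realized (pairing kappa y)"
proof (induction y)
  case Nil
  show ?case by (rule realized_cong[OF realized_zero]) simp
next
  case (Cons e y)
  obtain c m where e: "e = (c, m)" by (cases e)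
  have "gm_wf m" "vin m = vout m" "y \<in> Delta_B" using Cons.prems e by (auto simp: Delta_B_def)
  hence "realized (\<lambda>n. c * psi kappa (gm_mult m n) + pairing kappa y n)"
    using Cons.IH by (intro realized_add realized_scale realized_monomial)
  thus ?case by (rule realized_cong) (simp add: e)
qed

end

theorem theorem2p24:
  fixes sc :: "complex \<Rightarrow> 'a::ring_1 \<Rightarrow> 'a"
    and phi :: "'a \<Rightarrow> complex"
    and kappa :: "'a list \<Rightarrow> complex"
  assumes "complex_algebra sc"
    and "tracial_state sc phi"
    and "free_cumulants phi kappa"
  shows "(\<forall>x\<in>Delta_Q sc. \<exists>y\<in>Delta_B. fc_equiv kappa x y) \<and>
         (\<forall>y\<in>Delta_B. \<exists>x\<in>Delta_Q sc. fc_equiv kappa x y)"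
proof (intro conjI ballI)
  fix x assume "x \<in> Delta_Q sc"
  hence "x \<in> Delta_B" using Delta_Q_subset_Delta_B by blast
  moreover have "fc_equiv kappa x x" by (rule fc_equivI) simp
  ultimately show "\<exists>y\<in>Delta_B. fc_equiv kappa x y" by blast
next
  interpret tracial_space sc phi kappa using assms by unfold_locales
  fix y :: "'a fcomb" assume "y \<in> Delta_B"
  then obtain x where "x \<in> Delta_Q sc" "\<forall>n. gm_wf n \<longrightarrow> pairing kappa x n = pairing kappa y n"
    using realized_Delta_B unfolding realized_def by blast
  thus "\<exists>x\<in>Delta_Q sc. fc_equiv kappa x y" using fc_equivI by blast
qed

end
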